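(* Let $(M,g)=(\mathbf R^d,\mathrm{can})$ be Euclidean space and let $(u_h)$ be a bounded sequence in $L^2(\mathbf R^d)$ satisfying the $h$-oscillation property $$\limsup_{h\to0^+}\left\|\mathbf 1_{(-\infty,R)}(h^2\Delta)\,\phi u_h\right\|_{L^2(\mathbf R^d)}\to 0\quad\text{as }R\to-\infty,\ \text{for every }\phi\in C_c^\infty(\mathbf R^d),$$ and such that, for some $\mu_0\in\mathcal M_+(T^*\mathbf R^d)$, $$\lim_{h\to0^+}(\mathrm{op}_h(a)u_h|u_h)=\int_{T^*\mathbf R^d}a(x,\xi)\,\mu_0(dx,d\xi)\quad\text{for every }a\in C_c^\infty(T^*\mathbf R^d).$$ Let $(\alpha_h)$ be a sequence of positive reals with $\alpha_h\to\infty$ as $h\to0^+$. If $\mu_0(\{\xi=0\})=0$, then any $\mu\in L^\infty(\mathbf R_t;\mathcal M_+(T^*\mathbf R^d))$ such that, along some subsequence, $$\lim_{h\to0^+}\int_{\mathbf R}\varphi(t)\,(\mathrm{op}_h(a)e^{i\alpha_hht\Delta/2}u_h|e^{i\alpha_hht\Delta/2}u_h)\,dt=\int_{\mathbf R\times T^*\mathbf R^d}\varphi(t)a(x,\xi)\,\mu(t,dx,d\xi)\,dt$$ for every $\varphi\in L^1(\mathbf R)$ and $a\in C_c^\infty(T^*\mathbf R^d)$, vanishes identically. In other words, for every $\varphi\in L^1(\mathbf R)$ and every $a\in C_c^\infty(T^*\mathbf R^d)$, $$\lim_{h\to0^+}\int_{\mathbf R}\varphi(t)\,(\mathrm{op}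_h(a)e^{i\alpha_hht\Delta/2}u_h|e^{i\alpha_hht\Delta/2}u_h)\,dt=0.$$
   Context: $\Delta$ is the (non-positive) Laplacian on $\mathbf R^d$, self-adjoint on $L^2(\mathbf R^d)$ with inner product $(\cdot|\cdot)$; functions of $\Delta$ are defined by the spectral theorem, and $\mathbf 1_A$ is the characteristic function of $A\subset\mathbf R$. $T^*\mathbf R^d$ is identified with $\mathbf R^d_x\times\mathbf R^d_\xi$, and $\mathcal M_+(T^*\mathbf R^d)$ is the cone of positive Radon measures on it. An element $\mu\in L^\infty(\mathbf R;\mathcal M_+(T^*\mathbf R^d))$ is a (weakly measurable, essentially bounded) family $t\mapsto\mu(t,\cdot)$ of finite positive measures. Sequences such as $(u_h)$, $(\alpha_h)$ are indexed by small parameters $h>0$ with $h\to0^+$. For $a\in C_c^\infty(\mathbf R^d\times\mathbf R^d)$ and $h>0$, $\mathrm{op}_h(a)$ is the semiclassical Weyl quantization $$\mathrm{op}_h(a)u(x)=\int_{\mathbf R^d}\int_{\mathbf R^d}a\left(\tfrac{x+y}{2},h\xi\right)u(y)e^{i(x-y)\cdot\xi}\,dy\,\frac{d\xi}{(2\pi)^d}.$$ *)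

theory Defs
  imports "HOL-Analysis.Analysis"
begin

section \<open>Test functions\<close>

definition partial_deriv :: "'a::euclidean_space \<Rightarrow> ('a \<Rightarrow> 'b::real_normed_vector) \<Rightarrow> 'a \<Rightarrow> 'b" where
  "partial_deriv b f = (\<lambda>x. frechet_derivative f (at x) b)"

text \<open>Smoothness asks all iterated partial derivatives to be differentiable everywhere; they are
  then continuous as well, so this is \<open>C\<^sup>\<infinity>\<close>.\<close>

definition smooth :: "('a::euclidean_space \<Rightarrow> 'b::real_normed_vector) \<Rightarrow> bool" where
  "smooth f \<longleftrightarrow>
     (\<forall>bs x. set bs \<subseteq> Basis \<longrightarrow> foldr partial_deriv bs f differentiable (at x))"

definition compactly_supported :: "('a::topological_space \<Rightarrow> 'b::zero) \<Rightarrow> bool" where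
  "compactly_supported f \<longleftrightarrow> compact (closure {x. f x \<noteq> 0})"

definition test_fun :: "('a::euclidean_space \<Rightarrow> complex) set" where
  "test_fun = {f. smooth f \<and> compactly_supported f}"

definition classical_laplacian :: "('a::euclidean_space \<Rightarrow> complex) \<Rightarrow> 'a \<Rightarrow> complex" where
  "classical_laplacian f x = (\<Sum>b\<in>Basis. partial_deriv b (partial_deriv b f) x)"


section \<open>The space of square integrable functions\<close>

text \<open>Elements of \<open>L\<^sup>2\<close> are handled through Borel measurable representatives; every class
  of Lebesgue measurable functions modulo null sets contains one. An operator is given by its graph,
  a set of pairs of representatives.\<close>

definition L2 :: "('a::euclidean_space \<Rightarrow> complex) set" where
  "L2 = {u. u \<in> borel_measurable borel \<and> integrable lborel (\<lambda>x. (cmod (u x))\<^sup>2)}"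

definition L2_inner :: "('a::euclidean_space \<Rightarrow> complex) \<Rightarrow> ('a \<Rightarrow> complex) \<Rightarrow> complex" where
  "L2_inner u v = (LINT x|lborel. u x * cnj (v x))"

definition L2_norm :: "('a::euclidean_space \<Rightarrow> complex) \<Rightarrow> real" where
  "L2_norm u = sqrt (LINT x|lborel. (cmod (u x))\<^sup>2)"

type_synonym 'a L2_operator = "(('a \<Rightarrow> complex) \<times> ('a \<Rightarrow> complex)) set"

text \<open>The self-adjoint Laplacian has domain \<open>{u \<in> L\<^sup>2. \<Delta>u \<in> L\<^sup>2}\<close>, where \<open>\<Delta>u\<close> is taken
  in the sense of distributions; this is the Sobolev space \<open>H\<^sup>2\<close>.\<close>

definition laplacian :: "'a::euclidean_space L2_operator" where
  "laplacian = {(u, w). u \<in> L2 \<and> w \<in> L2 \<and>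
     (\<forall>\<psi>\<in>test_fun. (LINT x|lborel. u x * classical_laplacian \<psi> x) = (LINT x|lborel. w x * \<psi> x))}"


section \<open>Functional calculus of a self-adjoint operator\<close>

text \<open>The symmetry condition for all \<open>u, v \<in> L\<^sup>2\<close> forces \<open>P\<close> to be linear up to null sets and to
  respect equality almost everywhere.\<close>

definition orthogonal_projection ::
    "(('a::euclidean_space \<Rightarrow> complex) \<Rightarrow> 'a \<Rightarrow> complex) \<Rightarrow> bool" where
  "orthogonal_projection P \<longleftrightarrow>
     (\<forall>u\<in>L2. P u \<in> L2) \<and>
     (\<forall>u\<in>L2. AE x in lborel. P (P u) x = P u x) \<and>
     (\<forall>u\<in>L2. \<forall>v\<in>L2. L2_inner (P u) v = L2_inner u (P v))"

definition projection_valued_measure ::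
    "(real set \<Rightarrow> ('a::euclidean_space \<Rightarrow> complex) \<Rightarrow> 'a \<Rightarrow> complex) \<Rightarrow> bool" where
  "projection_valued_measure E \<longleftrightarrow>
     (\<forall>A\<in>sets borel. orthogonal_projection (E A)) \<and>
     (\<forall>u\<in>L2. AE x in lborel. E UNIV u x = u x) \<and>
     (\<forall>A\<in>sets borel. \<forall>B\<in>sets borel. \<forall>u\<in>L2. AE x in lborel. E (A \<inter> B) u x = E A (E B u) x) \<and>
     (\<forall>A. range A \<subseteq> sets borel \<longrightarrow> disjoint_family A \<longrightarrow>
        (\<forall>u\<in>L2. \<forall>v\<in>L2. (\<lambda>n::nat. L2_inner (E (A n) u) v) sums L2_inner (E (\<Union>n. A n) u) v))"

definition scalar_measure ::
    "(real set \<Rightarrow> ('a::euclidean_space \<Rightarrow> complex) \<Rightarrow> 'a \<Rightarrow> complex) \<Rightarrow> ('a \<Rightarrow> complex) \<Rightarrow> real measure" where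
  "scalar_measure E u = measure_of UNIV (sets borel) (\<lambda>A. ennreal (Re (L2_inner (E A u) u)))"

text \<open>The integral of \<open>f\<close> against the complex measure \<open>A \<mapsto> (E A u | v)\<close>, expressed by
  polarization through positive measures.\<close>

definition polarized_integral ::
    "(real set \<Rightarrow> ('a::euclidean_space \<Rightarrow> complex) \<Rightarrow> 'a \<Rightarrow> complex) \<Rightarrow> (real \<Rightarrow> complex) \<Rightarrow>
      ('a \<Rightarrow> complex) \<Rightarrow> ('a \<Rightarrow> complex) \<Rightarrow> complex" where
  "polarized_integral E f u v =
     (\<Sum>k<4. \<i> ^ k * (LINT s|scalar_measure E (\<lambda>x. u x + \<i> ^ k * v x). f s)) / 4"

definition spectral_domain ::
    "(real set \<Rightarrow> ('a::euclidean_space \<Rightarrow> complex) \<Rightarrow> 'a \<Rightarrow> complex) \<Rightarrow> (real \<Rightarrow> complex) \<Rightarrow>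
      ('a \<Rightarrow> complex) set" where
  "spectral_domain E f = {u \<in> L2. integrable (scalar_measure E u) (\<lambda>s. (cmod (f s))\<^sup>2)}"

text \<open>The possibly unbounded operator \<open>\<integral> f dE\<close>, for a Borel function \<open>f\<close>. Its domain is dense, so
  the image of \<open>u\<close> is determined almost everywhere by testing against that domain.\<close>

definition spectral_integral ::
    "(real set \<Rightarrow> ('a::euclidean_space \<Rightarrow> complex) \<Rightarrow> 'a \<Rightarrow> complex) \<Rightarrow> (real \<Rightarrow> complex) \<Rightarrow>
      'a L2_operator" where
  "spectral_integral E f = {(u, w). u \<in> spectral_domain E f \<and> w \<in> L2 \<and>
     (\<forall>v\<in>spectral_domain E f. L2_inner w v = polarized_integral E f u v)}"

text \<open>The spectral theorem: a self-adjoint \<open>T\<close> equals \<open>\<integral> s dE(s)\<close> for a projection-valued measure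
  \<open>E\<close>, which is unique up to the choice of representatives.\<close>

definition spectral_measure ::
    "'a::euclidean_space L2_operator \<Rightarrow> real set \<Rightarrow> ('a \<Rightarrow> complex) \<Rightarrow> 'a \<Rightarrow> complex" where
  "spectral_measure T =
     (SOME E. projection_valued_measure E \<and> T = spectral_integral E complex_of_real)"

definition op_fun ::
    "(real \<Rightarrow> complex) \<Rightarrow> 'a::euclidean_space L2_operator \<Rightarrow> ('a \<Rightarrow> complex) \<Rightarrow> 'a \<Rightarrow> complex" where
  "op_fun f T u = (SOME w. (u, w) \<in> spectral_integral (spectral_measure T) f)"

text \<open>\<open>1\<^sub>A(c\<Delta>)\<close> and \<open>exp(i\<tau>\<Delta>)\<close>\<close>

definition spectral_cutoff ::
    "real set \<Rightarrow> real \<Rightarrow> ('a::euclidean_space \<Rightarrow> complex) \<Rightarrow> 'a \<Rightarrow> complex" where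
  "spectral_cutoff A c = op_fun (\<lambda>s. indicator A (c * s)) laplacian"

definition schroedinger :: "real \<Rightarrow> ('a::euclidean_space \<Rightarrow> complex) \<Rightarrow> 'a \<Rightarrow> complex" where
  "schroedinger \<tau> = op_fun (\<lambda>s. exp (\<i> * complex_of_real (\<tau> * s))) laplacian"


section \<open>Semiclassical Weyl quantization\<close>

definition weyl_op ::
    "real \<Rightarrow> ('a \<times> 'a \<Rightarrow> complex) \<Rightarrow> ('a::euclidean_space \<Rightarrow> complex) \<Rightarrow> 'a \<Rightarrow> complex" where
  "weyl_op h a u x =
     (LINT \<xi>|lborel. (LINT y|lborel.
        a ((1/2) *\<^sub>R (x + y), h *\<^sub>R \<xi>) * u y * exp (\<i> * complex_of_real ((x - y) \<bullet> \<xi>))))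
     / (2 * pi) ^ DIM('a)"


text \<open>\<open>\<integral> \<phi>(t) (op\<^sub>h(a) exp(i\<alpha>ht\<Delta>/2)u | exp(i\<alpha>ht\<Delta>/2)u) dt\<close>\<close>

definition time_averaged_wigner ::
    "real \<Rightarrow> real \<Rightarrow> ('a::euclidean_space \<Rightarrow> complex) \<Rightarrow> (real \<Rightarrow> complex) \<Rightarrow> ('a \<times> 'a \<Rightarrow> complex) \<Rightarrow> complex" where
  "time_averaged_wigner h \<alpha> u \<phi> a =
     (LINT t|lborel. \<phi> t *
        L2_inner (weyl_op h a (schroedinger (\<alpha> * h * t / 2) u)) (schroedinger (\<alpha> * h * t / 2) u))"


section \<open>Measures on phase space\<close>

text \<open>On a Euclidean space every locally finite Borel measure is regular.\<close>

definition radon_measure :: "'a::euclidean_space measure \<Rightarrow> bool" where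
  "radon_measure \<mu> \<longleftrightarrow> sets \<mu> = sets borel \<and> (\<forall>K. compact K \<longrightarrow> emeasure \<mu> K < \<infinity>)"

text \<open>The elements of \<open>L\<^sup>\<infinity>(\<real>; \<M>\<^sub>+)\<close>\<close>

definition Linf_measures :: "(real \<Rightarrow> 'a::euclidean_space measure) set" where
  "Linf_measures = {\<mu>.
     (\<forall>t. radon_measure (\<mu> t) \<and> finite_measure (\<mu> t)) \<and>
     (\<forall>g :: 'a \<Rightarrow> real. continuous_on UNIV g \<longrightarrow> compactly_supported g \<longrightarrow>
        (\<lambda>t. LINT z|\<mu> t. g z) \<in> borel_measurable borel) \<and>
     (\<exists>C::real. AE t in lborel. measure (\<mu> t) UNIV \<le> C)}"

end

theory Submission
  imports Defs "HOL-Probability.Probability"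
begin

text \<open>On the Fourier side the propagator multiplies by \<open>cis (- \<alpha>ht|\<xi>|\<^sup>2 / 2)\<close>, and \<open>op\<^sub>h(a)\<close> is
  a superposition, with integrable weight \<open>ft a (p, q)\<close>, of phase space translations. Conjugation by
  the propagator therefore multiplies the term \<open>(p, q)\<close> by the phase \<open>cis (kt p \<bullet> (\<zeta> - p / 2))\<close>,
  where \<open>k = \<alpha>h\<close>. Split the Fourier transform of \<open>u\<^sub>h\<close> at \<open>k(1 + |\<zeta>|) = \<Lambda>\<close>.

  Above \<open>\<Lambda>\<close> the time average of the phase is the Fourier transform of \<open>\<phi>\<close> at \<open>k p \<bullet> (\<zeta> - p / 2)\<close>.
  By the Riemann-Lebesgue lemma it is small for most \<open>p\<close>, uniformly in \<open>k\<close> and \<open>\<zeta>\<close>, and a Schur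
  test bounds the average by a quantity that tends to \<open>0\<close> as \<open>\<Lambda> \<rightarrow> \<infinity>\<close>.

  Below \<open>\<Lambda>\<close> one has \<open>h|\<zeta>| \<le> 2\<Lambda> / \<alpha> \<rightarrow> 0\<close>, so \<open>op\<^sub>h(a)\<close> acts as multiplication by \<open>a(x, 0)\<close>. The
  speed of propagation is at most \<open>2\<Lambda>\<close>, hence for bounded times the mass in the support of
  \<open>a(x, 0)\<close> is controlled by the initial mass in a much larger ball and at frequencies \<open>h|\<xi>| \<le> \<delta>\<close>.
  In the limit this is at most the \<open>\<mu>\<^sub>0\<close>-mass of a compact set shrinking to a part of \<open>{\<xi> = 0}\<close>
  as \<open>\<delta> \<rightarrow> 0\<close>.

  The multiplier form of the propagator rests on the uniqueness of the spectral measure: if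
  \<open>\<Delta> = \<integral> s dE(s)\<close>, then \<open>E\<close> has the same scalar measures as the Fourier multipliers
  \<open>1\<^sub>A(- |\<xi>|\<^sup>2)\<close>.\<close>

section \<open>Square integrable functions\<close>

text \<open>The product k = \<alpha>h may tend to 0, stay bounded or blow up, which is why the
  threshold involves k(1 + |\<zeta>|). As a function of p the phase k p . (\<zeta> - p/2) is a
  quadratic polynomial with coefficients k\<zeta> and -k/2, and it oscillates as soon as one of them
  is large. The growth of \<alpha> enters through the bound h|\<zeta>| \<le> 2\<Lambda>/\<alpha> on
  the low part. The free flow is linear on phase space, so conjugation by it maps a phase space
  translation exactly to another one. All errors that remain compare two exponentials or two values
  of a multiplier; each is bounded by an integral of |F| min(2, K|Q|), which tends to 0 with K for
  every integrable F. The order of the constants matters: \<Lambda> comes first, the spatial radius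
  depends on \<Lambda> and on the time window, \<delta> depends on the radius, and h goes to 0 last,
  with the tested symbol already fixed. Vectors are representatives of classes and the propagator is
  a Hilbert choice, so it is known only through relations that hold almost everywhere.\<close>

lemma L2_measurable: "u \<in> L2 \<Longrightarrow> u \<in> borel_measurable borel"
  by (simp add: L2_def)

lemma L2_integrable: "u \<in> L2 \<Longrightarrow> integrable lborel (\<lambda>x. (cmod (u x))\<^sup>2)"
  by (simp add: L2_def)

lemma L2_mult_integrable:
  assumes "u \<in> L2" "v \<in> L2"
  shows "integrable lborel (\<lambda>x. u x * v x)"
proof -
  have [measurable]: "u \<in> borel_measurable borel" "v \<in> borel_measurable borel"
    using assms by (auto simp: L2_measurable)
  show ?thesis
  proof (rule Bochner_Integration.integrable_bound)
    show "integrable lborel (\<lambda>x. (cmod (u x))\<^sup>2 + (cmod (v x))\<^sup>2)"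
      using assms by (auto simp: L2_integrable)
    have "cmod (u x) * cmod (v x) \<le> (cmod (u x))\<^sup>2 + (cmod (v x))\<^sup>2" for x
      using sum_squares_bound[of "cmod (u x)" "cmod (v x)"]
        mult_nonneg_nonneg[OF norm_ge_zero[of "u x"] norm_ge_zero[of "v x"]] by linarith
    then show "AE x in lborel. norm (u x * v x) \<le> norm ((cmod (u x))\<^sup>2 + (cmod (v x))\<^sup>2)"
      by (auto simp: norm_mult)
  qed auto
qed

lemma L2_bounded_by:
  assumes "u \<in> L2" and [measurable]: "v \<in> borel_measurable borel" and "AE x in lborel. cmod (v x) \<le> C * cmod (u x)"
  shows "v \<in> L2"
proof -
  have "integrable lborel (\<lambda>x. (cmod (v x))\<^sup>2)"
  proof (rule Bochner_Integration.integrable_bound)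
    show "integrable lborel (\<lambda>x. C\<^sup>2 * (cmod (u x))\<^sup>2)"
      using assms(1) by (auto simp: L2_integrable)
    show "AE x in lborel. norm ((cmod (v x))\<^sup>2) \<le> norm (C\<^sup>2 * (cmod (u x))\<^sup>2)"
      using assms(3)
    proof eventually_elim
      case (elim x)
      then show ?case
        using power_mono[OF elim, of 2] by (auto simp: power_mult_distrib)
    qed
  qed auto
  then show ?thesis by (simp add: L2_def)
qed

lemma borel_measurable_cnj [measurable (raw)]:
  "f \<in> borel_measurable M \<Longrightarrow> (\<lambda>x. cnj (f x)) \<in> borel_measurable M"
  by (rule borel_measurable_continuous_on[OF continuous_on_cnj[OF continuous_on_id]])

lemma L2_cnj: "u \<in> L2 \<Longrightarrow> (\<lambda>x. cnj (u x)) \<in> L2"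
  by (auto simp: L2_def)

lemma L2_norm_mult_integrable:
  assumes "u \<in> L2" "v \<in> L2"
  shows "integrable lborel (\<lambda>x. cmod (u x) * cmod (v x))"
  using L2_mult_integrable[OF assms, THEN integrable_norm] by (simp add: norm_mult)

lemma L2_inner_integrable:
  assumes "u \<in> L2" "v \<in> L2"
  shows "integrable lborel (\<lambda>x. u x * cnj (v x))"
  using L2_mult_integrable[OF assms(1) L2_cnj[OF assms(2)]] .

lemma L2_bdd_mult:
  assumes "u \<in> L2" "m \<in> borel_measurable borel" "\<And>x. cmod (m x) \<le> C"
  shows "(\<lambda>x. m x * u x) \<in> L2"
proof -
  have [measurable]: "u \<in> borel_measurable borel" "m \<in> borel_measurable borel"
    using assms by (auto simp: L2_measurable)
  show ?thesis
    by (rule L2_bounded_by[OF assms(1), where C = C]) (auto simp: norm_mult assms(3) mult_right_mono)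
qed

lemma L2_scale: "u \<in> L2 \<Longrightarrow> (\<lambda>x. c * u x) \<in> L2"
  by (rule L2_bdd_mult[where C = "cmod c"]) auto

lemma L2_add:
  assumes "u \<in> L2" "v \<in> L2"
  shows "(\<lambda>x. u x + v x) \<in> L2"
proof -
  have [measurable]: "u \<in> borel_measurable borel" "v \<in> borel_measurable borel"
    using assms by (auto simp: L2_measurable)
  have "integrable lborel (\<lambda>x. (cmod (u x + v x))\<^sup>2)"
  proof (rule Bochner_Integration.integrable_bound)
    show "integrable lborel (\<lambda>x. 2 * (cmod (u x))\<^sup>2 + 2 * (cmod (v x))\<^sup>2)"
      using assms by (auto simp: L2_integrable)
    have "(cmod (u x + v x))\<^sup>2 \<le> 2 * (cmod (u x))\<^sup>2 + 2 * (cmod (v x))\<^sup>2" for x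
    proof -
      have "(cmod (u x + v x))\<^sup>2 \<le> (cmod (u x) + cmod (v x))\<^sup>2"
        by (intro power_mono norm_triangle_ineq) auto
      also have "\<dots> \<le> 2 * (cmod (u x))\<^sup>2 + 2 * (cmod (v x))\<^sup>2"
        using sum_squares_bound[of "cmod (u x)" "cmod (v x)"] by (simp add: power2_sum)
      finally show ?thesis .
    qed
    then show "AE x in lborel. norm ((cmod (u x + v x))\<^sup>2) \<le> norm (2 * (cmod (u x))\<^sup>2 + 2 * (cmod (v x))\<^sup>2)"
      by auto
  qed auto
  then show ?thesis by (simp add: L2_def)
qed

lemma L2_diff:
  assumes "u \<in> L2" "v \<in> L2"
  shows "(\<lambda>x. u x - v x) \<in> L2"
  using L2_add[OF assms(1) L2_scale[OF assms(2), of "-1"]] by simp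

lemma L2_inner_cnj: "L2_inner v u = cnj (L2_inner u v)"
proof -
  have "cnj (L2_inner u v) = (LINT x|lborel. cnj (u x * cnj (v x)))"
    unfolding L2_inner_def by (simp only: Bochner_Integration.integral_cnj)
  then show ?thesis unfolding L2_inner_def by (simp add: mult.commute)
qed

lemma L2_inner_add_left:
  assumes "u \<in> L2" "v \<in> L2" "w \<in> L2"
  shows "L2_inner (\<lambda>x. u x + v x) w = L2_inner u w + L2_inner v w"
  unfolding L2_inner_def
  by (simp add: distrib_right L2_inner_integrable[OF assms(1,3)] L2_inner_integrable[OF assms(2,3)])

lemma L2_inner_diff_left:
  assumes "u \<in> L2" "v \<in> L2" "w \<in> L2"
  shows "L2_inner (\<lambda>x. u x - v x) w = L2_inner u w - L2_inner v w"
  unfolding L2_inner_def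
  by (simp add: left_diff_distrib L2_inner_integrable[OF assms(1,3)] L2_inner_integrable[OF assms(2,3)])

lemma L2_inner_scale_left: "L2_inner (\<lambda>x. c * u x) w = c * L2_inner u w"
  unfolding L2_inner_def by (simp add: mult.assoc)

lemma L2_inner_add_right:
  assumes "u \<in> L2" "v \<in> L2" "w \<in> L2"
  shows "L2_inner w (\<lambda>x. u x + v x) = L2_inner w u + L2_inner w v"
  unfolding L2_inner_def
  by (simp add: distrib_left L2_inner_integrable[OF assms(3,1)] L2_inner_integrable[OF assms(3,2)])

lemma L2_inner_diff_right:
  assumes "u \<in> L2" "v \<in> L2" "w \<in> L2"
  shows "L2_inner w (\<lambda>x. u x - v x) = L2_inner w u - L2_inner w v"
  unfolding L2_inner_def
  by (simp add: right_diff_distrib L2_inner_integrable[OF assms(3,1)] L2_inner_integrable[OF assms(3,2)])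

lemma L2_inner_scale_right: "L2_inner w (\<lambda>x. c * u x) = cnj c * L2_inner w u"
  unfolding L2_inner_def by (simp add: mult.left_commute)

lemma L2_norm_sq: "(L2_norm u)\<^sup>2 = (LINT x|lborel. (cmod (u x))\<^sup>2)"
  unfolding L2_norm_def by (simp add: Bochner_Integration.integral_nonneg)

lemma L2_norm_nonneg: "0 \<le> L2_norm u"
  unfolding L2_norm_def by (simp add: Bochner_Integration.integral_nonneg)

lemma L2_inner_self: "L2_inner u u = complex_of_real ((L2_norm u)\<^sup>2)"
proof -
  have "u x * cnj (u x) = complex_of_real ((cmod (u x))\<^sup>2)" for x
    using complex_norm_square[of "u x"] by simp
  then show ?thesis unfolding L2_inner_def L2_norm_sq by (simp only: integral_complex_of_real)
qed

lemma L2_norm_scale: "L2_norm (\<lambda>x. c * u x) = cmod c * L2_norm u"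
  unfolding L2_norm_def by (simp add: norm_mult power_mult_distrib real_sqrt_mult)

lemma L2_norm_cnj: "L2_norm (\<lambda>x. cnj (u x)) = L2_norm u"
  unfolding L2_norm_def by simp

lemma L2_cauchy_schwarz:
  assumes "u \<in> L2" "v \<in> L2"
  shows "(LINT x|lborel. cmod (u x) * cmod (v x)) \<le> L2_norm u * L2_norm v"
proof -
  let ?I = "LINT x|lborel. cmod (u x) * cmod (v x)"
  let ?A = "(L2_norm u)\<^sup>2" and ?B = "(L2_norm v)\<^sup>2"
  \<comment> \<open>The integral of a square, for every real t. The case distinction on the leading
    coefficient below is the discriminant argument.\<close>
  have q: "0 \<le> t\<^sup>2 * ?A - 2 * t * ?I + ?B" for t
  proof -
    have "0 \<le> (LINT x|lborel. (t * cmod (u x) - cmod (v x))\<^sup>2)" by (simp add: Bochner_Integration.integral_nonneg)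
    also have "\<dots> = (LINT x|lborel. t\<^sup>2 * (cmod (u x))\<^sup>2 - 2 * t * (cmod (u x) * cmod (v x)) + (cmod (v x))\<^sup>2)"
      by (simp add: power2_diff power_mult_distrib algebra_simps)
    also have "\<dots> = t\<^sup>2 * ?A - 2 * t * ?I + ?B"
      using assms by (simp add: L2_norm_sq L2_integrable L2_norm_mult_integrable)
    finally show ?thesis .
  qed
  have I0: "0 \<le> ?I" by (simp add: Bochner_Integration.integral_nonneg)
  have "?I\<^sup>2 \<le> ?A * ?B"
  proof (cases "?A = 0")
    case True
    have "?I = 0"
    proof (rule ccontr)
      assume "?I \<noteq> 0"
      with I0 have "?I > 0" by linarith
      \<comment> \<open>With leading coefficient 0 the polynomial is affine in t, and this t gives
        it the value -1.\<close>
      then show False using q[of "(?B + 1) / (2 * ?I)"] True by (simp add: field_simps)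
    qed
    then show ?thesis by simp
  next
    case False
    then have A: "?A > 0" by (metis zero_less_power2 zero_eq_power2)
    \<comment> \<open>t = \<open>?I / ?A\<close> minimizes the polynomial.\<close>
    have "0 \<le> (?I / ?A)\<^sup>2 * ?A - 2 * (?I / ?A) * ?I + ?B" by (rule q)
    also have "\<dots> = ?B - ?I\<^sup>2 / ?A" using A by (simp add: power2_eq_square field_simps)
    finally show ?thesis using A by (simp add: field_simps)
  qed
  then have "?I\<^sup>2 \<le> (L2_norm u * L2_norm v)\<^sup>2" by (simp add: power_mult_distrib)
  then show ?thesis by (rule power2_le_imp_le) (simp add: L2_norm_nonneg)
qed

lemma L2_inner_bound:
  assumes "u \<in> L2" "v \<in> L2"
  shows "cmod (L2_inner u v) \<le> L2_norm u * L2_norm v"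
proof -
  have "cmod (L2_inner u v) \<le> (LINT x|lborel. cmod (u x * cnj (v x)))"
    unfolding L2_inner_def by simp
  also have "\<dots> = (LINT x|lborel. cmod (u x) * cmod (v x))" by (simp add: norm_mult)
  finally show ?thesis using L2_cauchy_schwarz[OF assms] by simp
qed

lemma L2_norm_triangle:
  assumes "u \<in> L2" "v \<in> L2"
  shows "L2_norm (\<lambda>x. u x + v x) \<le> L2_norm u + L2_norm v"
proof -
  have "complex_of_real ((L2_norm (\<lambda>x. u x + v x))\<^sup>2) = L2_inner u u + L2_inner u v + (L2_inner v u + L2_inner v v)"
    unfolding L2_inner_self[symmetric]
    using assms by (simp add: L2_inner_add_left L2_inner_add_right L2_add)
  also have "\<dots> = complex_of_real ((L2_norm u)\<^sup>2 + (L2_norm v)\<^sup>2 + 2 * Re (L2_inner u v))"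
    unfolding L2_inner_cnj[of v u] L2_inner_self by (simp add: complex_eq_iff)
  finally have "(L2_norm (\<lambda>x. u x + v x))\<^sup>2 = (L2_norm u)\<^sup>2 + (L2_norm v)\<^sup>2 + 2 * Re (L2_inner u v)"
    using of_real_eq_iff by blast
  also have "\<dots> \<le> (L2_norm u + L2_norm v)\<^sup>2"
    using L2_inner_bound[OF assms] complex_Re_le_cmod[of "L2_inner u v"] by (simp add: power2_sum)
  finally show ?thesis by (rule power2_le_imp_le) (simp add: L2_norm_nonneg)
qed

lemma L2_norm_zero_iff:
  assumes "u \<in> L2"
  shows "L2_norm u = 0 \<longleftrightarrow> (AE x in lborel. u x = 0)"
  unfolding L2_norm_def using assms
  by (subst real_sqrt_eq_0_iff, subst integral_nonneg_eq_0_iff_AE) (auto simp: L2_integrable)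

lemma L2_eq_AE_iff:
  assumes "u \<in> L2" "v \<in> L2"
  shows "(AE x in lborel. u x = v x) \<longleftrightarrow> L2_norm (\<lambda>x. u x - v x) = 0"
  using L2_norm_zero_iff[OF L2_diff[OF assms]] by simp

lemma L2_norm_cong_AE:
  assumes "u \<in> L2" "v \<in> L2" "AE x in lborel. u x = v x"
  shows "L2_norm u = L2_norm v"
proof -
  have [measurable]: "u \<in> borel_measurable borel" "v \<in> borel_measurable borel"
    using assms by (auto simp: L2_measurable)
  show ?thesis
    unfolding L2_norm_def using assms(3)
    by (intro arg_cong[where f = sqrt] integral_cong_AE) auto
qed

lemma L2_inner_cong_AE:
  assumes "u \<in> L2" "v \<in> L2" "u' \<in> L2" "v' \<in> L2" "AE x in lborel. u x = u' x" "AE x in lborel. v x = v' x"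
  shows "L2_inner u v = L2_inner u' v'"
  unfolding L2_inner_def using assms
  by (intro integral_cong_AE borel_measurable_integrable L2_inner_integrable) auto

lemma L2_eqI:
  assumes "u \<in> L2" "v \<in> L2" "\<And>w. w \<in> L2 \<Longrightarrow> L2_inner u w = L2_inner v w"
  shows "AE x in lborel. u x = v x"
proof -
  have d: "(\<lambda>x. u x - v x) \<in> L2" using assms by (simp add: L2_diff)
  have "L2_inner (\<lambda>x. u x - v x) (\<lambda>x. u x - v x) = 0"
    using assms(3)[OF d] assms(1,2) d by (simp add: L2_inner_diff_left)
  then show ?thesis using L2_eq_AE_iff[OF assms(1,2)] by (simp add: L2_inner_self)
qed

section \<open>Convergence in the norm and completeness\<close>

lemma L2_inner_tendsto:
  assumes "\<And>n. u n \<in> L2" "U \<in> L2" "v \<in> L2" "(\<lambda>n. L2_norm (\<lambda>x. u n x - U x)) \<longlonglongrightarrow> 0"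
  shows "(\<lambda>n. L2_inner (u n) v) \<longlonglongrightarrow> L2_inner U v"
proof -
  have "(\<lambda>n. L2_inner (u n) v - L2_inner U v) \<longlonglongrightarrow> 0"
  proof (rule Lim_null_comparison)
    show "\<forall>\<^sub>F n in sequentially. cmod (L2_inner (u n) v - L2_inner U v) \<le> L2_norm (\<lambda>x. u n x - U x) * L2_norm v"
      using assms L2_inner_bound[OF L2_diff[OF assms(1,2)] assms(3)]
      by (auto simp: L2_inner_diff_left)
    show "(\<lambda>n. L2_norm (\<lambda>x. u n x - U x) * L2_norm v) \<longlonglongrightarrow> 0"
      using tendsto_mult_left_zero[OF assms(4)] .
  qed
  then show ?thesis by (simp add: LIM_zero_iff)
qed

lemma L2_norm_triangle_diff:
  assumes "u \<in> L2" "v \<in> L2"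
  shows "\<bar>L2_norm u - L2_norm v\<bar> \<le> L2_norm (\<lambda>x. u x - v x)"
proof -
  have "L2_norm u \<le> L2_norm (\<lambda>x. u x - v x) + L2_norm v"
    using L2_norm_triangle[OF L2_diff[OF assms] assms(2)] by simp
  moreover have "L2_norm v \<le> L2_norm (\<lambda>x. v x - u x) + L2_norm u"
    using L2_norm_triangle[OF L2_diff[OF assms(2,1)] assms(1)] by simp
  moreover have "L2_norm (\<lambda>x. v x - u x) = L2_norm (\<lambda>x. u x - v x)"
    unfolding L2_norm_def by (simp add: norm_minus_commute)
  ultimately show ?thesis by linarith
qed

lemma L2_norm_tendsto:
  assumes "\<And>n. u n \<in> L2" "U \<in> L2" "(\<lambda>n. L2_norm (\<lambda>x. u n x - U x)) \<longlonglongrightarrow> 0"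
  shows "(\<lambda>n. L2_norm (u n)) \<longlonglongrightarrow> L2_norm U"
proof -
  have "(\<lambda>n. L2_norm (u n) - L2_norm U) \<longlonglongrightarrow> 0"
    by (rule Lim_null_comparison[OF _ assms(3)]) (auto simp: L2_norm_triangle_diff assms)
  then show ?thesis by (simp add: LIM_zero_iff)
qed

text \<open>Almost everywhere convergence comes from the finiteness of
  \<open>\<Sum>n. 2\<^sup>n * \<parallel>u (n + 1) - u n\<parallel>\<^sup>2\<close>, which bounds \<open>|u (n + 1) x - u n x|\<close> by a geometric
  sequence.\<close>

lemma L2_complete:
  assumes u: "\<And>n. u n \<in> L2" and step: "\<And>n. L2_norm (\<lambda>x. u (Suc n) x - u n x) \<le> (1/2) ^ n"
  obtains U where "U \<in> L2" "(\<lambda>n. L2_norm (\<lambda>x. u n x - U x)) \<longlonglongrightarrow> 0"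
proof -
  have [measurable]: "u n \<in> borel_measurable borel" for n using u by (simp add: L2_measurable)
  let ?g = "\<lambda>n x. (cmod (u (Suc n) x - u n x))\<^sup>2"
  have ig: "integrable lborel (?g n)" for n using L2_integrable[OF L2_diff[OF u u]] .
  have "(\<integral>\<^sup>+x. (\<Sum>n. ennreal (2 ^ n * ?g n x)) \<partial>lborel) = (\<Sum>n. \<integral>\<^sup>+x. ennreal (2 ^ n * ?g n x) \<partial>lborel)"
    by (rule nn_integral_suminf) measurable
  also have "\<dots> \<le> (\<Sum>n. ennreal ((1/2) ^ n))"
  proof (rule suminf_le)
    fix n
    have "(\<integral>\<^sup>+x. ennreal (2 ^ n * ?g n x) \<partial>lborel) = ennreal (2 ^ n * (L2_norm (\<lambda>x. u (Suc n) x - u n x))\<^sup>2)"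
      by (subst nn_integral_eq_integral) (auto simp: ig L2_norm_sq)
    also have "\<dots> \<le> ennreal (2 ^ n * ((1/2) ^ n)\<^sup>2)"
      using step[of n] by (intro ennreal_leI mult_left_mono power_mono) (auto simp: L2_norm_nonneg)
    also have "2 ^ n * ((1/2) ^ n)\<^sup>2 = (1/2 :: real) ^ n"
      by (simp add: power2_eq_square power_divide)
    finally show "(\<integral>\<^sup>+x. ennreal (2 ^ n * ?g n x) \<partial>lborel) \<le> ennreal ((1/2) ^ n)" .
  qed auto
  also have "\<dots> = ennreal (\<Sum>n. (1/2) ^ n)" by (rule suminf_ennreal2) auto
  also have "\<dots> < \<infinity>" by simp
  finally have "AE x in lborel. (\<Sum>n. ennreal (2 ^ n * ?g n x)) \<noteq> \<infinity>"
    by (intro nn_integral_noteq_infinite) auto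
  then have conv: "AE x in lborel. convergent (\<lambda>n. u n x)"
  proof eventually_elim
    case (elim x)
    have s: "summable (\<lambda>n. 2 ^ n * ?g n x)"
      by (rule summable_suminf_not_top) (use elim in auto)
    then have "Bseq (\<lambda>n. 2 ^ n * ?g n x)" using summable_LIMSEQ_zero convergent_imp_Bseq convergentI by blast
    then obtain K where K: "K > 0" "\<And>n. norm (2 ^ n * ?g n x) \<le> K" by (auto simp: Bseq_def)
    have b: "cmod (u (Suc n) x - u n x) \<le> sqrt K * (1 / sqrt 2) ^ n" for n
    proof -
      have "?g n x \<le> K / 2 ^ n" using K(2)[of n] by (simp add: field_simps)
      then have "cmod (u (Suc n) x - u n x) \<le> sqrt (K / 2 ^ n)" by (rule real_le_rsqrt)
      also have "\<dots> = sqrt K * (1 / sqrt 2) ^ n"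
        by (simp add: real_sqrt_divide real_sqrt_power power_divide)
      finally show ?thesis .
    qed
    have "summable (\<lambda>n. u (Suc n) x - u n x)"
    proof (rule summable_comparison_test)
      show "\<exists>N. \<forall>n\<ge>N. norm (u (Suc n) x - u n x) \<le> sqrt K * (1 / sqrt 2) ^ n" using b by blast
      show "summable (\<lambda>n. sqrt K * (1 / sqrt 2) ^ n)"
        by (intro summable_mult summable_geometric) (auto simp: real_less_rsqrt)
    qed
    then have "convergent (\<lambda>n. \<Sum>k<n. u (Suc k) x - u k x)" by (simp add: summable_iff_convergent)
    then have "convergent (\<lambda>n. u n x - u 0 x)" by (simp only: sum_lessThan_telescope[of "\<lambda>n. u n x"])
    then have "convergent (\<lambda>n. (u n x - u 0 x) + u 0 x)"
      by (intro convergent_add convergent_const)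
    then show ?case by simp
  qed
  define U where "U = (\<lambda>x. lim (\<lambda>n. u n x))"
  have [measurable]: "U \<in> borel_measurable borel" unfolding U_def by measurable
  have lim: "AE x in lborel. (\<lambda>n. u n x) \<longlonglongrightarrow> U x"
    using conv unfolding U_def by eventually_elim (simp add: convergent_LIMSEQ_iff)
  \<comment> \<open>The right-hand side is the exact sum of (1/2)^j for n \<le> j < n + k; keeping
    the subtracted term lets the induction on k close.\<close>
  have cauchy: "L2_norm (\<lambda>x. u (n + k) x - u n x) \<le> 2 * (1/2) ^ n - 2 * (1/2) ^ (n + k)" for n k
  proof (induction k)
    case 0
    then show ?case by (simp add: L2_norm_def)
  next
    case (Suc k)
    have "L2_norm (\<lambda>x. u (n + Suc k) x - u n x)
        \<le> L2_norm (\<lambda>x. u (Suc (n + k)) x - u (n + k) x) + L2_norm (\<lambda>x. u (n + k) x - u n x)"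
      using L2_norm_triangle[OF L2_diff[OF u[of "Suc (n + k)"] u[of "n + k"]] L2_diff[OF u[of "n + k"] u[of n]]]
      by simp
    with Suc step[of "n + k"] show ?case by simp
  qed
  \<comment> \<open>Fatou's lemma as k tends to infinity turns the Cauchy bound into a bound on the
    distance to the pointwise limit.\<close>
  have fat: "(\<integral>\<^sup>+x. ennreal ((cmod (u n x - U x))\<^sup>2) \<partial>lborel) \<le> ennreal ((2 * (1/2) ^ n)\<^sup>2)" for n
  proof -
    have "(\<integral>\<^sup>+x. ennreal ((cmod (u n x - U x))\<^sup>2) \<partial>lborel)
        = (\<integral>\<^sup>+x. liminf (\<lambda>k. ennreal ((cmod (u (n + k) x - u n x))\<^sup>2)) \<partial>lborel)"
    proof (rule nn_integral_cong_AE, use lim in eventually_elim)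
      case (elim x)
      have "(\<lambda>k. u (n + k) x) \<longlonglongrightarrow> U x"
        using LIMSEQ_ignore_initial_segment[OF elim, of n] by (simp add: add.commute)
      then have "(\<lambda>k. ennreal ((cmod (u (n + k) x - u n x))\<^sup>2)) \<longlonglongrightarrow> ennreal ((cmod (U x - u n x))\<^sup>2)"
        by (intro tendsto_intros) auto
      then have "liminf (\<lambda>k. ennreal ((cmod (u (n + k) x - u n x))\<^sup>2)) = ennreal ((cmod (U x - u n x))\<^sup>2)"
        by (rule lim_imp_Liminf[OF trivial_limit_sequentially])
      then show ?case by (simp only: norm_minus_commute[of "u n x" "U x"])
    qed
    also have "\<dots> \<le> liminf (\<lambda>k. \<integral>\<^sup>+x. ennreal ((cmod (u (n + k) x - u n x))\<^sup>2) \<partial>lborel)"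
      by (rule nn_integral_liminf) measurable
    also have "\<dots> \<le> liminf (\<lambda>k. ennreal ((2 * (1/2) ^ n)\<^sup>2))"
    proof (rule Liminf_mono, rule always_eventually, rule allI)
      fix k
      have "(\<integral>\<^sup>+x. ennreal ((cmod (u (n + k) x - u n x))\<^sup>2) \<partial>lborel) = ennreal ((L2_norm (\<lambda>x. u (n + k) x - u n x))\<^sup>2)"
        by (subst nn_integral_eq_integral) (auto simp: L2_integrable[OF L2_diff[OF u u]] L2_norm_sq)
      also have "\<dots> \<le> ennreal ((2 * (1/2) ^ n)\<^sup>2)"
      proof (intro ennreal_leI power_mono)
        have "0 \<le> 2 * (1/2 :: real) ^ (n + k)" by simp
        with cauchy[of n k] show "L2_norm (\<lambda>x. u (n + k) x - u n x) \<le> 2 * (1/2) ^ n" by linarith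
      qed (simp add: L2_norm_nonneg)
      finally show "(\<integral>\<^sup>+x. ennreal ((cmod (u (n + k) x - u n x))\<^sup>2) \<partial>lborel) \<le> ennreal ((2 * (1/2) ^ n)\<^sup>2)" .
    qed
    also have "\<dots> = ennreal ((2 * (1/2) ^ n)\<^sup>2)" by (simp add: Liminf_const)
    finally show ?thesis .
  qed
  have d: "(\<lambda>x. u n x - U x) \<in> L2" for n
    unfolding L2_def using le_less_trans[OF fat[of n]] by (auto intro!: integrableI_bounded)
  have "U \<in> L2" using L2_diff[OF u[of 0] d[of 0]] by simp
  moreover have "(\<lambda>n. L2_norm (\<lambda>x. u n x - U x)) \<longlonglongrightarrow> 0"
  proof (rule Lim_null_comparison)
    have "(L2_norm (\<lambda>x. u n x - U x))\<^sup>2 \<le> (2 * (1/2) ^ n)\<^sup>2" for n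
      using fat[of n] by (subst (asm) nn_integral_eq_integral) (auto simp: L2_integrable[OF d] L2_norm_sq)
    then have "L2_norm (\<lambda>x. u n x - U x) \<le> 2 * (1/2) ^ n" for n
      by (rule power2_le_imp_le) simp
    then show "\<forall>\<^sub>F n in sequentially. norm (L2_norm (\<lambda>x. u n x - U x)) \<le> 2 * (1/2) ^ n"
      by (simp add: L2_norm_nonneg)
    show "(\<lambda>n. 2 * (1/2 :: real) ^ n) \<longlonglongrightarrow> 0"
      by (intro tendsto_mult_right_zero LIMSEQ_power_zero) auto
  qed
  ultimately show ?thesis using that by blast
qed

section \<open>Change of variables and iterated integrals for Lebesgue measure\<close>

lemma lborel_integral_translate:
  fixes f :: "'a::euclidean_space \<Rightarrow> 'b::{banach, second_countable_topology}"
  assumes [measurable]: "f \<in> borel_measurable borel"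
  shows "(LINT x|lborel. f (c + x)) = (LINT x|lborel. f x)"
proof -
  have "(LINT x|lborel. f x) = (LINT x|distr lborel borel ((+) c). f x)"
    by (simp only: lborel_distr_plus)
  also have "\<dots> = (LINT x|lborel. f (c + x))"
    by (rule integral_distr) auto
  finally show ?thesis ..
qed

lemma lborel_integrable_translate:
  fixes f :: "'a::euclidean_space \<Rightarrow> 'b::{banach, second_countable_topology}"
  assumes "integrable lborel f"
  shows "integrable lborel (\<lambda>x. f (c + x))"
proof -
  have "integrable (distr lborel borel ((+) c)) f" using assms by (simp only: lborel_distr_plus)
  then show ?thesis by (rule integrable_distr[rotated]) auto
qed

lemma lborel_AE_translate:
  fixes c :: "'a::euclidean_space"
  assumes "AE x in lborel. P x"
  shows "AE x in lborel. P (c + x)"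
proof -
  have "AE x in distr lborel borel ((+) c). P x" using assms by (simp only: lborel_distr_plus)
  then show ?thesis by (rule AE_distrD[rotated]) auto
qed

lemma lborel_integral_scale:
  fixes f :: "'a::euclidean_space \<Rightarrow> 'b::{banach, second_countable_topology}"
  assumes [measurable]: "f \<in> borel_measurable borel" and c: "c \<noteq> 0"
  shows "(LINT x|lborel. f x) = \<bar>c\<bar> ^ DIM('a) *\<^sub>R (LINT x|lborel. f (t + c *\<^sub>R x))"
proof -
  have "(LINT x|lborel. f x) = (LINT x|density (distr lborel borel (\<lambda>x. t + c *\<^sub>R x)) (\<lambda>_. \<bar>c\<bar> ^ DIM('a)). f x)"
    using lborel_affine[OF c, of t] by simp
  also have "\<dots> = \<bar>c\<bar> ^ DIM('a) *\<^sub>R (LINT x|lborel. f (t + c *\<^sub>R x))"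
    by (subst integral_density) (auto simp: integral_distr)
  finally show ?thesis .
qed

lemma lborel_integrable_scale:
  fixes f :: "'a::euclidean_space \<Rightarrow> 'b::{banach, second_countable_topology}"
  assumes f: "integrable lborel f" and c: "c \<noteq> 0"
  shows "integrable lborel (\<lambda>x. f (t + c *\<^sub>R x))"
proof -
  have [measurable]: "f \<in> borel_measurable borel" using borel_measurable_integrable[OF f] by simp
  have "integrable (density (distr lborel borel (\<lambda>x. t + c *\<^sub>R x)) (\<lambda>_. \<bar>c\<bar> ^ DIM('a))) f"
    using f lborel_affine[OF c, of t] by simp
  then have *: "integrable lborel (\<lambda>x. \<bar>c\<bar> ^ DIM('a) *\<^sub>R f (t + c *\<^sub>R x))"
    by (subst (asm) integrable_density) (auto simp: integrable_distr_eq)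
  have "integrable lborel (\<lambda>x. inverse (\<bar>c\<bar> ^ DIM('a)) *\<^sub>R (\<bar>c\<bar> ^ DIM('a) *\<^sub>R f (t + c *\<^sub>R x)))"
    by (rule integrable_scaleR_right) (rule *)
  then show ?thesis using c by simp
qed

lemma L2_translate:
  assumes "u \<in> L2"
  shows "(\<lambda>x. u (c + x)) \<in> L2"
  using assms lborel_integrable_translate[of "\<lambda>x. (cmod (u x))\<^sup>2" c] unfolding L2_def by auto

lemma L2_norm_translate:
  assumes "u \<in> L2"
  shows "L2_norm (\<lambda>x. u (c + x)) = L2_norm u"
proof -
  have [measurable]: "u \<in> borel_measurable borel" using assms by (rule L2_measurable)
  show ?thesis using lborel_integral_translate[of "\<lambda>x. (cmod (u x))\<^sup>2" c] by (simp add: L2_norm_def)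
qed

lemma lborel_Fubini:
  fixes G :: "'a::euclidean_space \<Rightarrow> 'b::euclidean_space \<Rightarrow> complex"
  assumes m: "case_prod G \<in> borel_measurable (borel \<Otimes>\<^sub>M borel)"
    and N: "integrable lborel N"
    and G: "\<And>x. integrable lborel (G x)" "\<And>x. (LINT y|lborel. cmod (G x y)) \<le> N x"
  shows "(LINT x|lborel. LINT y|lborel. G x y) = (LINT y|lborel. LINT x|lborel. G x y)"
    and "integrable lborel (\<lambda>x. LINT y|lborel. G x y)"
    and "integrable lborel (\<lambda>y. LINT x|lborel. G x y)"
    and "AE y in lborel. integrable lborel (\<lambda>x. G x y)"
proof -
  have [measurable]: "case_prod G \<in> borel_measurable (lborel \<Otimes>\<^sub>M lborel)"
    using m by (simp cong: measurable_cong_sets sets_pair_measure_cong)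
  have "integrable (lborel \<Otimes>\<^sub>M lborel) (case_prod G)"
  proof (rule lborel_pair.Fubini_integrable)
    show "integrable lborel (\<lambda>x. LINT y|lborel. norm (case_prod G (x, y)))"
    proof (rule Bochner_Integration.integrable_bound[OF N])
      have "0 \<le> (LINT y|lborel. cmod (G x y))" for x by simp
      then show "AE x in lborel. norm (LINT y|lborel. norm (case_prod G (x, y))) \<le> norm (N x)"
        using G(2) by (auto intro!: order_trans[OF G(2)])
    qed measurable
  qed (use G in auto)
  then show "(LINT x|lborel. LINT y|lborel. G x y) = (LINT y|lborel. LINT x|lborel. G x y)"
    and "integrable lborel (\<lambda>x. LINT y|lborel. G x y)"
    and "integrable lborel (\<lambda>y. LINT x|lborel. G x y)"
    and "AE y in lborel. integrable lborel (\<lambda>x. G x y)"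
    by (auto intro: lborel_pair.Fubini_integral[symmetric] lborel_pair.integrable_fst lborel_pair.integrable_snd
        lborel_pair.AE_integrable_snd)
qed

text \<open>A majorant that factorizes is integrable on the product. Most exchanges of integrals
  below have this shape, one factor being a Fourier weight and the other a product of two
  \<open>L2\<close> functions or a time weight.\<close>

lemma lborel_Fubini_product_bound:
  fixes k :: "'a::euclidean_space \<Rightarrow> 'b::euclidean_space \<Rightarrow> complex"
  assumes m: "case_prod k \<in> borel_measurable (borel \<Otimes>\<^sub>M borel)"
    and X: "integrable lborel X" and Y: "integrable lborel Y"
    and k: "\<And>x y. cmod (k x y) \<le> cmod (X x) * cmod (Y y)"
  shows "(LINT x|lborel. LINT y|lborel. k x y) = (LINT y|lborel. LINT x|lborel. k x y)"
    and "integrable lborel (\<lambda>x. LINT y|lborel. k x y)"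
    and "integrable lborel (\<lambda>y. LINT x|lborel. k x y)"
proof -
  have [measurable]: "case_prod k \<in> borel_measurable (borel \<Otimes>\<^sub>M borel)" by (rule m)
  have i: "integrable lborel (k x)" for x
    by (rule Bochner_Integration.integrable_bound[of _ "\<lambda>y. X x * Y y"]) (use Y k in \<open>auto simp: norm_mult\<close>)
  have b: "(LINT y|lborel. cmod (k x y)) \<le> cmod (X x) * (LINT y|lborel. cmod (Y y))" for x
  proof -
    have "(LINT y|lborel. cmod (k x y)) \<le> (LINT y|lborel. cmod (X x) * cmod (Y y))"
      by (rule integral_mono) (use i Y k in auto)
    then show ?thesis by simp
  qed
  have N: "integrable lborel (\<lambda>x. cmod (X x) * (LINT y|lborel. cmod (Y y)))" using X by simp
  show "(LINT x|lborel. LINT y|lborel. k x y) = (LINT y|lborel. LINT x|lborel. k x y)"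
    and "integrable lborel (\<lambda>x. LINT y|lborel. k x y)"
    and "integrable lborel (\<lambda>y. LINT x|lborel. k x y)"
    by (rule lborel_Fubini[OF m N i b])+
qed

section \<open>Continuous functions of compact support\<close>

text \<open>Compact support is expressed as vanishing outside a ball, the form in which translations
  and scalings are easiest to follow; \<open>compactly_supported_iff\<close> links it to the
  topological notion.\<close>

definition Cc :: "('a::euclidean_space \<Rightarrow> complex) set" where
  "Cc = {f. continuous_on UNIV f \<and> (\<exists>R. \<forall>x. R < norm x \<longrightarrow> f x = 0)}"

lemma integrable_bounded_support:
  fixes f :: "'a::euclidean_space \<Rightarrow> 'b::{banach, second_countable_topology}"
  assumes [measurable]: "f \<in> borel_measurable borel" and "\<And>x. norm (f x) \<le> C" "\<And>x. R < norm x \<Longrightarrow> f x = 0"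
  shows "integrable lborel f"
proof (rule Bochner_Integration.integrable_bound)
  show "integrable lborel (\<lambda>x::'a. C * indicator (cball 0 R) x)"
    using emeasure_lborel_cball_finite[of "0::'a" R] by (intro integrable_mult_right) auto
  have "norm (f x) \<le> \<bar>C\<bar> * indicator (cball 0 R) x" for x
    using assms(2)[of x] assms(3)[of x] by (auto simp: indicator_def)
  then show "AE x in lborel. norm (f x) \<le> norm (C * indicator (cball 0 R) x)"
    by (auto simp: abs_mult)
qed auto

lemma Cc_measurable: "f \<in> Cc \<Longrightarrow> f \<in> borel_measurable borel"
  by (auto simp: Cc_def intro: borel_measurable_continuous_onI)

lemma Cc_bounded:
  assumes "f \<in> Cc"
  obtains C where "C > 0" "\<And>x. cmod (f x) \<le> C"
proof -
  obtain R where c: "continuous_on UNIV f" and R: "\<And>x. R < norm x \<Longrightarrow> f x = 0"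
    using assms by (auto simp: Cc_def)
  have "compact (f ` cball 0 R)"
    by (rule compact_continuous_image[OF continuous_on_subset[OF c]]) auto
  then obtain C where C: "C > 0" "\<And>x. x \<in> cball 0 R \<Longrightarrow> cmod (f x) \<le> C"
    using compact_imp_bounded bounded_pos by (metis imageI)
  have "cmod (f x) \<le> C" for x
    by (cases "norm x \<le> R") (use C R in auto)
  with C(1) show ?thesis using that by blast
qed

lemma Cc_integrable:
  assumes "f \<in> Cc"
  shows "integrable lborel f"
proof -
  obtain C where C: "\<And>x. cmod (f x) \<le> C" using Cc_bounded[OF assms] by blast
  obtain R where R: "\<And>x. R < norm x \<Longrightarrow> f x = 0" using assms by (auto simp: Cc_def)
  show ?thesis by (rule integrable_bounded_support[OF Cc_measurable[OF assms] C R])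
qed

lemma Cc_L2:
  assumes "f \<in> Cc"
  shows "f \<in> L2"
proof -
  obtain C where C: "\<And>x. cmod (f x) \<le> C" using Cc_bounded[OF assms] by blast
  obtain R where R: "\<And>x. R < norm x \<Longrightarrow> f x = 0" using assms by (auto simp: Cc_def)
  have [measurable]: "f \<in> borel_measurable borel" by (rule Cc_measurable[OF assms])
  have "integrable lborel (\<lambda>x. (cmod (f x))\<^sup>2)"
    by (rule integrable_bounded_support[where C = "C\<^sup>2" and R = R]) (auto simp: R power_mono C)
  then show ?thesis by (simp add: L2_def)
qed

lemma Cc_cnj: "f \<in> Cc \<Longrightarrow> (\<lambda>x. cnj (f x)) \<in> Cc"
  by (auto simp: Cc_def intro!: continuous_intros)

lemma Cc_mult: "f \<in> Cc \<Longrightarrow> continuous_on UNIV g \<Longrightarrow> (\<lambda>x. g x * f x) \<in> Cc"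
  by (auto simp: Cc_def intro!: continuous_intros)

lemma Cc_diff:
  assumes "f \<in> Cc" "g \<in> Cc"
  shows "(\<lambda>x. f x - g x) \<in> Cc"
proof -
  obtain R S where "\<And>x. R < norm x \<Longrightarrow> f x = 0" "\<And>x. S < norm x \<Longrightarrow> g x = 0"
    using assms by (auto simp: Cc_def)
  then have "\<exists>R. \<forall>x. R < norm x \<longrightarrow> f x - g x = 0" by (intro exI[of _ "max R S"]) auto
  moreover have "continuous_on UNIV (\<lambda>x. f x - g x)"
    using assms unfolding Cc_def by (auto intro!: continuous_intros)
  ultimately show ?thesis unfolding Cc_def by blast
qed

lemma Cc_translate:
  assumes "f \<in> Cc"
  shows "(\<lambda>x. f (c + x)) \<in> Cc"
proof -
  obtain R where R: "\<And>x. R < norm x \<Longrightarrow> f x = 0" using assms by (auto simp: Cc_def)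
  have "continuous_on UNIV (\<lambda>x. f (c + x))"
    using assms unfolding Cc_def
    by (auto intro!: continuous_on_compose2[of UNIV f] continuous_intros)
  moreover have "\<forall>x. R + norm c < norm x \<longrightarrow> f (c + x) = 0"
  proof (intro allI impI)
    fix x :: 'a assume "R + norm c < norm x"
    moreover have "norm x - norm c \<le> norm (c + x)" using norm_diff_ineq[of x c] by (simp add: add.commute)
    ultimately show "f (c + x) = 0" by (intro R) linarith
  qed
  ultimately show ?thesis by (auto simp: Cc_def)
qed

section \<open>Density of \<open>Cc\<close>\<close>

lemma AE_lborel_of_negligible:
  assumes "negligible N"
  shows "AE x in lborel. x \<notin> N"
proof -
  have "N \<in> null_sets (completion lborel)" using assms negligible_iff_null_sets by blast
  then have "AE x in completion lborel. x \<notin> N" by (rule AE_not_in)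
  then show ?thesis by (simp only: AE_completion_iff)
qed

text \<open>A Lebesgue measurable function is an almost everywhere limit of continuous ones.
  Truncating these in value and in space preserves the limit and provides the common bound and the
  common support that dominated convergence requires later.\<close>

lemma Cc_approx_bounded:
  assumes u: "u \<in> borel_measurable borel" and M: "\<And>x. cmod (u x) \<le> M" and R: "\<And>x. R < norm x \<Longrightarrow> u x = 0"
  obtains g where "\<forall>n. g n \<in> Cc" "\<forall>n x. cmod (g n x) \<le> M + 1"
    "\<forall>n x. R + 1 < norm x \<longrightarrow> g n x = 0" "AE x in lborel. (\<lambda>n. g n x) \<longlonglongrightarrow> u x"
proof -
  have M0: "M \<ge> 0" using M[of 0] norm_ge_zero order_trans by blast
  have "u measurable_on UNIV"
    by (rule lebesgue_measurable_imp_measurable_on) (use u in \<open>auto intro: measurable_completion\<close>)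
  then obtain N f where N: "negligible N" and f: "\<And>n. continuous_on UNIV (f n)"
    and l: "\<And>x. x \<notin> N \<Longrightarrow> (\<lambda>n. f n x) \<longlonglongrightarrow> u x"
    unfolding measurable_on_def by auto
  \<comment> \<open>The radial retraction onto the disc of radius M + 1. The added 1 keeps the
    denominator positive when M = 0.\<close>
  define clip where "clip = (\<lambda>z::complex. of_real ((M + 1) / max (M + 1) (cmod z)) * z)"
  define cut where "cut = (\<lambda>x::'a. max 0 (min 1 (R + 1 - norm x)))"
  have clip_cont: "continuous_on UNIV clip" unfolding clip_def using M0
    by (intro continuous_intros) (auto simp: max_def)
  have clip_le: "cmod (clip z) \<le> M + 1" for z
  proof -
    have "cmod (clip z) = (M + 1) / max (M + 1) (cmod z) * cmod z"
      using M0 unfolding clip_def norm_mult norm_of_real by simp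
    also have "\<dots> \<le> M + 1"
    proof (cases "M + 1 \<le> cmod z")
      case True
      then have "max (M + 1) (cmod z) = cmod z" "cmod z > 0" using M0 by auto
      then show ?thesis by simp
    next
      case False
      then have "max (M + 1) (cmod z) = M + 1" by auto
      then show ?thesis using False M0 by simp
    qed
    finally show ?thesis .
  qed
  have clip_id: "clip z = z" if "cmod z \<le> M" for z
  proof -
    have "max (M + 1) (cmod z) = M + 1" using that by auto
    then show ?thesis using M0 unfolding clip_def by (simp del: of_real_add of_real_divide)
  qed
  have cut_cont: "continuous_on UNIV cut" unfolding cut_def by (intro continuous_intros)
  have cut01: "0 \<le> cut x" "cut x \<le> 1" for x by (auto simp: cut_def)
  let ?g = "\<lambda>n x. of_real (cut x) * clip (f n x)"
  have gc: "continuous_on UNIV (?g n)" for n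
    by (intro continuous_intros cut_cont continuous_on_compose2[OF clip_cont f]) auto
  have g0: "?g n x = 0" if "R + 1 < norm x" for n x using that by (simp add: cut_def)
  show ?thesis
  proof (rule that[of ?g])
    show "\<forall>n. ?g n \<in> Cc" using gc g0 unfolding Cc_def by blast
    have "cmod (?g n x) \<le> M + 1" for n x
      using mult_mono[OF cut01(2)[of x] clip_le[of "f n x"]] cut01[of x] by (simp add: norm_mult)
    then show "\<forall>n x. cmod (?g n x) \<le> M + 1" by blast
    show "\<forall>n x. R + 1 < norm x \<longrightarrow> ?g n x = 0" using g0 by blast
    show "AE x in lborel. (\<lambda>n. ?g n x) \<longlonglongrightarrow> u x"
      using AE_lborel_of_negligible[OF N]
    proof eventually_elim
      case (elim x)
      have "(\<lambda>n. clip (f n x)) \<longlonglongrightarrow> clip (u x)"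
        by (rule continuous_on_tendsto_compose[OF clip_cont l[OF elim]]) auto
      then have "(\<lambda>n. ?g n x) \<longlonglongrightarrow> of_real (cut x) * u x"
        using clip_id[OF M] by (intro tendsto_mult tendsto_const) simp
      moreover have "of_real (cut x) * u x = u x"
        using R[of x] by (cases "R < norm x") (auto simp: cut_def)
      ultimately show ?case by simp
    qed
  qed
qed

text \<open>Stated for a general exponent because both p = 2 (vectors) and p = 1 (the time weight)
  occur.\<close>

lemma Cc_dense:
  assumes [measurable]: "u \<in> borel_measurable borel" and i: "integrable lborel (\<lambda>x. cmod (u x) ^ p)"
    and p: "p > 0" and e: "e > 0"
  obtains g where "g \<in> Cc" "(LINT x|lborel. cmod (u x - g x) ^ p) < e"
proof -
  \<comment> \<open>A crude convexity inequality; it yields an integrable majorant for the p-th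
    power of the difference.\<close>
  have pw: "(a + b) ^ p \<le> 2 ^ p * (a ^ p + b ^ p)" if "0 \<le> a" "0 \<le> b" for a b :: real
  proof -
    have "(a + b) ^ p \<le> (2 * max a b) ^ p" using that by (intro power_mono) auto
    also have "\<dots> = 2 ^ p * max a b ^ p" by (simp add: power_mult_distrib)
    also have "max a b ^ p \<le> a ^ p + b ^ p" using that by (auto simp: max_def)
    finally show ?thesis by simp
  qed
  \<comment> \<open>Cutting both space and size makes \<open>Cc_approx_bounded\<close> applicable;
    at each point the cut is eventually inactive.\<close>
  define U where "U = (\<lambda>(k::nat) x. if norm x \<le> real k \<and> cmod (u x) \<le> real k then u x else 0)"
  have [measurable]: "U k \<in> borel_measurable borel" for k unfolding U_def by measurable
  have "(\<lambda>k. LINT x|lborel. cmod (u x - U k x) ^ p) \<longlonglongrightarrow> (LINT x|(lborel :: 'a measure). (0::real))"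
  proof (rule integral_dominated_convergence[where w = "\<lambda>x. cmod (u x) ^ p"])
    show "AE x in lborel. (\<lambda>k. cmod (u x - U k x) ^ p) \<longlonglongrightarrow> 0"
    proof (rule AE_I2, rule tendsto_eventually)
      fix x :: 'a
      obtain K :: nat where "norm x + cmod (u x) \<le> real K" using real_arch_simple by blast
      then have K: "norm x \<le> real K" "cmod (u x) \<le> real K"
        using norm_ge_zero[of x] norm_ge_zero[of "u x"] by linarith+
      show "\<forall>\<^sub>F k in sequentially. cmod (u x - U k x) ^ p = 0"
        unfolding eventually_sequentially using K p by (intro exI[of _ K]) (auto simp: U_def)
    qed
    show "AE x in lborel. norm (cmod (u x - U k x) ^ p) \<le> cmod (u x) ^ p" for k
      using p by (auto simp: U_def)
  qed (use i in auto)
  then have "(\<lambda>k. LINT x|lborel. cmod (u x - U k x) ^ p) \<longlonglongrightarrow> 0" by simp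
  then have "\<forall>\<^sub>F k in sequentially. (LINT x|lborel. cmod (u x - U k x) ^ p) < e"
    using e by (rule order_tendstoD)
  then obtain k where k: "(LINT x|lborel. cmod (u x - U k x) ^ p) < e"
    unfolding eventually_sequentially by blast
  have "U k \<in> borel_measurable borel" "\<And>x. cmod (U k x) \<le> real k" "\<And>x. real k < norm x \<Longrightarrow> U k x = 0"
    by (auto simp: U_def)
  then obtain g where g: "\<forall>n. g n \<in> Cc" "\<forall>n x. cmod (g n x) \<le> real k + 1"
    "\<forall>n x. real k + 1 < norm x \<longrightarrow> g n x = 0" "AE x in lborel. (\<lambda>n. g n x) \<longlonglongrightarrow> U k x"
    by (rule Cc_approx_bounded)
  have [measurable]: "g n \<in> borel_measurable borel" for n using g(1) by (auto intro: Cc_measurable)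
  have "(\<lambda>n. LINT x|lborel. cmod (u x - g n x) ^ p) \<longlonglongrightarrow> (LINT x|lborel. cmod (u x - U k x) ^ p)"
  proof (rule integral_dominated_convergence)
    let ?w = "\<lambda>x::'a. 2 ^ p * (cmod (u x) ^ p + (real k + 1) ^ p * indicator (cball 0 (real k + 1)) x)"
    have "integrable lborel (\<lambda>x::'a. (real k + 1) ^ p * indicator (cball 0 (real k + 1)) x)"
      using emeasure_lborel_cball_finite[of "0::'a" "real k + 1"] by (intro integrable_mult_right) auto
    then show "integrable lborel ?w" using i by simp
    show "AE x in lborel. (\<lambda>n. cmod (u x - g n x) ^ p) \<longlonglongrightarrow> cmod (u x - U k x) ^ p"
      using g(4) by eventually_elim (intro tendsto_intros)
    show "AE x in lborel. norm (cmod (u x - g n x) ^ p) \<le> ?w x" for n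
    proof (rule AE_I2)
      fix x
      have "cmod (u x - g n x) ^ p \<le> (cmod (u x) + cmod (g n x)) ^ p"
        by (intro power_mono norm_triangle_ineq4) auto
      also have "\<dots> \<le> 2 ^ p * (cmod (u x) ^ p + cmod (g n x) ^ p)" by (rule pw) auto
      also have "cmod (g n x) ^ p \<le> (real k + 1) ^ p * indicator (cball 0 (real k + 1)) x"
      proof (cases "norm x \<le> real k + 1")
        case True
        then show ?thesis using power_mono[of "cmod (g n x)" "real k + 1" p] g(2) by simp
      next
        case False
        then have "g n x = 0" using g(3) by auto
        then show ?thesis using p by (simp add: zero_power)
      qed
      finally show "norm (cmod (u x - g n x) ^ p) \<le> ?w x" by simp
    qed
  qed auto
  then have "\<forall>\<^sub>F n in sequentially. (LINT x|lborel. cmod (u x - g n x) ^ p) < e"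
    using k by (rule order_tendstoD)
  then obtain n where "(LINT x|lborel. cmod (u x - g n x) ^ p) < e"
    unfolding eventually_sequentially by blast
  with g(1) show ?thesis using that by blast
qed

lemma Cc_dense_L2:
  assumes "u \<in> L2" "e > 0"
  obtains g where "g \<in> Cc" "L2_norm (\<lambda>x. u x - g x) < e"
proof -
  obtain g where g: "g \<in> Cc" "(LINT x|lborel. (cmod (u x - g x))\<^sup>2) < e\<^sup>2"
    by (rule Cc_dense[of u 2 "e\<^sup>2"]) (use assms in \<open>auto simp: L2_def\<close>)
  have "(L2_norm (\<lambda>x. u x - g x))\<^sup>2 < e\<^sup>2" using g(2) by (simp add: L2_norm_sq)
  then have "L2_norm (\<lambda>x. u x - g x) < e" using assms(2) by (simp add: power2_less_imp_less)
  with g(1) show ?thesis using that by blast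
qed

text \<open>If u were nonzero, some g in \<open>Cc\<close> would be closer to u than the norm of u,
  and the square of that norm would equal |(u | u - g)|, which is strictly smaller.\<close>

lemma L2_eq_zeroI:
  assumes u: "u \<in> L2" and z: "\<And>v. v \<in> Cc \<Longrightarrow> L2_inner u v = 0"
  shows "AE x in lborel. u x = 0"
proof -
  have "L2_norm u = 0"
  proof (rule ccontr)
    assume "L2_norm u \<noteq> 0"
    then have p: "L2_norm u > 0" using L2_norm_nonneg[of u] by linarith
    obtain g where g: "g \<in> Cc" "L2_norm (\<lambda>x. u x - g x) < L2_norm u" using Cc_dense_L2[OF u p] by blast
    have "L2_inner u u = L2_inner u (\<lambda>x. u x - g x)"
      using z[OF g(1)] u Cc_L2[OF g(1)] by (simp add: L2_inner_diff_right)
    moreover have "cmod (L2_inner u u) = (L2_norm u)\<^sup>2" unfolding L2_inner_self norm_of_real by simp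
    ultimately have "(L2_norm u)\<^sup>2 = cmod (L2_inner u (\<lambda>x. u x - g x))" by simp
    also have "\<dots> \<le> L2_norm u * L2_norm (\<lambda>x. u x - g x)"
      by (rule L2_inner_bound[OF u L2_diff[OF u Cc_L2[OF g(1)]]])
    also have "\<dots> < L2_norm u * L2_norm u" using g(2) p by simp
    finally show False by (simp add: power2_eq_square)
  qed
  then show ?thesis using L2_norm_zero_iff[OF u] by simp
qed

section \<open>Gaussian regularization of the Fourier integral\<close>

lemma borel_measurable_cis [measurable (raw)]:
  "f \<in> borel_measurable M \<Longrightarrow> (\<lambda>x. cis (f x)) \<in> borel_measurable M"
  by (rule borel_measurable_continuous_on[OF continuous_on_cis[OF continuous_on_id]])

text \<open>\<open>lborel\<close> is the image of a product of one-dimensional Lebesgue measures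
  under the coordinate map. This reduces the Gaussian and the weight \<open>japanese\<close> to
  integrals over the line.\<close>

lemma lborel_integral_prod:
  fixes f :: "'a::euclidean_space \<Rightarrow> real \<Rightarrow> 'b::{real_normed_field, banach, second_countable_topology}"
  assumes f: "\<And>b. b \<in> Basis \<Longrightarrow> integrable lborel (f b)"
  shows "integrable lborel (\<lambda>x::'a. \<Prod>b\<in>Basis. f b (x \<bullet> b))"
    and "(LINT x|lborel. (\<Prod>b\<in>Basis. f b (x \<bullet> b))) = (\<Prod>b\<in>Basis. LINT t|lborel. f b t)"
proof -
  interpret product_sigma_finite "\<lambda>_::'a. lborel :: real measure" ..
  let ?P = "\<Pi>\<^sub>M b\<in>(Basis::'a set). (lborel :: real measure)"
  let ?T = "\<lambda>g::'a \<Rightarrow> real. \<Sum>b\<in>Basis. g b *\<^sub>R b"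
  have [measurable]: "f b \<in> borel_measurable borel" if "b \<in> Basis" for b
    using borel_measurable_integrable[OF f[OF that]] by simp
  have m: "(\<lambda>x::'a. \<Prod>b\<in>Basis. f b (x \<bullet> b)) \<in> borel_measurable borel"
    by (rule borel_measurable_prod) measurable
  have T: "?T \<in> ?P \<rightarrow>\<^sub>M borel" by measurable
  have e: "(\<Prod>b\<in>Basis. f b (?T g \<bullet> b)) = (\<Prod>b\<in>Basis. f b (g b))" for g
    by (rule prod.cong) (auto simp: inner_sum_left inner_Basis if_distrib cong: if_cong)
  have "integrable ?P (\<lambda>g. \<Prod>b\<in>Basis. f b (g b))"
    by (rule product_integrable_prod) (auto simp: f)
  then show "integrable lborel (\<lambda>x::'a. \<Prod>b\<in>Basis. f b (x \<bullet> b))"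
    unfolding lborel_eq[where 'a = 'a] by (subst integrable_distr_eq[OF T m]) (simp only: e)
  have "(LINT x|lborel. (\<Prod>b\<in>Basis. f b (x \<bullet> b))) = (LINT g|?P. (\<Prod>b\<in>Basis. f b (g b)))"
    unfolding lborel_eq[where 'a = 'a] by (subst integral_distr[OF T m]) (simp only: e)
  also have "\<dots> = (\<Prod>b\<in>Basis. LINT t|lborel. f b t)"
    by (rule product_integral_prod) (auto simp: f)
  finally show "(LINT x|lborel. (\<Prod>b\<in>Basis. f b (x \<bullet> b))) = (\<Prod>b\<in>Basis. LINT t|lborel. f b t)" .
qed

lemma integral_norm_le:
  fixes f :: "'b \<Rightarrow> 'a::{banach, second_countable_topology}"
  assumes "integrable M g" "\<And>x. norm (f x) \<le> g x"
  shows "norm (integral\<^sup>L M f) \<le> integral\<^sup>L M g"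
proof (cases "integrable M f")
  case True
  then have "norm (integral\<^sup>L M f) \<le> (LINT x|M. norm (f x))" by simp
  also have "\<dots> \<le> integral\<^sup>L M g" using True assms by (intro integral_mono) auto
  finally show ?thesis .
next
  case False
  have "0 \<le> integral\<^sup>L M g" using assms(2) by (intro Bochner_Integration.integral_nonneg) (metis norm_ge_zero order_trans)
  then show ?thesis using False by (simp add: not_integrable_integral_eq)
qed

definition gauss :: "'a::euclidean_space \<Rightarrow> real" where
  "gauss x = exp (- (norm x)\<^sup>2 / 2)"

lemma gauss_measurable [measurable]: "gauss \<in> borel_measurable borel"
  unfolding gauss_def[abs_def] by measurable

lemma gauss_pos: "0 < gauss x" and gauss_nonneg [simp]: "0 \<le> gauss x" and gauss_le_1 [simp]: "gauss x \<le> 1"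
  by (auto simp: gauss_def)

lemma abs_gauss [simp]: "\<bar>gauss x\<bar> = gauss x"
  by (simp add: gauss_def)

lemma gauss_prod: "gauss (x::'a::euclidean_space) = (\<Prod>b\<in>Basis. exp (- (x \<bullet> b)\<^sup>2 / 2))"
proof -
  have "(norm x)\<^sup>2 = (\<Sum>b\<in>Basis. (x \<bullet> b)\<^sup>2)"
    by (subst power2_norm_eq_inner, subst euclidean_inner) (simp add: power2_eq_square)
  then show ?thesis
    by (simp add: gauss_def exp_sum sum_divide_distrib sum_negf flip: exp_sum)
qed

text \<open>Up to the factor sqrt(2 pi) this is the characteristic function of the standard normal
  distribution.\<close>

lemma gauss_1D:
  "integrable lborel (\<lambda>t::real. complex_of_real (exp (- t\<^sup>2 / 2)) * cis (- (t * s)))"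
  "(LINT t|lborel. complex_of_real (exp (- t\<^sup>2 / 2)) * cis (- (t * s)))
     = complex_of_real (sqrt (2 * pi) * exp (- s\<^sup>2 / 2))"
proof -
  have e: "complex_of_real (exp (- t\<^sup>2 / 2)) = complex_of_real (sqrt (2 * pi)) * complex_of_real (std_normal_density t)" for t
    by (simp add: std_normal_density_def)
  have i: "integrable lborel (\<lambda>t. complex_of_real (exp (- t\<^sup>2 / 2)))"
    unfolding e using integrable_std_normal_moment[of 0] by (intro integrable_mult_right) simp
  show "integrable lborel (\<lambda>t::real. complex_of_real (exp (- t\<^sup>2 / 2)) * cis (- (t * s)))"
    by (rule Bochner_Integration.integrable_bound[OF i]) (auto simp: norm_mult)
  have "(LINT t|lborel. complex_of_real (exp (- t\<^sup>2 / 2)) * cis (- (t * s)))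
      = complex_of_real (sqrt (2 * pi)) * (LINT t|lborel. std_normal_density t *\<^sub>R cis (- (t * s)))"
    unfolding e by (simp add: scaleR_conv_of_real mult.assoc)
  also have "(LINT t|lborel. std_normal_density t *\<^sub>R cis (- (t * s))) = char std_normal_distribution (- s)"
    unfolding char_def by (subst integral_density) (auto simp: cis_conv_exp mult.commute)
  also have "\<dots> = complex_of_real (exp (- s\<^sup>2 / 2))"
    by (simp add: char_std_normal_distribution)
  finally show "(LINT t|lborel. complex_of_real (exp (- t\<^sup>2 / 2)) * cis (- (t * s)))
     = complex_of_real (sqrt (2 * pi) * exp (- s\<^sup>2 / 2))" by simp
qed

lemma cis_sum: "finite A \<Longrightarrow> cis (\<Sum>i\<in>A. f i) = (\<Prod>i\<in>A. cis (f i))"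
  by (induction A rule: finite_induct) (auto simp: cis_mult[symmetric])

lemma gauss_fourier:
  fixes p :: "'a::euclidean_space"
  shows "integrable lborel (\<lambda>x::'a. complex_of_real (gauss x) * cis (- (x \<bullet> p)))"
    and "(LINT x|lborel. complex_of_real (gauss x) * cis (- (x \<bullet> p)))
      = complex_of_real (sqrt ((2 * pi) ^ DIM('a)) * gauss p)"
proof -
  have e: "complex_of_real (gauss x) * cis (- (x \<bullet> p))
      = (\<Prod>b\<in>Basis. complex_of_real (exp (- (x \<bullet> b)\<^sup>2 / 2)) * cis (- ((x \<bullet> b) * (p \<bullet> b))))" for x :: 'a
    unfolding gauss_prod euclidean_inner[of x p]
    by (simp add: prod.distrib sum_negf[symmetric] cis_sum)
  show "integrable lborel (\<lambda>x::'a. complex_of_real (gauss x) * cis (- (x \<bullet> p)))"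
    unfolding e by (rule lborel_integral_prod(1)) (rule gauss_1D)
  have "(LINT x|lborel. complex_of_real (gauss x) * cis (- (x \<bullet> p)))
      = (\<Prod>b\<in>(Basis::'a set). complex_of_real (sqrt (2 * pi) * exp (- (p \<bullet> b)\<^sup>2 / 2)))"
    unfolding e by (subst lborel_integral_prod(2)) (simp_all only: gauss_1D)
  also have "\<dots> = complex_of_real (sqrt (2 * pi) ^ DIM('a) * gauss p)"
    unfolding gauss_prod by (simp add: prod.distrib)
  finally show "(LINT x|lborel. complex_of_real (gauss x) * cis (- (x \<bullet> p)))
      = complex_of_real (sqrt ((2 * pi) ^ DIM('a)) * gauss p)" by (simp only: real_sqrt_power)
qed

lemma gauss_integrable: "integrable lborel (gauss :: 'a::euclidean_space \<Rightarrow> real)"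
  using integrable_norm[OF gauss_fourier(1)[of "0::'a"]] by (simp add: gauss_def[abs_def])

lemma gauss_scale_integrable: "e \<noteq> 0 \<Longrightarrow> integrable lborel (\<lambda>x::'a::euclidean_space. gauss (e *\<^sub>R x))"
  using lborel_integrable_scale[OF gauss_integrable, of e 0] by simp

lemma gauss_integral: "(LINT x|lborel. gauss (x::'a::euclidean_space)) = sqrt ((2 * pi) ^ DIM('a))"
proof -
  have "complex_of_real (LINT x|lborel. gauss (x::'a)) = complex_of_real (sqrt ((2 * pi) ^ DIM('a)))"
    using gauss_fourier(2)[of "0::'a"] by (simp add: gauss_def)
  then show ?thesis using of_real_eq_iff by blast
qed

lemma gauss_fourier_scale:
  fixes p :: "'a::euclidean_space"
  assumes "e > 0"
  shows "(LINT x|lborel. complex_of_real (gauss (e *\<^sub>R x)) * cis (- (x \<bullet> p)))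
      = complex_of_real (sqrt ((2 * pi) ^ DIM('a)) / e ^ DIM('a) * gauss (p /\<^sub>R e))"
proof -
  have "(LINT x|lborel. complex_of_real (gauss x) * cis (- (x \<bullet> (p /\<^sub>R e))))
      = e ^ DIM('a) *\<^sub>R (LINT x|lborel. complex_of_real (gauss (e *\<^sub>R x)) * cis (- (x \<bullet> p)))"
    by (subst lborel_integral_scale[where c = e and t = 0])
       (use assms in \<open>auto simp: mult.assoc[symmetric]\<close>)
  then show ?thesis using assms unfolding gauss_fourier(2)
    by (simp add: scaleR_conv_of_real field_simps)
qed

text \<open>The unnormalized transform, meaningful for integrable functions. The unitary versions
  are \<open>F0\<close> on \<open>Cc\<close> and \<open>fourier\<close> on
  \<open>L2\<close>.\<close>

definition ft :: "('a::euclidean_space \<Rightarrow> complex) \<Rightarrow> 'a \<Rightarrow> complex" where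
  "ft u p = (LINT x|lborel. u x * cis (- (x \<bullet> p)))"

lemma integrable_mult_cis:
  assumes "integrable lborel u" and [measurable]: "f \<in> borel_measurable borel"
  shows "integrable lborel (\<lambda>x::'a::euclidean_space. u x * cis (f x))"
  by (rule Bochner_Integration.integrable_bound[OF assms(1)])
     (use borel_measurable_integrable[OF assms(1)] in \<open>auto simp: norm_mult\<close>)

lemma ft_measurable [measurable]:
  assumes [measurable]: "u \<in> borel_measurable borel"
  shows "ft u \<in> borel_measurable borel"
  unfolding ft_def[abs_def] by measurable

lemma ft_bound: "cmod (ft u p) \<le> (LINT x|lborel. cmod (u x))"
proof -
  have "cmod (ft u p) \<le> (LINT x|lborel. cmod (u x * cis (- (x \<bullet> p))))" unfolding ft_def by simp
  then show ?thesis by (simp add: norm_mult)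
qed

lemma ft_exchange:
  assumes u: "integrable lborel u" and w: "integrable lborel w"
  shows "(LINT p|lborel. ft u p * w p) = (LINT x|lborel. u x * ft w x)"
proof -
  have [measurable]: "u \<in> borel_measurable borel" "w \<in> borel_measurable borel"
    using borel_measurable_integrable[OF u] borel_measurable_integrable[OF w] by auto
  have "(LINT p|lborel. ft u p * w p) = (LINT p|lborel. LINT x|lborel. u x * cis (- (x \<bullet> p)) * w p)"
    unfolding ft_def by simp
  also have "\<dots> = (LINT x|lborel. LINT p|lborel. u x * cis (- (x \<bullet> p)) * w p)"
    by (rule lborel_Fubini_product_bound(1)[OF _ w u]) (auto simp: norm_mult)
  also have "\<dots> = (LINT x|lborel. u x * ft w x)"
    unfolding ft_def by (simp add: mult.assoc inner_commute mult.commute[of "cis _"])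
  finally show ?thesis .
qed

lemma ft_gauss_integrable:
  assumes u: "integrable lborel (u :: 'a::euclidean_space \<Rightarrow> complex)" and "e \<noteq> 0"
  shows "integrable lborel (\<lambda>p. ft u p * complex_of_real (gauss (e *\<^sub>R p)))"
proof -
  have [measurable]: "u \<in> borel_measurable borel" using borel_measurable_integrable[OF u] by simp
  show ?thesis
  proof (rule Bochner_Integration.integrable_bound)
    show "integrable lborel (\<lambda>p::'a. (LINT x|lborel. cmod (u x)) * gauss (e *\<^sub>R p))"
      by (intro integrable_mult_right gauss_scale_integrable assms(2))
    show "AE p in lborel. norm (ft u p * complex_of_real (gauss (e *\<^sub>R p)))
        \<le> norm ((LINT x|lborel. cmod (u x)) * gauss (e *\<^sub>R p))"
      using ft_bound[of u] by (auto simp: norm_mult abs_mult intro!: mult_right_mono)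
  qed measurable
qed

text \<open>Exchanging the integrals moves the transform onto a modulated Gaussian. Its transform is
  a Gaussian of width e centred at x, that is, an approximate identity; the substitution y = x + e z
  then removes e from the weight.\<close>

lemma ft_gauss_inversion:
  fixes v :: "'a::euclidean_space \<Rightarrow> complex"
  assumes v: "v \<in> Cc" and e: "e > 0"
  shows "(LINT p|lborel. ft v p * complex_of_real (gauss (e *\<^sub>R p)) * cis (x \<bullet> p))
    = complex_of_real (sqrt ((2 * pi) ^ DIM('a))) * (LINT z|lborel. v (x + e *\<^sub>R z) * complex_of_real (gauss z))"
proof -
  have [measurable]: "v \<in> borel_measurable borel" by (rule Cc_measurable[OF v])
  let ?w = "\<lambda>p. complex_of_real (gauss (e *\<^sub>R p)) * cis (x \<bullet> p)"
  have "integrable lborel (\<lambda>p::'a. complex_of_real (gauss (e *\<^sub>R p)))"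
    using gauss_scale_integrable[of e] e by (intro integrable_of_real) auto
  then have w: "integrable lborel ?w" by (rule integrable_mult_cis) measurable
  have "(LINT p|lborel. ft v p * complex_of_real (gauss (e *\<^sub>R p)) * cis (x \<bullet> p)) = (LINT p|lborel. ft v p * ?w p)"
    by (simp add: mult.assoc)
  also have "\<dots> = (LINT y|lborel. v y * ft ?w y)" by (rule ft_exchange[OF Cc_integrable[OF v] w])
  also have "\<dots> = (LINT y|lborel. v y * complex_of_real (sqrt ((2 * pi) ^ DIM('a)) / e ^ DIM('a) * gauss ((y - x) /\<^sub>R e)))"
  proof -
    have "ft ?w y = complex_of_real (sqrt ((2 * pi) ^ DIM('a)) / e ^ DIM('a) * gauss ((y - x) /\<^sub>R e))" for y
    proof -
      have "ft ?w y = (LINT p|lborel. complex_of_real (gauss (e *\<^sub>R p)) * cis (- (p \<bullet> (y - x))))"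
        unfolding ft_def by (simp add: mult.assoc cis_mult inner_diff_right inner_commute)
      then show ?thesis using gauss_fourier_scale[OF e] by simp
    qed
    then show ?thesis by simp
  qed
  also have "\<dots> = \<bar>e\<bar> ^ DIM('a) *\<^sub>R (LINT z|lborel. v (x + e *\<^sub>R z) *
         complex_of_real (sqrt ((2 * pi) ^ DIM('a)) / e ^ DIM('a) * gauss (((x + e *\<^sub>R z) - x) /\<^sub>R e)))"
    using e by (intro lborel_integral_scale) auto
  also have "\<dots> = complex_of_real (sqrt ((2 * pi) ^ DIM('a))) * (LINT z|lborel. v (x + e *\<^sub>R z) * complex_of_real (gauss z))"
  proof -
    have "v (x + e *\<^sub>R z) * complex_of_real (sqrt ((2 * pi) ^ DIM('a)) / e ^ DIM('a) * gauss (((x + e *\<^sub>R z) - x) /\<^sub>R e))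
      = complex_of_real (sqrt ((2 * pi) ^ DIM('a)) / e ^ DIM('a)) * (v (x + e *\<^sub>R z) * complex_of_real (gauss z))" for z
      using e by simp
    then show ?thesis using e
      by (simp only: integral_mult_right_zero scaleR_conv_of_real) simp
  qed
  finally show ?thesis .
qed

lemma gauss_average_bound:
  fixes v :: "'a::euclidean_space \<Rightarrow> complex"
  assumes C: "\<And>x. cmod (v x) \<le> C"
  shows "cmod (LINT z|lborel. v (x + e *\<^sub>R z) * complex_of_real (gauss z)) \<le> C * sqrt ((2 * pi) ^ DIM('a))"
proof -
  have "cmod (LINT z|lborel. v (x + e *\<^sub>R z) * complex_of_real (gauss z)) \<le> (LINT z|lborel. C * gauss (z::'a))"
  proof (rule integral_norm_le)
    show "integrable lborel (\<lambda>z::'a. C * gauss z)" by (intro integrable_mult_right gauss_integrable)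
    show "norm (v (x + e *\<^sub>R z) * complex_of_real (gauss z)) \<le> C * gauss z" for z
      using C by (simp add: norm_mult mult_right_mono)
  qed
  then show ?thesis by (simp add: gauss_integral)
qed

lemma gauss_average_tendsto:
  fixes v :: "'a::euclidean_space \<Rightarrow> complex"
  assumes v: "v \<in> Cc" and e: "e \<longlonglongrightarrow> 0"
  shows "(\<lambda>n. LINT z|lborel. v (x + e n *\<^sub>R z) * complex_of_real (gauss z))
    \<longlonglongrightarrow> v x * complex_of_real (sqrt ((2 * pi) ^ DIM('a)))"
proof -
  have [measurable]: "v \<in> borel_measurable borel" by (rule Cc_measurable[OF v])
  obtain C where C: "\<And>x. cmod (v x) \<le> C" using Cc_bounded[OF v] by blast
  have "(\<lambda>n. LINT z|lborel. v (x + e n *\<^sub>R z) * complex_of_real (gauss z))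
    \<longlonglongrightarrow> (LINT z|lborel. v x * complex_of_real (gauss (z::'a)))"
  proof (rule integral_dominated_convergence[where w = "\<lambda>z. C * gauss z"])
    show "integrable lborel (\<lambda>z::'a. C * gauss z)" by (intro integrable_mult_right gauss_integrable)
    show "AE z in lborel. (\<lambda>n. v (x + e n *\<^sub>R z) * complex_of_real (gauss z)) \<longlonglongrightarrow> v x * complex_of_real (gauss z)"
    proof (rule AE_I2)
      fix z :: 'a
      have "(\<lambda>n. x + e n *\<^sub>R z) \<longlonglongrightarrow> x + 0 *\<^sub>R z" by (intro tendsto_intros e)
      then have "(\<lambda>n. v (x + e n *\<^sub>R z)) \<longlonglongrightarrow> v x"
        using v by (intro continuous_on_tendsto_compose[of UNIV v]) (auto simp: Cc_def)
      then show "(\<lambda>n. v (x + e n *\<^sub>R z) * complex_of_real (gauss z)) \<longlonglongrightarrow> v x * complex_of_real (gauss z)"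
        by (intro tendsto_intros)
    qed
    show "AE z in lborel. norm (v (x + e n *\<^sub>R z) * complex_of_real (gauss z)) \<le> C * gauss z" for n
      using C by (auto simp: norm_mult mult_right_mono)
  qed measurable
  then show ?thesis by (simp add: gauss_integral)
qed

lemma gauss_tendsto_1: "(\<lambda>n. gauss ((1 / real (Suc n)) *\<^sub>R p)) \<longlonglongrightarrow> 1"
proof -
  have "(\<lambda>n. exp (- (norm ((1 / real (Suc n)) *\<^sub>R p))\<^sup>2 / 2)) \<longlonglongrightarrow> exp (- (norm (0 *\<^sub>R p))\<^sup>2 / 2)"
    by (intro tendsto_intros LIMSEQ_Suc[OF lim_1_over_n]) auto
  then show ?thesis by (simp add: gauss_def)
qed

text \<open>The damped integral has two limits as e tends to 0: by dominated convergence the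
  undamped one, and by the approximate identity a multiple of v x.\<close>

theorem ft_inversion:
  fixes v :: "'a::euclidean_space \<Rightarrow> complex"
  assumes v: "v \<in> Cc" and i: "integrable lborel (ft v)"
  shows "(LINT p|lborel. ft v p * cis (x \<bullet> p)) = (2 * pi) ^ DIM('a) * v x"
proof (rule LIMSEQ_unique)
  have [measurable]: "v \<in> borel_measurable borel" by (rule Cc_measurable[OF v])
  let ?e = "\<lambda>n. 1 / real (Suc n)"
  show "(\<lambda>n. LINT p|lborel. ft v p * complex_of_real (gauss (?e n *\<^sub>R p)) * cis (x \<bullet> p))
    \<longlonglongrightarrow> (LINT p|lborel. ft v p * cis (x \<bullet> p))"
  proof (rule integral_dominated_convergence[where w = "\<lambda>p. cmod (ft v p)"])
    show "AE p in lborel. (\<lambda>n. ft v p * complex_of_real (gauss (?e n *\<^sub>R p)) * cis (x \<bullet> p)) \<longlonglongrightarrow> ft v p * cis (x \<bullet> p)"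
    proof (rule AE_I2)
      fix p :: 'a
      have "(\<lambda>n. ft v p * complex_of_real (gauss (?e n *\<^sub>R p)) * cis (x \<bullet> p)) \<longlonglongrightarrow> ft v p * complex_of_real 1 * cis (x \<bullet> p)"
        by (intro tendsto_intros gauss_tendsto_1)
      then show "(\<lambda>n. ft v p * complex_of_real (gauss (?e n *\<^sub>R p)) * cis (x \<bullet> p)) \<longlonglongrightarrow> ft v p * cis (x \<bullet> p)" by simp
    qed
    show "AE p in lborel. norm (ft v p * complex_of_real (gauss (?e n *\<^sub>R p)) * cis (x \<bullet> p)) \<le> cmod (ft v p)" for n
      by (auto simp: norm_mult intro!: mult_left_le)
  qed (use i in auto)
  have "(\<lambda>n. complex_of_real (sqrt ((2 * pi) ^ DIM('a))) * (LINT z|lborel. v (x + ?e n *\<^sub>R z) * complex_of_real (gauss z)))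
    \<longlonglongrightarrow> complex_of_real (sqrt ((2 * pi) ^ DIM('a))) * (v x * complex_of_real (sqrt ((2 * pi) ^ DIM('a))))"
    by (intro tendsto_mult tendsto_const gauss_average_tendsto[OF v] LIMSEQ_Suc[OF lim_1_over_n])
  also have "complex_of_real (sqrt ((2 * pi) ^ DIM('a))) * (v x * complex_of_real (sqrt ((2 * pi) ^ DIM('a))))
      = complex_of_real (sqrt ((2 * pi) ^ DIM('a)) * sqrt ((2 * pi) ^ DIM('a))) * v x"
    by (simp only: of_real_mult mult_ac)
  also have "\<dots> = (2 * pi) ^ DIM('a) * v x" by (simp only: real_sqrt_mult_self) simp
  finally show "(\<lambda>n. LINT p|lborel. ft v p * complex_of_real (gauss (?e n *\<^sub>R p)) * cis (x \<bullet> p))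
    \<longlonglongrightarrow> (2 * pi) ^ DIM('a) * v x"
    by (subst ft_gauss_inversion[OF v]) auto
qed

text \<open>The square integrability of \<open>ft u\<close> is still unknown here, so the pairing is
  damped by a Gaussian that makes every integral absolutely convergent.\<close>

lemma ft_plancherel_gauss:
  fixes u v :: "'a::euclidean_space \<Rightarrow> complex"
  assumes u: "u \<in> Cc" and v: "v \<in> Cc"
  shows "(\<lambda>n. LINT p|lborel. ft u p * cnj (ft v p) * complex_of_real (gauss ((1 / real (Suc n)) *\<^sub>R p)))
    \<longlonglongrightarrow> (2 * pi) ^ DIM('a) * L2_inner u v"
proof -
  have [measurable]: "u \<in> borel_measurable borel" "v \<in> borel_measurable borel"
    by (auto simp: Cc_measurable u v)
  obtain C where C: "\<And>x. cmod (v x) \<le> C" using Cc_bounded[OF v] by blast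
  let ?s = "sqrt ((2 * pi) ^ DIM('a))"
  let ?e = "\<lambda>n. 1 / real (Suc n)"
  let ?A = "\<lambda>n x. LINT z|lborel. v (x + ?e n *\<^sub>R z) * complex_of_real (gauss z)"
  have eq: "(LINT p|lborel. ft u p * cnj (ft v p) * complex_of_real (gauss (?e n *\<^sub>R p)))
      = (LINT x|lborel. u x * cnj (complex_of_real ?s * ?A n x))" for n
  proof -
    let ?w = "\<lambda>p. cnj (ft v p * complex_of_real (gauss (?e n *\<^sub>R p)))"
    have w: "integrable lborel ?w"
      by (subst complex_integrable_cnj, rule ft_gauss_integrable[OF Cc_integrable[OF v]]) simp
    have "(LINT p|lborel. ft u p * cnj (ft v p) * complex_of_real (gauss (?e n *\<^sub>R p)))
        = (LINT p|lborel. ft u p * ?w p)" by (simp add: mult.assoc)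
    also have "\<dots> = (LINT x|lborel. u x * ft ?w x)" by (rule ft_exchange[OF Cc_integrable[OF u] w])
    also have "ft ?w = (\<lambda>x. cnj (LINT p|lborel. ft v p * complex_of_real (gauss (?e n *\<^sub>R p)) * cis (x \<bullet> p)))"
      unfolding ft_def[of ?w, abs_def] Bochner_Integration.integral_cnj[symmetric] by (simp add: cis_cnj inner_commute)
    finally show ?thesis by (subst (asm) ft_gauss_inversion[OF v]) auto
  qed
  have "(\<lambda>n. LINT x|lborel. u x * cnj (complex_of_real ?s * ?A n x))
      \<longlonglongrightarrow> (LINT x|lborel. u x * cnj (complex_of_real ?s * (v x * complex_of_real ?s)))"
  proof (rule integral_dominated_convergence[where w = "\<lambda>x. cmod (u x) * (?s * (C * ?s))"])
    show "integrable lborel (\<lambda>x. cmod (u x) * (?s * (C * ?s)))" using Cc_integrable[OF u] by simp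
    show "AE x in lborel. (\<lambda>n. u x * cnj (complex_of_real ?s * ?A n x))
        \<longlonglongrightarrow> u x * cnj (complex_of_real ?s * (v x * complex_of_real ?s))"
      by (intro AE_I2 tendsto_intros gauss_average_tendsto[OF v] LIMSEQ_Suc[OF lim_1_over_n])
    have "cmod (u x * cnj (complex_of_real ?s * ?A n x)) \<le> cmod (u x) * (?s * (C * ?s))" for n x
      unfolding norm_mult complex_mod_cnj norm_of_real
      by (intro mult_left_mono mult_mono gauss_average_bound[OF C]) auto
    then show "AE x in lborel. norm (u x * cnj (complex_of_real ?s * ?A n x)) \<le> cmod (u x) * (?s * (C * ?s))" for n
      by blast
  qed measurable
  moreover have "(LINT x|lborel. u x * cnj (complex_of_real ?s * (v x * complex_of_real ?s)))
     = complex_of_real (?s * ?s) * L2_inner u v"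
  proof -
    have "u x * cnj (complex_of_real ?s * (v x * complex_of_real ?s)) = complex_of_real (?s * ?s) * (u x * cnj (v x))" for x
      by (simp only: of_real_mult complex_cnj_mult complex_cnj_complex_of_real mult_ac)
    then show ?thesis unfolding L2_inner_def by (simp only: integral_mult_right_zero)
  qed
  ultimately show ?thesis unfolding eq by (simp del: of_real_mult)
qed

text \<open>For v = u the damped integrands increase to |ft u|^2 while their integrals have a finite
  limit, so monotone convergence gives integrability.\<close>

theorem ft_L2:
  fixes u :: "'a::euclidean_space \<Rightarrow> complex"
  assumes u: "u \<in> Cc"
  shows "ft u \<in> L2"
proof -
  have [measurable]: "u \<in> borel_measurable borel" by (simp add: Cc_measurable u)
  let ?e = "\<lambda>n. 1 / real (Suc n)"
  let ?f = "\<lambda>n p. (cmod (ft u p))\<^sup>2 * gauss (?e n *\<^sub>R p)"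
  have fc: "ft u p * cnj (ft u p) * complex_of_real (gauss (?e n *\<^sub>R p)) = complex_of_real (?f n p)" for n p
    using complex_norm_square[of "ft u p"] by simp
  have "integrable lborel (\<lambda>p. (cmod (ft u p))\<^sup>2)"
  proof (rule integrable_monotone_convergence[where f = ?f])
    show "integrable lborel (?f n)" for n
    proof (rule Bochner_Integration.integrable_bound)
      show "integrable lborel (\<lambda>p::'a. (LINT x|lborel. cmod (u x))\<^sup>2 * gauss (?e n *\<^sub>R p))"
        by (intro integrable_mult_right gauss_scale_integrable) simp
      have "norm (?f n p) \<le> norm ((LINT x|lborel. cmod (u x))\<^sup>2 * gauss (?e n *\<^sub>R p))" for p
        using ft_bound[of u p] gauss_pos[of "?e n *\<^sub>R p"]
        by (simp add: abs_mult abs_of_pos mult_right_mono power_mono)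
      then show "AE p in lborel. norm (?f n p) \<le> norm ((LINT x|lborel. cmod (u x))\<^sup>2 * gauss (?e n *\<^sub>R p))"
        by blast
    qed measurable
    have "gauss (?e m *\<^sub>R p) \<le> gauss (?e n *\<^sub>R p)" if "m \<le> n" for m n and p :: 'a
    proof -
      have "norm (?e n *\<^sub>R p) \<le> norm (?e m *\<^sub>R p)"
        using that by (auto intro!: mult_right_mono divide_left_mono)
      then show ?thesis unfolding gauss_def by (auto intro!: power_mono)
    qed
    then show "AE p in lborel. mono (\<lambda>n. ?f n p)" by (auto simp: mono_def intro!: mult_left_mono)
    show "AE p in lborel. (\<lambda>n. ?f n p) \<longlonglongrightarrow> (cmod (ft u p))\<^sup>2"
    proof (rule AE_I2)
      fix p
      have "(\<lambda>n. ?f n p) \<longlonglongrightarrow> (cmod (ft u p))\<^sup>2 * 1" by (intro tendsto_intros gauss_tendsto_1)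
      then show "(\<lambda>n. ?f n p) \<longlonglongrightarrow> (cmod (ft u p))\<^sup>2" by simp
    qed
    have "(\<lambda>n. complex_of_real (LINT p|lborel. ?f n p)) \<longlonglongrightarrow> (2 * pi) ^ DIM('a) * L2_inner u u"
      using ft_plancherel_gauss[OF u u] unfolding fc by (simp only: integral_complex_of_real)
    from tendsto_Re[OF this] show "(\<lambda>n. LINT p|lborel. ?f n p) \<longlonglongrightarrow> Re ((2 * pi) ^ DIM('a) * L2_inner u u)"
      by simp
  qed measurable
  then show ?thesis unfolding L2_def by auto
qed

theorem ft_plancherel:
  fixes u v :: "'a::euclidean_space \<Rightarrow> complex"
  assumes u: "u \<in> Cc" and v: "v \<in> Cc"
  shows "L2_inner (ft u) (ft v) = (2 * pi) ^ DIM('a) * L2_inner u v"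
proof (rule LIMSEQ_unique[OF _ ft_plancherel_gauss[OF u v]])
  let ?e = "\<lambda>n. 1 / real (Suc n)"
  have [measurable]: "u \<in> borel_measurable borel" "v \<in> borel_measurable borel"
    by (auto simp: Cc_measurable u v)
  have i: "integrable lborel (\<lambda>p. ft u p * cnj (ft v p))"
    by (rule L2_inner_integrable[OF ft_L2[OF u] ft_L2[OF v]])
  show "(\<lambda>n. LINT p|lborel. ft u p * cnj (ft v p) * complex_of_real (gauss (?e n *\<^sub>R p))) \<longlonglongrightarrow> L2_inner (ft u) (ft v)"
    unfolding L2_inner_def
  proof (rule integral_dominated_convergence[where w = "\<lambda>p. cmod (ft u p * cnj (ft v p))"])
    show "AE p in lborel. (\<lambda>n. ft u p * cnj (ft v p) * complex_of_real (gauss (?e n *\<^sub>R p))) \<longlonglongrightarrow> ft u p * cnj (ft v p)"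
    proof (rule AE_I2)
      fix p
      have "(\<lambda>n. ft u p * cnj (ft v p) * complex_of_real (gauss (?e n *\<^sub>R p))) \<longlonglongrightarrow> ft u p * cnj (ft v p) * complex_of_real 1"
        by (intro tendsto_intros gauss_tendsto_1)
      then show "(\<lambda>n. ft u p * cnj (ft v p) * complex_of_real (gauss (?e n *\<^sub>R p))) \<longlonglongrightarrow> ft u p * cnj (ft v p)" by simp
    qed
    show "AE p in lborel. norm (ft u p * cnj (ft v p) * complex_of_real (gauss (?e n *\<^sub>R p))) \<le> cmod (ft u p * cnj (ft v p))" for n
      by (auto simp: norm_mult intro!: mult_left_le)
  qed (use i in auto)
qed

section \<open>The unitary Fourier transform on the space of square integrable functions\<close>

definition F0 :: "('a::euclidean_space \<Rightarrow> complex) \<Rightarrow> 'a \<Rightarrow> complex" where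
  "F0 u p = ft u p / complex_of_real (sqrt ((2 * pi) ^ DIM('a)))"

text \<open>Conjugating before and after changes the sign in the exponential, so this is the
  integral formula of the inverse, which is also the adjoint by \<open>F0_adjoint\<close>.\<close>

definition F0inv :: "('a::euclidean_space \<Rightarrow> complex) \<Rightarrow> 'a \<Rightarrow> complex" where
  "F0inv u x = cnj (F0 (\<lambda>y. cnj (u y)) x)"

lemma F0_eq: "F0 u = (\<lambda>p. inverse (complex_of_real (sqrt ((2 * pi) ^ DIM('a)))) * ft (u::'a::euclidean_space \<Rightarrow> complex) p)"
  by (rule ext) (simp add: F0_def divide_inverse mult.commute)

lemma F0_L2: "u \<in> Cc \<Longrightarrow> F0 u \<in> L2"
  unfolding F0_eq by (intro L2_scale ft_L2)

lemma F0inv_L2: "u \<in> Cc \<Longrightarrow> F0inv u \<in> L2"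
  unfolding F0inv_def[abs_def] by (intro L2_cnj F0_L2 Cc_cnj)

lemma F0_inner:
  fixes u v :: "'a::euclidean_space \<Rightarrow> complex"
  assumes "u \<in> Cc" "v \<in> Cc"
  shows "L2_inner (F0 u) (F0 v) = L2_inner u v"
proof -
  let ?s = "sqrt ((2 * pi) ^ DIM('a))"
  have "L2_inner (F0 u) (F0 v) = inverse (complex_of_real (?s * ?s)) * L2_inner (ft u) (ft v)"
    unfolding F0_eq L2_inner_scale_left L2_inner_scale_right
    by (simp only: complex_cnj_inverse complex_cnj_complex_of_real of_real_mult inverse_mult_distrib mult_ac)
  also have "\<dots> = L2_inner u v"
    unfolding ft_plancherel[OF assms] real_sqrt_mult_self by (simp add: field_simps)
  finally show ?thesis .
qed

lemma F0_norm:
  assumes "u \<in> Cc"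
  shows "L2_norm (F0 u) = L2_norm u"
proof -
  have "complex_of_real ((L2_norm (F0 u))\<^sup>2) = complex_of_real ((L2_norm u)\<^sup>2)"
    unfolding L2_inner_self[symmetric] by (rule F0_inner[OF assms assms])
  then have "(L2_norm (F0 u))\<^sup>2 = (L2_norm u)\<^sup>2" using of_real_eq_iff by blast
  then show ?thesis by (simp add: L2_norm_nonneg power2_eq_iff_nonneg)
qed

lemma ft_diff:
  assumes "integrable lborel u" "integrable lborel v"
  shows "ft (\<lambda>x::'a::euclidean_space. u x - v x) p = ft u p - ft v p"
  unfolding ft_def left_diff_distrib
  by (rule Bochner_Integration.integral_diff) (intro integrable_mult_cis assms, measurable)+

lemma F0_diff:
  assumes "u \<in> Cc" "v \<in> Cc"
  shows "F0 (\<lambda>x. u x - v x) p = F0 u p - F0 v p"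
  unfolding F0_def using assms by (simp add: ft_diff Cc_integrable diff_divide_distrib)

lemma F0_adjoint:
  fixes u v :: "'a::euclidean_space \<Rightarrow> complex"
  assumes u: "u \<in> Cc" and v: "v \<in> Cc"
  shows "L2_inner (F0 u) v = L2_inner u (F0inv v)"
proof -
  have "(LINT p|lborel. ft u p * cnj (v p)) = (LINT x|lborel. u x * ft (\<lambda>y. cnj (v y)) x)"
    by (rule ft_exchange[OF Cc_integrable[OF u] Cc_integrable[OF Cc_cnj[OF v]]])
  moreover have "L2_inner u (\<lambda>x. cnj (c * w x)) = c * (LINT x|lborel. u x * w x)" for c w
    unfolding L2_inner_def complex_cnj_cnj
    by (subst integral_mult_right_zero[symmetric]) (simp add: mult.left_commute)
  ultimately show ?thesis unfolding F0_eq F0inv_def[abs_def] L2_inner_scale_left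
    by (simp add: L2_inner_def)
qed

text \<open>The extension of \<open>F0\<close> to \<open>L2\<close> is characterized by duality
  against \<open>Cc\<close>; by density this fixes the value almost everywhere, independently of any
  approximating sequence.\<close>

definition fourier :: "('a::euclidean_space \<Rightarrow> complex) \<Rightarrow> 'a \<Rightarrow> complex" where
  "fourier u = (SOME w. w \<in> L2 \<and> (\<forall>v\<in>Cc. L2_inner w v = L2_inner u (F0inv v)))"

definition fourinv :: "('a::euclidean_space \<Rightarrow> complex) \<Rightarrow> 'a \<Rightarrow> complex" where
  "fourinv u x = cnj (fourier (\<lambda>y. cnj (u y)) x)"

text \<open>The rate is chosen so that consecutive approximants differ by at most (1/4)(1/2)^(n+1) +
  (1/4)(1/2)^n \<le> (1/2)^n, as \<open>L2_complete\<close> demands.\<close>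

lemma L2_approx_fast:
  assumes "u \<in> L2"
  obtains g where "\<forall>n. g n \<in> Cc" "\<forall>n. L2_norm (\<lambda>x. g n x - u x) \<le> (1/4) * (1/2) ^ n"
proof -
  have "\<exists>g. g \<in> Cc \<and> L2_norm (\<lambda>x. g x - u x) \<le> (1/4) * (1/2) ^ n" for n :: nat
  proof -
    have "0 < (1/4) * (1/2 :: real) ^ n" by simp
    then obtain g where "g \<in> Cc" "L2_norm (\<lambda>x. u x - g x) < (1/4) * (1/2) ^ n"
      using Cc_dense_L2[OF assms] by blast
    moreover have "L2_norm (\<lambda>x. g x - u x) = L2_norm (\<lambda>x. u x - g x)"
      unfolding L2_norm_def by (simp add: norm_minus_commute)
    ultimately show ?thesis by (intro exI[of _ g]) auto
  qed
  then show ?thesis using that by metis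
qed

lemma null_geometric: "(\<forall>n. 0 \<le> f n \<and> f n \<le> (1/4) * (1/2 :: real) ^ n) \<Longrightarrow> f \<longlonglongrightarrow> 0"
  by (rule Lim_null_comparison[of _ "\<lambda>n. (1/4) * (1/2) ^ n"])
     (auto intro!: tendsto_mult_right_zero LIMSEQ_power_zero)

lemma fourier_exists:
  fixes u :: "'a::euclidean_space \<Rightarrow> complex"
  assumes u: "u \<in> L2"
  obtains w g where "w \<in> L2" "\<forall>v\<in>Cc. L2_inner w v = L2_inner u (F0inv v)" "\<forall>n. g n \<in> Cc"
    "(\<lambda>n. L2_norm (\<lambda>x. g n x - u x)) \<longlonglongrightarrow> 0" "(\<lambda>n. L2_norm (\<lambda>x. F0 (g n) x - w x)) \<longlonglongrightarrow> 0"
proof -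
  obtain g where g: "\<forall>n. g n \<in> Cc" and b: "\<forall>n. L2_norm (\<lambda>x. g n x - u x) \<le> (1/4) * (1/2) ^ n"
    by (rule L2_approx_fast[OF u])
  have gL: "g n \<in> L2" for n using g Cc_L2 by blast
  have lim: "(\<lambda>n. L2_norm (\<lambda>x. g n x - u x)) \<longlonglongrightarrow> 0"
    by (rule null_geometric) (use b L2_norm_nonneg in blast)
  have step: "L2_norm (\<lambda>x. F0 (g (Suc n)) x - F0 (g n) x) \<le> (1/2) ^ n" for n
  proof -
    have "L2_norm (\<lambda>x. F0 (g (Suc n)) x - F0 (g n) x) = L2_norm (F0 (\<lambda>x. g (Suc n) x - g n x))"
      using g by (intro arg_cong[where f = L2_norm] ext) (simp add: F0_diff)
    also have "\<dots> = L2_norm (\<lambda>x. g (Suc n) x - g n x)" using g by (intro F0_norm Cc_diff) auto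
    also have "\<dots> \<le> L2_norm (\<lambda>x. g (Suc n) x - u x) + L2_norm (\<lambda>x. u x - g n x)"
      using L2_norm_triangle[OF L2_diff[OF gL u] L2_diff[OF u gL]] by simp
    also have "L2_norm (\<lambda>x. u x - g n x) = L2_norm (\<lambda>x. g n x - u x)"
      unfolding L2_norm_def by (simp add: norm_minus_commute)
    also have "L2_norm (\<lambda>x. g (Suc n) x - u x) + L2_norm (\<lambda>x. g n x - u x) \<le> (1/4) * (1/2) ^ Suc n + (1/4) * (1/2) ^ n"
      using b by (intro add_mono) blast+
    also have "\<dots> \<le> (1/2) ^ n" by simp
    finally show ?thesis .
  qed
  have "F0 (g n) \<in> L2" for n using g F0_L2 by blast
  then obtain w where w: "w \<in> L2" "(\<lambda>n. L2_norm (\<lambda>x. F0 (g n) x - w x)) \<longlonglongrightarrow> 0"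
    by (rule L2_complete[OF _ step])
  have "L2_inner w v = L2_inner u (F0inv v)" if v: "v \<in> Cc" for v
  proof (rule LIMSEQ_unique)
    show "(\<lambda>n. L2_inner (F0 (g n)) v) \<longlonglongrightarrow> L2_inner w v"
      using g by (intro L2_inner_tendsto w F0_L2 Cc_L2[OF v]) auto
    have "(\<lambda>n. L2_inner (g n) (F0inv v)) \<longlonglongrightarrow> L2_inner u (F0inv v)"
      by (intro L2_inner_tendsto gL u F0inv_L2 v lim)
    then show "(\<lambda>n. L2_inner (F0 (g n)) v) \<longlonglongrightarrow> L2_inner u (F0inv v)"
      using g v by (simp add: F0_adjoint)
  qed
  with w g lim show ?thesis using that by blast
qed

lemma
  assumes "u \<in> L2"
  shows fourier_L2: "fourier u \<in> L2"
    and fourier_Cc: "v \<in> Cc \<Longrightarrow> L2_inner (fourier u) v = L2_inner u (F0inv v)"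
proof -
  have "\<exists>w. w \<in> L2 \<and> (\<forall>v\<in>Cc. L2_inner w v = L2_inner u (F0inv v))"
    using fourier_exists[OF assms] by metis
  from someI_ex[OF this] show "fourier u \<in> L2" "v \<in> Cc \<Longrightarrow> L2_inner (fourier u) v = L2_inner u (F0inv v)"
    unfolding fourier_def by auto
qed

lemma L2_eqI_Cc:
  assumes "u \<in> L2" "w \<in> L2" "\<And>v. v \<in> Cc \<Longrightarrow> L2_inner u v = L2_inner w v"
  shows "AE x in lborel. u x = w x"
proof -
  have "L2_inner (\<lambda>x. u x - w x) v = 0" if "v \<in> Cc" for v
    using assms that Cc_L2[OF that] by (simp add: L2_inner_diff_left)
  then have "AE x in lborel. u x - w x = 0" by (rule L2_eq_zeroI[OF L2_diff[OF assms(1,2)]])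
  then show ?thesis by simp
qed

text \<open>The working principle for algebraic identities of \<open>fourier\<close>: check the
  duality relation for the candidate on \<open>Cc\<close>.\<close>

lemma fourier_unique:
  assumes "u \<in> L2" "w \<in> L2" "\<And>v. v \<in> Cc \<Longrightarrow> L2_inner w v = L2_inner u (F0inv v)"
  shows "AE x in lborel. fourier u x = w x"
  using assms by (intro L2_eqI_Cc) (auto simp: fourier_L2 fourier_Cc)

lemma fourier_approx:
  assumes u: "u \<in> L2"
  obtains g where "\<forall>n. g n \<in> Cc" "(\<lambda>n. L2_norm (\<lambda>x. g n x - u x)) \<longlonglongrightarrow> 0"
    "(\<lambda>n. L2_norm (\<lambda>x. F0 (g n) x - fourier u x)) \<longlonglongrightarrow> 0"
proof -
  obtain w g where w: "w \<in> L2" "\<forall>v\<in>Cc. L2_inner w v = L2_inner u (F0inv v)" and g: "\<forall>n. g n \<in> Cc"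
    "(\<lambda>n. L2_norm (\<lambda>x. g n x - u x)) \<longlonglongrightarrow> 0" and l: "(\<lambda>n. L2_norm (\<lambda>x. F0 (g n) x - w x)) \<longlonglongrightarrow> 0"
    by (rule fourier_exists[OF u])
  have ae: "AE x in lborel. fourier u x = w x" using fourier_unique[OF u w(1)] w(2) by blast
  have "L2_norm (\<lambda>x. F0 (g n) x - w x) = L2_norm (\<lambda>x. F0 (g n) x - fourier u x)" for n
    by (rule L2_norm_cong_AE) (use g ae in \<open>auto intro!: L2_diff F0_L2 w fourier_L2 u\<close>)
  with l g show ?thesis using that by simp
qed

lemma fourier_F0:
  assumes "u \<in> Cc"
  shows "AE x in lborel. fourier u x = F0 u x"
  by (rule fourier_unique) (auto simp: Cc_L2 assms F0_L2 F0_adjoint)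

lemma fourier_norm:
  assumes u: "u \<in> L2"
  shows "L2_norm (fourier u) = L2_norm u"
proof -
  obtain g where g: "\<forall>n. g n \<in> Cc" "(\<lambda>n. L2_norm (\<lambda>x. g n x - u x)) \<longlonglongrightarrow> 0"
    "(\<lambda>n. L2_norm (\<lambda>x. F0 (g n) x - fourier u x)) \<longlonglongrightarrow> 0"
    by (rule fourier_approx[OF u])
  have "(\<lambda>n. L2_norm (g n)) \<longlonglongrightarrow> L2_norm u"
    by (rule L2_norm_tendsto) (use g u Cc_L2 in auto)
  moreover have "(\<lambda>n. L2_norm (F0 (g n))) \<longlonglongrightarrow> L2_norm (fourier u)"
    by (rule L2_norm_tendsto) (use g u F0_L2 fourier_L2 in auto)
  moreover have "L2_norm (F0 (g n)) = L2_norm (g n)" for n using g F0_norm by blast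
  ultimately show ?thesis using LIMSEQ_unique by simp
qed

lemma fourier_add:
  assumes "u \<in> L2" "v \<in> L2"
  shows "AE x in lborel. fourier (\<lambda>x. u x + v x) x = fourier u x + fourier v x"
  by (rule fourier_unique)
     (use assms in \<open>auto intro!: L2_add fourier_L2 simp: L2_inner_add_left fourier_L2 Cc_L2 F0inv_L2 fourier_Cc\<close>)

lemma fourier_scale:
  assumes "u \<in> L2"
  shows "AE x in lborel. fourier (\<lambda>x. c * u x) x = c * fourier u x"
  by (rule fourier_unique)
     (use assms in \<open>auto intro!: L2_scale fourier_L2 simp: L2_inner_scale_left fourier_Cc\<close>)

lemma fourier_diff:
  assumes "u \<in> L2" "v \<in> L2"
  shows "AE x in lborel. fourier (\<lambda>x. u x - v x) x = fourier u x - fourier v x"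
  by (rule fourier_unique)
     (use assms in \<open>auto intro!: L2_diff fourier_L2 simp: L2_inner_diff_left fourier_L2 Cc_L2 F0inv_L2 fourier_Cc\<close>)

lemma L2_inner_tendsto_right:
  assumes "\<And>n. u n \<in> L2" "U \<in> L2" "v \<in> L2" "(\<lambda>n. L2_norm (\<lambda>x. u n x - U x)) \<longlonglongrightarrow> 0"
  shows "(\<lambda>n. L2_inner v (u n)) \<longlonglongrightarrow> L2_inner v U"
  using tendsto_cnj[OF L2_inner_tendsto[OF assms]] by (simp flip: L2_inner_cnj)

lemma fourier_inner:
  assumes u: "u \<in> L2" and v: "v \<in> L2"
  shows "L2_inner (fourier u) (fourier v) = L2_inner u v"
proof -
  have 1: "L2_inner (fourier u) (F0 h) = L2_inner u h" if h: "h \<in> Cc" for h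
  proof -
    obtain g where g: "\<forall>n. g n \<in> Cc" "(\<lambda>n. L2_norm (\<lambda>x. g n x - u x)) \<longlonglongrightarrow> 0"
      "(\<lambda>n. L2_norm (\<lambda>x. F0 (g n) x - fourier u x)) \<longlonglongrightarrow> 0"
      by (rule fourier_approx[OF u])
    have "(\<lambda>n. L2_inner (F0 (g n)) (F0 h)) \<longlonglongrightarrow> L2_inner (fourier u) (F0 h)"
      by (rule L2_inner_tendsto) (use g u h F0_L2 fourier_L2 in auto)
    moreover have "(\<lambda>n. L2_inner (g n) h) \<longlonglongrightarrow> L2_inner u h"
      by (rule L2_inner_tendsto) (use g u h Cc_L2 in auto)
    moreover have "L2_inner (F0 (g n)) (F0 h) = L2_inner (g n) h" for n using g h F0_inner by blast
    ultimately show ?thesis using LIMSEQ_unique by simp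
  qed
  obtain g where g: "\<forall>n. g n \<in> Cc" "(\<lambda>n. L2_norm (\<lambda>x. g n x - v x)) \<longlonglongrightarrow> 0"
    "(\<lambda>n. L2_norm (\<lambda>x. F0 (g n) x - fourier v x)) \<longlonglongrightarrow> 0"
    by (rule fourier_approx[OF v])
  have "(\<lambda>n. L2_inner (fourier u) (F0 (g n))) \<longlonglongrightarrow> L2_inner (fourier u) (fourier v)"
    by (rule L2_inner_tendsto_right) (use g u v F0_L2 fourier_L2 in auto)
  moreover have "(\<lambda>n. L2_inner u (g n)) \<longlonglongrightarrow> L2_inner u v"
    by (rule L2_inner_tendsto_right) (use g u v Cc_L2 in auto)
  moreover have "L2_inner (fourier u) (F0 (g n)) = L2_inner u (g n)" for n using g 1 by blast
  ultimately show ?thesis using LIMSEQ_unique by simp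
qed

lemma fourinv_L2: "u \<in> L2 \<Longrightarrow> fourinv u \<in> L2"
  unfolding fourinv_def[abs_def] by (intro L2_cnj fourier_L2)

lemma L2_inner_cnj_both: "L2_inner (\<lambda>x. cnj (u x)) (\<lambda>x. cnj (v x)) = L2_inner v u"
  unfolding L2_inner_def by (simp add: mult.commute)

lemma fourinv_inner:
  assumes "u \<in> L2" "v \<in> L2"
  shows "L2_inner (fourinv u) (fourinv v) = L2_inner u v"
  unfolding fourinv_def[abs_def] L2_inner_cnj_both
  using fourier_inner[OF L2_cnj[OF assms(2)] L2_cnj[OF assms(1)]] by (simp add: L2_inner_cnj_both)

lemma fourinv_norm: "u \<in> L2 \<Longrightarrow> L2_norm (fourinv u) = L2_norm u"
  unfolding fourinv_def[abs_def] by (simp add: L2_norm_cnj fourier_norm L2_cnj)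

lemma fourinv_diff:
  assumes "u \<in> L2" "v \<in> L2"
  shows "AE x in lborel. fourinv (\<lambda>x. u x - v x) x = fourinv u x - fourinv v x"
  using fourier_diff[OF L2_cnj[OF assms(1)] L2_cnj[OF assms(2)]]
  by eventually_elim (simp add: fourinv_def)

lemma fourinv_F0inv:
  assumes "u \<in> Cc"
  shows "AE x in lborel. fourinv u x = F0inv u x"
  using fourier_F0[OF Cc_cnj[OF assms]] by eventually_elim (simp add: fourinv_def F0inv_def)

lemma fourier_adjoint:
  assumes u: "u \<in> L2" and v: "v \<in> L2"
  shows "L2_inner (fourier u) v = L2_inner u (fourinv v)"
proof -
  obtain g where g: "\<forall>n. g n \<in> Cc" and b: "\<forall>n. L2_norm (\<lambda>x. g n x - v x) \<le> (1/4) * (1/2) ^ n"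
    by (rule L2_approx_fast[OF v])
  have gL: "g n \<in> L2" for n using g Cc_L2 by blast
  have lim: "(\<lambda>n. L2_norm (\<lambda>x. g n x - v x)) \<longlonglongrightarrow> 0"
    by (rule null_geometric) (use b L2_norm_nonneg in blast)
  have e: "L2_norm (\<lambda>x. fourinv (g n) x - fourinv v x) = L2_norm (\<lambda>x. g n x - v x)" for n
  proof -
    have "L2_norm (\<lambda>x. fourinv (g n) x - fourinv v x) = L2_norm (fourinv (\<lambda>x. g n x - v x))"
      using fourinv_diff[OF gL[of n] v]
      by (intro L2_norm_cong_AE L2_diff fourinv_L2 gL v) (auto elim: eventually_mono)
    then show ?thesis by (simp add: fourinv_norm L2_diff gL v)
  qed
  have "(\<lambda>n. L2_inner (fourier u) (g n)) \<longlonglongrightarrow> L2_inner (fourier u) v"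
    by (intro L2_inner_tendsto_right gL v fourier_L2 u lim)
  moreover have "(\<lambda>n. L2_inner u (fourinv (g n))) \<longlonglongrightarrow> L2_inner u (fourinv v)"
    by (intro L2_inner_tendsto_right fourinv_L2 gL v u) (simp add: e lim)
  moreover have "L2_inner (fourier u) (g n) = L2_inner u (fourinv (g n))" for n
  proof -
    have "L2_inner (fourier u) (g n) = L2_inner u (F0inv (g n))" using g u by (simp add: fourier_Cc)
    also have "\<dots> = L2_inner u (fourinv (g n))"
      using fourinv_F0inv[of "g n"] g
      by (intro L2_inner_cong_AE u F0inv_L2 fourinv_L2 gL) (auto elim: eventually_mono)
    finally show ?thesis .
  qed
  ultimately show ?thesis using LIMSEQ_unique by simp
qed

text \<open>By the adjoint relation and the isometry of \<open>fourinv\<close>, pairing the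
  left-hand side with w gives (fourinv u | fourinv w) = (u | w).\<close>

lemma fourier_fourinv:
  assumes "u \<in> L2"
  shows "AE x in lborel. fourier (fourinv u) x = u x"
proof (rule L2_eqI)
  fix w :: "'a \<Rightarrow> complex" assume "w \<in> L2"
  then show "L2_inner (fourier (fourinv u)) w = L2_inner u w"
    using assms by (simp add: fourier_adjoint fourinv_L2 fourinv_inner)
qed (simp_all add: fourier_L2 fourinv_L2 assms)

lemma fourier_cong_AE:
  assumes "u \<in> L2" "v \<in> L2" "AE x in lborel. u x = v x"
  shows "AE x in lborel. fourier u x = fourier v x"
  by (rule fourier_unique[OF assms(1) fourier_L2[OF assms(2)]])
     (use assms in \<open>auto simp: fourier_Cc intro!: L2_inner_cong_AE F0inv_L2 elim: eventually_mono\<close>)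

lemma fourier_eqD:
  assumes "u \<in> L2" "v \<in> L2" "AE x in lborel. fourier u x = fourier v x"
  shows "AE x in lborel. u x = v x"
proof -
  have "L2_norm (\<lambda>x. fourier u x - fourier v x) = 0"
    using assms by (subst L2_eq_AE_iff[symmetric]) (auto simp: fourier_L2)
  moreover have "L2_norm (fourier (\<lambda>x. u x - v x)) = L2_norm (\<lambda>x. fourier u x - fourier v x)"
    using fourier_diff[OF assms(1,2)] assms(1,2) by (intro L2_norm_cong_AE) (auto simp: fourier_L2 L2_diff)
  ultimately show ?thesis
    using assms(1,2) by (subst L2_eq_AE_iff) (auto simp: fourier_norm L2_diff)
qed

section \<open>Modulation, translation and injectivity\<close>

lemma L2_cis_mult:
  assumes "u \<in> L2" "f \<in> borel_measurable borel"
  shows "(\<lambda>x. cis (f x) * u x) \<in> L2"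
  by (rule L2_bdd_mult[OF assms(1), where C = 1]) (use assms(2) in auto)

lemma fourier_modulate:
  assumes u: "u \<in> L2"
  shows "AE z in lborel. fourier (\<lambda>x. cis (x \<bullet> p) * u x) z = fourier u (z - p)"
proof (rule fourier_unique)
  show "(\<lambda>x. cis (x \<bullet> p) * u x) \<in> L2" by (rule L2_cis_mult[OF u]) simp
  have tr: "(\<lambda>z. fourier u (z - p)) \<in> L2" using L2_translate[OF fourier_L2[OF u], of "-p"] by simp
  then show "(\<lambda>z. fourier u (z - p)) \<in> L2" .
  fix v :: "'a \<Rightarrow> complex" assume v: "v \<in> Cc"
  have [measurable]: "v \<in> borel_measurable borel" by (rule Cc_measurable[OF v])
  have m: "(\<lambda>z. fourier u (z - p) * cnj (v z)) \<in> borel_measurable borel"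
    using tr by (auto intro!: borel_measurable_times dest: L2_measurable)
  have "L2_inner (\<lambda>z. fourier u (z - p)) v = (LINT z|lborel. fourier u (p + z - p) * cnj (v (p + z)))"
    unfolding L2_inner_def by (rule lborel_integral_translate[OF m, symmetric])
  also have "\<dots> = L2_inner (fourier u) (\<lambda>z. v (p + z))" unfolding L2_inner_def by simp
  also have "\<dots> = L2_inner u (F0inv (\<lambda>z. v (p + z)))" by (rule fourier_Cc[OF u Cc_translate[OF v]])
  also have "F0inv (\<lambda>z. v (p + z)) = (\<lambda>x. cis (- (x \<bullet> p)) * F0inv v x)"
  proof
    fix x
    have "(LINT z|lborel. cnj (v (p + z)) * cis (- ((p + z) \<bullet> x))) = ft (\<lambda>z. cnj (v z)) x"
      unfolding ft_def by (rule lborel_integral_translate[where f = "\<lambda>z. cnj (v z) * cis (- (z \<bullet> x))"]) measurable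
    moreover have "cnj (v (p + z)) * cis (- (z \<bullet> x)) = cis (p \<bullet> x) * (cnj (v (p + z)) * cis (- ((p + z) \<bullet> x)))" for z
      by (simp add: inner_add_left mult.left_commute cis_mult)
    ultimately have "ft (\<lambda>z. cnj (v (p + z))) x = cis (p \<bullet> x) * ft (\<lambda>z. cnj (v z)) x"
      unfolding ft_def by (simp only: integral_mult_right_zero)
    then show "F0inv (\<lambda>z. v (p + z)) x = cis (- (x \<bullet> p)) * F0inv v x"
      by (simp add: F0inv_def F0_def cis_cnj inner_commute)
  qed
  also have "L2_inner u (\<lambda>x. cis (- (x \<bullet> p)) * F0inv v x) = L2_inner (\<lambda>x. cis (x \<bullet> p) * u x) (F0inv v)"
    unfolding L2_inner_def by (simp add: cis_cnj mult_ac)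
  finally show "L2_inner (\<lambda>z. fourier u (z - p)) v = L2_inner (\<lambda>x. cis (x \<bullet> p) * u x) (F0inv v)" .
qed

lemma fourier_translate:
  assumes u: "u \<in> L2"
  shows "AE z in lborel. fourier (\<lambda>x. u (c + x)) z = cis (z \<bullet> c) * fourier u z"
proof (rule fourier_unique)
  show "(\<lambda>x. u (c + x)) \<in> L2" by (rule L2_translate[OF u])
  show "(\<lambda>z. cis (z \<bullet> c) * fourier u z) \<in> L2" by (rule L2_cis_mult[OF fourier_L2[OF u]]) simp
  fix v :: "'a \<Rightarrow> complex" assume v: "v \<in> Cc"
  let ?v = "\<lambda>z. cis (- (z \<bullet> c)) * v z"
  have vC: "?v \<in> Cc" by (rule Cc_mult[OF v]) (intro continuous_intros)
  have "L2_inner (\<lambda>z. cis (z \<bullet> c) * fourier u z) v = L2_inner (fourier u) ?v"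
    unfolding L2_inner_def by (simp add: cis_cnj mult_ac)
  also have "\<dots> = L2_inner u (F0inv ?v)" by (rule fourier_Cc[OF u vC])
  also have "F0inv ?v = (\<lambda>x. F0inv v (x - c))"
  proof
    fix x
    have "cis (z \<bullet> c) * cis (- (z \<bullet> x)) = cis (- (z \<bullet> (x - c)))" for z
      by (simp add: cis_mult inner_diff_right)
    then have "cnj (cis (- (z \<bullet> c)) * v z) * cis (- (z \<bullet> x)) = cnj (v z) * cis (- (z \<bullet> (x - c)))" for z
      by (simp add: cis_cnj mult.commute mult.left_commute flip: \<open>\<And>z. cis (z \<bullet> c) * cis (- (z \<bullet> x)) = cis (- (z \<bullet> (x - c)))\<close>)
    then show "F0inv ?v x = F0inv v (x - c)"
      unfolding F0inv_def F0_def ft_def by (simp only:)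
  qed
  also have "L2_inner u (\<lambda>x. F0inv v (x - c)) = (LINT x|lborel. u (c + x) * cnj (F0inv v (c + x - c)))"
  proof -
    have "(\<lambda>x. F0inv v (- c + x)) \<in> L2" by (rule L2_translate[OF F0inv_L2[OF v]])
    then have "(\<lambda>x. u x * cnj (F0inv v (x - c))) \<in> borel_measurable borel"
      using u by (auto intro!: borel_measurable_times borel_measurable_cnj dest!: L2_measurable)
    from lborel_integral_translate[OF this, of c] show ?thesis unfolding L2_inner_def by simp
  qed
  also have "\<dots> = L2_inner (\<lambda>x. u (c + x)) (F0inv v)" unfolding L2_inner_def by simp
  finally show "L2_inner (\<lambda>z. cis (z \<bullet> c) * fourier u z) v = L2_inner (\<lambda>x. u (c + x)) (F0inv v)" .
qed

text \<open>Integrating the hypothesis against the conjugate of v and using Fubini shows that G is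
  orthogonal to every \<open>F0 v\<close>; hence \<open>fourinv G\<close> is orthogonal to
  \<open>Cc\<close> and vanishes, and \<open>fourinv\<close> is isometric.\<close>

lemma fourier_integral_injective:
  fixes G :: "'a::euclidean_space \<Rightarrow> complex"
  assumes G2: "G \<in> L2" and G1: "integrable lborel G" and z: "\<And>y. (LINT p|lborel. G p * cis (y \<bullet> p)) = 0"
  shows "AE p in lborel. G p = 0"
proof -
  have [measurable]: "G \<in> borel_measurable borel" by (rule L2_measurable[OF G2])
  have "L2_inner (fourinv G) v = 0" if v: "v \<in> Cc" for v
  proof -
    have [measurable]: "v \<in> borel_measurable borel" by (rule Cc_measurable[OF v])
    have "(LINT p|lborel. G p * cnj (ft v p)) = (LINT p|lborel. LINT y|lborel. G p * (cnj (v y) * cis (y \<bullet> p)))"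
      unfolding ft_def Bochner_Integration.integral_cnj[symmetric] by (simp add: cis_cnj)
    also have "\<dots> = (LINT y|lborel. LINT p|lborel. G p * (cnj (v y) * cis (y \<bullet> p)))"
      by (rule lborel_Fubini_product_bound(1)[OF _ G1 Cc_integrable[OF Cc_cnj[OF v]]]) (auto simp: norm_mult)
    also have "\<dots> = (LINT y|lborel. cnj (v y) * (LINT p|lborel. G p * cis (y \<bullet> p)))"
    proof -
      have "(LINT p|lborel. G p * (cnj (v y) * cis (y \<bullet> p))) = cnj (v y) * (LINT p|lborel. G p * cis (y \<bullet> p))" for y
        by (subst integral_mult_right_zero[symmetric]) (simp add: mult.left_commute)
      then show ?thesis by simp
    qed
    finally have "(LINT p|lborel. G p * cnj (ft v p)) = 0" by (simp add: z)
    then have "L2_inner G (F0 v) = 0"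
      unfolding F0_eq L2_inner_scale_right by (simp add: L2_inner_def)
    then have "L2_inner G (fourier v) = 0"
      using L2_inner_cong_AE[OF G2 fourier_L2[OF Cc_L2[OF v]] G2 F0_L2[OF v] _ fourier_F0[OF v]] by simp
    then have "L2_inner (fourier v) G = 0" using L2_inner_cnj[of "fourier v" G] by simp
    then have "L2_inner v (fourinv G) = 0" using fourier_adjoint[OF Cc_L2[OF v] G2] by simp
    then show ?thesis using L2_inner_cnj[of "fourinv G" v] by simp
  qed
  then have "L2_norm (fourinv G) = 0"
    using L2_eq_zeroI[OF fourinv_L2[OF G2]] L2_norm_zero_iff[OF fourinv_L2[OF G2]] by blast
  then show ?thesis using L2_norm_zero_iff[OF G2] fourinv_norm[OF G2] by simp
qed

section \<open>Smooth functions of compact support\<close>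

lemma smooth_partial: "smooth f \<Longrightarrow> b \<in> Basis \<Longrightarrow> smooth (partial_deriv b f)"
  unfolding smooth_def
proof (intro allI impI)
  fix bs :: "'a list" and x
  assume "\<forall>bs x. set bs \<subseteq> Basis \<longrightarrow> foldr partial_deriv bs f differentiable at x" "b \<in> Basis" "set bs \<subseteq> Basis"
  then have "foldr partial_deriv (bs @ [b]) f differentiable at x" by (simp del: foldr_append)
  then show "foldr partial_deriv bs (partial_deriv b f) differentiable at x" by simp
qed

lemma smooth_has_derivative:
  assumes "smooth f"
  shows "(f has_derivative frechet_derivative f (at x)) (at x)"
proof -
  have "f differentiable at x" using assms[unfolded smooth_def, rule_format, of "[]" x] by simp
  then show ?thesis by (simp add: frechet_derivative_works)
qed

lemma smooth_continuous: "smooth f \<Longrightarrow> continuous_on UNIV f"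
  by (intro continuous_at_imp_continuous_on ballI has_derivative_continuous[OF smooth_has_derivative])

lemma compactly_supported_iff:
  fixes f :: "'a::euclidean_space \<Rightarrow> 'b::zero"
  shows "compactly_supported f \<longleftrightarrow> (\<exists>R. \<forall>x. R < norm x \<longrightarrow> f x = 0)"
proof
  assume "compactly_supported f"
  then have "bounded (closure {x. f x \<noteq> 0})" unfolding compactly_supported_def by (rule compact_imp_bounded)
  then obtain R where "\<forall>x\<in>closure {x. f x \<noteq> 0}. norm x \<le> R" unfolding bounded_iff by blast
  then have "\<forall>x. f x \<noteq> 0 \<longrightarrow> norm x \<le> R" using closure_subset[of "{x. f x \<noteq> 0}"] by blast
  then show "\<exists>R. \<forall>x. R < norm x \<longrightarrow> f x = 0" using linorder_not_less by blast
next
  assume "\<exists>R. \<forall>x. R < norm x \<longrightarrow> f x = 0"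
  then obtain R where R: "\<forall>x. R < norm x \<longrightarrow> f x = 0" by blast
  have "bounded {x. f x \<noteq> 0}" unfolding bounded_iff using R by (intro exI[of _ R]) force
  then show "compactly_supported f" unfolding compactly_supported_def by simp
qed

lemma has_derivative_zero_outside:
  assumes d: "(f has_derivative D) (at x)" and z: "\<And>x. R < norm x \<Longrightarrow> f x = 0" and x: "R < norm x"
  shows "D = (\<lambda>_. 0)"
proof -
  have "open {x::'a::real_normed_vector. R < norm x}" by (intro open_Collect_less continuous_intros)
  then have "((\<lambda>_. 0) has_derivative D) (at x)"
    by (rule has_derivative_transform_within_open[OF d]) (use x z in auto)
  from has_derivative_unique[OF this has_derivative_const] show ?thesis .
qed

lemma test_fun_partial:
  assumes f: "f \<in> test_fun" and b: "b \<in> Basis"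
  shows "partial_deriv b f \<in> test_fun"
proof -
  have s: "smooth f" using f by (simp add: test_fun_def)
  obtain R where R: "\<And>x. R < norm x \<Longrightarrow> f x = 0"
    using f by (auto simp: test_fun_def compactly_supported_iff)
  have "partial_deriv b f x = 0" if "R < norm x" for x
    using has_derivative_zero_outside[OF smooth_has_derivative[OF s] R that] by (simp add: partial_deriv_def)
  then show ?thesis using smooth_partial[OF s b] by (auto simp: test_fun_def compactly_supported_iff)
qed

lemma test_fun_Cc: "f \<in> test_fun \<Longrightarrow> f \<in> Cc"
  by (auto simp: test_fun_def Cc_def compactly_supported_iff smooth_continuous)

text \<open>The integral of \<open>n (g (x + b / n) - g x)\<close> vanishes by translation invariance.\<close>

lemma integral_derivative_zero:
  fixes g :: "'a::euclidean_space \<Rightarrow> complex"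
  assumes d: "\<And>x. (g has_derivative D x) (at x)" and c: "continuous_on UNIV (\<lambda>x. D x b)"
    and R: "\<And>x. R < norm x \<Longrightarrow> g x = 0"
  shows "(LINT x|lborel. D x b) = 0"
proof -
  have gc: "continuous_on UNIV g"
    by (intro continuous_at_imp_continuous_on ballI has_derivative_continuous[OF d])
  then have gC: "g \<in> Cc" using R by (auto simp: Cc_def)
  have D0: "D x b = 0" if "R < norm x" for x using has_derivative_zero_outside[OF d R that] by simp
  then have DC: "(\<lambda>x. D x b) \<in> Cc" using c by (auto simp: Cc_def)
  obtain M where M: "M > 0" "\<And>x. cmod (D x b) \<le> M" using Cc_bounded[OF DC] by blast
  have [measurable]: "g \<in> borel_measurable borel" "(\<lambda>x. D x b) \<in> borel_measurable borel"
    using Cc_measurable[OF gC] Cc_measurable[OF DC] by auto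
  have line: "((\<lambda>s. g (x + s *\<^sub>R b)) has_derivative (\<lambda>h. h *\<^sub>R D (x + s *\<^sub>R b) b)) (at s)" for x s
  proof -
    have l: "linear (D (x + s *\<^sub>R b))" by (rule has_derivative_linear[OF d])
    have "((\<lambda>s. x + s *\<^sub>R b) has_derivative (\<lambda>h. h *\<^sub>R b)) (at s)" by (auto intro!: derivative_eq_intros)
    from has_derivative_compose[OF this d[of "x + s *\<^sub>R b"]] show ?thesis
      by (simp add: linear_scale[OF l])
  qed
  \<comment> \<open>The mean value inequality along the direction b bounds the difference quotients
    uniformly.\<close>
  have lip: "cmod (g (x + s *\<^sub>R b) - g x) \<le> M * \<bar>s\<bar>" for x s
  proof -
    have "cmod (g (x + s *\<^sub>R b) - g (x + 0 *\<^sub>R b)) \<le> M * norm (s - 0)"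
    proof (rule differentiable_bound[where S = UNIV and f' = "\<lambda>s h. h *\<^sub>R D (x + s *\<^sub>R b) b"])
      show "onorm (\<lambda>h. h *\<^sub>R D (x + r *\<^sub>R b) b) \<le> M" for r
        using mult_right_mono[OF M(2)[of "x + r *\<^sub>R b"] abs_ge_zero]
        by (intro onorm_le) (simp add: mult.commute)
    qed (use line in auto)
    then show ?thesis by simp
  qed
  let ?F = "\<lambda>n x. of_nat (Suc n) * (g ((1 / real (Suc n)) *\<^sub>R b + x) - g x)"
  have "(\<lambda>n. LINT x|lborel. ?F n x) \<longlonglongrightarrow> (LINT x|lborel. D x b)"
  \<comment> \<open>The shifts have length at most |b|, so all difference quotients vanish outside
    the ball of radius R + |b|.\<close>
  proof (rule integral_dominated_convergence[where w = "\<lambda>x. M * indicator (cball 0 (R + norm b)) x"])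
    show "integrable lborel (\<lambda>x::'a. M * indicator (cball 0 (R + norm b)) x)"
      using emeasure_lborel_cball_finite[of "0::'a" "R + norm b"] by (intro integrable_mult_right) auto
    show "AE x in lborel. (\<lambda>n. ?F n x) \<longlonglongrightarrow> D x b"
    proof (rule AE_I2)
      fix x
      have "((\<lambda>s. norm (g (x + s *\<^sub>R b) - g x - s *\<^sub>R D x b) / norm s) \<longlongrightarrow> 0) (at 0)"
        using line[of x 0] unfolding has_derivative_at by simp
      moreover have "filterlim (\<lambda>n. 1 / real (Suc n)) (at 0) sequentially"
        unfolding filterlim_at using LIMSEQ_Suc[OF lim_1_over_n[where 'a = real]] by auto
      ultimately have l: "(\<lambda>n. norm (g (x + (1 / real (Suc n)) *\<^sub>R b) - g x - (1 / real (Suc n)) *\<^sub>R D x b) / norm (1 / real (Suc n))) \<longlonglongrightarrow> 0"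
        by (rule filterlim_compose)
      have e: "norm (?F n x - D x b)
          = norm (g (x + (1 / real (Suc n)) *\<^sub>R b) - g x - (1 / real (Suc n)) *\<^sub>R D x b) / norm (1 / real (Suc n))" for n
      proof -
        have "of_nat (Suc n) * ((1 / real (Suc n)) *\<^sub>R D x b) = D x b"
          by (simp add: scaleR_conv_of_real flip: of_nat_Suc)
        then have "?F n x - D x b
            = of_nat (Suc n) * (g (x + (1 / real (Suc n)) *\<^sub>R b) - g x - (1 / real (Suc n)) *\<^sub>R D x b)"
          by (simp only: right_diff_distrib add.commute)
        then have "norm (?F n x - D x b)
            = real (Suc n) * norm (g (x + (1 / real (Suc n)) *\<^sub>R b) - g x - (1 / real (Suc n)) *\<^sub>R D x b)"
          by (simp only: norm_mult norm_of_nat)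
        then show ?thesis by (simp add: mult.commute)
      qed
      have "(\<lambda>n. ?F n x - D x b) \<longlonglongrightarrow> 0"
        unfolding tendsto_norm_zero_iff[symmetric, of "\<lambda>n. ?F n x - D x b"] e by (rule l)
      then show "(\<lambda>n. ?F n x) \<longlonglongrightarrow> D x b" by (rule LIM_zero_cancel)
    qed
    show "AE x in lborel. norm (?F n x) \<le> M * indicator (cball 0 (R + norm b)) x" for n
    proof (rule AE_I2)
      fix x
      have e: "cmod (?F n x) = real (Suc n) * cmod (g (x + (1 / real (Suc n)) *\<^sub>R b) - g x)"
        by (simp only: norm_mult norm_of_nat add.commute)
      show "norm (?F n x) \<le> M * indicator (cball 0 (R + norm b)) x"
      proof (cases "norm x \<le> R + norm b")
        case True
        have "real (Suc n) * cmod (g (x + (1 / real (Suc n)) *\<^sub>R b) - g x) \<le> real (Suc n) * (M * \<bar>1 / real (Suc n)\<bar>)"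
          by (intro mult_left_mono lip) auto
        also have "real (Suc n) * (M * \<bar>1 / real (Suc n)\<bar>) = M" by (simp del: of_nat_Suc)
        finally show ?thesis using True unfolding e by simp
      next
        case False
        have "norm ((1 / real (Suc n)) *\<^sub>R b) \<le> norm b" by (simp add: field_simps mult_left_le)
        then have "R < norm (x + (1 / real (Suc n)) *\<^sub>R b)"
          using False norm_diff_ineq[of x "(1 / real (Suc n)) *\<^sub>R b"] by linarith
        moreover have "R < norm x" using False norm_ge_zero[of b] by linarith
        ultimately show ?thesis using M(1) unfolding e by (simp add: R)
      qed
    qed
  qed measurable
  moreover have "(LINT x|lborel. ?F n x) = 0" for n
  proof -
    have "integrable lborel g" by (rule Cc_integrable[OF gC])
    then have "(LINT x|lborel. g ((1 / real (Suc n)) *\<^sub>R b + x) - g x) = 0"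
      by (simp add: lborel_integrable_translate lborel_integral_translate)
    then show ?thesis by (simp only: integral_mult_right_zero mult_zero_right)
  qed
  ultimately have "(\<lambda>n::nat. 0) \<longlonglongrightarrow> (LINT x|lborel. D x b)" by (simp only:)
  then show ?thesis by (simp add: LIMSEQ_const_iff)
qed

text \<open>Integration by parts: the integral of the b-derivative of the product f(x) cis(-(x . z))
  is 0.\<close>

lemma ft_partial:
  assumes f: "f \<in> test_fun" and b: "b \<in> Basis"
  shows "ft (partial_deriv b f) z = \<i> * complex_of_real (z \<bullet> b) * ft f z"
proof -
  have s: "smooth f" using f by (simp add: test_fun_def)
  obtain R where R: "\<And>x. R < norm x \<Longrightarrow> f x = 0"
    using f by (auto simp: test_fun_def compactly_supported_iff)
  let ?e = "\<lambda>x. cis (- (x \<bullet> z))"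
  let ?D = "\<lambda>x h. f x * (complex_of_real (- (h \<bullet> z)) * (\<i> * ?e x)) + frechet_derivative f (at x) h * ?e x"
  have pc: "partial_deriv b f \<in> Cc" by (rule test_fun_Cc[OF test_fun_partial[OF f b]])
  have fc: "f \<in> Cc" by (rule test_fun_Cc[OF f])
  have "(?e has_derivative (\<lambda>h. complex_of_real (- (h \<bullet> z)) * (\<i> * ?e x))) (at x)" for x
  proof -
    have 1: "((\<lambda>x. - (x \<bullet> z)) has_derivative (\<lambda>h. - (h \<bullet> z))) (at x)"
      by (auto intro!: derivative_eq_intros)
    have "(cis has_vector_derivative \<i> * cis (- (x \<bullet> z))) (at (- (x \<bullet> z)))"
      unfolding cis_conv_exp
      by (auto intro!: derivative_eq_intros has_vector_derivative_real_field simp: scaleR_conv_of_real)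
    then have 2: "(cis has_derivative (\<lambda>h. h *\<^sub>R (\<i> * cis (- (x \<bullet> z))))) (at (- (x \<bullet> z)))"
      by (simp add: has_vector_derivative_def)
    from has_derivative_compose[OF 1 2] show ?thesis by (simp add: scaleR_conv_of_real)
  qed
  from has_derivative_mult[OF smooth_has_derivative[OF s] this]
  have d: "((\<lambda>x. f x * ?e x) has_derivative ?D x) (at x)" for x .
  have cont: "continuous_on UNIV (\<lambda>x. ?D x b)"
  proof -
    have "continuous_on UNIV (\<lambda>x. f x * (complex_of_real (- (b \<bullet> z)) * (\<i> * ?e x)) + partial_deriv b f x * ?e x)"
      using pc fc by (auto simp: Cc_def intro!: continuous_intros)
    then show ?thesis by (simp add: partial_deriv_def)
  qed
  have "(LINT x|lborel. ?D x b) = 0"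
    by (rule integral_derivative_zero[OF d cont, of R]) (simp add: R)
  moreover have "(LINT x|lborel. ?D x b)
      = (LINT x|lborel. complex_of_real (- (b \<bullet> z)) * \<i> * (f x * ?e x)) + (LINT x|lborel. partial_deriv b f x * ?e x)"
  proof -
    have "integrable lborel (\<lambda>x. complex_of_real (- (b \<bullet> z)) * \<i> * (f x * ?e x))"
      by (intro integrable_mult_right integrable_mult_cis Cc_integrable[OF fc]) measurable
    moreover have "integrable lborel (\<lambda>x. partial_deriv b f x * ?e x)"
      by (intro integrable_mult_cis Cc_integrable[OF pc]) measurable
    ultimately show ?thesis
      by (subst Bochner_Integration.integral_add[symmetric]) (simp_all add: partial_deriv_def mult_ac)
  qed
  ultimately show ?thesis unfolding ft_def integral_mult_right_zero
    by (simp add: inner_commute mult_ac)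
qed

lemma test_fun_foldr_partial: "f \<in> test_fun \<Longrightarrow> set bs \<subseteq> Basis \<Longrightarrow> foldr partial_deriv bs f \<in> test_fun"
  by (induction bs) (auto simp: test_fun_partial)

lemma ft_foldr_partial:
  assumes f: "f \<in> test_fun" and "set bs \<subseteq> Basis"
  shows "cmod (ft (foldr partial_deriv bs f) z) = prod_list (map (\<lambda>b. \<bar>z \<bullet> b\<bar>) bs) * cmod (ft f z)"
  using assms(2)
  by (induction bs) (auto simp: ft_partial[OF test_fun_foldr_partial[OF f]] norm_mult)

text \<open>A product over coordinates instead of a power of 1 + |z|^2: its integral splits into
  integrals of 1/(1 + t^2), and on phase space it factorizes, see
  \<open>japanese_Pair\<close>.\<close>

definition japanese :: "'a::euclidean_space \<Rightarrow> real" where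
  "japanese z = (\<Prod>b\<in>Basis. inverse (1 + (z \<bullet> b)\<^sup>2))"

lemma japanese_pos: "0 < japanese z"
  unfolding japanese_def by (intro prod_pos ballI) (simp add: add_pos_nonneg)

lemma japanese_measurable [measurable]: "japanese \<in> borel_measurable borel"
  unfolding japanese_def[abs_def] by measurable

lemma japanese_integrable: "integrable lborel (japanese :: 'a::euclidean_space \<Rightarrow> real)"
proof -
  have "integrable lborel (\<lambda>t::real. inverse (1 + t\<^sup>2))"
    using integrable_inverse_1_plus_square by (simp add: set_integrable_def einterval_eq_UNIV)
  from lborel_integral_prod(1)[where f = "\<lambda>_::'a. \<lambda>t::real. inverse (1 + t\<^sup>2)", OF this]
  show ?thesis by (simp add: japanese_def[abs_def])
qed

lemma japanese_le_1: "japanese z \<le> 1"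
proof -
  have "inverse (1 + (z \<bullet> b)\<^sup>2) \<le> 1" for b by (rule inverse_le_1_iff[THEN iffD2]) simp
  moreover have "0 \<le> inverse (1 + (z \<bullet> b)\<^sup>2)" for b by (simp add: add_nonneg_nonneg)
  ultimately show ?thesis unfolding japanese_def by (intro prod_le_1) auto
qed

lemma prod_Basis_prod:
  fixes f :: "'a::euclidean_space \<times> 'b::euclidean_space \<Rightarrow> 'c::comm_monoid_mult"
  shows "(\<Prod>b\<in>Basis. f b) = (\<Prod>b\<in>Basis. f (b, 0)) * (\<Prod>b\<in>Basis. f (0, b))"
proof -
  have "(\<Prod>b\<in>Basis. f b) = (\<Prod>b\<in>(\<lambda>u. (u, 0)) ` Basis. f b) * (\<Prod>b\<in>(\<lambda>u. (0, u)) ` Basis. f b)"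
    unfolding Basis_prod_def by (rule prod.union_disjoint) auto
  also have "\<dots> = (\<Prod>b\<in>Basis. f (b, 0)) * (\<Prod>b\<in>Basis. f (0, b))"
    by (subst (1 2) prod.reindex) (auto simp: inj_on_def)
  finally show ?thesis .
qed

lemma japanese_Pair: "japanese (p, q) = japanese p * japanese q"
  unfolding japanese_def by (simp add: prod_Basis_prod)

text \<open>Expand the product of the factors 1 + (z . b)^2 over subsets S of the basis. The term of
  S is the transform of f differentiated twice in each direction of S, which is bounded.\<close>

lemma ft_decay:
  fixes f :: "'a::euclidean_space \<Rightarrow> complex"
  assumes f: "f \<in> test_fun"
  obtains C where "C > 0" "\<And>z. cmod (ft f z) \<le> C * japanese z"
proof -
  have "\<exists>C. \<forall>z. (\<Prod>b\<in>S. (z \<bullet> b)\<^sup>2) * cmod (ft f z) \<le> C" if S: "S \<subseteq> Basis" for S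
  proof -
    have "finite S" using S finite_Basis finite_subset by blast
    then obtain bs where bs: "set bs = S" "distinct bs" using finite_distinct_list by blast
    have sub: "set (bs @ bs) \<subseteq> Basis" using S bs by simp
    let ?g = "foldr partial_deriv (bs @ bs) f"
    have "(\<Prod>b\<in>S. (z \<bullet> b)\<^sup>2) * cmod (ft f z) = cmod (ft ?g z)" for z
    proof -
      have "prod_list (map (\<lambda>b. \<bar>z \<bullet> b\<bar>) (bs @ bs)) = (\<Prod>b\<in>S. \<bar>z \<bullet> b\<bar>)\<^sup>2"
        using prod.distinct_set_conv_list[OF bs(2), of "\<lambda>b. \<bar>z \<bullet> b\<bar>"] bs(1) by (simp add: power2_eq_square)
      also have "\<dots> = (\<Prod>b\<in>S. (z \<bullet> b)\<^sup>2)" by (simp add: prod_power_distrib)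
      finally show ?thesis unfolding ft_foldr_partial[OF f sub] by simp
    qed
    then show ?thesis using ft_bound[of ?g] by metis
  qed
  then obtain K where K: "\<And>S z. S \<subseteq> Basis \<Longrightarrow> (\<Prod>b\<in>S. (z \<bullet> b)\<^sup>2) * cmod (ft f z) \<le> K S" by metis
  \<comment> \<open>One constant for all subsets; the added 1 makes it positive.\<close>
  define C where "C = \<bar>\<Sum>S\<in>Pow (Basis::'a set). K S\<bar> + 1"
  have "cmod (ft f z) \<le> C * japanese z" for z
  proof -
    have "(\<Prod>b\<in>(Basis::'a set). (z \<bullet> b)\<^sup>2 + 1) * cmod (ft f z) = (\<Sum>S\<in>Pow Basis. (\<Prod>b\<in>S. (z \<bullet> b)\<^sup>2) * cmod (ft f z))"
      by (subst prod_add) (simp_all add: sum_distrib_right)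
    also have "\<dots> \<le> (\<Sum>S\<in>Pow Basis. K S)" by (intro sum_mono K) auto
    also have "\<dots> \<le> C" by (simp add: C_def)
    finally have "(\<Prod>b\<in>(Basis::'a set). (z \<bullet> b)\<^sup>2 + 1) * cmod (ft f z) \<le> C" .
    moreover have "(\<Prod>b\<in>(Basis::'a set). (z \<bullet> b)\<^sup>2 + 1) = inverse (japanese z)"
      unfolding japanese_def by (simp add: prod_inversef[symmetric] add.commute)
    ultimately have "cmod (ft f z) / japanese z \<le> C" by (simp add: divide_inverse mult.commute)
    then show ?thesis using pos_divide_le_eq[OF japanese_pos[of z]] by simp
  qed
  moreover have "C > 0" by (simp add: C_def add_nonneg_pos)
  ultimately show ?thesis using that by blast
qed

lemma ft_test_fun_integrable:
  assumes f: "(f :: 'a::euclidean_space \<Rightarrow> complex) \<in> test_fun"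
  shows "integrable lborel (ft f)"
proof -
  obtain C where C: "C > 0" "\<And>z. cmod (ft f z) \<le> C * japanese z" using ft_decay[OF f] by blast
  have [measurable]: "f \<in> borel_measurable borel" by (rule Cc_measurable[OF test_fun_Cc[OF f]])
  show ?thesis
  proof (rule Bochner_Integration.integrable_bound)
    show "integrable lborel (\<lambda>z::'a. C * japanese z)" by (intro integrable_mult_right japanese_integrable)
    show "AE z in lborel. norm (ft f z) \<le> norm (C * japanese z)"
      using C(2) by (auto intro!: AE_I2 order_trans[OF C(2)])
  qed measurable
qed

section \<open>Bump functions\<close>

lemma poly_exp_at_top:
  assumes c: "c > (0::real)"
  shows "((\<lambda>y. poly q y * exp (- c * y)) \<longlongrightarrow> 0) at_top"
proof -
  have "((\<lambda>y. y ^ k * exp (- c * y)) \<longlongrightarrow> 0) at_top" for k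
  proof -
    have "filterlim (\<lambda>y. c * y) at_top at_top"
      by (rule filterlim_tendsto_pos_mult_at_top[OF tendsto_const c filterlim_ident])
    then have "((\<lambda>y. (c * y) ^ k / exp (c * y)) \<longlongrightarrow> 0) at_top"
      by (rule filterlim_compose[OF tendsto_power_div_exp_0])
    then have "((\<lambda>y. (1 / c ^ k) * ((c * y) ^ k / exp (c * y))) \<longlongrightarrow> 0) at_top"
      by (rule tendsto_mult_right_zero)
    moreover have "(1 / c ^ k) * ((c * y) ^ k / exp (c * y)) = y ^ k * exp (- c * y)" for y
      using c by (simp add: power_mult_distrib exp_minus divide_inverse)
    ultimately show ?thesis by simp
  qed
  then have "((\<lambda>y. \<Sum>i\<le>degree q. coeff q i * (y ^ i * exp (- c * y))) \<longlongrightarrow> 0) at_top"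
    by (intro tendsto_null_sum tendsto_mult_right_zero)
  then show ?thesis by (simp add: poly_altdef sum_distrib_right mult.assoc)
qed

text \<open>For q = 1 this is the flat function exp(-c/t). Polynomial factors in 1/t make the family
  closed under differentiation.\<close>

definition expflat :: "real \<Rightarrow> real poly \<Rightarrow> real \<Rightarrow> real" where
  "expflat c q t = (if 0 < t then poly q (inverse t) * exp (- c * inverse t) else 0)"

text \<open>Differentiating in 1/t produces the factor (1/t)^2, which is the polynomial
  \<open>[:0, 0, 1:]\<close>. At t = 0 the difference quotient is again a polynomial in 1/t times
  exp(-c/t), and the exponential wins.\<close>

lemma flat_deriv:
  assumes c: "c > 0"
  shows "(expflat c q has_real_derivative expflat c ([:0, 0, 1:] * (smult c q - pderiv q)) t) (at t)"
proof -
  consider "t < 0" | "t > 0" | "t = 0" by linarith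
  then show ?thesis
  proof cases
    case 1
    have "((\<lambda>_. 0) has_real_derivative 0) (at t)" by simp
    then have "(expflat c q has_real_derivative 0) (at t)"
      by (rule has_field_derivative_transform_within_open[where S = "{..<0}"]) (use 1 in \<open>auto simp: expflat_def\<close>)
    then show ?thesis using 1 by (simp add: expflat_def)
  next
    case 2
    have "((\<lambda>t. poly q (inverse t) * exp (- c * inverse t)) has_real_derivative
        (- (inverse t)\<^sup>2 * poly (pderiv q) (inverse t)) * exp (- c * inverse t)
          + poly q (inverse t) * (exp (- c * inverse t) * (c * (inverse t)\<^sup>2))) (at t)"
      using 2 by (auto intro!: derivative_eq_intros DERIV_chain2[OF poly_DERIV] simp: power2_eq_square)
    moreover have "(- (inverse t)\<^sup>2 * poly (pderiv q) (inverse t)) * exp (- c * inverse t)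
          + poly q (inverse t) * (exp (- c * inverse t) * (c * (inverse t)\<^sup>2))
        = expflat c ([:0, 0, 1:] * (smult c q - pderiv q)) t"
      using 2 by (simp add: expflat_def power2_eq_square algebra_simps)
    ultimately have "((\<lambda>t. poly q (inverse t) * exp (- c * inverse t)) has_real_derivative
        expflat c ([:0, 0, 1:] * (smult c q - pderiv q)) t) (at t)" by simp
    then show ?thesis
      by (rule has_field_derivative_transform_within_open[where S = "{0<..}"]) (use 2 in \<open>auto simp: expflat_def\<close>)
  next
    case 3
    have "((\<lambda>h. expflat c q h / h) \<longlongrightarrow> 0) (at 0)"
    proof (rule filterlim_split_at)
      have "((\<lambda>h. 0) \<longlongrightarrow> (0::real)) (at_left 0)" by simp
      then show "((\<lambda>h. expflat c q h / h) \<longlongrightarrow> 0) (at_left 0)"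
        by (rule Lim_transform_eventually) (auto simp: eventually_at_filter expflat_def)
      have "((\<lambda>h. poly ([:0, 1:] * q) (inverse h) * exp (- c * inverse h)) \<longlongrightarrow> 0) (at_right 0)"
        by (rule filterlim_compose[OF poly_exp_at_top[OF c] filterlim_inverse_at_top_right])
      then show "((\<lambda>h. expflat c q h / h) \<longlongrightarrow> 0) (at_right 0)"
        by (rule Lim_transform_eventually)
           (auto simp: eventually_at_filter expflat_def divide_inverse mult_ac)
    qed
    then show ?thesis using 3 by (simp add: DERIV_def expflat_def)
  qed
qed

text \<open>A function is carried together with its derivatives: D 0 is the function and D n its
  n-th derivative.\<close>

definition smooth_real :: "(nat \<Rightarrow> real \<Rightarrow> real) \<Rightarrow> bool" where
  "smooth_real D \<longleftrightarrow> (\<forall>n x. (D n has_real_derivative D (Suc n) x) (at x))"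

text \<open>Functions of the form \<open>\<Sum>p(s) expflat c q (4 - s\<^sup>2)\<close>, given by the list of the pairs
  \<open>(p, q)\<close>, are stable under differentiation.\<close>

definition flat_sum :: "real \<Rightarrow> (real poly \<times> real poly) list \<Rightarrow> real \<Rightarrow> real" where
  "flat_sum c L s = (\<Sum>(p, q)\<leftarrow>L. poly p s * expflat c q (4 - s\<^sup>2))"

fun flat_step :: "real \<Rightarrow> (real poly \<times> real poly) list \<Rightarrow> (real poly \<times> real poly) list" where
  "flat_step c [] = []"
| "flat_step c ((p, q) # L) =
    (pderiv p, q) # ([:0, -2:] * p, [:0, 0, 1:] * (smult c q - pderiv q)) # flat_step c L"

lemma flat_sum_deriv:
  assumes "c > 0"
  shows "(flat_sum c L has_real_derivative flat_sum c (flat_step c L) s) (at s)"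
proof (induction L)
  case Nil
  then show ?case by (simp add: flat_sum_def[abs_def])
next
  case (Cons a L)
  obtain p q where a: "a = (p, q)" by (cases a)
  have 1: "((\<lambda>s. expflat c q (4 - s\<^sup>2)) has_real_derivative
      expflat c ([:0, 0, 1:] * (smult c q - pderiv q)) (4 - s\<^sup>2) * (- (2 * s))) (at s)"
    by (rule DERIV_chain2[OF flat_deriv[OF assms]]) (auto intro!: derivative_eq_intros)
  have "((\<lambda>s. poly p s * expflat c q (4 - s\<^sup>2) + flat_sum c L s) has_real_derivative
      (poly (pderiv p) s * expflat c q (4 - s\<^sup>2)
        + (expflat c ([:0, 0, 1:] * (smult c q - pderiv q)) (4 - s\<^sup>2) * (- (2 * s))) * poly p s)
      + flat_sum c (flat_step c L) s) (at s)"
    by (rule DERIV_add[OF DERIV_mult[OF poly_DERIV 1] Cons.IH])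
  moreover have "flat_sum c (a # L) = (\<lambda>s. poly p s * expflat c q (4 - s\<^sup>2) + flat_sum c L s)"
    by (rule ext) (simp add: a flat_sum_def)
  moreover have "flat_sum c (flat_step c (a # L)) s = (poly (pderiv p) s * expflat c q (4 - s\<^sup>2)
        + (expflat c ([:0, 0, 1:] * (smult c q - pderiv q)) (4 - s\<^sup>2) * (- (2 * s))) * poly p s)
      + flat_sum c (flat_step c L) s"
    by (simp add: a flat_sum_def)
  ultimately show ?case by simp
qed

text \<open>Vanishes for |s| \<ge> 2. The parameter c is there because squaring doubles it: every
  bump has a smooth square root of the same family.\<close>

definition bump1 :: "real \<Rightarrow> real \<Rightarrow> real" where
  "bump1 c s = (if s\<^sup>2 < 4 then exp (- c / (4 - s\<^sup>2)) else 0)"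

lemma bump1_smooth:
  assumes "c > 0"
  obtains D where "smooth_real D" "D 0 = (\<lambda>s. bump1 c (s / N))"
proof -
  \<comment> \<open>The list \<open>[(1, 1)]\<close> represents the bump itself, each
    \<open>flat_step\<close> differentiates once, and the powers of 1/N come from the chain
    rule.\<close>
  define D where "D = (\<lambda>n s. inverse N ^ n * flat_sum c ((flat_step c ^^ n) [(1, 1)]) (s * inverse N))"
  have "(D n has_real_derivative D (Suc n) s) (at s)" for n s
    unfolding D_def
    by (rule derivative_eq_intros DERIV_chain2[OF flat_sum_deriv[OF assms]] refl)+ simp
  then have "smooth_real D" by (simp add: smooth_real_def)
  moreover have "D 0 = (\<lambda>s. bump1 c (s / N))"
    by (rule ext) (simp add: D_def flat_sum_def expflat_def bump1_def divide_inverse)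
  ultimately show ?thesis using that by blast
qed

text \<open>The products in which the factor of direction b is differentiated k b times form a
  family closed under partial derivatives: the direction b raises k b by one. Every iterated partial
  derivative is therefore such a product.\<close>

lemma tensor_smooth:
  fixes D :: "'a::euclidean_space \<Rightarrow> nat \<Rightarrow> real \<Rightarrow> real"
  assumes D: "\<And>b. b \<in> Basis \<Longrightarrow> smooth_real (D b)"
  shows "smooth (\<lambda>x. complex_of_real (\<Prod>b\<in>Basis. D b 0 (x \<bullet> b)))"
proof -
  define T where "T = (\<lambda>(k :: 'a \<Rightarrow> nat) x. complex_of_real (\<Prod>b\<in>Basis. D b (k b) (x \<bullet> b)))"
  have d: "(T k has_derivative
      (\<lambda>y. complex_of_real (\<Sum>i\<in>Basis. ((y \<bullet> i) * D i (Suc (k i)) (x \<bullet> i)) * (\<Prod>j\<in>Basis - {i}. D j (k j) (x \<bullet> j))))) (at x)" for k x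
  proof -
    have "((\<lambda>x. D i (k i) (x \<bullet> i)) has_derivative (\<lambda>y. (y \<bullet> i) * D i (Suc (k i)) (x \<bullet> i))) (at x)" if "i \<in> Basis" for i
    proof -
      have 1: "((\<lambda>x. x \<bullet> i) has_derivative (\<lambda>y. y \<bullet> i)) (at x)" by (auto intro!: derivative_eq_intros)
      have "(D i (k i) has_derivative (\<lambda>h. h * D i (Suc (k i)) (x \<bullet> i))) (at (x \<bullet> i))"
        using D[OF that] by (simp add: smooth_real_def has_field_derivative_def mult_commute_abs)
      from has_derivative_compose[OF 1 this] show ?thesis .
    qed
    then have "((\<lambda>x. \<Prod>i\<in>Basis. D i (k i) (x \<bullet> i)) has_derivative
        (\<lambda>y. \<Sum>i\<in>Basis. ((y \<bullet> i) * D i (Suc (k i)) (x \<bullet> i)) * (\<Prod>j\<in>Basis - {i}. D j (k j) (x \<bullet> j)))) (at x)"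
      by (rule has_derivative_prod)
    then show ?thesis unfolding T_def by (rule has_derivative_of_real)
  qed
  have p: "partial_deriv b (T k) = T (k(b := Suc (k b)))" if b: "b \<in> Basis" for b k
  proof
    fix x
    have "partial_deriv b (T k) x
        = complex_of_real (\<Sum>i\<in>Basis. ((b \<bullet> i) * D i (Suc (k i)) (x \<bullet> i)) * (\<Prod>j\<in>Basis - {i}. D j (k j) (x \<bullet> j)))"
      unfolding partial_deriv_def frechet_derivative_at[OF d, symmetric] ..
    also have "(\<Sum>i\<in>Basis. ((b \<bullet> i) * D i (Suc (k i)) (x \<bullet> i)) * (\<Prod>j\<in>Basis - {i}. D j (k j) (x \<bullet> j)))
        = (\<Sum>i\<in>Basis. if i = b then D b (Suc (k b)) (x \<bullet> b) * (\<Prod>j\<in>Basis - {b}. D j (k j) (x \<bullet> j)) else 0)"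
      using b by (intro sum.cong) (auto simp: inner_Basis)
    also have "\<dots> = D b (Suc (k b)) (x \<bullet> b) * (\<Prod>j\<in>Basis - {b}. D j (k j) (x \<bullet> j))" using b by simp
    also have "\<dots> = (\<Prod>j\<in>Basis. D j ((k(b := Suc (k b))) j) (x \<bullet> j))"
      using b by (subst prod.remove[OF finite_Basis b]) (auto intro!: prod.cong)
    finally show "partial_deriv b (T k) x = T (k(b := Suc (k b))) x" by (simp add: T_def)
  qed
  have iter: "\<exists>k'. foldr partial_deriv bs (T k) = T k'" if "set bs \<subseteq> Basis" for bs k
    using that
  proof (induction bs)
    case (Cons b bs)
    then obtain k' where "foldr partial_deriv bs (T k) = T k'" by auto
    then show ?case using p[of b k'] Cons.prems by auto
  qed auto
  then have "foldr partial_deriv bs (T (\<lambda>_. 0)) differentiable at x" if bs: "set bs \<subseteq> Basis" for bs x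
  proof -
    obtain k' where "foldr partial_deriv bs (T (\<lambda>_. 0)) = T k'" using iter[OF bs] by blast
    then show ?thesis using d[of k' x] by (auto simp: differentiable_def)
  qed
  then show ?thesis unfolding smooth_def T_def by blast
qed

definition bump :: "real \<Rightarrow> real \<Rightarrow> 'a::euclidean_space \<Rightarrow> real" where
  "bump c N x = (\<Prod>b\<in>Basis. bump1 c (x \<bullet> b / N))"

lemma bump1_nonneg: "0 \<le> bump1 c s" by (simp add: bump1_def)

lemma bump1_le_1: "c > 0 \<Longrightarrow> bump1 c s \<le> 1" by (simp add: bump1_def)

lemma bump_nonneg: "0 \<le> bump c N x"
  unfolding bump_def by (intro prod_nonneg bump1_nonneg)

lemma bump_le_1: "c > 0 \<Longrightarrow> bump c N x \<le> 1"
  unfolding bump_def by (intro prod_le_1) (auto simp: bump1_nonneg bump1_le_1)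

lemma bump_square: "(bump c N x)\<^sup>2 = bump (2 * c) N x"
proof -
  have "(bump1 c s)\<^sup>2 = bump1 (2 * c) s" for s
    by (simp add: bump1_def flip: exp_double)
  then show ?thesis by (simp add: bump_def prod_power_distrib)
qed

text \<open>The Euclidean norm is at most the sum of the |x . b|; a point beyond 2N times the
  dimension has a coordinate beyond 2N.\<close>

lemma bump_support:
  fixes x :: "'a::euclidean_space" and N :: real
  assumes N: "N > 0" and x: "2 * N * DIM('a) < norm x"
  shows "bump c N x = 0"
proof -
  have "\<exists>b\<in>Basis. 2 * N < \<bar>x \<bullet> b\<bar>"
  proof (rule ccontr)
    assume "\<not> ?thesis"
    then have "(\<Sum>b\<in>Basis. \<bar>x \<bullet> b\<bar>) \<le> (\<Sum>b\<in>(Basis::'a set). 2 * N)" by (intro sum_mono) auto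
    then show False using norm_le_l1[of x] x by (simp add: algebra_simps)
  qed
  then obtain b where b: "b \<in> Basis" "2 * N < \<bar>x \<bullet> b\<bar>" by blast
  then have "2 < \<bar>x \<bullet> b / N\<bar>" using N by (simp add: field_simps)
  then have "2\<^sup>2 < (x \<bullet> b / N)\<^sup>2" by (metis abs_numeral abs_power2 power2_abs power_strict_mono zero_le_numeral zero_less_numeral pos2)
  then have "bump1 c (x \<bullet> b / N) = 0" by (simp add: bump1_def)
  then show ?thesis unfolding bump_def using b(1) by (intro prod_zero) auto
qed

text \<open>For |x| \<le> N every scaled coordinate s satisfies 4 - s^2 \<ge> 3; this is the origin
  of c/3.\<close>

lemma bump_lower:
  fixes x :: "'a::euclidean_space"
  assumes N: "N > 0" and c: "c > 0" and x: "norm x \<le> N"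
  shows "exp (- c / 3) ^ DIM('a) \<le> bump c N x"
proof -
  have "exp (- c / 3) \<le> bump1 c (x \<bullet> b / N)" if "b \<in> Basis" for b
  proof -
    have "\<bar>x \<bullet> b\<bar> \<le> N" using Basis_le_norm[OF that, of x] x by linarith
    then have "\<bar>x \<bullet> b / N\<bar> \<le> 1" using N by (simp add: field_simps)
    then have s: "(x \<bullet> b / N)\<^sup>2 \<le> 1" by (simp add: abs_square_le_1)
    then have "c / (4 - (x \<bullet> b / N)\<^sup>2) \<le> c / 3" using c by (intro divide_left_mono) auto
    then show ?thesis using s by (simp add: bump1_def)
  qed
  then have "(\<Prod>b\<in>(Basis::'a set). exp (- c / 3)) \<le> bump c N x"
    unfolding bump_def by (intro prod_mono) auto
  then show ?thesis by simp
qed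

lemma bump_test_fun:
  assumes "c > 0" "N > 0"
  shows "(\<lambda>x::'a::euclidean_space. complex_of_real (bump c N x)) \<in> test_fun"
proof -
  obtain D where D: "smooth_real D" "D 0 = (\<lambda>s. bump1 c (s / N))" using bump1_smooth[OF assms(1)] by blast
  have "smooth (\<lambda>x::'a. complex_of_real (\<Prod>b\<in>Basis. D 0 (x \<bullet> b)))" by (rule tensor_smooth) (rule D)
  then have "smooth (\<lambda>x::'a. complex_of_real (bump c N x))" by (simp add: D(2) bump_def)
  moreover have "compactly_supported (\<lambda>x::'a. complex_of_real (bump c N x))"
    unfolding compactly_supported_iff using bump_support[OF assms(2)] by auto
  ultimately show ?thesis by (simp add: test_fun_def)
qed

lemma bump_shift_test_fun:
  assumes "c > 0" "N > 0"
  shows "(\<lambda>x::'a::euclidean_space. complex_of_real (bump c N (x - y))) \<in> test_fun"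
proof -
  obtain D where D: "smooth_real D" "D 0 = (\<lambda>s. bump1 c (s / N))" using bump1_smooth[OF assms(1)] by blast
  define F where "F = (\<lambda>(b::'a) n s. D n (s - y \<bullet> b))"
  have "smooth_real (F b)" for b
    unfolding smooth_real_def
  proof (intro allI)
    fix n x
    have "((\<lambda>s. D n (s - y \<bullet> b)) has_real_derivative D (Suc n) (x - y \<bullet> b) * 1) (at x)"
      by (rule DERIV_chain2[of "D n" _ "\<lambda>s. s - y \<bullet> b"])
         (use D(1) in \<open>auto simp: smooth_real_def intro!: derivative_eq_intros\<close>)
    then show "(F b n has_real_derivative F b (Suc n) x) (at x)" by (simp add: F_def)
  qed
  then have "smooth (\<lambda>x::'a. complex_of_real (\<Prod>b\<in>Basis. F b 0 (x \<bullet> b)))" by (intro tensor_smooth)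
  then have "smooth (\<lambda>x::'a. complex_of_real (bump c N (x - y)))" by (simp add: F_def D(2) bump_def inner_diff_left)
  moreover have "compactly_supported (\<lambda>x::'a. complex_of_real (bump c N (x - y)))"
    unfolding compactly_supported_iff
  proof (intro exI allI impI)
    fix x :: 'a assume "2 * N * DIM('a) + norm y < norm x"
    then have "2 * N * DIM('a) < norm (x - y)" using norm_triangle_ineq2[of x y] by linarith
    then show "complex_of_real (bump c N (x - y)) = 0" using bump_support[OF assms(2)] by simp
  qed
  ultimately show ?thesis by (simp add: test_fun_def)
qed

lemma bump_pair_test_fun:
  assumes "c > 0" "N > 0" "c' > 0" "M > 0"
  shows "(\<lambda>z::'a::euclidean_space \<times> 'b::euclidean_space. complex_of_real (bump c N (fst z) * bump c' M (snd z))) \<in> test_fun"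
proof -
  obtain D where D: "smooth_real D" "D 0 = (\<lambda>s. bump1 c (s / N))" using bump1_smooth[OF assms(1)] by blast
  obtain E where E: "smooth_real E" "E 0 = (\<lambda>s. bump1 c' (s / M))" using bump1_smooth[OF assms(3)] by blast
  \<comment> \<open>The basis vectors of the product with second component 0 are those of the first
    factor, so this test selects the profile of each coordinate.\<close>
  define F where "F = (\<lambda>b::'a \<times> 'b. if snd b = 0 then D else E)"
  have "smooth (\<lambda>z::'a \<times> 'b. complex_of_real (\<Prod>b\<in>Basis. F b 0 (z \<bullet> b)))"
    by (rule tensor_smooth) (simp add: F_def D E)
  moreover have "(\<Prod>b\<in>Basis. F b 0 (z \<bullet> b)) = bump c N (fst z) * bump c' M (snd z)" for z :: "'a \<times> 'b"
    unfolding prod_Basis_prod bump_def F_def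
    by (intro arg_cong2[where f = "(*)"] prod.cong) (auto simp: D E inner_prod_def)
  ultimately have "smooth (\<lambda>z::'a \<times> 'b. complex_of_real (bump c N (fst z) * bump c' M (snd z)))" by simp
  moreover have "compactly_supported (\<lambda>z::'a \<times> 'b. complex_of_real (bump c N (fst z) * bump c' M (snd z)))"
    unfolding compactly_supported_iff
  proof (intro exI allI impI)
    fix z :: "'a \<times> 'b"
    assume "2 * N * DIM('a) + 2 * M * DIM('b) < norm z"
    also have "norm z \<le> norm (fst z) + norm (snd z)" using norm_Pair_le[of "fst z" "snd z"] by simp
    finally have "2 * N * DIM('a) < norm (fst z) \<or> 2 * M * DIM('b) < norm (snd z)" by linarith
    then show "complex_of_real (bump c N (fst z) * bump c' M (snd z)) = 0"
      using bump_support[OF assms(2)] bump_support[OF assms(4)] by auto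
  qed
  ultimately show ?thesis by (simp add: test_fun_def)
qed

lemma bump_measurable [measurable]: "bump c N \<in> borel_measurable borel"
  unfolding bump_def[abs_def] bump1_def[abs_def] by measurable

section \<open>Fourier multipliers\<close>

lemma fourinv_adjoint:
  assumes "u \<in> L2" "v \<in> L2"
  shows "L2_inner (fourinv u) v = L2_inner u (fourier v)"
  using fourier_adjoint[OF assms(2,1)] by (metis L2_inner_cnj)

definition fmult :: "('a::euclidean_space \<Rightarrow> complex) \<Rightarrow> ('a \<Rightarrow> complex) \<Rightarrow> 'a \<Rightarrow> complex" where
  "fmult m u = fourinv (\<lambda>z. m z * fourier u z)"

lemma
  assumes "u \<in> L2" "m \<in> borel_measurable borel" "\<And>z. cmod (m z) \<le> C"
  shows fmult_aux_L2: "(\<lambda>z. m z * fourier u z) \<in> L2"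
    and fmult_L2: "fmult m u \<in> L2"
    and fourier_fmult: "AE z in lborel. fourier (fmult m u) z = m z * fourier u z"
    and fmult_inner: "v \<in> L2 \<Longrightarrow> L2_inner (fmult m u) v = (LINT z|lborel. m z * (fourier u z * cnj (fourier v z)))"
proof -
  show 1: "(\<lambda>z. m z * fourier u z) \<in> L2" by (rule L2_bdd_mult[OF fourier_L2[OF assms(1)] assms(2,3)])
  show "fmult m u \<in> L2" unfolding fmult_def by (rule fourinv_L2[OF 1])
  show "AE z in lborel. fourier (fmult m u) z = m z * fourier u z"
    unfolding fmult_def by (rule fourier_fourinv[OF 1])
  show "L2_inner (fmult m u) v = (LINT z|lborel. m z * (fourier u z * cnj (fourier v z)))" if "v \<in> L2"
    unfolding fmult_def fourinv_adjoint[OF 1 that] by (simp add: L2_inner_def mult.assoc)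
qed

lemma nsq_measurable [measurable]: "(\<lambda>z::'a::euclidean_space. - (norm z)\<^sup>2) \<in> borel_measurable borel"
  by measurable

text \<open>The model resolution of the Laplacian, which acts at frequency z as multiplication by
  -|z|^2.\<close>

definition EF :: "real set \<Rightarrow> ('a::euclidean_space \<Rightarrow> complex) \<Rightarrow> 'a \<Rightarrow> complex" where
  "EF A u = fmult (\<lambda>z. indicator A (- (norm z)\<^sup>2)) u"

lemma EF_mult_measurable: "A \<in> sets borel \<Longrightarrow> (\<lambda>z::'a::euclidean_space. indicator A (- (norm z)\<^sup>2) :: complex) \<in> borel_measurable borel"
  by (rule measurable_compose[OF nsq_measurable borel_measurable_indicator])

lemma cmod_indicator_le: "cmod (indicator A s) \<le> 1"
  by (simp add: indicator_def)

lemmas EF_L2 = fmult_L2[OF _ EF_mult_measurable cmod_indicator_le, folded EF_def]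
lemmas fourier_EF = fourier_fmult[OF _ EF_mult_measurable cmod_indicator_le, folded EF_def]
lemmas EF_inner = fmult_inner[OF _ EF_mult_measurable cmod_indicator_le, folded EF_def]

text \<open>All axioms become pointwise identities for indicators on the Fourier side. Countable
  additivity is dominated convergence, the partial sums of disjoint indicators being at most
  1.\<close>

lemma pvm_EF: "projection_valued_measure (EF :: real set \<Rightarrow> ('a::euclidean_space \<Rightarrow> complex) \<Rightarrow> 'a \<Rightarrow> complex)"
  unfolding projection_valued_measure_def orthogonal_projection_def
proof (intro conjI ballI allI impI)
  fix A :: "real set" and u :: "'a \<Rightarrow> complex" assume A: "A \<in> sets borel" and u: "u \<in> L2"
  show L: "EF A u \<in> L2" by (rule EF_L2[OF u A])
  show "AE x in lborel. EF A (EF A u) x = EF A u x"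
  proof (rule fourier_eqD[OF EF_L2[OF L A] L])
    show "AE x in lborel. fourier (EF A (EF A u)) x = fourier (EF A u) x"
      using fourier_EF[OF L A] fourier_EF[OF u A] by eventually_elim (simp add: indicator_def)
  qed
  fix v :: "'a \<Rightarrow> complex" assume v: "v \<in> L2"
  have "L2_inner (EF A v) u = (LINT z|lborel. indicator A (- (norm z)\<^sup>2) * (fourier v z * cnj (fourier u z)))"
    by (rule EF_inner[OF v A u])
  from arg_cong[where f = cnj, OF this]
  have "L2_inner u (EF A v) = (LINT z|lborel. cnj (indicator A (- (norm z)\<^sup>2) * (fourier v z * cnj (fourier u z))))"
    by (simp only: Bochner_Integration.integral_cnj L2_inner_cnj[symmetric])
  also have "\<dots> = (LINT z|lborel. indicator A (- (norm z)\<^sup>2) * (fourier u z * cnj (fourier v z)))"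
    by (rule Bochner_Integration.integral_cong) (auto simp: indicator_def)
  also have "\<dots> = L2_inner (EF A u) v" by (rule EF_inner[OF u A v, symmetric])
  finally show "L2_inner (EF A u) v = L2_inner u (EF A v)" ..
next
  fix u :: "'a \<Rightarrow> complex" assume u: "u \<in> L2"
  have U: "UNIV \<in> sets (borel :: real measure)" by simp
  show "AE x in lborel. EF UNIV u x = u x"
    by (rule fourier_eqD[OF EF_L2[OF u U] u]) (use fourier_EF[OF u U] in simp)
next
  fix A B :: "real set" and u :: "'a \<Rightarrow> complex"
  assume A: "A \<in> sets borel" and B: "B \<in> sets borel" and u: "u \<in> L2"
  have AB: "A \<inter> B \<in> sets borel" using A B by simp
  note L = EF_L2[OF u B]
  show "AE x in lborel. EF (A \<inter> B) u x = EF A (EF B u) x"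
  proof (rule fourier_eqD[OF EF_L2[OF u AB] EF_L2[OF L A]])
    show "AE x in lborel. fourier (EF (A \<inter> B) u) x = fourier (EF A (EF B u)) x"
      using fourier_EF[OF L A] fourier_EF[OF u B] fourier_EF[OF u AB]
      by eventually_elim (simp add: indicator_def)
  qed
next
  fix A :: "nat \<Rightarrow> real set" and u v :: "'a \<Rightarrow> complex"
  assume A: "range A \<subseteq> sets borel" and d: "disjoint_family A" and u: "u \<in> L2" and v: "v \<in> L2"
  have An: "A n \<in> sets borel" for n using A by auto
  then have Un: "(\<Union>n. A n) \<in> sets borel" by auto
  have [measurable]: "fourier u \<in> borel_measurable borel" "fourier v \<in> borel_measurable borel"
    using L2_measurable[OF fourier_L2[OF u]] L2_measurable[OF fourier_L2[OF v]] by auto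
  note [measurable] = EF_mult_measurable[OF Un] EF_mult_measurable[OF An]
  let ?p = "\<lambda>z. fourier u z * cnj (fourier v z)"
  have ip: "integrable lborel ?p" by (rule L2_inner_integrable[OF fourier_L2[OF u] fourier_L2[OF v]])
  have s: "(\<lambda>n. indicator (A n) t :: real) sums indicator (\<Union>n. A n) t" for t
    using d by (intro indicator_sums) (auto simp: disjoint_family_on_def)
  have i: "integrable lborel (\<lambda>z. indicator (A n) (- (norm z)\<^sup>2) * ?p z)" for n
    by (rule Bochner_Integration.integrable_bound[OF ip]) (measurable, auto simp: norm_mult indicator_def)
  have "(\<lambda>N. LINT z|lborel. (\<Sum>n<N. indicator (A n) (- (norm z)\<^sup>2) * ?p z))
      \<longlonglongrightarrow> (LINT z|lborel. indicator (\<Union>n. A n) (- (norm z)\<^sup>2) * ?p z)"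
  proof (rule integral_dominated_convergence[where w = "\<lambda>z. cmod (?p z)"])
    have c: "(\<Sum>n<N. indicator (A n) t * ?p z) = complex_of_real (\<Sum>n<N. indicator (A n) t) * ?p z" for N t z
      by (simp add: sum_distrib_right indicator_def if_distrib cong: if_cong)
    have c': "indicator (\<Union>n. A n) t * ?p z = complex_of_real (indicator (\<Union>n. A n) t) * ?p z" for t z
      by (simp add: indicator_def)
    show "AE z in lborel. (\<lambda>N. \<Sum>n<N. indicator (A n) (- (norm z)\<^sup>2) * ?p z) \<longlonglongrightarrow> indicator (\<Union>n. A n) (- (norm z)\<^sup>2) * ?p z"
      unfolding c c' using s[unfolded sums_def] by (intro AE_I2 tendsto_intros)
    have "(\<Sum>n<N. indicator (A n) t) \<le> (1::real)" for N t
    proof -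
      have "(\<Sum>n<N. indicator (A n) t) \<le> (indicator (\<Union>n. A n) t :: real)"
        using sum_le_suminf[OF sums_summable[OF s], of "{..<N}" t] sums_unique[OF s, of t] by simp
      then show ?thesis using indicator_le_1 by (rule order_trans)
    qed
    then have "cmod (\<Sum>n<N. indicator (A n) t * ?p z) \<le> cmod (?p z)" for N t z
      unfolding c norm_mult norm_of_real by (intro mult_left_le_one_le) (auto simp: sum_nonneg)
    then show "AE z in lborel. norm (\<Sum>n<N. indicator (A n) (- (norm z)\<^sup>2) * ?p z) \<le> cmod (?p z)" for N
      by blast
    show "integrable lborel (\<lambda>z. cmod (?p z))" using ip by (rule integrable_norm)
  qed measurable
  moreover have "(LINT z|lborel. (\<Sum>n<N. indicator (A n) (- (norm z)\<^sup>2) * ?p z)) = (\<Sum>n<N. L2_inner (EF (A n) u) v)" for N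
    by (subst Bochner_Integration.integral_sum, rule i, simp only: EF_inner[OF u An v])
  ultimately show "(\<lambda>n. L2_inner (EF (A n) u) v) sums L2_inner (EF (\<Union>n. A n) u) v"
    unfolding sums_def EF_inner[OF u Un v] by simp
qed

section \<open>Projection-valued measures\<close>

lemma
  assumes E: "projection_valued_measure E"
  shows pvm_L2: "A \<in> sets borel \<Longrightarrow> u \<in> L2 \<Longrightarrow> E A u \<in> L2"
    and pvm_sym: "A \<in> sets borel \<Longrightarrow> u \<in> L2 \<Longrightarrow> v \<in> L2 \<Longrightarrow> L2_inner (E A u) v = L2_inner u (E A v)"
    and pvm_UNIV: "u \<in> L2 \<Longrightarrow> AE x in lborel. E UNIV u x = u x"
    and pvm_Int_AE: "A \<in> sets borel \<Longrightarrow> B \<in> sets borel \<Longrightarrow> u \<in> L2 \<Longrightarrow> AE x in lborel. E (A \<inter> B) u x = E A (E B u) x"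
    and pvm_sums: "range A' \<subseteq> sets borel \<Longrightarrow> disjoint_family A' \<Longrightarrow> u \<in> L2 \<Longrightarrow> v \<in> L2 \<Longrightarrow>
      (\<lambda>n::nat. L2_inner (E (A' n) u) v) sums L2_inner (E (\<Union>n. A' n) u) v"
  using E unfolding projection_valued_measure_def orthogonal_projection_def by blast+

lemma pvm_Int:
  assumes E: "projection_valued_measure E" and A: "A \<in> sets borel" and B: "B \<in> sets borel" and u: "u \<in> L2" and v: "v \<in> L2"
  shows "L2_inner (E A u) (E B v) = L2_inner (E (A \<inter> B) u) v"
proof -
  have "L2_inner (E (B \<inter> A) u) v = L2_inner (E B (E A u)) v"
    using pvm_Int_AE[OF E B A u] by (intro L2_inner_cong_AE pvm_L2[OF E] sets.Int A B u v) auto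
  also have "\<dots> = L2_inner (E A u) (E B v)" by (rule pvm_sym[OF E B pvm_L2[OF E A u] v])
  finally show ?thesis by (simp add: Int_commute)
qed

lemma pvm_inner_self:
  assumes E: "projection_valued_measure E" and A: "A \<in> sets borel" and u: "u \<in> L2"
  shows "L2_inner (E A u) u = complex_of_real ((L2_norm (E A u))\<^sup>2)"
  using pvm_Int[OF E A A u u] by (simp add: L2_inner_self)

lemma pvm_empty:
  assumes E: "projection_valued_measure E" and u: "u \<in> L2" and v: "v \<in> L2"
  shows "L2_inner (E {} u) v = 0"
proof -
  have "(\<lambda>n::nat. L2_inner (E {} u) v) sums L2_inner (E (\<Union>n::nat. {}) u) v"
    by (rule pvm_sums[OF E _ _ u v]) (auto simp: disjoint_family_on_def)
  then have "(\<lambda>n::nat. L2_inner (E {} u) v) \<longlonglongrightarrow> 0" using sums_summable summable_LIMSEQ_zero by blast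
  then show ?thesis by (simp add: LIMSEQ_const_iff)
qed

lemma pvm_compl:
  assumes E: "projection_valued_measure E" and A: "A \<in> sets borel" and u: "u \<in> L2" and v: "v \<in> L2"
  shows "L2_inner (E A u) v + L2_inner (E (- A) u) v = L2_inner u v"
proof -
  \<comment> \<open>A and its complement, padded with empty sets to the sequence that countable
    additivity expects.\<close>
  let ?A = "\<lambda>n::nat. if n = 0 then A else if n = 1 then - A else {}"
  have cA: "- A \<in> sets borel" using A borel_comp by blast
  have "(\<lambda>n::nat. L2_inner (E (?A n) u) v) sums L2_inner (E (\<Union>n. ?A n) u) v"
    by (rule pvm_sums[OF E _ _ u v]) (use A cA in \<open>auto simp: disjoint_family_on_def\<close>)
  moreover have "(\<Union>n. ?A n) = UNIV" by (auto split: if_splits)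
  moreover have "(\<lambda>n::nat. L2_inner (E (?A n) u) v) sums (\<Sum>n\<in>{0, 1}. L2_inner (E (?A n) u) v)"
    by (rule sums_finite) (auto simp: pvm_empty[OF E u v])
  ultimately have "L2_inner (E A u) v + L2_inner (E (- A) u) v = L2_inner (E UNIV u) v"
    using sums_unique2 by fastforce
  also have "\<dots> = L2_inner u v"
    using pvm_UNIV[OF E u] by (intro L2_inner_cong_AE pvm_L2[OF E] u v) auto
  finally show ?thesis .
qed

lemma pvm_contraction:
  assumes E: "projection_valued_measure E" and A: "A \<in> sets borel" and u: "u \<in> L2"
  shows "L2_norm (E A u) \<le> L2_norm u"
proof -
  have "(L2_norm (E A u))\<^sup>2 = cmod (L2_inner (E A u) u)"
    unfolding pvm_inner_self[OF assms] norm_of_real by simp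
  also have "\<dots> \<le> L2_norm (E A u) * L2_norm u" by (rule L2_inner_bound[OF pvm_L2[OF assms] u])
  finally have "L2_norm (E A u) * L2_norm (E A u) \<le> L2_norm (E A u) * L2_norm u" by (simp add: power2_eq_square)
  then show ?thesis
    using L2_norm_nonneg[of "E A u"] L2_norm_nonneg[of u] by (cases "L2_norm (E A u) = 0") auto
qed

lemma
  assumes E: "projection_valued_measure E" and u: "u \<in> L2"
  shows sets_scalar_measure [measurable_cong]: "sets (scalar_measure E u) = sets borel"
    and space_scalar_measure: "space (scalar_measure E u) = UNIV"
    and emeasure_scalar_measure: "A \<in> sets borel \<Longrightarrow> emeasure (scalar_measure E u) A = ennreal ((L2_norm (E A u))\<^sup>2)"
proof -
  have sa: "sigma_algebra UNIV (sets (borel :: real measure))"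
    using sets.sigma_algebra_axioms[of "borel :: real measure"] by simp
  have re: "Re (L2_inner (E A u) u) = (L2_norm (E A u))\<^sup>2" if "A \<in> sets borel" for A
    using pvm_inner_self[OF E that u] by simp
  show "sets (scalar_measure E u) = sets borel"
    unfolding scalar_measure_def by (rule sigma_algebra.sets_measure_of_eq[OF sa])
  show "space (scalar_measure E u) = UNIV"
    unfolding scalar_measure_def by (rule sigma_algebra.space_measure_of_eq[OF sa])
  have "emeasure (scalar_measure E u) A = ennreal (Re (L2_inner (E A u) u))" if A: "A \<in> sets borel" for A
    unfolding scalar_measure_def
  proof (rule emeasure_measure_of_sigma[OF sa _ _ A])
    show "positive (sets borel) (\<lambda>A. ennreal (Re (L2_inner (E A u) u)))"
      by (simp add: positive_def pvm_empty[OF E u u])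
    show "countably_additive (sets borel) (\<lambda>A. ennreal (Re (L2_inner (E A u) u)))"
    proof (rule countably_additiveI)
      fix A :: "nat \<Rightarrow> real set"
      assume A: "range A \<subseteq> sets borel" "disjoint_family A" "(\<Union>i. A i) \<in> sets borel"
      have s: "(\<lambda>n. Re (L2_inner (E (A n) u) u)) sums Re (L2_inner (E (\<Union>n. A n) u) u)"
        using pvm_sums[OF E A(1,2) u u] by (simp add: sums_Re)
      have "A n \<in> sets borel" for n using A(1) by auto
      then have nn: "0 \<le> Re (L2_inner (E (A n) u) u)" for n by (simp add: re)
      show "(\<Sum>i. ennreal (Re (L2_inner (E (A i) u) u))) = ennreal (Re (L2_inner (E (\<Union>i. A i) u) u))"
        by (rule suminf_ennreal_eq[OF nn s])
    qed
  qed
  then show "A \<in> sets borel \<Longrightarrow> emeasure (scalar_measure E u) A = ennreal ((L2_norm (E A u))\<^sup>2)" by (simp add: re)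
qed

lemma finite_scalar_measure:
  assumes E: "projection_valued_measure E" and u: "u \<in> L2"
  shows "finite_measure (scalar_measure E u)"
  by (rule finite_measureI) (simp add: space_scalar_measure[OF assms] emeasure_scalar_measure[OF assms])

lemma measure_scalar_measure:
  assumes "projection_valued_measure E" "u \<in> L2" "A \<in> sets borel"
  shows "measure (scalar_measure E u) A = (L2_norm (E A u))\<^sup>2"
  unfolding measure_def emeasure_scalar_measure[OF assms] by simp

lemma pvm_inner_scaled:
  assumes E: "projection_valued_measure E" and A: "A \<in> sets borel" and x: "x \<in> L2" and y: "y \<in> L2" and z: "z \<in> L2"
  shows "L2_inner (E A (\<lambda>t. x t + c * y t)) z = L2_inner (E A x) z + c * L2_inner (E A y) z"
proof -
  have xy: "(\<lambda>t. x t + c * y t) \<in> L2" by (intro L2_add L2_scale x y)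
  show ?thesis
    using pvm_L2[OF E A z]
    by (simp add: pvm_sym[OF E A] xy x y z L2_inner_add_left L2_scale L2_inner_scale_left)
qed

text \<open>Follows from \<open>E A\<close> composed with \<open>E B\<close> being
  \<open>E (A \<inter> B)\<close>. It transfers the integrability of s^2 from x to
  \<open>E B x\<close>, which makes \<open>E B x\<close> an admissible test vector in
  \<open>pvm_gap\<close>.\<close>

lemma scalar_measure_projected:
  assumes E: "projection_valued_measure E" and B: "B \<in> sets borel" and x: "x \<in> L2"
  shows "scalar_measure E (E B x) = density (scalar_measure E x) (\<lambda>s. ennreal (indicator B s))"
proof (rule measure_eqI)
  note y = pvm_L2[OF E B x]
  show "sets (scalar_measure E (E B x)) = sets (density (scalar_measure E x) (\<lambda>s. ennreal (indicator B s)))"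
    by (simp add: sets_scalar_measure[OF E] x y)
  fix A assume "A \<in> sets (scalar_measure E (E B x))"
  then have A: "A \<in> sets borel" by (simp add: sets_scalar_measure[OF E y])
  have m [measurable_cong]: "sets (scalar_measure E x) = sets borel" by (rule sets_scalar_measure[OF E x])
  note [measurable] = A B
  have "L2_inner (E A (E B x)) (E A (E B x)) = L2_inner (E A (E B x)) (E B x)"
    using pvm_Int[OF E A A y y] by simp
  also have "\<dots> = L2_inner (E (A \<inter> B) x) (E B x)"
    using pvm_Int_AE[OF E A B x] by (intro L2_inner_cong_AE pvm_L2[OF E] sets.Int A B x) (auto elim: eventually_mono)
  also have "\<dots> = L2_inner (E (A \<inter> B) x) x" using pvm_Int[OF E sets.Int[OF A B] B x x] by (simp add: Int_assoc)
  finally have "(L2_norm (E A (E B x)))\<^sup>2 = (L2_norm (E (A \<inter> B) x))\<^sup>2"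
    unfolding L2_inner_self pvm_inner_self[OF E sets.Int[OF A B] x] using of_real_eq_iff by blast
  then have "emeasure (scalar_measure E (E B x)) A = emeasure (scalar_measure E x) (A \<inter> B)"
    using A B by (simp add: emeasure_scalar_measure[OF E] x y)
  also have "\<dots> = (\<integral>\<^sup>+s. indicator (A \<inter> B) s \<partial>scalar_measure E x)" by (rule nn_integral_indicator[symmetric]) measurable
  also have "\<dots> = (\<integral>\<^sup>+s. ennreal (indicator B s) * indicator A s \<partial>scalar_measure E x)"
    by (rule nn_integral_cong) (auto simp: indicator_def)
  also have "\<dots> = emeasure (density (scalar_measure E x) (\<lambda>s. ennreal (indicator B s))) A"
    by (rule emeasure_density[symmetric]) (use A m in auto)
  finally show "emeasure (scalar_measure E (E B x)) A = emeasure (density (scalar_measure E x) (\<lambda>s. ennreal (indicator B s))) A" .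
qed

text \<open>The density is \<open>|1 + \<kappa>|\<^sup>2\<close> on \<open>B\<close> and \<open>1\<close> off \<open>B\<close>.\<close>

lemma scalar_measure_polarized:
  assumes E: "projection_valued_measure E" and B: "B \<in> sets borel" and x: "x \<in> L2" and k: "cmod \<kappa> = 1"
  shows "scalar_measure E (\<lambda>t. x t + \<kappa> * E B x t)
    = density (scalar_measure E x) (\<lambda>s. ennreal (1 + (1 + 2 * Re \<kappa>) * indicator B s))"
proof (rule measure_eqI)
  note y = pvm_L2[OF E B x]
  let ?z = "\<lambda>t. x t + \<kappa> * E B x t"
  have z: "?z \<in> L2" by (intro L2_add L2_scale x y)
  show "sets (scalar_measure E ?z) = sets (density (scalar_measure E x) (\<lambda>s. ennreal (1 + (1 + 2 * Re \<kappa>) * indicator B s)))"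
    by (simp add: sets_scalar_measure[OF E] x z)
  fix A assume "A \<in> sets (scalar_measure E ?z)"
  then have A: "A \<in> sets borel" by (simp add: sets_scalar_measure[OF E z])
  have m [measurable_cong]: "sets (scalar_measure E x) = sets borel" by (rule sets_scalar_measure[OF E x])
  interpret M: finite_measure "scalar_measure E x" by (rule finite_scalar_measure[OF E x])
  note [measurable] = A B
  note AB = sets.Int[OF A B]
  let ?a = "(L2_norm (E A x))\<^sup>2" and ?b = "(L2_norm (E (A \<inter> B) x))\<^sup>2"
  have kk: "\<kappa> * cnj \<kappa> = 1" using k by (simp add: complex_norm_square[symmetric])
  have r: "-1 \<le> Re \<kappa>" using abs_Re_le_cmod[of \<kappa>] k by linarith
  have AEy: "L2_inner (E A (E B x)) w = L2_inner (E (A \<inter> B) x) w" if "w \<in> L2" for w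
    using pvm_Int_AE[OF E A B x] by (intro L2_inner_cong_AE pvm_L2[OF E] sets.Int A B x that) (auto elim: eventually_mono)
  have t1: "L2_inner (E A x) x = of_real ?a" by (rule pvm_inner_self[OF E A x])
  have t2: "L2_inner (E A x) (E B x) = of_real ?b"
    using pvm_Int[OF E A B x x] pvm_inner_self[OF E AB x] by simp
  have t3: "L2_inner (E A (E B x)) x = of_real ?b"
    using AEy[OF x] pvm_inner_self[OF E AB x] by simp
  have t4: "L2_inner (E A (E B x)) (E B x) = of_real ?b"
    using AEy[OF y] pvm_Int[OF E AB B x x] pvm_inner_self[OF E AB x] by (simp add: Int_assoc)
  have "L2_inner (E A ?z) ?z = L2_inner (E A x) ?z + \<kappa> * L2_inner (E A (E B x)) ?z"
    by (rule pvm_inner_scaled[OF E A x y z])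
  also have "\<dots> = (of_real ?a + cnj \<kappa> * of_real ?b) + \<kappa> * (of_real ?b + cnj \<kappa> * of_real ?b)"
    by (simp add: L2_inner_add_right L2_inner_scale_right L2_scale x y pvm_L2[OF E A] t1 t2 t3 t4)
  also have "\<dots> = of_real ?a + (cnj \<kappa> + \<kappa> + \<kappa> * cnj \<kappa>) * of_real ?b" by (simp add: algebra_simps)
  also have "cnj \<kappa> + \<kappa> = of_real (2 * Re \<kappa>)" using complex_add_cnj[of \<kappa>] by (simp add: add.commute)
  finally have "complex_of_real ((L2_norm (E A ?z))\<^sup>2) = of_real (?a + (2 * Re \<kappa> + 1) * ?b)"
    unfolding pvm_inner_self[OF E A z] kk by simp
  then have n: "(L2_norm (E A ?z))\<^sup>2 = ?a + (2 * Re \<kappa> + 1) * ?b" using of_real_eq_iff by blast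
  have iA: "integrable (scalar_measure E x) (indicator A :: real \<Rightarrow> real)"
    and iAB: "integrable (scalar_measure E x) (indicator (A \<inter> B) :: real \<Rightarrow> real)"
    by (auto intro!: integrable_real_indicator simp: m A AB M.emeasure_eq_measure)
  have i: "integrable (scalar_measure E x) (\<lambda>s. indicator A s + (1 + 2 * Re \<kappa>) * indicator (A \<inter> B) s :: real)"
    by (intro Bochner_Integration.integrable_add integrable_mult_right iA iAB)
  have "emeasure (density (scalar_measure E x) (\<lambda>s. ennreal (1 + (1 + 2 * Re \<kappa>) * indicator B s))) A
      = (\<integral>\<^sup>+s. ennreal (indicator A s + (1 + 2 * Re \<kappa>) * indicator (A \<inter> B) s) \<partial>scalar_measure E x)"
    by (subst emeasure_density) (auto intro!: nn_integral_cong simp: indicator_def)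
  also have "\<dots> = ennreal (LINT s|scalar_measure E x. indicator A s + (1 + 2 * Re \<kappa>) * indicator (A \<inter> B) s)"
    by (rule nn_integral_eq_integral[OF i]) (use r in \<open>auto simp: indicator_def\<close>)
  also have "(LINT s|scalar_measure E x. indicator A s + (1 + 2 * Re \<kappa>) * indicator (A \<inter> B) s)
      = measure (scalar_measure E x) A + (1 + 2 * Re \<kappa>) * measure (scalar_measure E x) (A \<inter> B)"
    by (subst Bochner_Integration.integral_add[OF iA integrable_mult_right]) (simp_all add: iAB space_scalar_measure[OF E x])
  also have "\<dots> = (L2_norm (E A ?z))\<^sup>2"
    using n A AB by (simp add: measure_scalar_measure[OF E x] algebra_simps)
  finally show "emeasure (scalar_measure E ?z) A = emeasure (density (scalar_measure E x) (\<lambda>s. ennreal (1 + (1 + 2 * Re \<kappa>) * indicator B s))) A"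
    using A by (simp add: emeasure_scalar_measure[OF E z])
qed

text \<open>For \<kappa> = \<i>^j the polarized measure integrates f to I + (1 + 2 Re \<kappa>) J.
  The sum of the \<i>^j over j < 4 is 0 and that of 2 \<i>^j Re(\<i>^j) is 4, so a quarter of the
  weighted sum is J.\<close>

lemma polarized_integral_projected:
  assumes E: "projection_valued_measure E" and B: "B \<in> sets borel" and x: "x \<in> L2"
    and f [measurable]: "f \<in> borel_measurable borel" and i: "integrable (scalar_measure E x) f"
  shows "polarized_integral E f x (E B x) = (LINT s|scalar_measure E x. indicator B s *\<^sub>R f s)"
proof -
  have m [measurable_cong]: "sets (scalar_measure E x) = sets borel" by (rule sets_scalar_measure[OF E x])
  note [measurable] = B
  let ?I = "LINT s|scalar_measure E x. f s" and ?J = "LINT s|scalar_measure E x. indicator B s *\<^sub>R f s"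
  have iB: "integrable (scalar_measure E x) (\<lambda>s. indicator B s *\<^sub>R f s)"
    by (rule integrable_mult_indicator[OF _ i]) (simp add: m B)
  have "(LINT s|scalar_measure E (\<lambda>t. x t + \<kappa> * E B x t). f s) = ?I + (1 + 2 * Re \<kappa>) *\<^sub>R ?J" if k: "cmod \<kappa> = 1" for \<kappa>
  proof -
    have r: "-1 \<le> Re \<kappa>" using abs_Re_le_cmod[of \<kappa>] k by linarith
    have "(LINT s|scalar_measure E (\<lambda>t. x t + \<kappa> * E B x t). f s)
        = (LINT s|scalar_measure E x. (1 + (1 + 2 * Re \<kappa>) * indicator B s) *\<^sub>R f s)"
      unfolding scalar_measure_polarized[OF E B x k]
      by (rule integral_density) (use r in \<open>auto simp: indicator_def\<close>)
    also have "\<dots> = (LINT s|scalar_measure E x. f s + (1 + 2 * Re \<kappa>) *\<^sub>R (indicator B s *\<^sub>R f s))"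
      by (simp add: scaleR_add_left)
    also have "\<dots> = ?I + (1 + 2 * Re \<kappa>) *\<^sub>R ?J"
    proof -
      have iB': "integrable (scalar_measure E x) (\<lambda>s. (1 + 2 * Re \<kappa>) *\<^sub>R (indicator B s *\<^sub>R f s))"
        by (rule integrable_scaleR_right) (rule iB)
      show ?thesis by (simp only: Bochner_Integration.integral_add[OF i iB'] Bochner_Integration.integral_scaleR_right)
    qed
    finally show ?thesis .
  qed
  note k = this
  have "(LINT s|scalar_measure E (\<lambda>t. x t + \<i> ^ j * E B x t). f s) = ?I + (1 + 2 * Re (\<i> ^ j)) *\<^sub>R ?J" for j
    by (rule k) (simp add: norm_power)
  then show ?thesis
    unfolding polarized_integral_def by (simp add: eval_nat_numeral scaleR_conv_of_real algebra_simps)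
qed

section \<open>Uniqueness of the spectral measure\<close>

text \<open>On the range of \<open>E B\<close> the operator minus c is bounded below. Testing w
  against \<open>E B x\<close> turns (w - c x | E B x) into the integral over B of s - c, which has
  the sign \<sigma> and size at least \<rho> when \<rho> is positive; Cauchy-Schwarz and a division
  finish.\<close>

lemma pvm_gap:
  assumes E: "projection_valued_measure E" and xw: "(x, w) \<in> spectral_integral E complex_of_real"
    and B: "B \<in> sets borel" and bd: "\<And>s. s \<in> B \<Longrightarrow> \<bar>s\<bar> \<le> n"
    and \<sigma>: "\<bar>\<sigma>\<bar> = 1" and gap: "\<And>s. s \<in> B \<Longrightarrow> \<rho> \<le> \<sigma> * (s - c)"
  shows "\<rho> * L2_norm (E B x) \<le> L2_norm (E B (\<lambda>t. w t - complex_of_real c * x t))"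
proof -
  have x: "x \<in> L2" and w: "w \<in> L2" and sq: "integrable (scalar_measure E x) (\<lambda>s. s\<^sup>2)"
    and weak: "\<And>v. v \<in> spectral_domain E complex_of_real \<Longrightarrow> L2_inner w v = polarized_integral E complex_of_real x v"
    using xw by (auto simp: spectral_integral_def spectral_domain_def)
  let ?M = "scalar_measure E x"
  have m [measurable_cong]: "sets ?M = sets borel" by (rule sets_scalar_measure[OF E x])
  interpret M: finite_measure ?M by (rule finite_scalar_measure[OF E x])
  note [measurable] = B
  have i1: "integrable ?M (\<lambda>s. s)"
  proof (rule Bochner_Integration.integrable_bound)
    show "integrable ?M (\<lambda>s. 1 + s\<^sup>2)" using sq by simp
    have "\<bar>s\<bar> \<le> 1 + s\<^sup>2" for s :: real
      using sum_squares_bound[of 1 "\<bar>s\<bar>"] abs_ge_zero[of s] by (simp add: power2_eq_square)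
    then show "AE s in ?M. norm s \<le> norm (1 + s\<^sup>2)" by (intro AE_I2) (simp add: abs_of_nonneg add_nonneg_nonneg)
  qed measurable
  note y = pvm_L2[OF E B x]
  have "E B x \<in> spectral_domain E complex_of_real"
  proof -
    have "integrable (density ?M (\<lambda>s. ennreal (indicator B s))) (\<lambda>s. s\<^sup>2)"
      using integrable_mult_indicator[OF _ sq, of B] by (subst integrable_density) (use m B in auto)
    then show ?thesis using y by (simp add: spectral_domain_def scalar_measure_projected[OF E B x])
  qed
  from weak[OF this] have wB: "L2_inner w (E B x) = (LINT s|?M. indicator B s *\<^sub>R complex_of_real s)"
    by (simp add: polarized_integral_projected[OF E B x] i1)
  also have "\<dots> = complex_of_real (LINT s|?M. indicator B s * s)"
    by (simp add: scaleR_conv_of_real flip: of_real_mult)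
  finally have wB: "L2_inner w (E B x) = complex_of_real (LINT s|?M. indicator B s * s)" .
  let ?z = "\<lambda>t. w t - complex_of_real c * x t"
  have z: "?z \<in> L2" by (intro L2_diff L2_scale w x)
  have iBs: "integrable ?M (\<lambda>s. indicator B s * s)"
    using integrable_mult_indicator[OF _ i1, of B] by (simp add: m B)
  have iB: "integrable ?M (indicator B :: real \<Rightarrow> real)"
    by (auto intro!: integrable_real_indicator simp: m B M.emeasure_eq_measure)
  have xB: "L2_inner x (E B x) = complex_of_real (LINT s|?M. indicator B s)"
    using pvm_sym[OF E B x x] pvm_inner_self[OF E B x]
    by (simp add: measure_scalar_measure[OF E x B] space_scalar_measure[OF E x])
  have "L2_inner ?z (E B x) = complex_of_real ((LINT s|?M. indicator B s * s) - c * (LINT s|?M. indicator B s))"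
    using L2_inner_diff_left[OF w L2_scale[OF x, of "complex_of_real c"] y] by (simp add: wB xB L2_inner_scale_left)
  also have "(LINT s|?M. indicator B s * s) - c * (LINT s|?M. indicator B s) = (LINT s|?M. indicator B s * (s - c))"
    using iBs iB by (simp add: right_diff_distrib mult.commute[of c])
  finally have zB: "L2_inner ?z (E B x) = complex_of_real (LINT s|?M. indicator B s * (s - c))" .
  have "\<rho> * (L2_norm (E B x))\<^sup>2 = (LINT s|?M. \<rho> * indicator B s)"
    by (simp add: measure_scalar_measure[OF E x B] space_scalar_measure[OF E x])
  also have "\<dots> \<le> (LINT s|?M. \<sigma> * (indicator B s * (s - c)))"
  proof (rule integral_mono)
    show "integrable ?M (\<lambda>s. \<rho> * indicator B s)" using iB by simp
    have "integrable ?M (\<lambda>s. \<sigma> * (indicator B s * s - c * indicator B s))" using iB iBs by simp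
    then show "integrable ?M (\<lambda>s. \<sigma> * (indicator B s * (s - c)))" by (simp add: algebra_simps)
    show "\<rho> * indicator B s \<le> \<sigma> * (indicator B s * (s - c))" for s
      using gap[of s] by (simp add: indicator_def)
  qed
  also have "\<dots> = \<sigma> * (LINT s|?M. indicator B s * (s - c))" by simp
  also have "\<dots> \<le> \<bar>\<sigma> * (LINT s|?M. indicator B s * (s - c))\<bar>" by simp
  also have "\<dots> = cmod (L2_inner ?z (E B x))" unfolding zB norm_of_real abs_mult \<sigma> by simp
  also have "L2_inner ?z (E B x) = L2_inner (E B ?z) (E B x)"
    using pvm_Int[OF E B B z x] pvm_sym[OF E B z x] by simp
  also have "cmod (L2_inner (E B ?z) (E B x)) \<le> L2_norm (E B ?z) * L2_norm (E B x)"
    by (rule L2_inner_bound[OF pvm_L2[OF E B z] y])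
  finally have "\<rho> * L2_norm (E B x) * L2_norm (E B x) \<le> L2_norm (E B ?z) * L2_norm (E B x)"
    by (simp add: power2_eq_square mult.assoc)
  then show ?thesis
    using L2_norm_nonneg[of "E B x"] L2_norm_nonneg[of "E B ?z"]
    by (cases "L2_norm (E B x) = 0") auto
qed

section \<open>The functional calculus of the model projections\<close>

lemma scalar_measure_EF:
  fixes u :: "'a::euclidean_space \<Rightarrow> complex"
  assumes u: "u \<in> L2"
  shows "scalar_measure EF u = distr (density lborel (\<lambda>z. ennreal ((cmod (fourier u z))\<^sup>2))) borel (\<lambda>z. - (norm z)\<^sup>2)"
proof (rule measure_eqI)
  have [measurable]: "fourier u \<in> borel_measurable borel" by (rule L2_measurable[OF fourier_L2[OF u]])
  show "sets (scalar_measure EF u) = sets (distr (density lborel (\<lambda>z. ennreal ((cmod (fourier u z))\<^sup>2))) borel (\<lambda>z. - (norm z)\<^sup>2))"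
    by (simp add: sets_scalar_measure[OF pvm_EF u])
  fix A assume "A \<in> sets (scalar_measure EF u)"
  then have A: "A \<in> sets borel" by (simp add: sets_scalar_measure[OF pvm_EF u])
  note [measurable] = A
  have pA [measurable]: "(\<lambda>z::'a. - (norm z)\<^sup>2) -` A \<in> sets borel"
    using measurable_sets[OF nsq_measurable A] by simp
  have "complex_of_real ((L2_norm (EF A u))\<^sup>2) = (LINT z|lborel. indicator A (- (norm z)\<^sup>2) * (fourier u z * cnj (fourier u z)))"
    using EF_inner[OF u A u] pvm_inner_self[OF pvm_EF A u] by simp
  also have "\<dots> = (LINT z|lborel. complex_of_real (indicator ((\<lambda>z. - (norm z)\<^sup>2) -` A) z * (cmod (fourier u z))\<^sup>2))"
  proof (rule Bochner_Integration.integral_cong[OF refl])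
    fix z
    show "indicator A (- (norm z)\<^sup>2) * (fourier u z * cnj (fourier u z))
        = complex_of_real (indicator ((\<lambda>z. - (norm z)\<^sup>2) -` A) z * (cmod (fourier u z))\<^sup>2)"
      using complex_norm_square[of "fourier u z"] by (simp add: indicator_def)
  qed
  also have "\<dots> = complex_of_real (LINT z|lborel. indicator ((\<lambda>z. - (norm z)\<^sup>2) -` A) z * (cmod (fourier u z))\<^sup>2)"
    by (rule integral_complex_of_real)
  finally have n: "(L2_norm (EF A u))\<^sup>2 = (LINT z|lborel. indicator ((\<lambda>z. - (norm z)\<^sup>2) -` A) z * (cmod (fourier u z))\<^sup>2)"
    using of_real_eq_iff by blast
  have i: "integrable lborel (\<lambda>z. indicator ((\<lambda>z. - (norm z)\<^sup>2) -` A) z * (cmod (fourier u z))\<^sup>2)"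
    using integrable_mult_indicator[OF _ L2_integrable[OF fourier_L2[OF u]], of "(\<lambda>z. - (norm z)\<^sup>2) -` A"] pA by simp
  have "emeasure (distr (density lborel (\<lambda>z. ennreal ((cmod (fourier u z))\<^sup>2))) borel (\<lambda>z. - (norm z)\<^sup>2)) A
      = emeasure (density lborel (\<lambda>z. ennreal ((cmod (fourier u z))\<^sup>2))) ((\<lambda>z. - (norm z)\<^sup>2) -` A)"
    by (subst emeasure_distr) auto
  also have "\<dots> = (\<integral>\<^sup>+z. ennreal ((cmod (fourier u z))\<^sup>2) * indicator ((\<lambda>z. - (norm z)\<^sup>2) -` A) z \<partial>lborel)"
    by (rule emeasure_density) auto
  also have "\<dots> = (\<integral>\<^sup>+z. ennreal (indicator ((\<lambda>z. - (norm z)\<^sup>2) -` A) z * (cmod (fourier u z))\<^sup>2) \<partial>lborel)"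
    by (rule nn_integral_cong) (auto simp: indicator_def)
  also have "\<dots> = ennreal ((L2_norm (EF A u))\<^sup>2)"
    unfolding n by (rule nn_integral_eq_integral[OF i]) simp
  finally show "emeasure (scalar_measure EF u) A
      = emeasure (distr (density lborel (\<lambda>z. ennreal ((cmod (fourier u z))\<^sup>2))) borel (\<lambda>z. - (norm z)\<^sup>2)) A"
    by (simp add: emeasure_scalar_measure[OF pvm_EF u A])
qed

lemma
  fixes f :: "real \<Rightarrow> 'b::{banach, second_countable_topology}"
  assumes u: "(u :: 'a::euclidean_space \<Rightarrow> complex) \<in> L2" and f [measurable]: "f \<in> borel_measurable borel"
  shows integrable_scalar_measure_EF:
      "integrable (scalar_measure EF u) f \<longleftrightarrow> integrable lborel (\<lambda>z. (cmod (fourier u z))\<^sup>2 *\<^sub>R f (- (norm z)\<^sup>2))"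
    and integral_scalar_measure_EF:
      "(LINT s|scalar_measure EF u. f s) = (LINT z|lborel. (cmod (fourier u z))\<^sup>2 *\<^sub>R f (- (norm z)\<^sup>2))"
proof -
  have [measurable]: "fourier u \<in> borel_measurable borel" by (rule L2_measurable[OF fourier_L2[OF u]])
  show "integrable (scalar_measure EF u) f \<longleftrightarrow> integrable lborel (\<lambda>z. (cmod (fourier u z))\<^sup>2 *\<^sub>R f (- (norm z)\<^sup>2))"
    unfolding scalar_measure_EF[OF u] by (subst integrable_distr_eq) (auto simp: integrable_density)
  show "(LINT s|scalar_measure EF u. f s) = (LINT z|lborel. (cmod (fourier u z))\<^sup>2 *\<^sub>R f (- (norm z)\<^sup>2))"
    unfolding scalar_measure_EF[OF u] by (subst integral_distr) (auto simp: integral_density)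
qed

lemma spectral_domain_EF:
  assumes [measurable]: "f \<in> borel_measurable borel"
  shows "u \<in> spectral_domain EF f \<longleftrightarrow> u \<in> L2 \<and> (\<lambda>z. f (- (norm z)\<^sup>2) * fourier u z) \<in> L2"
proof (cases "u \<in> L2")
  case True
  have [measurable]: "fourier u \<in> borel_measurable borel" by (rule L2_measurable[OF fourier_L2[OF True]])
  show ?thesis using True
    by (simp add: spectral_domain_def integrable_scalar_measure_EF[OF True] L2_def norm_mult power_mult_distrib mult.commute)
qed (simp add: spectral_domain_def)

text \<open>Expanding |fourier (u + \<kappa> v)|^2 gives four terms. After weighting by \<kappa> =
  \<i>^k and summing, those with total factor \<kappa>, \<kappa>^2 or \<kappa>|\<kappa>|^2 cancel,
  and the one with |\<kappa>|^2 = 1 remains.\<close>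

lemma polarized_integral_EF:
  fixes u v :: "'a::euclidean_space \<Rightarrow> complex"
  assumes f [measurable]: "f \<in> borel_measurable borel"
    and ud: "u \<in> spectral_domain EF f" and vd: "v \<in> spectral_domain EF f"
  shows "polarized_integral EF f u v = (LINT z|lborel. f (- (norm z)\<^sup>2) * (fourier u z * cnj (fourier v z)))"
proof -
  have u: "u \<in> L2" and fu: "(\<lambda>z. f (- (norm z)\<^sup>2) * fourier u z) \<in> L2"
    and v: "v \<in> L2" and fv: "(\<lambda>z. f (- (norm z)\<^sup>2) * fourier v z) \<in> L2"
    using ud vd by (auto simp: spectral_domain_EF)
  note U = fourier_L2[OF u] and V = fourier_L2[OF v]
  let ?f = "\<lambda>z::'a. f (- (norm z)\<^sup>2)"
  let ?U = "fourier u" and ?V = "fourier v"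
  have uu: "integrable lborel (\<lambda>z. ?f z * (?U z * cnj (?U z)))"
    and uv: "integrable lborel (\<lambda>z. ?f z * (?U z * cnj (?V z)))"
    and vu: "integrable lborel (\<lambda>z. ?f z * (?V z * cnj (?U z)))"
    and vv: "integrable lborel (\<lambda>z. ?f z * (?V z * cnj (?V z)))"
    using L2_inner_integrable[OF fu U] L2_inner_integrable[OF fu V] L2_inner_integrable[OF fv U] L2_inner_integrable[OF fv V]
    by (simp_all add: mult.assoc)
  have k: "(LINT s|scalar_measure EF (\<lambda>x. u x + \<kappa> * v x). f s)
      = (LINT z|lborel. ?f z * (?U z * cnj (?U z))) + cnj \<kappa> * (LINT z|lborel. ?f z * (?U z * cnj (?V z)))
        + \<kappa> * (LINT z|lborel. ?f z * (?V z * cnj (?U z))) + \<kappa> * cnj \<kappa> * (LINT z|lborel. ?f z * (?V z * cnj (?V z)))" for \<kappa>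
  proof -
    let ?w = "\<lambda>x. u x + \<kappa> * v x"
    have w: "?w \<in> L2" by (intro L2_add L2_scale u v)
    have [measurable]: "fourier ?w \<in> borel_measurable borel" "?U \<in> borel_measurable borel" "?V \<in> borel_measurable borel"
      using L2_measurable[OF fourier_L2[OF w]] L2_measurable[OF U] L2_measurable[OF V] by auto
    have "(LINT s|scalar_measure EF ?w. f s) = (LINT z|lborel. (cmod (fourier ?w z))\<^sup>2 *\<^sub>R ?f z)"
      by (rule integral_scalar_measure_EF[OF w f])
    also have "\<dots> = (LINT z|lborel. ?f z * (?U z * cnj (?U z)) + cnj \<kappa> * (?f z * (?U z * cnj (?V z)))
        + \<kappa> * (?f z * (?V z * cnj (?U z))) + \<kappa> * cnj \<kappa> * (?f z * (?V z * cnj (?V z))))"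
    proof (rule integral_cong_AE)
      show "AE z in lborel. (cmod (fourier ?w z))\<^sup>2 *\<^sub>R ?f z = ?f z * (?U z * cnj (?U z)) + cnj \<kappa> * (?f z * (?U z * cnj (?V z)))
        + \<kappa> * (?f z * (?V z * cnj (?U z))) + \<kappa> * cnj \<kappa> * (?f z * (?V z * cnj (?V z)))"
        using fourier_add[OF u L2_scale[OF v, of \<kappa>]] fourier_scale[OF v, of \<kappa>]
      proof eventually_elim
        case (elim z)
        have "(cmod (fourier ?w z))\<^sup>2 *\<^sub>R ?f z = fourier ?w z * cnj (fourier ?w z) * ?f z"
          unfolding scaleR_conv_of_real complex_norm_square ..
        then show ?case using elim by (simp add: algebra_simps)
      qed
    qed measurable
    also have "\<dots> = (LINT z|lborel. ?f z * (?U z * cnj (?U z))) + cnj \<kappa> * (LINT z|lborel. ?f z * (?U z * cnj (?V z)))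
        + \<kappa> * (LINT z|lborel. ?f z * (?V z * cnj (?U z))) + \<kappa> * cnj \<kappa> * (LINT z|lborel. ?f z * (?V z * cnj (?V z)))"
    proof -
      have i1: "integrable lborel (\<lambda>z. cnj \<kappa> * (?f z * (?U z * cnj (?V z))))" by (rule integrable_mult_right) (rule uv)
      have i2: "integrable lborel (\<lambda>z. \<kappa> * (?f z * (?V z * cnj (?U z))))" by (rule integrable_mult_right) (rule vu)
      have i3: "integrable lborel (\<lambda>z. \<kappa> * cnj \<kappa> * (?f z * (?V z * cnj (?V z))))" by (rule integrable_mult_right) (rule vv)
      note j = Bochner_Integration.integrable_add[OF uu i1]
      note jj = Bochner_Integration.integrable_add[OF j i2]
      show ?thesis
        by (simp only: Bochner_Integration.integral_add[OF jj i3] Bochner_Integration.integral_add[OF j i2]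
            Bochner_Integration.integral_add[OF uu i1] integral_mult_right_zero)
    qed
    finally show ?thesis .
  qed
  show ?thesis unfolding polarized_integral_def k
    by (simp add: eval_nat_numeral algebra_simps)
qed

text \<open>A power iteration. Applying the operator minus c k times costs at most r^k in norm,
  because the Fourier support of x lies where the multiplier is at most r. By \<open>pvm_gap\<close>
  it multiplies the component in B by at least \<rho>^k. Since r < \<rho>, this component is
  0.\<close>

lemma pvm_no_mass:
  assumes E: "projection_valued_measure E" and T: "spectral_integral E complex_of_real = spectral_integral EF complex_of_real"
    and x: "x \<in> L2" and r: "0 \<le> r" and supp: "AE z in lborel. fourier x z \<noteq> 0 \<longrightarrow> \<bar>- (norm z)\<^sup>2 - c\<bar> \<le> r"
    and B: "B \<in> sets borel" and bd: "\<And>s. s \<in> B \<Longrightarrow> \<bar>s\<bar> \<le> n"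
    and \<sigma>: "\<bar>\<sigma>\<bar> = 1" and gap: "\<And>s. s \<in> B \<Longrightarrow> \<rho> \<le> \<sigma> * (s - c)" and \<rho>: "r < \<rho>"
  shows "L2_norm (E B x) = 0"
proof -
  note X = fourier_L2[OF x]
  have [measurable]: "fourier x \<in> borel_measurable borel" by (rule L2_measurable[OF X])
  let ?m = "\<lambda>z::'a. - (norm z)\<^sup>2 - c"
  \<comment> \<open>The Fourier transform of the k-th iterate of x under the Laplacian minus c; on
    the support of \<open>fourier x\<close> the multiplier is bounded, so all iterates stay in
    \<open>L2\<close>.\<close>
  define h where "h = (\<lambda>k z. complex_of_real (?m z ^ k) * fourier x z)"
  have hb: "AE z in lborel. cmod (h k z) \<le> r ^ k * cmod (fourier x z)" for k
    using supp
  proof eventually_elim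
    case (elim z)
    show ?case
    proof (cases "fourier x z = 0")
      case False
      then have "\<bar>?m z\<bar> ^ k \<le> r ^ k" using elim by (intro power_mono) auto
      then show ?thesis unfolding h_def norm_mult norm_of_real power_abs by (rule mult_right_mono) simp
    qed (simp add: h_def)
  qed
  have hm [measurable]: "h k \<in> borel_measurable borel" for k unfolding h_def by measurable
  have hL: "h k \<in> L2" for k by (rule L2_bounded_by[OF X hm hb])
  define xx where "xx = (\<lambda>k. fourinv (h k))"
  have xL: "xx k \<in> L2" for k unfolding xx_def by (rule fourinv_L2[OF hL])
  have fx: "AE z in lborel. fourier (xx k) z = h k z" for k unfolding xx_def by (rule fourier_fourinv[OF hL])
  have hSuc: "h (Suc k) z + complex_of_real c * h k z = complex_of_real (- (norm z)\<^sup>2) * h k z" for k z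
    by (simp add: h_def algebra_simps)
  \<comment> \<open>By definition of the iterates, the operator sends iterate k to iterate k + 1
    plus c times iterate k.\<close>
  have inT: "(xx k, \<lambda>t. xx (Suc k) t + complex_of_real c * xx k t) \<in> spectral_integral EF complex_of_real" for k
    unfolding spectral_integral_def
  proof (clarify, intro conjI ballI)
    have l1: "(\<lambda>z. complex_of_real (- (norm z)\<^sup>2) * h k z) \<in> L2"
      unfolding hSuc[symmetric] by (intro L2_add L2_scale hL)
    have l2: "AE z in lborel. cmod (complex_of_real (- (norm z)\<^sup>2) * fourier (xx k) z)
        \<le> 1 * cmod (complex_of_real (- (norm z)\<^sup>2) * h k z)"
      using fx[of k] by eventually_elim simp
    have l3: "(\<lambda>z. complex_of_real (- (norm z)\<^sup>2) * fourier (xx k) z) \<in> borel_measurable borel"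
      using L2_measurable[OF fourier_L2[OF xL]] by measurable
    have "(\<lambda>z. complex_of_real (- (norm z)\<^sup>2) * fourier (xx k) z) \<in> L2"
      by (rule L2_bounded_by[OF l1 l3 l2])
    then show dom: "xx k \<in> spectral_domain EF complex_of_real" by (simp add: spectral_domain_EF xL)
    show "(\<lambda>t. xx (Suc k) t + complex_of_real c * xx k t) \<in> L2" by (intro L2_add L2_scale xL)
    fix v :: "'a \<Rightarrow> complex" assume vd: "v \<in> spectral_domain EF complex_of_real"
    then have v: "v \<in> L2" by (simp add: spectral_domain_def)
    have [measurable]: "fourier v \<in> borel_measurable borel" "fourier (xx k) \<in> borel_measurable borel"
      using L2_measurable[OF fourier_L2[OF v]] L2_measurable[OF fourier_L2[OF xL]] by auto
    have "L2_inner (\<lambda>t. xx (Suc k) t + complex_of_real c * xx k t) v = L2_inner (\<lambda>z. h (Suc k) z + complex_of_real c * h k z) (fourier v)"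
      by (simp add: L2_inner_add_left L2_scale L2_inner_scale_left xL v hL fourier_L2)
         (simp add: xx_def fourinv_adjoint hL v)
    also have "\<dots> = (LINT z|lborel. complex_of_real (- (norm z)\<^sup>2) * (fourier (xx k) z * cnj (fourier v z)))"
      unfolding L2_inner_def hSuc using fx[of k]
      by (intro integral_cong_AE) (measurable, auto elim!: eventually_mono)
    also have "\<dots> = polarized_integral EF complex_of_real (xx k) v"
      by (rule polarized_integral_EF[OF _ dom vd, symmetric]) simp
    finally show "L2_inner (\<lambda>t. xx (Suc k) t + complex_of_real c * xx k t) v = polarized_integral EF complex_of_real (xx k) v" .
  qed
  have step: "\<rho> * L2_norm (E B (xx k)) \<le> L2_norm (E B (xx (Suc k)))" for k
    using pvm_gap[OF E inT[folded T] B bd \<sigma> gap, of k] by simp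
  have iter: "\<rho> ^ k * L2_norm (E B (xx 0)) \<le> L2_norm (E B (xx k))" for k
  proof (induction k)
    case (Suc k)
    have "\<rho> * (\<rho> ^ k * L2_norm (E B (xx 0))) \<le> \<rho> * L2_norm (E B (xx k))"
      using Suc r \<rho> by (intro mult_left_mono) auto
    then show ?case using step[of k] by simp
  qed simp
  have up: "L2_norm (E B (xx k)) \<le> r ^ k * L2_norm x" for k
  proof -
    have "L2_norm (E B (xx k)) \<le> L2_norm (h k)"
      using pvm_contraction[OF E B xL] by (simp add: xx_def fourinv_norm hL)
    also have "\<dots> \<le> r ^ k * L2_norm (fourier x)"
    proof -
      have "(L2_norm (h k))\<^sup>2 \<le> (LINT z|lborel. (r ^ k)\<^sup>2 * (cmod (fourier x z))\<^sup>2)"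
        unfolding L2_norm_sq
      proof (rule integral_mono_AE)
        show "AE z in lborel. (cmod (h k z))\<^sup>2 \<le> (r ^ k)\<^sup>2 * (cmod (fourier x z))\<^sup>2"
          using hb[of k] by eventually_elim (simp add: power_mono flip: power_mult_distrib)
      qed (use L2_integrable[OF hL] L2_integrable[OF X] in auto)
      then have "(L2_norm (h k))\<^sup>2 \<le> (r ^ k * L2_norm (fourier x))\<^sup>2"
        by (simp add: L2_norm_sq power_mult_distrib)
      then show ?thesis by (rule power2_le_imp_le) (simp add: r L2_norm_nonneg)
    qed
    finally show ?thesis by (simp add: fourier_norm x)
  qed
  have \<rho>0: "\<rho> > 0" using r \<rho> by linarith
  have "L2_norm (E B (xx 0)) \<le> (r / \<rho>) ^ k * L2_norm x" for k
  proof -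
    have "\<rho> ^ k * L2_norm (E B (xx 0)) \<le> r ^ k * L2_norm x" using iter[of k] up[of k] by linarith
    then show ?thesis using \<rho>0 by (simp add: power_divide field_simps)
  qed
  moreover have "(\<lambda>k. (r / \<rho>) ^ k * L2_norm x) \<longlonglongrightarrow> 0"
    by (intro tendsto_mult_left_zero LIMSEQ_power_zero) (use r \<rho> \<rho>0 in auto)
  ultimately have "L2_norm (E B (xx 0)) \<le> 0" by (intro LIMSEQ_le_const) auto
  then have z: "L2_norm (E B (xx 0)) = 0" using L2_norm_nonneg[of "E B (xx 0)"] by linarith
  have ae: "AE t in lborel. xx 0 t = x t"
  proof (rule fourier_eqD[OF xL x])
    show "AE z in lborel. fourier (xx 0) z = fourier x z" using fx[of 0] by eventually_elim (simp add: h_def)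
  qed
  have "AE t in lborel. E B (xx 0) t = E B x t"
  proof (rule L2_eqI[OF pvm_L2[OF E B xL] pvm_L2[OF E B x]])
    fix w :: "'a \<Rightarrow> complex" assume w: "w \<in> L2"
    show "L2_inner (E B (xx 0)) w = L2_inner (E B x) w"
      unfolding pvm_sym[OF E B xL w] pvm_sym[OF E B x w]
      by (rule L2_inner_cong_AE) (use ae xL x pvm_L2[OF E B w] in auto)
  qed
  from L2_norm_cong_AE[OF pvm_L2[OF E B xL] pvm_L2[OF E B x] this] show ?thesis using z by simp
qed

text \<open>With c the midpoint and r half the length of the interval, \<open>pvm_no_mass\<close>
  applies to every bounded set at a positive distance from it, on either side; countably many of
  these cover the complement.\<close>

lemma pvm_interval:
  assumes E: "projection_valued_measure E" and T: "spectral_integral E complex_of_real = spectral_integral EF complex_of_real"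
    and x: "x \<in> L2" and pq: "p \<le> q" and supp: "AE z in lborel. fourier x z \<noteq> 0 \<longrightarrow> - (norm z)\<^sup>2 \<in> {p..q}"
    and A: "A \<in> sets borel" "A \<inter> {p..q} = {}"
  shows "L2_norm (E A x) = 0"
proof -
  let ?M = "scalar_measure E x"
  define c r where "c = (p + q) / 2" and "r = (q - p) / 2"
  have cr: "c - r = p" "c + r = q" "0 \<le> r" using pq by (auto simp: c_def r_def field_simps)
  have supp': "AE z in lborel. fourier x z \<noteq> 0 \<longrightarrow> \<bar>- (norm z)\<^sup>2 - c\<bar> \<le> r"
    using supp by eventually_elim (use cr in \<open>auto simp: abs_le_iff\<close>)
  \<comment> \<open>The distance 1/(n+1) from the interval provides the strict inequality r < \<rho>
    with \<rho> = r + 1/(n+1).\<close>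
  let ?U = "\<lambda>n::nat. {q + 1 / real (Suc n)..real n}" and ?L = "\<lambda>n::nat. {- real n..p - 1 / real (Suc n)}"
  have U0: "L2_norm (E (?U n) x) = 0" for n
    by (rule pvm_no_mass[OF E T x cr(3) supp', where \<sigma> = 1 and \<rho> = "r + 1 / real (Suc n)" and n = "\<bar>q + 1 / real (Suc n)\<bar> + real n"])
       (use cr in \<open>auto simp: abs_le_iff\<close>)
  have L0: "L2_norm (E (?L n) x) = 0" for n
    by (rule pvm_no_mass[OF E T x cr(3) supp', where \<sigma> = "-1" and \<rho> = "r + 1 / real (Suc n)" and n = "\<bar>p - 1 / real (Suc n)\<bar> + real n"])
       (use cr in \<open>auto simp: abs_le_iff\<close>)
  have null: "?U n \<in> null_sets ?M" "?L n \<in> null_sets ?M" for n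
    by (auto simp: null_sets_def sets_scalar_measure[OF E x] emeasure_scalar_measure[OF E x] U0 L0 simp del: of_nat_Suc)
  have "(\<Union>n. ?U n) \<union> (\<Union>n. ?L n) \<in> null_sets ?M" by (intro null_sets.Un null_sets_UN null)
  moreover have "A \<subseteq> (\<Union>n. ?U n) \<union> (\<Union>n. ?L n)"
  proof
    fix s assume "s \<in> A"
    then consider "s > q" | "s < p" using A(2) by fastforce
    then show "s \<in> (\<Union>n. ?U n) \<union> (\<Union>n. ?L n)"
    proof cases
      case 1
      then obtain n1 where n1: "1 / real (Suc n1) < s - q" using nat_approx_posE[of "s - q"] by auto
      obtain n2 where n2: "s \<le> real n2" using real_arch_simple by blast
      have "1 / real (Suc (max n1 n2)) \<le> 1 / real (Suc n1)" by (intro divide_left_mono) auto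
      then have "s \<in> ?U (max n1 n2)" using n1 n2 by auto
      then show ?thesis by blast
    next
      case 2
      then obtain n1 where n1: "1 / real (Suc n1) < p - s" using nat_approx_posE[of "p - s"] by auto
      obtain n2 where n2: "- s \<le> real n2" using real_arch_simple by blast
      have "1 / real (Suc (max n1 n2)) \<le> 1 / real (Suc n1)" by (intro divide_left_mono) auto
      then have "s \<in> ?L (max n1 n2)" using n1 n2 by auto
      then show ?thesis by blast
    qed
  qed
  ultimately have "A \<in> null_sets ?M"
    using null_sets_subset[of _ ?M A] A(1) sets_scalar_measure[OF E x] by blast
  then show ?thesis by (simp add: null_sets_def emeasure_scalar_measure[OF E x A(1)])
qed

text \<open>Exhausts S by compact intervals: each \<open>EF {p n..q n} x\<close> has no component in
  \<open>E (- S)\<close> by \<open>pvm_interval\<close>, these vectors converge to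
  \<open>EF S x\<close>, and \<open>E (- S)\<close> is a contraction.\<close>

lemma pvm_support:
  assumes E: "projection_valued_measure E" and T: "spectral_integral E complex_of_real = spectral_integral EF complex_of_real"
    and x: "x \<in> L2" and S: "S \<in> sets borel" and pq: "\<And>n::nat. p n \<le> q n" "\<And>n. {p n..q n} \<subseteq> S"
    and ex: "\<And>s. s \<in> S \<Longrightarrow> eventually (\<lambda>n. s \<in> {p n..q n}) sequentially"
  shows "L2_norm (E (- S) (EF S x)) = 0"
proof -
  note X = fourier_L2[OF x]
  have cS: "- S \<in> sets borel" using S borel_comp by blast
  have [measurable]: "fourier x \<in> borel_measurable borel" by (rule L2_measurable[OF X])
  have I: "{p n..q n} \<in> sets borel" for n by simp
  let ?x = "\<lambda>n. EF {p n..q n} x"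
  have xL: "?x n \<in> L2" for n by (rule EF_L2[OF x I])
  note yL = EF_L2[OF x S]
  have "L2_norm (E (- S) (?x n)) = 0" for n
  proof (rule pvm_interval[OF E T xL pq(1) _ cS])
    show "AE z in lborel. fourier (?x n) z \<noteq> 0 \<longrightarrow> - (norm z)\<^sup>2 \<in> {p n..q n}"
      using fourier_EF[OF x I, of n] by eventually_elim (auto simp: indicator_def split: if_splits)
    show "- S \<inter> {p n..q n} = {}" using pq(2)[of n] by blast
  qed
  moreover have "(\<lambda>n. L2_norm (\<lambda>t. ?x n t - EF S x t)) \<longlonglongrightarrow> 0"
  proof -
    have e: "L2_norm (\<lambda>t. ?x n t - EF S x t) = sqrt (LINT z|lborel. (indicator S (- (norm z)\<^sup>2) - indicator {p n..q n} (- (norm z)\<^sup>2)) * (cmod (fourier x z))\<^sup>2)" for n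
    proof -
      have "L2_norm (\<lambda>t. ?x n t - EF S x t) = L2_norm (fourier (\<lambda>t. ?x n t - EF S x t))"
        by (rule fourier_norm[symmetric]) (intro L2_diff xL yL)
      moreover have "(LINT z|lborel. (cmod (fourier (\<lambda>t. ?x n t - EF S x t) z))\<^sup>2)
        = (LINT z|lborel. (indicator S (- (norm z)\<^sup>2) - indicator {p n..q n} (- (norm z)\<^sup>2)) * (cmod (fourier x z))\<^sup>2)"
      proof (rule integral_cong_AE)
        show "AE z in lborel. (cmod (fourier (\<lambda>t. ?x n t - EF S x t) z))\<^sup>2
            = (indicator S (- (norm z)\<^sup>2) - indicator {p n..q n} (- (norm z)\<^sup>2)) * (cmod (fourier x z))\<^sup>2"
          using fourier_diff[OF xL[of n] yL] fourier_EF[OF x I[of n]] fourier_EF[OF x S]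
        proof eventually_elim
          case (elim z)
          then show ?case using pq(2)[of n] by (auto simp: indicator_def)
        qed
        have [measurable]: "fourier (\<lambda>t. ?x n t - EF S x t) \<in> borel_measurable borel"
          by (intro L2_measurable fourier_L2 L2_diff xL yL)
        show "(\<lambda>z. (cmod (fourier (\<lambda>t. ?x n t - EF S x t) z))\<^sup>2) \<in> borel_measurable lborel" by measurable
        show "(\<lambda>z. (indicator S (- (norm z)\<^sup>2) - indicator {p n..q n} (- (norm z)\<^sup>2)) * (cmod (fourier x z))\<^sup>2) \<in> borel_measurable lborel"
          using measurable_compose[OF nsq_measurable borel_measurable_indicator[OF S]]
            measurable_compose[OF nsq_measurable borel_measurable_indicator[OF I[of n]]] by measurable
      qed
      ultimately show ?thesis unfolding L2_norm_def by simp
    qed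
    have "(\<lambda>n. LINT z|lborel. (indicator S (- (norm z)\<^sup>2) - indicator {p n..q n} (- (norm z)\<^sup>2)) * (cmod (fourier x z))\<^sup>2)
        \<longlonglongrightarrow> (LINT z|(lborel :: 'a measure). (0::real))"
    proof (rule integral_dominated_convergence[where w = "\<lambda>z. (cmod (fourier x z))\<^sup>2"])
      show "AE z in lborel. (\<lambda>n. (indicator S (- (norm z)\<^sup>2) - indicator {p n..q n} (- (norm z)\<^sup>2)) * (cmod (fourier x z))\<^sup>2) \<longlonglongrightarrow> 0"
      proof (rule AE_I2, rule tendsto_eventually)
        fix z :: 'a
        show "\<forall>\<^sub>F n in sequentially. (indicator S (- (norm z)\<^sup>2) - indicator {p n..q n} (- (norm z)\<^sup>2)) * (cmod (fourier x z))\<^sup>2 = 0"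
        proof (cases "- (norm z)\<^sup>2 \<in> S")
          case True
          show ?thesis using ex[OF True] by eventually_elim (use True in simp)
        next
          case False
          then have "- (norm z)\<^sup>2 \<notin> {p n..q n}" for n using pq(2) by blast
          then show ?thesis using False by simp
        qed
      qed
      show "AE z in lborel. norm ((indicator S (- (norm z)\<^sup>2) - indicator {p n..q n} (- (norm z)\<^sup>2)) * (cmod (fourier x z))\<^sup>2) \<le> (cmod (fourier x z))\<^sup>2" for n
        by (auto simp: indicator_def)
      show "(\<lambda>z. (indicator S (- (norm z)\<^sup>2) - indicator {p n..q n} (- (norm z)\<^sup>2)) * (cmod (fourier x z))\<^sup>2) \<in> borel_measurable lborel" for n
        using measurable_compose[OF nsq_measurable borel_measurable_indicator[OF S]]
          measurable_compose[OF nsq_measurable borel_measurable_indicator[OF I[of n]]] by measurable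
    qed (use L2_integrable[OF X] in auto)
    then show ?thesis unfolding e using tendsto_real_sqrt[of _ 0] by fastforce
  qed
  moreover have "\<bar>L2_norm (E (- S) (?x n)) - L2_norm (E (- S) (EF S x))\<bar> \<le> L2_norm (\<lambda>t. ?x n t - EF S x t)" for n
  proof -
    have "\<bar>L2_norm (E (- S) (?x n)) - L2_norm (E (- S) (EF S x))\<bar> \<le> L2_norm (\<lambda>t. E (- S) (?x n) t - E (- S) (EF S x) t)"
      by (intro L2_norm_triangle_diff pvm_L2[OF E cS] xL yL)
    also have "\<dots> = L2_norm (E (- S) (\<lambda>t. ?x n t - EF S x t))"
    proof (rule L2_norm_cong_AE)
      show "AE t in lborel. E (- S) (?x n) t - E (- S) (EF S x) t = E (- S) (\<lambda>t. ?x n t - EF S x t) t"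
      proof (rule L2_eqI)
        fix w :: "'a \<Rightarrow> complex" assume w: "w \<in> L2"
        show "L2_inner (\<lambda>t. E (- S) (?x n) t - E (- S) (EF S x) t) w = L2_inner (E (- S) (\<lambda>t. ?x n t - EF S x t)) w"
          by (simp add: L2_inner_diff_left pvm_L2[OF E cS] xL yL w pvm_sym[OF E cS] L2_diff)
      qed (intro L2_diff pvm_L2[OF E cS] xL yL)+
    qed (intro L2_diff pvm_L2[OF E cS] xL yL)+
    also have "\<dots> \<le> L2_norm (\<lambda>t. ?x n t - EF S x t)" by (intro pvm_contraction[OF E cS] L2_diff xL yL)
    finally show ?thesis .
  qed
  ultimately have "\<bar>L2_norm (E (- S) (EF S x))\<bar> \<le> 0"
    by (intro LIMSEQ_le_const[of "\<lambda>n. L2_norm (\<lambda>t. ?x n t - EF S x t)"]) (auto simp: abs_minus_commute)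
  then show ?thesis by simp
qed

text \<open>Finite measures on the line are determined by half-lines. Split u by the model
  projections of {..a} and its complement. By \<open>pvm_support\<close> the projection
  \<open>E {..a}\<close> fixes the first piece and kills the second, so it agrees with
  \<open>EF {..a}\<close> in the pairing with u.\<close>

theorem scalar_measure_unique:
  assumes E: "projection_valued_measure E" and T: "spectral_integral E complex_of_real = spectral_integral EF complex_of_real"
    and u: "u \<in> L2"
  shows "scalar_measure E u = scalar_measure EF u"
proof -
  have "L2_inner (E {..a} u) u = L2_inner (EF {..a} u) u" for a
  proof -
    have A: "{..a} \<in> sets borel" and C: "{a<..} \<in> sets borel" by simp_all
    have cA: "- {..a} = {a<..}" and cC: "- {a<..} = {..a}" by auto
    let ?Q = "EF {..a} u" and ?R = "EF {a<..} u"
    have QL: "?Q \<in> L2" and RL: "?R \<in> L2" by (intro EF_L2[OF u] A C)+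
    have 1: "L2_norm (E {a<..} ?Q) = 0"
      unfolding cA[symmetric]
    proof (rule pvm_support[OF E T u A, where p = "\<lambda>n. a - real n" and q = "\<lambda>n. a"])
      fix s assume "s \<in> {..a}"
      moreover obtain N where "a - s \<le> real N" using real_arch_simple by blast
      ultimately show "\<forall>\<^sub>F n in sequentially. s \<in> {a - real n..a}"
        unfolding eventually_sequentially by (intro exI[of _ N]) auto
    qed auto
    have 2: "L2_norm (E {..a} ?R) = 0"
      unfolding cC[symmetric]
    proof (rule pvm_support[OF E T u C, where p = "\<lambda>n. a + 1 / real (Suc n)" and q = "\<lambda>n. a + 1 / real (Suc n) + real n"])
      fix s assume s: "s \<in> {a<..}"
      then obtain n1 where n1: "1 / real (Suc n1) < s - a" using nat_approx_posE[of "s - a"] by auto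
      obtain n2 where n2: "s - a \<le> real n2" using real_arch_simple by blast
      have "s \<in> {a + 1 / real (Suc n)..a + 1 / real (Suc n) + real n}" if "n \<ge> max n1 n2" for n
      proof -
        have "1 / real (Suc n) \<le> 1 / real (Suc n1)" using that by (intro divide_left_mono) auto
        moreover have "0 \<le> 1 / real (Suc n)" by simp
        moreover have "real n2 \<le> real n" using that by simp
        ultimately have "a + 1 / real (Suc n) \<le> s" "s \<le> a + 1 / real (Suc n) + real n" using n1 n2 by linarith+
        then show ?thesis by simp
      qed
      then show "\<forall>\<^sub>F n in sequentially. s \<in> {a + 1 / real (Suc n)..a + 1 / real (Suc n) + real n}"
        unfolding eventually_sequentially by blast
    next
      show "{a + 1 / real (Suc n)..a + 1 / real (Suc n) + real n} \<subseteq> {a<..}" for n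
      proof
        fix s assume "s \<in> {a + 1 / real (Suc n)..a + 1 / real (Suc n) + real n}"
        then have "a + 1 / real (Suc n) \<le> s" by simp
        moreover have "0 < 1 / real (Suc n)" by simp
        ultimately have "a < s" by linarith
        then show "s \<in> {a<..}" by simp
      qed
    qed auto
    have zero: "L2_inner (E B z) w = 0" if "L2_norm (E B z) = 0" "B \<in> sets borel" "z \<in> L2" "w \<in> L2" for B z w
      using L2_inner_bound[OF pvm_L2[OF E that(2,3)] that(4)] that(1) by simp
    have dec: "L2_inner u w = L2_inner ?Q w + L2_inner ?R w" if "w \<in> L2" for w
      using pvm_compl[OF pvm_EF A u that] by (simp add: cA)
    note Eu = pvm_L2[OF E A u]
    have "L2_inner (E {..a} u) u = L2_inner u (E {..a} u)" by (rule pvm_sym[OF E A u u])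
    also have "\<dots> = L2_inner ?Q (E {..a} u) + L2_inner ?R (E {..a} u)" by (rule dec[OF Eu])
    also have "\<dots> = L2_inner (E {..a} ?Q) u + L2_inner (E {..a} ?R) u"
      by (simp add: pvm_sym[OF E A] QL RL u)
    also have "L2_inner (E {..a} ?R) u = 0" by (rule zero[OF 2 A RL u])
    also have "L2_inner (E {..a} ?Q) u = L2_inner ?Q u"
      using pvm_compl[OF E A QL u] zero[OF 1 C QL u] by (simp add: cA)
    finally show ?thesis by simp
  qed
  then have "complex_of_real ((L2_norm (E {..a} u))\<^sup>2) = complex_of_real ((L2_norm (EF {..a} u))\<^sup>2)" for a
    using pvm_inner_self[OF E _ u] pvm_inner_self[OF pvm_EF _ u] by simp
  then have c: "(L2_norm (E {..a} u))\<^sup>2 = (L2_norm (EF {..a} u))\<^sup>2" for a using of_real_eq_iff by blast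
  have fb: "finite_borel_measure (scalar_measure F u)" if "projection_valued_measure F" for F
    unfolding finite_borel_measure_def finite_borel_measure_axioms_def
    using finite_scalar_measure[OF that u] sets_scalar_measure[OF that u] by simp
  show ?thesis
    by (rule cdf_unique'[OF fb[OF E] fb[OF pvm_EF]])
       (simp add: cdf_def fun_eq_iff measure_scalar_measure[OF E u] measure_scalar_measure[OF pvm_EF u] c)
qed

section \<open>The Laplacian as a Fourier multiplier\<close>

lemma L2_reflect:
  assumes "u \<in> L2"
  shows "(\<lambda>x. u (- x)) \<in> L2"
proof -
  have [measurable]: "u \<in> borel_measurable borel" by (rule L2_measurable[OF assms])
  show ?thesis
    using lborel_integrable_scale[OF L2_integrable[OF assms], of "-1" 0] by (simp add: L2_def)
qed

lemma ft_cnj: "ft (\<lambda>x. cnj (u x)) p = cnj (ft u (- p))"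
  unfolding ft_def Bochner_Integration.integral_cnj[symmetric] by (simp add: cis_cnj)

lemma F0_cnj: "F0 (\<lambda>x. cnj (u x)) p = cnj (F0 u (- p))"
  unfolding F0_def by (simp add: ft_cnj)

lemma integral_mult_fourier:
  assumes u: "u \<in> L2" and v: "v \<in> Cc"
  shows "(LINT x|lborel. u x * v x) = (LINT z|lborel. fourier u z * F0 v (- z))"
proof -
  have "(LINT x|lborel. u x * v x) = L2_inner u (\<lambda>x. cnj (v x))" by (simp add: L2_inner_def)
  also have "\<dots> = L2_inner (fourier u) (fourier (\<lambda>x. cnj (v x)))"
    by (rule fourier_inner[OF u Cc_L2[OF Cc_cnj[OF v]], symmetric])
  also have "\<dots> = L2_inner (fourier u) (F0 (\<lambda>x. cnj (v x)))"
    using fourier_F0[OF Cc_cnj[OF v]]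
    by (intro L2_inner_cong_AE fourier_L2 u Cc_L2 Cc_cnj v F0_L2) auto
  finally show ?thesis unfolding L2_inner_def F0_cnj by simp
qed

lemma Cc_sum:
  assumes "\<And>i. i \<in> I \<Longrightarrow> f i \<in> Cc"
  shows "(\<lambda>x. \<Sum>i\<in>I. f i x) \<in> (Cc :: ('a::euclidean_space \<Rightarrow> complex) set)"
  using assms
proof (induction I rule: infinite_finite_induct)
  case (insert i I)
  have "(\<lambda>x. f i x - (0 - (\<Sum>i\<in>I. f i x))) \<in> Cc"
    using insert by (intro Cc_diff) (auto simp: Cc_def)
  then show ?case using insert by simp
qed (auto simp: Cc_def)

lemma
  fixes \<psi> :: "'a::euclidean_space \<Rightarrow> complex"
  assumes \<psi>: "\<psi> \<in> test_fun"
  shows laplacian_Cc: "classical_laplacian \<psi> \<in> Cc"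
    and ft_laplacian: "ft (classical_laplacian \<psi>) z = - complex_of_real ((norm z)\<^sup>2) * ft \<psi> z"
proof -
  have t: "partial_deriv b (partial_deriv b \<psi>) \<in> test_fun" if "b \<in> Basis" for b
    by (intro test_fun_partial \<psi> that)
  have e: "classical_laplacian \<psi> = (\<lambda>x. \<Sum>b\<in>Basis. partial_deriv b (partial_deriv b \<psi>) x)"
    by (rule ext) (simp add: classical_laplacian_def)
  show "classical_laplacian \<psi> \<in> Cc" unfolding e by (intro Cc_sum test_fun_Cc t)
  have "ft (classical_laplacian \<psi>) z = (\<Sum>b\<in>Basis. ft (partial_deriv b (partial_deriv b \<psi>)) z)"
    unfolding e ft_def sum_distrib_right
    by (rule Bochner_Integration.integral_sum)
       (intro integrable_mult_cis Cc_integrable test_fun_Cc t, assumption, measurable)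
  also have "\<dots> = (\<Sum>b\<in>Basis. - complex_of_real ((z \<bullet> b)\<^sup>2) * ft \<psi> z)"
  proof (rule sum.cong[OF refl])
    fix b :: 'a assume b: "b \<in> Basis"
    have "ft (partial_deriv b (partial_deriv b \<psi>)) z = (\<i> * complex_of_real (z \<bullet> b)) * (\<i> * complex_of_real (z \<bullet> b) * ft \<psi> z)"
      by (simp only: ft_partial \<psi> test_fun_partial b)
    also have "\<dots> = (\<i> * \<i>) * (complex_of_real (z \<bullet> b) * complex_of_real (z \<bullet> b) * ft \<psi> z)"
      by (simp only: mult_ac)
    finally show "ft (partial_deriv b (partial_deriv b \<psi>)) z = - complex_of_real ((z \<bullet> b)\<^sup>2) * ft \<psi> z"
      by (simp add: power2_eq_square)
  qed
  also have "\<dots> = - complex_of_real (\<Sum>b\<in>Basis. (z \<bullet> b)\<^sup>2) * ft \<psi> z"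
    by (simp add: sum_distrib_right sum_negf)
  also have "(\<Sum>b\<in>Basis. (z \<bullet> b)\<^sup>2) = (norm z)\<^sup>2"
    by (subst power2_norm_eq_inner, subst euclidean_inner) (simp add: power2_eq_square)
  finally show "ft (classical_laplacian \<psi>) z = - complex_of_real ((norm z)\<^sup>2) * ft \<psi> z" .
qed

lemma F0_laplacian:
  assumes "\<psi> \<in> test_fun"
  shows "F0 (classical_laplacian \<psi>) z = - complex_of_real ((norm z)\<^sup>2) * F0 \<psi> z"
  unfolding F0_def ft_laplacian[OF assms] by simp

text \<open>2N times the dimension is the support radius of \<open>bump_support\<close>, so |x . z|
  \<le> 1 on the support. There the cosine is at least 1/2 and the real part of the integral is
  positive.\<close>

lemma ft_bump_nonzero:
  fixes z :: "'a::euclidean_space" and N :: real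
  assumes N: "N > 0" and z: "2 * N * DIM('a) * norm z \<le> 1"
  shows "ft (\<lambda>x. complex_of_real (bump 1 N x)) z \<noteq> 0"
proof -
  have bt: "(\<lambda>x::'a. complex_of_real (bump 1 N x)) \<in> test_fun" by (rule bump_test_fun) (use N in auto)
  then have bi: "integrable lborel (\<lambda>x::'a. complex_of_real (bump 1 N x))" by (intro Cc_integrable test_fun_Cc)
  have bir: "integrable lborel (bump 1 N :: 'a \<Rightarrow> real)"
    using integrable_Re[OF bi] by simp
  have ge: "bump 1 N x / 2 \<le> bump 1 N x * cos (x \<bullet> z)" for x :: 'a
  proof (cases "2 * N * DIM('a) < norm x")
    case True
    then show ?thesis using bump_support[OF N True, of 1] by simp
  next
    case False
    have "\<bar>x \<bullet> z\<bar> \<le> norm x * norm z" by (rule Cauchy_Schwarz_ineq2)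
    also have "\<dots> \<le> 2 * N * DIM('a) * norm z" using False by (intro mult_right_mono) auto
    finally have s: "\<bar>x \<bullet> z\<bar> \<le> 1" using z by simp
    have "1/2 \<le> cos (x \<bullet> z)"
    proof -
      \<comment> \<open>1 \<le> pi/3, hence cos 1 \<ge> 1/2.\<close>
      have "cos 1 \<le> cos \<bar>x \<bullet> z\<bar>" using s pi_gt3 by (intro cos_monotone_0_pi_le) auto
      moreover have "cos (pi/3) \<le> cos (1::real)" using pi_gt3 by (intro cos_monotone_0_pi_le) auto
      ultimately show ?thesis by (simp add: cos_60)
    qed
    then show ?thesis using mult_left_mono[of "1/2" "cos (x \<bullet> z)" "bump 1 N x"] bump_nonneg[of 1 N x] by simp
  qed
  let ?c = "exp (- 1 / 3 :: real) ^ DIM('a)"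
  have ci: "integrable lborel (\<lambda>x::'a. complex_of_real (bump 1 N x) * cis (- (x \<bullet> z)))"
    by (intro integrable_mult_cis bi) measurable
  have "Re (ft (\<lambda>x. complex_of_real (bump 1 N x)) z) = (LINT x|lborel. Re (complex_of_real (bump 1 N x) * cis (- (x \<bullet> z))))"
    unfolding ft_def by (rule integral_Re[OF ci, symmetric])
  also have "\<dots> = (LINT x|lborel. bump 1 N x * cos (x \<bullet> z))" by simp
  finally have re: "Re (ft (\<lambda>x. complex_of_real (bump 1 N x)) z) = (LINT x|lborel. bump 1 N x * cos (x \<bullet> z))" .
  have ge1: "(LINT x|lborel. bump 1 N (x::'a) / 2) \<le> (LINT x|lborel. bump 1 N x * cos (x \<bullet> z))"
    using integrable_Re[OF ci] bir ge by (intro integral_mono) auto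
  have ge2: "(LINT x|lborel. (?c / 2) * indicator (cball 0 N) (x::'a)) \<le> (LINT x|lborel. bump 1 N (x::'a) / 2)"
  proof (rule integral_mono)
    show "integrable lborel (\<lambda>x::'a. (?c / 2) * indicator (cball 0 N) x)"
      using emeasure_lborel_cball_finite[of "0::'a" N] by (intro integrable_mult_right) auto
    show "integrable lborel (\<lambda>x::'a. bump 1 N x / 2)" using bir by simp
    show "(?c / 2) * indicator (cball 0 N) x \<le> bump 1 N x / 2" for x :: 'a
      using bump_lower[OF N, of 1 x] bump_nonneg[of 1 N x] by (auto simp: indicator_def)
  qed
  have "(LINT x|lborel. (?c / 2) * indicator (cball 0 N) (x::'a)) = ?c / 2 * measure lborel (cball (0::'a) N)" by simp
  also have "\<dots> > 0"
  proof -
    have "measure lborel (cball (0::'a) N) > 0"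
      using content_cball_pos[OF N, of "0::'a"] by simp
    then show ?thesis by simp
  qed
  finally have "0 < Re (ft (\<lambda>x. complex_of_real (bump 1 N x)) z)" using re ge1 ge2 by linarith
  then show ?thesis by auto
qed

text \<open>Testing the weak equation with all translates of one bump says that a single function G,
  the multiplier defect times the transform of the bump, has vanishing Fourier integrals. Hence G =
  0 almost everywhere, and where the transform of the bump is nonzero the defect vanishes. Narrower
  bumps reach larger frequencies.\<close>

lemma laplacian_fourier:
  fixes u w :: "'a::euclidean_space \<Rightarrow> complex"
  assumes uw: "(u, w) \<in> laplacian"
  shows "AE z in lborel. fourier w z = - complex_of_real ((norm z)\<^sup>2) * fourier u z"
proof -
  have u: "u \<in> L2" and w: "w \<in> L2"
    and weak: "\<And>\<psi>. \<psi> \<in> test_fun \<Longrightarrow> (LINT x|lborel. u x * classical_laplacian \<psi> x) = (LINT x|lborel. w x * \<psi> x)"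
    using uw by (auto simp: laplacian_def)
  note U = fourier_L2[OF u] and W = fourier_L2[OF w]
  have "AE z in lborel. norm z \<le> real n \<longrightarrow> fourier w z + complex_of_real ((norm z)\<^sup>2) * fourier u z = 0" for n
  proof -
    \<comment> \<open>Chosen so that 2N times the dimension times n + 1 is 1, which places the ball
      |z| \<le> n in the range of \<open>ft_bump_nonzero\<close>.\<close>
    define N where "N = 1 / (2 * (real n + 1) * DIM('a))"
    have N: "N > 0" by (simp add: N_def)
    have Nz: "2 * N * DIM('a) * norm z \<le> 1" if "norm z \<le> real n" for z :: 'a
    proof -
      have "2 * N * DIM('a) * (real n + 1) = 1" by (simp add: N_def)
      moreover have "2 * N * DIM('a) * norm z \<le> 2 * N * DIM('a) * (real n + 1)"
        using that N by (intro mult_left_mono) auto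
      ultimately show ?thesis by simp
    qed
    define \<beta> where "\<beta> = (\<lambda>x::'a. complex_of_real (bump 1 N x))"
    have \<beta>t: "\<beta> \<in> test_fun" unfolding \<beta>_def by (rule bump_test_fun) (use N in auto)
    have \<beta>C: "\<beta> \<in> Cc" and l\<beta>C: "classical_laplacian \<beta> \<in> Cc"
      by (rule test_fun_Cc[OF \<beta>t], rule laplacian_Cc[OF \<beta>t])
    let ?b = "\<lambda>z. F0 \<beta> (- z)" and ?lb = "\<lambda>z. F0 (classical_laplacian \<beta>) (- z)"
    have bL: "?b \<in> L2" "?lb \<in> L2" by (intro L2_reflect F0_L2 \<beta>C l\<beta>C)+
    have bB: "\<exists>K. \<forall>z. cmod (F0 v z) \<le> K" for v :: "'a \<Rightarrow> complex"
    proof -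
      have "cmod (F0 v z) \<le> (LINT x|lborel. cmod (v x)) / sqrt ((2 * pi) ^ DIM('a))" for z
        unfolding F0_def norm_divide norm_of_real using ft_bound[of v z]
        by (intro divide_mono) auto
      then show ?thesis by blast
    qed
    let ?G = "\<lambda>z. fourier w z * ?b z - fourier u z * ?lb z"
    have GL: "?G \<in> L2"
    proof (rule L2_diff)
      obtain K where "\<And>z. cmod (F0 \<beta> z) \<le> K" using bB by blast
      then have "(\<lambda>z. ?b z * fourier w z) \<in> L2"
        by (intro L2_bdd_mult[OF W, where C = K]) (auto intro: L2_measurable[OF bL(1)])
      then show "(\<lambda>z. fourier w z * ?b z) \<in> L2" by (simp add: mult.commute)
      obtain K where "\<And>z. cmod (F0 (classical_laplacian \<beta>) z) \<le> K" using bB by blast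
      then have "(\<lambda>z. ?lb z * fourier u z) \<in> L2"
        by (intro L2_bdd_mult[OF U, where C = K]) (auto intro: L2_measurable[OF bL(2)])
      then show "(\<lambda>z. fourier u z * ?lb z) \<in> L2" by (simp add: mult.commute)
    qed
    have i1: "integrable lborel (\<lambda>z. fourier w z * ?b z)" and i2: "integrable lborel (\<lambda>z. fourier u z * ?lb z)"
      by (intro L2_mult_integrable W U bL)+
    have GI: "integrable lborel ?G" using i1 i2 by simp
    have zero: "(LINT z|lborel. ?G z * cis (y \<bullet> z)) = 0" for y
    proof -
      let ?\<psi> = "\<lambda>x. complex_of_real (bump 1 N (x - y))"
      have \<psi>t: "?\<psi> \<in> test_fun" by (rule bump_shift_test_fun) (use N in auto)
      \<comment> \<open>Translating the bump by y multiplies its transform by a character; varying y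
        thus runs through all Fourier integrals of \<open>?G\<close>.\<close>
      have sh: "F0 ?\<psi> (- z) = cis (y \<bullet> z) * F0 \<beta> (- z)" for z
      proof -
        have "(\<lambda>x. ?\<psi> x * cis (- (x \<bullet> - z))) \<in> borel_measurable borel" by measurable
        from lborel_integral_translate[OF this, of y]
        have "ft ?\<psi> (- z) = (LINT x|lborel. \<beta> x * cis ((y + x) \<bullet> z))"
          by (simp add: ft_def \<beta>_def)
        also have "\<dots> = (LINT x|lborel. cis (y \<bullet> z) * (\<beta> x * cis (- (x \<bullet> - z))))"
          by (simp add: inner_add_left cis_mult[symmetric] mult.left_commute)
        also have "\<dots> = cis (y \<bullet> z) * ft \<beta> (- z)" by (simp only: integral_mult_right_zero ft_def)
        finally show ?thesis by (simp add: F0_def)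
      qed
      have sh2: "F0 (classical_laplacian ?\<psi>) (- z) = cis (y \<bullet> z) * F0 (classical_laplacian \<beta>) (- z)" for z
        unfolding F0_laplacian[OF \<psi>t] F0_laplacian[OF \<beta>t] sh by simp
      have "(LINT z|lborel. fourier u z * F0 (classical_laplacian ?\<psi>) (- z)) = (LINT z|lborel. fourier w z * F0 ?\<psi> (- z))"
        using weak[OF \<psi>t] integral_mult_fourier[OF u laplacian_Cc[OF \<psi>t]] integral_mult_fourier[OF w test_fun_Cc[OF \<psi>t]]
        by simp
      then have "(LINT z|lborel. fourier u z * ?lb z * cis (y \<bullet> z)) = (LINT z|lborel. fourier w z * ?b z * cis (y \<bullet> z))"
        unfolding sh sh2 by (simp add: mult.assoc mult.commute[of "cis _"])
      moreover have "(LINT z|lborel. ?G z * cis (y \<bullet> z))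
          = (LINT z|lborel. fourier w z * ?b z * cis (y \<bullet> z)) - (LINT z|lborel. fourier u z * ?lb z * cis (y \<bullet> z))"
        unfolding left_diff_distrib
        by (rule Bochner_Integration.integral_diff) (intro integrable_mult_cis i1 i2, measurable)+
      ultimately show ?thesis by simp
    qed
    have "AE z in lborel. ?G z = 0" by (rule fourier_integral_injective[OF GL GI zero])
    then show ?thesis
    proof eventually_elim
      case (elim z)
      show ?case
      proof
        assume "norm z \<le> real n"
        then have "ft \<beta> (- z) \<noteq> 0" unfolding \<beta>_def by (intro ft_bump_nonzero N) (use Nz in simp)
        then have nz: "F0 \<beta> (- z) \<noteq> 0" by (simp add: F0_def)
        have "(fourier w z + complex_of_real ((norm z)\<^sup>2) * fourier u z) * F0 \<beta> (- z) = 0"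
          using elim F0_laplacian[OF \<beta>t, of "- z"] by (simp add: algebra_simps)
        with nz show "fourier w z + complex_of_real ((norm z)\<^sup>2) * fourier u z = 0" by simp
      qed
    qed
  qed
  then have "AE z in lborel. \<forall>n. norm z \<le> real n \<longrightarrow> fourier w z + complex_of_real ((norm z)\<^sup>2) * fourier u z = 0"
    unfolding AE_all_countable by blast
  then show ?thesis
  proof eventually_elim
    case (elim z)
    obtain n where "norm z \<le> real n" using real_arch_simple by blast
    with elim have "fourier w z + complex_of_real ((norm z)\<^sup>2) * fourier u z = 0" by blast
    then show ?case by (simp add: eq_neg_iff_add_eq_0)
  qed
qed

text \<open>Supplies the witness for the choice in \<open>spectral_measure\<close>. Both graphs
  describe multiplication by -|z|^2 on the Fourier side with its maximal domain.\<close>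

theorem laplacian_spectral_integral:
  "(laplacian :: 'a::euclidean_space L2_operator) = spectral_integral EF complex_of_real"
proof (rule set_eqI, clarify, rule iffI)
  fix u w :: "'a \<Rightarrow> complex" assume uw: "(u, w) \<in> laplacian"
  then have u: "u \<in> L2" and w: "w \<in> L2" by (auto simp: laplacian_def)
  note ae = laplacian_fourier[OF uw]
  have [measurable]: "fourier u \<in> borel_measurable borel" "fourier w \<in> borel_measurable borel"
    using L2_measurable[OF fourier_L2[OF u]] L2_measurable[OF fourier_L2[OF w]] by auto
  have "(\<lambda>z. complex_of_real (- (norm z)\<^sup>2) * fourier u z) \<in> L2"
  proof (rule L2_bounded_by[OF fourier_L2[OF w]])
    show "AE z in lborel. cmod (complex_of_real (- (norm z)\<^sup>2) * fourier u z) \<le> 1 * cmod (fourier w z)"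
      using ae by eventually_elim simp
  qed measurable
  then have ud: "u \<in> spectral_domain EF complex_of_real" by (simp add: spectral_domain_EF u)
  have "L2_inner w v = polarized_integral EF complex_of_real u v" if vd: "v \<in> spectral_domain EF complex_of_real" for v
  proof -
    have v: "v \<in> L2" using vd by (simp add: spectral_domain_def)
    have [measurable]: "fourier v \<in> borel_measurable borel" by (rule L2_measurable[OF fourier_L2[OF v]])
    have "L2_inner w v = L2_inner (fourier w) (fourier v)" by (rule fourier_inner[OF w v, symmetric])
    also have "\<dots> = (LINT z|lborel. complex_of_real (- (norm z)\<^sup>2) * (fourier u z * cnj (fourier v z)))"
      unfolding L2_inner_def using ae by (intro integral_cong_AE) (measurable, auto elim!: eventually_mono)
    also have "\<dots> = polarized_integral EF complex_of_real u v"
      by (rule polarized_integral_EF[OF _ ud vd, symmetric]) simp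
    finally show ?thesis .
  qed
  then show "(u, w) \<in> spectral_integral EF complex_of_real" using ud w by (simp add: spectral_integral_def)
next
  fix u w :: "'a \<Rightarrow> complex" assume uw: "(u, w) \<in> spectral_integral EF complex_of_real"
  then have ud: "u \<in> spectral_domain EF complex_of_real" and w: "w \<in> L2"
    and weak: "\<And>v. v \<in> spectral_domain EF complex_of_real \<Longrightarrow> L2_inner w v = polarized_integral EF complex_of_real u v"
    by (auto simp: spectral_integral_def)
  then have u: "u \<in> L2" by (simp add: spectral_domain_def)
  have [measurable]: "fourier u \<in> borel_measurable borel" by (rule L2_measurable[OF fourier_L2[OF u]])
  have "(LINT x|lborel. u x * classical_laplacian \<psi> x) = (LINT x|lborel. w x * \<psi> x)" if \<psi>: "\<psi> \<in> test_fun" for \<psi>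
  proof -
    \<comment> \<open>The weak formulation of the Laplacian is bilinear and \<open>L2_inner\<close>
      is sesquilinear, hence the conjugate.\<close>
    let ?v = "\<lambda>x. cnj (\<psi> x)"
    have \<psi>C: "\<psi> \<in> Cc" by (rule test_fun_Cc[OF \<psi>])
    have vC: "?v \<in> Cc" by (rule Cc_cnj[OF \<psi>C])
    note v = Cc_L2[OF vC]
    have F [measurable]: "F0 \<psi> \<in> borel_measurable borel" by (rule L2_measurable[OF F0_L2[OF \<psi>C]])
    have [measurable]: "fourier ?v \<in> borel_measurable borel" by (rule L2_measurable[OF fourier_L2[OF v]])
    have fv: "AE z in lborel. fourier ?v z = cnj (F0 \<psi> (- z))"
      using fourier_F0[OF vC] by (simp add: F0_cnj)
    have "(\<lambda>z. complex_of_real (- (norm z)\<^sup>2) * fourier ?v z) \<in> L2"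
    proof (rule L2_bounded_by[OF L2_reflect[OF F0_L2[OF laplacian_Cc[OF \<psi>]]]])
      show "AE z in lborel. cmod (complex_of_real (- (norm z)\<^sup>2) * fourier ?v z) \<le> 1 * cmod (F0 (classical_laplacian \<psi>) (- z))"
        using fv by eventually_elim (simp add: F0_laplacian[OF \<psi>] norm_mult)
    qed measurable
    then have vd: "?v \<in> spectral_domain EF complex_of_real" by (simp add: spectral_domain_EF v)
    have "(LINT x|lborel. w x * \<psi> x) = L2_inner w ?v" by (simp add: L2_inner_def)
    also have "\<dots> = (LINT z|lborel. complex_of_real (- (norm z)\<^sup>2) * (fourier u z * cnj (fourier ?v z)))"
      unfolding weak[OF vd] by (rule polarized_integral_EF[OF _ ud vd]) simp
    also have "\<dots> = (LINT z|lborel. fourier u z * F0 (classical_laplacian \<psi>) (- z))"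
    proof (rule integral_cong_AE)
      show "AE z in lborel. complex_of_real (- (norm z)\<^sup>2) * (fourier u z * cnj (fourier ?v z)) = fourier u z * F0 (classical_laplacian \<psi>) (- z)"
        using fv by eventually_elim (simp add: F0_laplacian[OF \<psi>] mult_ac)
      have [measurable]: "F0 (classical_laplacian \<psi>) \<in> borel_measurable borel"
        by (rule L2_measurable[OF F0_L2[OF laplacian_Cc[OF \<psi>]]])
      show "(\<lambda>z. fourier u z * F0 (classical_laplacian \<psi>) (- z)) \<in> borel_measurable lborel" by measurable
    qed measurable
    also have "\<dots> = (LINT x|lborel. u x * classical_laplacian \<psi> x)"
      by (rule integral_mult_fourier[OF u laplacian_Cc[OF \<psi>], symmetric])
    finally show ?thesis ..
  qed
  then show "(u, w) \<in> laplacian" using u w by (simp add: laplacian_def)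
qed

text \<open>The projections chosen by \<open>spectral_measure\<close> are unknown, but
  \<open>spectral_integral\<close> sees them only through their scalar measures, which are those of
  \<open>EF\<close>. For bounded f the domain is all of \<open>L2\<close>, so the chosen image is
  determined almost everywhere.\<close>

lemma op_fun_laplacian:
  fixes u :: "'a::euclidean_space \<Rightarrow> complex"
  assumes u: "u \<in> L2" and f [measurable]: "f \<in> borel_measurable borel" and C: "\<And>s. cmod (f s) \<le> C"
  shows "op_fun f laplacian u \<in> L2"
    and "AE z in lborel. fourier (op_fun f laplacian u) z = f (- (norm z)\<^sup>2) * fourier u z"
proof -
  let ?E = "spectral_measure (laplacian :: 'a L2_operator)"
  have "\<exists>E. projection_valued_measure E \<and> (laplacian :: 'a L2_operator) = spectral_integral E complex_of_real"
    using pvm_EF laplacian_spectral_integral by blast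
  from someI_ex[OF this] have E: "projection_valued_measure ?E" and T: "spectral_integral ?E complex_of_real = spectral_integral EF complex_of_real"
    unfolding spectral_measure_def[symmetric] laplacian_spectral_integral by auto
  note sm = scalar_measure_unique[OF E T]
  have dom: "spectral_domain ?E f = spectral_domain EF f"
    unfolding spectral_domain_def using sm by (auto cong: conj_cong)
  have pol: "polarized_integral ?E f x y = polarized_integral EF f x y" if "x \<in> L2" "y \<in> L2" for x y
    unfolding polarized_integral_def using sm[OF L2_add[OF that(1) L2_scale[OF that(2)]]] by simp
  have all: "v \<in> spectral_domain EF f" if "v \<in> L2" for v
    unfolding spectral_domain_EF[OF f]
    using that by (auto intro!: L2_bdd_mult[OF fourier_L2[OF that], where C = C] C)
  have si: "(u, w) \<in> spectral_integral ?E f \<longleftrightarrow> w \<in> L2 \<and> (\<forall>v\<in>L2. L2_inner w v = L2_inner (fmult (\<lambda>z. f (- (norm z)\<^sup>2)) u) v)" for w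
  proof -
    have fm: "(\<lambda>z::'a. f (- (norm z)\<^sup>2)) \<in> borel_measurable borel" by measurable
    have "polarized_integral ?E f u v = L2_inner (fmult (\<lambda>z. f (- (norm z)\<^sup>2)) u) v" if v: "v \<in> L2" for v
      unfolding pol[OF u v] polarized_integral_EF[OF f all[OF u] all[OF v]]
      by (rule fmult_inner[OF u fm C v, symmetric])
    moreover have "spectral_domain EF f = L2" using all by (auto simp: spectral_domain_def)
    ultimately show ?thesis using u unfolding spectral_integral_def dom by auto
  qed
  have fm: "(\<lambda>z::'a. f (- (norm z)\<^sup>2)) \<in> borel_measurable borel" by measurable
  note mL = fmult_L2[OF u fm C]
  have "\<exists>w. (u, w) \<in> spectral_integral ?E f" unfolding si using mL by blast
  from someI_ex[OF this] have "(u, op_fun f laplacian u) \<in> spectral_integral ?E f"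
    unfolding op_fun_def .
  then have w: "op_fun f laplacian u \<in> L2"
    and i: "\<And>v. v \<in> L2 \<Longrightarrow> L2_inner (op_fun f laplacian u) v = L2_inner (fmult (\<lambda>z. f (- (norm z)\<^sup>2)) u) v"
    unfolding si by auto
  show "op_fun f laplacian u \<in> L2" by (rule w)
  have "AE x in lborel. op_fun f laplacian u x = fmult (\<lambda>z. f (- (norm z)\<^sup>2)) u x" by (rule L2_eqI[OF w mL i])
  from fourier_cong_AE[OF w mL this] fourier_fmult[OF u fm C]
  show "AE z in lborel. fourier (op_fun f laplacian u) z = f (- (norm z)\<^sup>2) * fourier u z"
    by eventually_elim simp
qed

section \<open>The Schroedinger propagator\<close>

lemma
  fixes u :: "'a::euclidean_space \<Rightarrow> complex"
  assumes u: "u \<in> L2"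
  shows schroedinger_L2: "schroedinger \<tau> u \<in> L2"
    and fourier_schroedinger: "AE z in lborel. fourier (schroedinger \<tau> u) z = cis (- (\<tau> * (norm z)\<^sup>2)) * fourier u z"
proof -
  have e: "exp (\<i> * complex_of_real (\<tau> * s)) = cis (\<tau> * s)" for s by (simp add: cis_conv_exp)
  have m: "(\<lambda>s. cis (\<tau> * s)) \<in> borel_measurable borel" by measurable
  show "schroedinger \<tau> u \<in> L2" unfolding schroedinger_def e by (rule op_fun_laplacian(1)[OF u m, where C = 1]) simp
  show "AE z in lborel. fourier (schroedinger \<tau> u) z = cis (- (\<tau> * (norm z)\<^sup>2)) * fourier u z"
    using op_fun_laplacian(2)[OF u m, where C = 1] unfolding schroedinger_def e by simp
qed

section \<open>Weyl operators as superpositions of phase space translations\<close>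

lemma test_fun_pair_support:
  assumes "a \<in> test_fun"
  obtains R where "R > 0" "\<And>m \<xi>. R < norm m \<or> R < norm \<xi> \<Longrightarrow> a (m, \<xi>) = 0"
proof -
  obtain R where R: "\<And>z. R < norm z \<Longrightarrow> a z = 0"
    using assms by (auto simp: test_fun_def compactly_supported_iff)
  have "a (m, \<xi>) = 0" if "max R 1 < norm m \<or> max R 1 < norm \<xi>" for m \<xi>
    using that norm_fst_le[of m \<xi>] norm_snd_le[of \<xi> m] by (intro R) auto
  then show ?thesis using that[of "max R 1"] by auto
qed

lemma ft_inversion_test_fun:
  fixes f :: "'a::euclidean_space \<Rightarrow> complex"
  assumes "f \<in> test_fun"
  shows "f x = (LINT p|lborel. ft f p * cis (x \<bullet> p)) / complex_of_real ((2 * pi) ^ DIM('a))"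
  using ft_inversion[OF test_fun_Cc[OF assms] ft_test_fun_integrable[OF assms]] by simp

lemma abs_japanese [simp]: "\<bar>japanese z\<bar> = japanese z"
  using japanese_pos[of z] by simp

lemma japanese_L2: "(\<lambda>x::'a::euclidean_space. complex_of_real (japanese x)) \<in> L2"
proof -
  have "integrable lborel (\<lambda>x::'a. (japanese x)\<^sup>2)"
  proof (rule Bochner_Integration.integrable_bound[OF japanese_integrable])
    have "norm ((japanese x)\<^sup>2) \<le> norm (japanese x)" for x :: 'a
      using japanese_le_1[of x] japanese_pos[of x] by (simp add: power2_eq_square mult_left_le)
    then show "AE x in lborel. norm ((japanese (x::'a))\<^sup>2) \<le> norm (japanese x)" by blast
  qed measurable
  then show ?thesis by (simp add: L2_def)
qed

lemma L2_scale_arg: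
  fixes u :: "'a::euclidean_space \<Rightarrow> complex"
  assumes "u \<in> L2" "h \<noteq> 0"
  shows "(\<lambda>q. u (x + h *\<^sub>R q)) \<in> L2"
proof -
  have [measurable]: "u \<in> borel_measurable borel" by (rule L2_measurable[OF assms(1)])
  show ?thesis using lborel_integrable_scale[OF L2_integrable[OF assms(1)] assms(2), of x] by (simp add: L2_def)
qed

text \<open>As a function of m the left-hand side is continuous with compact support, and its
  transform at p is \<open>ft a (p, q)\<close>; inversion in the variable m alone gives the
  formula.\<close>

lemma partial_ft_inversion:
  fixes a :: "'a::euclidean_space \<times> 'a \<Rightarrow> complex"
  assumes a: "a \<in> test_fun"
  shows "(LINT \<xi>|lborel. a (m, \<xi>) * cis (- (\<xi> \<bullet> q)))
    = (LINT p|lborel. ft a (p, q) * cis (m \<bullet> p)) / complex_of_real ((2 * pi) ^ DIM('a))"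
proof -
  have aC: "a \<in> Cc" by (rule test_fun_Cc[OF a])
  have [measurable]: "a \<in> borel_measurable borel" by (rule Cc_measurable[OF aC])
  have am [measurable]: "case_prod (\<lambda>m \<xi>. a (m, \<xi>)) \<in> borel_measurable (borel \<Otimes>\<^sub>M borel)"
    using Cc_measurable[OF aC] by (simp add: borel_prod)
  obtain R where R: "R > 0" "\<And>m \<xi>. R < norm m \<or> R < norm \<xi> \<Longrightarrow> a (m, \<xi>) = 0"
    by (rule test_fun_pair_support[OF a]) (rule that)
  obtain B where B: "B > 0" "\<And>z. cmod (a z) \<le> B" using Cc_bounded[OF aC] by blast
  let ?g = "\<lambda>m. LINT \<xi>|lborel. a (m, \<xi>) * cis (- (\<xi> \<bullet> q))"
  have dom: "integrable lborel (\<lambda>\<xi>::'a. B * indicator (cball 0 R) \<xi>)"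
    using emeasure_lborel_cball_finite[of "0::'a" R] by (intro integrable_mult_right) auto
  have am1: "(\<lambda>\<xi>. a (m, \<xi>)) \<in> borel_measurable borel" for m
  proof -
    have "continuous_on UNIV (\<lambda>\<xi>. a (m, \<xi>))"
      using aC unfolding Cc_def by (auto intro!: continuous_on_compose2[of UNIV a] continuous_intros)
    then show ?thesis by (rule borel_measurable_continuous_onI)
  qed
  have bnd: "cmod (a (m, \<xi>) * cis t) \<le> B * indicator (cball 0 R) \<xi>" for m \<xi> t
    using B(1) B(2)[of "(m, \<xi>)"] R(2)[of m \<xi>] by (auto simp: norm_mult indicator_def)
  have "continuous_on UNIV ?g"
    unfolding continuous_on_sequentially o_def
  proof (intro allI ballI impI, elim conjE)
    fix s :: "nat \<Rightarrow> 'a" and m assume s: "s \<longlonglongrightarrow> m"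
    show "(\<lambda>n. ?g (s n)) \<longlonglongrightarrow> ?g m"
    proof (rule integral_dominated_convergence[OF _ _ dom])
      show "AE \<xi> in lborel. (\<lambda>n. a (s n, \<xi>) * cis (- (\<xi> \<bullet> q))) \<longlonglongrightarrow> a (m, \<xi>) * cis (- (\<xi> \<bullet> q))"
      proof (rule AE_I2)
        fix \<xi>
        have "(\<lambda>n. a (s n, \<xi>)) \<longlonglongrightarrow> a (m, \<xi>)"
          by (rule continuous_on_tendsto_compose[of UNIV a]) (use aC s in \<open>auto simp: Cc_def intro!: tendsto_intros\<close>)
        then show "(\<lambda>n. a (s n, \<xi>) * cis (- (\<xi> \<bullet> q))) \<longlonglongrightarrow> a (m, \<xi>) * cis (- (\<xi> \<bullet> q))"
          by (intro tendsto_intros)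
      qed
    qed (use bnd am1 in auto)
  qed
  moreover have "?g m = 0" if "R < norm m" for m using R(2) that by simp
  ultimately have gC: "?g \<in> Cc" by (auto simp: Cc_def)
  have ftg: "ft ?g p = ft a (p, q)" for p
  proof -
    let ?F = "\<lambda>m \<xi>. a (m, \<xi>) * cis (- ((m, \<xi>) \<bullet> (p, q)))"
    have ai: "integrable lborel (\<lambda>z. a z * cis (- (z \<bullet> (p, q))))"
      by (intro integrable_mult_cis Cc_integrable[OF aC]) measurable
    then have "integrable (lborel \<Otimes>\<^sub>M lborel) (case_prod ?F)"
      by (simp add: lborel_prod case_prod_beta' del: inner_Pair)
    from lborel_pair.integral_fst[OF this]
    have "ft a (p, q) = (LINT m|lborel. LINT \<xi>|lborel. ?F m \<xi>)"
      unfolding ft_def by (simp add: lborel_prod case_prod_beta' del: inner_Pair)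
    also have "\<dots> = (LINT m|lborel. ?g m * cis (- (m \<bullet> p)))"
    proof (rule Bochner_Integration.integral_cong[OF refl])
      fix m
      have "?F m \<xi> = (a (m, \<xi>) * cis (- (\<xi> \<bullet> q))) * cis (- (m \<bullet> p))" for \<xi>
      proof -
        have "- ((m, \<xi>) \<bullet> (p, q)) = - (\<xi> \<bullet> q) + - (m \<bullet> p)" by simp
        then show ?thesis by (simp only: cis_mult[symmetric] mult.assoc)
      qed
      then show "(LINT \<xi>|lborel. ?F m \<xi>) = ?g m * cis (- (m \<bullet> p))" by (simp only: integral_mult_left_zero)
    qed
    finally show ?thesis by (simp add: ft_def)
  qed
  obtain C where C: "C > 0" "\<And>z. cmod (ft a z) \<le> C * japanese z" using ft_decay[OF a] by blast
  have [measurable]: "ft ?g \<in> borel_measurable borel" by (rule ft_measurable[OF Cc_measurable[OF gC]])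
  have gi: "integrable lborel (ft ?g)"
  proof (rule Bochner_Integration.integrable_bound)
    show "integrable lborel (\<lambda>p::'a. C * japanese q * japanese p)" by (intro integrable_mult_right japanese_integrable)
    show "AE p in lborel. norm (ft ?g p) \<le> norm (C * japanese q * japanese p)"
      unfolding ftg using C(2) by (intro AE_I2 order_trans[OF C(2)]) (simp add: japanese_Pair mult_ac)
  qed measurable
  show ?thesis using ft_inversion[OF gC gi, of m] unfolding ftg by simp
qed

text \<open>The term (p, q) translates u by h q and modulates it by p, evaluated at the midpoint x +
  (h/2) q of the two arguments, as Weyl quantization prescribes.\<close>

lemma weyl_rep:
  fixes a :: "'a::euclidean_space \<times> 'a \<Rightarrow> complex"
  assumes a: "a \<in> test_fun" and h: "h > 0" and u: "u \<in> L2"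
  shows "weyl_op h a u x = (LINT q|lborel. LINT p|lborel. ft a (p, q) * cis ((x + (h / 2) *\<^sub>R q) \<bullet> p) * u (x + h *\<^sub>R q))
    / complex_of_real ((2 * pi) ^ DIM('a) * (2 * pi) ^ DIM('a))"
proof -
  have aC: "a \<in> Cc" by (rule test_fun_Cc[OF a])
  have [measurable]: "u \<in> borel_measurable borel" by (rule L2_measurable[OF u])
  have am [measurable]: "a \<in> borel_measurable (borel \<Otimes>\<^sub>M borel)"
    using Cc_measurable[OF aC] by (simp add: borel_prod)
  obtain R where R: "R > 0" "\<And>m \<xi>. R < norm m \<or> R < norm \<xi> \<Longrightarrow> a (m, \<xi>) = 0"
    by (rule test_fun_pair_support[OF a]) (rule that)
  obtain B where B: "B > 0" "\<And>z. cmod (a z) \<le> B" using Cc_bounded[OF aC] by blast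
  let ?k = "\<lambda>\<xi> y. a ((1/2) *\<^sub>R (x + y), h *\<^sub>R \<xi>) * u y * cis ((x - y) \<bullet> \<xi>)"
  \<comment> \<open>The support of the symbol forces |\<xi>| \<le> R/h and |y| \<le> 2R + |x|, so
    the kernel has a factorized majorant.\<close>
  let ?X = "\<lambda>\<xi>::'a. complex_of_real (B * indicator (cball 0 (R / h)) \<xi>)"
  let ?Y = "\<lambda>y. complex_of_real (indicator (cball 0 (2 * R + norm x)) y) * u y"
  have km: "case_prod ?k \<in> borel_measurable (borel \<Otimes>\<^sub>M borel)" by measurable
  have iX: "integrable lborel ?X"
    using emeasure_lborel_cball_finite[of "0::'a" "R / h"] by (intro integrable_of_real integrable_mult_right) auto
  have iY: "integrable lborel ?Y"
  proof (rule L2_mult_integrable[OF _ u])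
    show "(\<lambda>y::'a. complex_of_real (indicator (cball 0 (2 * R + norm x)) y)) \<in> L2"
    proof -
      have eq: "(\<lambda>y::'a. (cmod (complex_of_real (indicator (cball 0 (2 * R + norm x)) y)))\<^sup>2) = indicator (cball 0 (2 * R + norm x))"
        by (auto simp: indicator_def fun_eq_iff)
      have "integrable lborel (indicator (cball (0::'a) (2 * R + norm x)) :: 'a \<Rightarrow> real)"
        using emeasure_lborel_cball_finite[of "0::'a" "2 * R + norm x"] by (intro integrable_real_indicator) auto
      moreover have "(\<lambda>y::'a. complex_of_real (indicator (cball 0 (2 * R + norm x)) y)) \<in> borel_measurable borel"
      proof -
        have "(\<lambda>y::'a. complex_of_real (indicator (cball 0 (2 * R + norm x)) y)) = indicator (cball 0 (2 * R + norm x))"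
          by (auto simp: indicator_def fun_eq_iff)
        then show ?thesis by (simp only: borel_measurable_indicator[OF borel_closed[OF closed_cball]])
      qed
      ultimately show ?thesis unfolding L2_def mem_Collect_eq eq by blast
    qed
  qed
  have kb: "cmod (?k \<xi> y) \<le> cmod (?X \<xi>) * cmod (?Y y)" for \<xi> y
  proof (cases "norm \<xi> \<le> R / h \<and> norm y \<le> 2 * R + norm x")
    case True
    then show ?thesis using B by (simp add: norm_mult mult_right_mono)
  next
    case False
    have "a ((1/2) *\<^sub>R (x + y), h *\<^sub>R \<xi>) = 0"
    proof (rule R(2))
      show "R < norm ((1/2) *\<^sub>R (x + y)) \<or> R < norm (h *\<^sub>R \<xi>)"
      proof (cases "norm \<xi> \<le> R / h")
        case True
        then have "2 * R + norm x < norm y" using False by simp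
        moreover have "norm y - norm x \<le> norm (x + y)" using norm_diff_ineq[of y x] by (simp add: add.commute)
        ultimately show ?thesis by simp
      next
        case False
        then show ?thesis using h by (simp add: field_simps)
      qed
    qed
    then show ?thesis by (simp add: norm_mult)
  qed
  have "weyl_op h a u x * complex_of_real ((2 * pi) ^ DIM('a)) = (LINT \<xi>|lborel. LINT y|lborel. ?k \<xi> y)"
    unfolding weyl_op_def by (simp add: cis_conv_exp)
  also have "\<dots> = (LINT y|lborel. LINT \<xi>|lborel. ?k \<xi> y)"
    by (rule lborel_Fubini_product_bound(1)[OF km iX iY kb])
  \<comment> \<open>The substitution y = x + h q. Its Jacobian cancels against that of the rescaling
    of \<xi> in the next step.\<close>
  also have "\<dots> = h ^ DIM('a) *\<^sub>R (LINT q|lborel. LINT \<xi>|lborel. ?k \<xi> (x + h *\<^sub>R q))"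
  proof -
    have "(\<lambda>y. LINT \<xi>|lborel. ?k \<xi> y) \<in> borel_measurable borel" by measurable
    from lborel_integral_scale[OF this, of h x] show ?thesis using h by simp
  qed
  also have "\<dots> = (LINT q|lborel. u (x + h *\<^sub>R q) * (LINT \<xi>|lborel. a (x + (h / 2) *\<^sub>R q, \<xi>) * cis (- (\<xi> \<bullet> q))))"
  proof -
    have "h ^ DIM('a) *\<^sub>R (LINT \<xi>|lborel. ?k \<xi> (x + h *\<^sub>R q))
        = u (x + h *\<^sub>R q) * (LINT \<xi>|lborel. a (x + (h / 2) *\<^sub>R q, \<xi>) * cis (- (\<xi> \<bullet> q)))" for q
    proof -
      let ?F = "\<lambda>\<xi>. a (x + (h / 2) *\<^sub>R q, \<xi>) * cis (- (\<xi> \<bullet> q))"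
      have mid: "(1/2) *\<^sub>R (x + (x + h *\<^sub>R q)) = x + (h / 2) *\<^sub>R q"
        by (simp add: scaleR_add_right[symmetric] algebra_simps flip: scaleR_2)
      have "?k \<xi> (x + h *\<^sub>R q) = u (x + h *\<^sub>R q) * ?F (0 + h *\<^sub>R \<xi>)" for \<xi>
        unfolding mid by (simp add: mult_ac inner_commute)
      then have "(LINT \<xi>|lborel. ?k \<xi> (x + h *\<^sub>R q)) = u (x + h *\<^sub>R q) * (LINT \<xi>|lborel. ?F (0 + h *\<^sub>R \<xi>))"
        by (simp only: integral_mult_right_zero)
      moreover have "(LINT \<xi>|lborel. ?F \<xi>) = h ^ DIM('a) *\<^sub>R (LINT \<xi>|lborel. ?F (0 + h *\<^sub>R \<xi>))"
        using lborel_integral_scale[of ?F h 0] h by simp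
      ultimately show ?thesis by (simp add: scaleR_conv_of_real)
    qed
    then show ?thesis by (simp only: Bochner_Integration.integral_scaleR_right[symmetric])
  qed
  also have "\<dots> = (LINT q|lborel. (LINT p|lborel. ft a (p, q) * cis ((x + (h / 2) *\<^sub>R q) \<bullet> p) * u (x + h *\<^sub>R q))
      / complex_of_real ((2 * pi) ^ DIM('a)))"
    unfolding partial_ft_inversion[OF a] by (simp add: mult.commute)
  finally have "weyl_op h a u x * complex_of_real ((2 * pi) ^ DIM('a))
      = (LINT q|lborel. LINT p|lborel. ft a (p, q) * cis ((x + (h / 2) *\<^sub>R q) \<bullet> p) * u (x + h *\<^sub>R q))
        / complex_of_real ((2 * pi) ^ DIM('a))" by simp
  then show ?thesis by (simp add: field_simps)
qed

text \<open>The matrix element of a phase space translation, seen on the Fourier side: p shifts the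
  frequency and s is the displacement in position. The phase sits at the midpoint of z and z -
  p.\<close>

definition phase_form :: "'a \<Rightarrow> 'a \<Rightarrow> ('a::euclidean_space \<Rightarrow> complex) \<Rightarrow> ('a \<Rightarrow> complex) \<Rightarrow> complex" where
  "phase_form s p f g = (LINT z|lborel. cis (s \<bullet> (z - (1/2) *\<^sub>R p)) * (f (z - p) * cnj (g z)))"

lemma shift_L2:
  assumes "f \<in> L2"
  shows "(\<lambda>z. f (z - p)) \<in> L2" and "L2_norm (\<lambda>z. f (z - p)) = L2_norm f"
  using L2_translate[OF assms, of "- p"] L2_norm_translate[OF assms, of "- p"] by simp_all

lemma shifted_form_bound:
  assumes f: "f \<in> L2" and g: "g \<in> L2" and K: "K \<ge> 0"
    and m: "\<And>z. f (z - p) \<noteq> 0 \<Longrightarrow> g z \<noteq> 0 \<Longrightarrow> cmod (m z) \<le> K"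
  shows "cmod (LINT z|lborel. m z * (f (z - p) * cnj (g z))) \<le> K * (L2_norm f * L2_norm g)"
proof -
  have "cmod (LINT z|lborel. m z * (f (z - p) * cnj (g z))) \<le> (LINT z|lborel. K * (cmod (f (z - p)) * cmod (g z)))"
  proof (rule integral_norm_le)
    show "integrable lborel (\<lambda>z. K * (cmod (f (z - p)) * cmod (g z)))"
      by (intro integrable_mult_right L2_norm_mult_integrable shift_L2 f g)
    show "cmod (m z * (f (z - p) * cnj (g z))) \<le> K * (cmod (f (z - p)) * cmod (g z))" for z
      by (cases "f (z - p) = 0 \<or> g z = 0") (use m[of z] in \<open>auto simp: norm_mult mult_right_mono\<close>)
  qed
  also have "\<dots> \<le> K * (L2_norm f * L2_norm g)"
    using L2_cauchy_schwarz[OF shift_L2(1)[OF f, of p] g] K by (simp add: shift_L2(2)[OF f] mult_left_mono)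
  finally show ?thesis .
qed

lemma phase_form_bound:
  assumes "f \<in> L2" "g \<in> L2"
  shows "cmod (phase_form s p f g) \<le> L2_norm f * L2_norm g"
  unfolding phase_form_def using shifted_form_bound[OF assms, of 1 p "\<lambda>z. cis (s \<bullet> (z - (1/2) *\<^sub>R p))"] by simp

lemma phase_translation_inner:
  fixes u v :: "'a::euclidean_space \<Rightarrow> complex"
  assumes u: "u \<in> L2" and v: "v \<in> L2"
  shows "(LINT x|lborel. cis ((x + (1/2) *\<^sub>R s) \<bullet> p) * u (x + s) * cnj (v x)) = phase_form s p (fourier u) (fourier v)"
proof -
  let ?w = "\<lambda>x. cis ((1/2) * (s \<bullet> p)) * u (s + x)"
  have tu: "(\<lambda>x. u (s + x)) \<in> L2" by (rule L2_translate[OF u])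
  have w: "?w \<in> L2" by (rule L2_scale[OF tu])
  have cw: "(\<lambda>x. cis (x \<bullet> p) * ?w x) \<in> L2" by (rule L2_cis_mult[OF w]) measurable
  have [measurable]: "fourier u \<in> borel_measurable borel" "fourier v \<in> borel_measurable borel"
    "fourier (\<lambda>x. cis (x \<bullet> p) * ?w x) \<in> borel_measurable borel"
    by (rule L2_measurable[OF fourier_L2[OF u]] L2_measurable[OF fourier_L2[OF v]] L2_measurable[OF fourier_L2[OF cw]])+
  have "(LINT x|lborel. cis ((x + (1/2) *\<^sub>R s) \<bullet> p) * u (x + s) * cnj (v x)) = L2_inner (\<lambda>x. cis (x \<bullet> p) * ?w x) v"
    unfolding L2_inner_def
    by (rule Bochner_Integration.integral_cong) (simp_all add: inner_add_left cis_mult[symmetric] add.commute mult.assoc)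
  also have "\<dots> = L2_inner (fourier (\<lambda>x. cis (x \<bullet> p) * ?w x)) (fourier v)" by (rule fourier_inner[OF cw v, symmetric])
  also have "\<dots> = phase_form s p (fourier u) (fourier v)"
    unfolding L2_inner_def phase_form_def
  proof (rule integral_cong_AE)
    have "AE z in lborel. fourier ?w z = cis ((1/2) * (s \<bullet> p)) * (cis (z \<bullet> s) * fourier u z)"
      using fourier_scale[OF tu, of "cis ((1/2) * (s \<bullet> p))"] fourier_translate[OF u, of s] by eventually_elim simp
    from lborel_AE_translate[OF this, of "- p"]
    have "AE z in lborel. fourier ?w (z - p) = cis ((1/2) * (s \<bullet> p)) * (cis ((z - p) \<bullet> s) * fourier u (z - p))" by simp
    with fourier_modulate[OF w, of p]
    show "AE z in lborel. fourier (\<lambda>x. cis (x \<bullet> p) * ?w x) z * cnj (fourier v z)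
        = cis (s \<bullet> (z - (1/2) *\<^sub>R p)) * (fourier u (z - p) * cnj (fourier v z))"
    proof eventually_elim
      case (elim z)
      have "cis ((1/2) * (s \<bullet> p)) * cis ((z - p) \<bullet> s) = cis (s \<bullet> (z - (1/2) *\<^sub>R p))"
        by (simp add: cis_mult inner_diff_left inner_diff_right inner_commute)
      then show ?case using elim by (simp add: mult.assoc[symmetric])
    qed
  qed measurable
  finally show ?thesis .
qed

text \<open>The exchange of the integrals is absolute because \<open>ft a\<close> is integrable and
  each translation preserves the norm.\<close>

lemma weyl_inner:
  fixes a :: "'a::euclidean_space \<times> 'a \<Rightarrow> complex"
  assumes a: "a \<in> test_fun" and h: "h > 0" and u: "u \<in> L2" and v: "v \<in> L2"
  shows "L2_inner (weyl_op h a u) v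
    = (LINT z|lborel. ft a z * phase_form (h *\<^sub>R snd z) (fst z) (fourier u) (fourier v))
      / complex_of_real ((2 * pi) ^ DIM('a) * (2 * pi) ^ DIM('a))"
proof -
  let ?c = "complex_of_real ((2 * pi) ^ DIM('a) * (2 * pi) ^ DIM('a))"
  have aC: "a \<in> Cc" by (rule test_fun_Cc[OF a])
  have [measurable]: "u \<in> borel_measurable borel" "v \<in> borel_measurable borel" by (auto intro!: L2_measurable u v)
  have Am: "ft a \<in> borel_measurable borel" by (rule ft_measurable[OF Cc_measurable[OF aC]])
  have [measurable]: "ft a \<in> borel_measurable (borel \<Otimes>\<^sub>M borel)" using Am by (simp add: borel_prod)
  have Ai: "integrable lborel (ft a)" by (rule ft_test_fun_integrable[OF a])
  obtain C where C: "C > 0" "\<And>z. cmod (ft a z) \<le> C * japanese z" using ft_decay[OF a] by blast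
  let ?H = "\<lambda>z x. ft a z * (cis ((x + (h / 2) *\<^sub>R snd z) \<bullet> fst z) * u (x + h *\<^sub>R snd z) * cnj (v x))"
  have rep: "weyl_op h a u x * cnj (v x) = (LINT z|lborel. ?H z x) / ?c" for x
  proof -
    let ?F = "\<lambda>p q. ft a (p, q) * cis ((x + (h / 2) *\<^sub>R q) \<bullet> p) * u (x + h *\<^sub>R q)"
    have Fm: "case_prod ?F \<in> borel_measurable (lborel \<Otimes>\<^sub>M lborel)"
      by (simp cong: measurable_cong_sets sets_pair_measure_cong)
    have i: "integrable (lborel \<Otimes>\<^sub>M lborel) (case_prod ?F)"
    proof (rule Bochner_Integration.integrable_bound[OF _ Fm])
      \<comment> \<open>The majorant factorizes; its q-factor is a product of two \<open>L2\<close>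
        functions, since \<open>japanese\<close> is also square integrable.\<close>
      have iq: "integrable lborel (\<lambda>q. complex_of_real (japanese q) * u (x + h *\<^sub>R q))"
        using h by (intro L2_mult_integrable japanese_L2 L2_scale_arg u) auto
      show "integrable (lborel \<Otimes>\<^sub>M lborel) (\<lambda>(p::'a, q). complex_of_real (C * japanese p) * (complex_of_real (japanese q) * u (x + h *\<^sub>R q)))"
      proof (rule lborel_pair.Fubini_integrable)
        show "(\<lambda>(p::'a, q). complex_of_real (C * japanese p) * (complex_of_real (japanese q) * u (x + h *\<^sub>R q))) \<in> borel_measurable (lborel \<Otimes>\<^sub>M lborel)"
          by (simp cong: measurable_cong_sets sets_pair_measure_cong)
        have "integrable lborel (\<lambda>p::'a. C * japanese p * (LINT q|lborel. cmod (complex_of_real (japanese q) * u (x + h *\<^sub>R q))))"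
          by (intro integrable_mult_left integrable_mult_right japanese_integrable)
        then show "integrable lborel (\<lambda>p::'a. LINT q|lborel. norm (case (p, q) of (p, q) \<Rightarrow> complex_of_real (C * japanese p) * (complex_of_real (japanese q) * u (x + h *\<^sub>R q))))"
          using C(1) less_imp_le[OF japanese_pos] by (simp add: norm_mult abs_mult abs_of_nonneg)
        show "AE p in lborel. integrable lborel (\<lambda>q. case (p::'a, q) of (p, q) \<Rightarrow> complex_of_real (C * japanese p) * (complex_of_real (japanese q) * u (x + h *\<^sub>R q)))"
          using iq by (auto intro!: AE_I2 integrable_mult_right)
      qed
      have "cmod (?F p q) \<le> cmod (complex_of_real (C * japanese p) * (complex_of_real (japanese q) * u (x + h *\<^sub>R q)))" for p q
      proof -
        have "cmod (?F p q) \<le> C * japanese (p, q) * cmod (u (x + h *\<^sub>R q))"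
          using C(2)[of "(p, q)"] by (simp add: norm_mult mult_right_mono)
        then show ?thesis using C(1) less_imp_le[OF japanese_pos[of p]] less_imp_le[OF japanese_pos[of q]]
          by (simp add: norm_mult japanese_Pair mult.assoc)
      qed
      then show "AE z in lborel \<Otimes>\<^sub>M lborel. norm (case_prod ?F z)
          \<le> norm (case z of (p, q) \<Rightarrow> complex_of_real (C * japanese p) * (complex_of_real (japanese q) * u (x + h *\<^sub>R q)))"
        by (auto intro!: AE_I2)
    qed
    have "(LINT q|lborel. LINT p|lborel. ?F p q) = (LINT z|lborel. case_prod ?F z)"
      using lborel_pair.integral_snd[OF i] by (simp add: lborel_prod)
    then have "weyl_op h a u x * cnj (v x) = (LINT z|lborel. case_prod ?F z) * cnj (v x) / ?c"
      unfolding weyl_rep[OF a h u] by simp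
    also have "(LINT z|lborel. case_prod ?F z) * cnj (v x) = (LINT z|lborel. ?H z x)"
      by (subst integral_mult_left_zero[symmetric]) (simp add: case_prod_beta' mult.assoc)
    finally show ?thesis .
  qed
  have inner: "(LINT x|lborel. ?H z x) = ft a z * phase_form (h *\<^sub>R snd z) (fst z) (fourier u) (fourier v)" for z
    using phase_translation_inner[OF u v, of "h *\<^sub>R snd z" "fst z"] by (simp only: integral_mult_right_zero) simp
  have "L2_inner (weyl_op h a u) v = (LINT x|lborel. LINT z|lborel. ?H z x) / ?c"
    unfolding L2_inner_def rep by simp
  also have "(LINT x|lborel. LINT z|lborel. ?H z x) = (LINT z|lborel. LINT x|lborel. ?H z x)"
  proof (rule lborel_Fubini(1)[symmetric])
    have [measurable]: "ft a \<in> borel_measurable borel" by (rule Am)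
    have [measurable]: "fst \<in> borel_measurable (borel :: ('a \<times> 'a) measure)" "snd \<in> borel_measurable (borel :: ('a \<times> 'a) measure)"
      by (auto simp: borel_prod[symmetric])
    show "case_prod ?H \<in> borel_measurable (borel \<Otimes>\<^sub>M borel)" by measurable
    show "integrable lborel (\<lambda>z. cmod (ft a z) * (L2_norm u * L2_norm v))" using Ai by (intro integrable_mult_left integrable_norm)
    fix z :: "'a \<times> 'a"
    have su: "(\<lambda>x. u (x + h *\<^sub>R snd z)) \<in> L2" using L2_translate[OF u, of "h *\<^sub>R snd z"] by (simp add: add.commute)
    have nu: "L2_norm (\<lambda>x. u (x + h *\<^sub>R snd z)) = L2_norm u"
      using L2_norm_translate[OF u, of "h *\<^sub>R snd z"] by (simp add: add.commute)
    have cu: "(\<lambda>x. cis ((x + (h / 2) *\<^sub>R snd z) \<bullet> fst z) * u (x + h *\<^sub>R snd z)) \<in> L2" by (rule L2_cis_mult[OF su]) measurable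
    show "integrable lborel (?H z)" by (intro integrable_mult_right L2_inner_integrable cu v)
    have "(LINT x|lborel. cmod (?H z x)) = cmod (ft a z) * (LINT x|lborel. cmod (u (x + h *\<^sub>R snd z)) * cmod (v x))"
      by (simp add: norm_mult)
    also have "\<dots> \<le> cmod (ft a z) * (L2_norm u * L2_norm v)"
      using L2_cauchy_schwarz[OF su v] unfolding nu by (intro mult_left_mono) auto
    finally show "(LINT x|lborel. cmod (?H z x)) \<le> cmod (ft a z) * (L2_norm u * L2_norm v)" .
  qed
  finally show ?thesis unfolding inner .
qed

section \<open>Averaging in time at high frequency\<close>

lemma norm_integral_nn:
  fixes f :: "'b \<Rightarrow> 'a::{banach, second_countable_topology}"
  shows "ennreal (norm (integral\<^sup>L M f)) \<le> (\<integral>\<^sup>+x. ennreal (norm (f x)) \<partial>M)"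
proof (cases "integrable M f")
  case True
  then show ?thesis by (rule integral_norm_bound_ennreal)
qed (simp add: not_integrable_integral_eq)

lemma weighted_am_gm:
  fixes x y l :: real
  assumes "l > 0"
  shows "x * y \<le> (l / 2) * x\<^sup>2 + y\<^sup>2 / (2 * l)"
proof -
  have "x * y = (2 * (l * x) * y) / (2 * l)" using assms by simp
  also have "\<dots> \<le> ((l * x)\<^sup>2 + y\<^sup>2) / (2 * l)"
    using assms by (intro divide_right_mono sum_squares_bound) auto
  also have "\<dots> = (l / 2) * x\<^sup>2 + y\<^sup>2 / (2 * l)"
    using assms by (simp add: add_divide_distrib power_mult_distrib power2_eq_square)
  finally show ?thesis .
qed

text \<open>A Schur test in which only the integral over \<open>z\<close> is small.\<close>

lemma schur_nn:
  fixes w :: "'c::euclidean_space \<Rightarrow> real" and f g :: "'a::euclidean_space \<Rightarrow> complex"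
  assumes w: "integrable lborel w" "\<And>z. 0 \<le> w z" and P: "P \<in> borel_measurable borel"
    and G: "case_prod G \<in> borel_measurable (borel \<Otimes>\<^sub>M borel)" "\<And>z x. 0 \<le> G z x" "\<And>z x. G z x \<le> B"
    and f: "f \<in> L2" and g: "g \<in> L2" and l: "l > 0" and e: "e \<ge> 0"
    and small: "\<And>x. g x \<noteq> 0 \<Longrightarrow> (\<integral>\<^sup>+z. ennreal (w z * G z x) \<partial>lborel) \<le> ennreal e"
  shows "(\<integral>\<^sup>+z. \<integral>\<^sup>+x. ennreal (w z * G z x * (cmod (f (x - P z)) * cmod (g x))) \<partial>lborel \<partial>lborel)
    \<le> ennreal ((l / 2) * B * (LINT z|lborel. w z) * (L2_norm f)\<^sup>2 + e / (2 * l) * (L2_norm g)\<^sup>2)"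
proof -
  have [measurable]: "w \<in> borel_measurable borel" using borel_measurable_integrable[OF w(1)] by simp
  have [measurable]: "f \<in> borel_measurable borel" "g \<in> borel_measurable borel" by (auto intro!: L2_measurable f g)
  note [measurable] = P G(1)
  have B0: "0 \<le> B" using G(2,3) order_trans by blast
  let ?c = "(l / 2) * B"
  let ?F1 = "\<lambda>z x. ?c * (w z * (cmod (f (x - P z)))\<^sup>2)" and ?F2 = "\<lambda>z x. (cmod (g x))\<^sup>2 / (2 * l) * (w z * G z x)"
  have c0: "0 \<le> ?c" using l B0 by simp
  \<comment> \<open>The uniform bound G \<le> B is spent on the term with f, while the term with g
    keeps G, to be integrated over z by the smallness hypothesis.\<close>
  have pt: "w z * G z x * (cmod (f (x - P z)) * cmod (g x)) \<le> ?F1 z x + ?F2 z x" for z x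
  proof -
    have "w z * G z x * (cmod (f (x - P z)) * cmod (g x))
        \<le> w z * G z x * ((l / 2) * (cmod (f (x - P z)))\<^sup>2 + (cmod (g x))\<^sup>2 / (2 * l))"
      using w(2) G(2) by (intro mult_left_mono weighted_am_gm l) auto
    also have "\<dots> = G z x * ((l / 2) * (w z * (cmod (f (x - P z)))\<^sup>2)) + ?F2 z x" by (simp add: algebra_simps)
    also have "G z x * ((l / 2) * (w z * (cmod (f (x - P z)))\<^sup>2)) \<le> B * ((l / 2) * (w z * (cmod (f (x - P z)))\<^sup>2))"
      using w(2) l by (intro mult_right_mono G(3)) auto
    finally show ?thesis by (simp add: mult_ac)
  qed
  have "(\<integral>\<^sup>+z. \<integral>\<^sup>+x. ennreal (w z * G z x * (cmod (f (x - P z)) * cmod (g x))) \<partial>lborel \<partial>lborel)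
      \<le> (\<integral>\<^sup>+z. \<integral>\<^sup>+x. (ennreal (?F1 z x) + ennreal (?F2 z x)) \<partial>lborel \<partial>lborel)"
  proof (intro nn_integral_mono)
    fix z :: 'c and x :: 'a
    have "ennreal (w z * G z x * (cmod (f (x - P z)) * cmod (g x))) \<le> ennreal (?F1 z x + ?F2 z x)"
      by (rule ennreal_leI[OF pt])
    also have "\<dots> = ennreal (?F1 z x) + ennreal (?F2 z x)"
      using c0 w(2) G(2) l by (intro ennreal_plus) auto
    finally show "ennreal (w z * G z x * (cmod (f (x - P z)) * cmod (g x))) \<le> ennreal (?F1 z x) + ennreal (?F2 z x)" .
  qed
  also have "\<dots> = (\<integral>\<^sup>+z. \<integral>\<^sup>+x. ennreal (?F1 z x) \<partial>lborel \<partial>lborel) + (\<integral>\<^sup>+z. \<integral>\<^sup>+x. ennreal (?F2 z x) \<partial>lborel \<partial>lborel)"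
    by (subst nn_integral_add[symmetric]) (auto simp: nn_integral_add)
  also have "(\<integral>\<^sup>+z. \<integral>\<^sup>+x. ennreal (?F1 z x) \<partial>lborel \<partial>lborel) = ennreal (?c * (LINT z|lborel. w z) * (L2_norm f)\<^sup>2)"
  proof -
    have "(\<integral>\<^sup>+x. ennreal (?F1 z x) \<partial>lborel) = ennreal (?c * w z * (L2_norm f)\<^sup>2)" for z
    proof -
      have i: "integrable lborel (\<lambda>x. (cmod (f (x - P z)))\<^sup>2)" by (rule L2_integrable[OF shift_L2(1)[OF f]])
      have "(\<integral>\<^sup>+x. ennreal (?F1 z x) \<partial>lborel) = ennreal (LINT x|lborel. ?F1 z x)"
        using i c0 w(2) by (intro nn_integral_eq_integral) auto
      also have "(LINT x|lborel. ?F1 z x) = ?c * w z * (L2_norm (\<lambda>x. f (x - P z)))\<^sup>2"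
        unfolding L2_norm_sq by (simp add: mult.assoc)
      finally show ?thesis by (simp add: shift_L2(2)[OF f])
    qed
    then have "(\<integral>\<^sup>+z. \<integral>\<^sup>+x. ennreal (?F1 z x) \<partial>lborel \<partial>lborel) = (\<integral>\<^sup>+z. ennreal (?c * w z * (L2_norm f)\<^sup>2) \<partial>lborel)" by simp
    also have "\<dots> = ennreal (LINT z|lborel. ?c * w z * (L2_norm f)\<^sup>2)"
      using w c0 by (intro nn_integral_eq_integral) auto
    finally show ?thesis by simp
  qed
  also have "(\<integral>\<^sup>+z. \<integral>\<^sup>+x. ennreal (?F2 z x) \<partial>lborel \<partial>lborel) \<le> ennreal (e / (2 * l) * (L2_norm g)\<^sup>2)"
  proof -
    have "(\<integral>\<^sup>+z. \<integral>\<^sup>+x. ennreal (?F2 z x) \<partial>lborel \<partial>lborel) = (\<integral>\<^sup>+x. \<integral>\<^sup>+z. ennreal (?F2 z x) \<partial>lborel \<partial>lborel)"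
      by (rule lborel_pair.Fubini'[symmetric]) (simp cong: measurable_cong_sets sets_pair_measure_cong)
    also have "\<dots> \<le> (\<integral>\<^sup>+x. ennreal (e / (2 * l) * (cmod (g x))\<^sup>2) \<partial>lborel)"
    proof (rule nn_integral_mono)
      fix x
      have "(\<integral>\<^sup>+z. ennreal (?F2 z x) \<partial>lborel) = ennreal ((cmod (g x))\<^sup>2 / (2 * l)) * (\<integral>\<^sup>+z. ennreal (w z * G z x) \<partial>lborel)"
      proof -
        have "ennreal (?F2 z x) = ennreal ((cmod (g x))\<^sup>2 / (2 * l)) * ennreal (w z * G z x)" for z
          by (rule ennreal_mult') (use l in simp)
        then show ?thesis by (simp only:) (rule nn_integral_cmult, measurable)
      qed
      also have "\<dots> \<le> ennreal ((cmod (g x))\<^sup>2 / (2 * l)) * ennreal e"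
        by (cases "g x = 0") (use small[of x] in \<open>auto intro: mult_left_mono\<close>)
      also have "\<dots> = ennreal (e / (2 * l) * (cmod (g x))\<^sup>2)"
        using l e by (subst ennreal_mult'[symmetric]) (auto simp: mult_ac)
      finally show "(\<integral>\<^sup>+z. ennreal (?F2 z x) \<partial>lborel) \<le> ennreal (e / (2 * l) * (cmod (g x))\<^sup>2)" .
    qed
    also have "\<dots> = ennreal (LINT x|lborel. e / (2 * l) * (cmod (g x))\<^sup>2)"
      using L2_integrable[OF g] l e by (intro nn_integral_eq_integral) auto
    finally show ?thesis by (simp add: L2_norm_sq)
  qed
  also have "ennreal (?c * (LINT z|lborel. w z) * (L2_norm f)\<^sup>2) + ennreal (e / (2 * l) * (L2_norm g)\<^sup>2)
      = ennreal (?c * (LINT z|lborel. w z) * (L2_norm f)\<^sup>2 + e / (2 * l) * (L2_norm g)\<^sup>2)"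
    using c0 w(2) l e by (intro ennreal_plus[symmetric]) (auto intro!: mult_nonneg_nonneg Bochner_Integration.integral_nonneg)
  finally show ?thesis by (simp add: add_left_mono)
qed

text \<open>The two alternatives correspond to the factor that carries the high frequencies. In the
  second one a translation by P z exchanges the roles of f and g, which is why the multiplier is
  evaluated at P z + x.\<close>

lemma schur_form:
  fixes A :: "'c::euclidean_space \<Rightarrow> complex" and f g :: "'a::euclidean_space \<Rightarrow> complex"
  assumes A: "integrable lborel A" and P: "P \<in> borel_measurable borel"
    and m: "case_prod m \<in> borel_measurable (borel \<Otimes>\<^sub>M borel)" "\<And>z x. cmod (m z x) \<le> B"
    and f: "f \<in> L2" and g: "g \<in> L2" and l: "l > 0" and e: "e \<ge> 0"
    and small: "(\<forall>x. g x \<noteq> 0 \<longrightarrow> (\<integral>\<^sup>+z. ennreal (cmod (A z) * cmod (m z x)) \<partial>lborel) \<le> ennreal e)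
      \<or> (\<forall>x. f x \<noteq> 0 \<longrightarrow> (\<integral>\<^sup>+z. ennreal (cmod (A z) * cmod (m z (P z + x))) \<partial>lborel) \<le> ennreal e)"
  shows "cmod (LINT z|lborel. A z * (LINT x|lborel. m z x * (f (x - P z) * cnj (g x))))
    \<le> (l / 2) * B * (LINT z|lborel. cmod (A z)) * ((L2_norm f)\<^sup>2 + (L2_norm g)\<^sup>2) + e / (2 * l) * ((L2_norm f)\<^sup>2 + (L2_norm g)\<^sup>2)"
    (is "_ \<le> ?R")
proof -
  have Am: "A \<in> borel_measurable borel" using borel_measurable_integrable[OF A] by simp
  have fm: "f \<in> borel_measurable borel" and gm: "g \<in> borel_measurable borel" by (auto intro!: L2_measurable f g)
  note [measurable] = Am fm gm P m(1)
  let ?W = "LINT z|lborel. cmod (A z)"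
  have wi: "integrable lborel (\<lambda>z. cmod (A z))" using A by (rule integrable_norm)
  have W0: "0 \<le> ?W" by simp
  have B0: "0 \<le> B" using m(2) norm_ge_zero order_trans by blast
  have R0: "0 \<le> ?R" using B0 W0 l e by (intro add_nonneg_nonneg mult_nonneg_nonneg) auto
  have pull: "ennreal (cmod (A z * I)) \<le> (\<integral>\<^sup>+x. ennreal (cmod (A z) * k x) \<partial>lborel)"
    if "ennreal (cmod I) \<le> (\<integral>\<^sup>+x. ennreal (k x) \<partial>lborel)" "k \<in> borel_measurable borel" for z I and k :: "'a \<Rightarrow> real"
  proof -
    have "ennreal (cmod (A z * I)) = ennreal (cmod (A z)) * ennreal (cmod I)" by (simp add: norm_mult ennreal_mult)
    also have "\<dots> \<le> ennreal (cmod (A z)) * (\<integral>\<^sup>+x. ennreal (k x) \<partial>lborel)" using that(1) by (rule mult_left_mono) simp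
    also have "\<dots> = (\<integral>\<^sup>+x. ennreal (cmod (A z)) * ennreal (k x) \<partial>lborel)"
      using that(2) by (intro nn_integral_cmult[symmetric]) simp
    also have "\<dots> = (\<integral>\<^sup>+x. ennreal (cmod (A z) * k x) \<partial>lborel)" by (simp add: ennreal_mult')
    finally show ?thesis .
  qed
  have "ennreal (cmod (LINT z|lborel. A z * (LINT x|lborel. m z x * (f (x - P z) * cnj (g x))))) \<le> ennreal ?R"
    using small
  proof
    assume s: "\<forall>x. g x \<noteq> 0 \<longrightarrow> (\<integral>\<^sup>+z. ennreal (cmod (A z) * cmod (m z x)) \<partial>lborel) \<le> ennreal e"
    have "ennreal (cmod (LINT z|lborel. A z * (LINT x|lborel. m z x * (f (x - P z) * cnj (g x)))))
        \<le> (\<integral>\<^sup>+z. ennreal (cmod (A z * (LINT x|lborel. m z x * (f (x - P z) * cnj (g x))))) \<partial>lborel)"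
      by (rule norm_integral_nn)
    also have "\<dots> \<le> (\<integral>\<^sup>+z. \<integral>\<^sup>+x. ennreal (cmod (A z) * (cmod (m z x) * (cmod (f (x - P z)) * cmod (g x)))) \<partial>lborel \<partial>lborel)"
    proof (intro nn_integral_mono pull)
      fix z
      show "ennreal (cmod (LINT x|lborel. m z x * (f (x - P z) * cnj (g x))))
          \<le> (\<integral>\<^sup>+x. ennreal (cmod (m z x) * (cmod (f (x - P z)) * cmod (g x))) \<partial>lborel)"
        using norm_integral_nn[of lborel "\<lambda>x. m z x * (f (x - P z) * cnj (g x))"] by (simp add: norm_mult)
      show "(\<lambda>x. cmod (m z x) * (cmod (f (x - P z)) * cmod (g x))) \<in> borel_measurable borel" by measurable
    qed
    also have "\<dots> \<le> ennreal ((l / 2) * B * ?W * (L2_norm f)\<^sup>2 + e / (2 * l) * (L2_norm g)\<^sup>2)"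
      unfolding mult.assoc[symmetric, of "cmod (A _)" "cmod (m _ _)"]
      by (rule schur_nn[OF wi _ P _ _ m(2) f g l e]) (use s in auto)
    also have "\<dots> \<le> ennreal ?R"
      using B0 W0 l e by (intro ennreal_leI add_mono mult_left_mono) (auto simp del: times_divide_eq_left)
    finally show ?thesis .
  next
    assume s: "\<forall>x. f x \<noteq> 0 \<longrightarrow> (\<integral>\<^sup>+z. ennreal (cmod (A z) * cmod (m z (P z + x))) \<partial>lborel) \<le> ennreal e"
    have tr: "(LINT x|lborel. m z x * (f (x - P z) * cnj (g x))) = (LINT x|lborel. m z (P z + x) * (f x * cnj (g (P z + x))))" for z
    proof -
      have "(\<lambda>x. m z x * (f (x - P z) * cnj (g x))) \<in> borel_measurable borel" by measurable
      from lborel_integral_translate[OF this, of "P z"] show ?thesis by simp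
    qed
    have "ennreal (cmod (LINT z|lborel. A z * (LINT x|lborel. m z x * (f (x - P z) * cnj (g x)))))
        \<le> (\<integral>\<^sup>+z. ennreal (cmod (A z * (LINT x|lborel. m z (P z + x) * (f x * cnj (g (P z + x)))))) \<partial>lborel)"
      unfolding tr by (rule norm_integral_nn)
    also have "\<dots> \<le> (\<integral>\<^sup>+z. \<integral>\<^sup>+x. ennreal (cmod (A z) * (cmod (m z (P z + x)) * (cmod (g (x - (- P z))) * cmod (f x)))) \<partial>lborel \<partial>lborel)"
    proof (intro nn_integral_mono pull)
      fix z
      show "ennreal (cmod (LINT x|lborel. m z (P z + x) * (f x * cnj (g (P z + x)))))
          \<le> (\<integral>\<^sup>+x. ennreal (cmod (m z (P z + x)) * (cmod (g (x - (- P z))) * cmod (f x))) \<partial>lborel)"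
        using norm_integral_nn[of lborel "\<lambda>x. m z (P z + x) * (f x * cnj (g (P z + x)))"]
        by (simp add: norm_mult add.commute mult.commute[of "cmod (f _)"])
      show "(\<lambda>x. cmod (m z (P z + x)) * (cmod (g (x - (- P z))) * cmod (f x))) \<in> borel_measurable borel" by measurable
    qed
    also have "\<dots> \<le> ennreal ((l / 2) * B * ?W * (L2_norm g)\<^sup>2 + e / (2 * l) * (L2_norm f)\<^sup>2)"
      unfolding mult.assoc[symmetric, of "cmod (A _)" "cmod (m _ _)"]
      by (rule schur_nn[OF wi _ _ _ _ m(2) g f l e]) (use s in auto)
    also have "\<dots> \<le> ennreal ?R"
      using B0 W0 l e by (intro ennreal_leI add_mono mult_left_mono) (auto simp del: times_divide_eq_left)
    finally show ?thesis .
  qed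
  then show ?thesis using R0 by (simp only: ennreal_le_iff)
qed

section \<open>Uniform decay of oscillating averages\<close>

lemma AE_lborel_fst:
  assumes "AE p in lborel. Q (p::'a::euclidean_space)"
  shows "AE z in lborel. Q (fst (z :: 'a \<times> 'b::euclidean_space))"
proof -
  obtain N where N: "{p \<in> space lborel. \<not> Q p} \<subseteq> N" "emeasure lborel N = 0" "N \<in> sets lborel"
    by (rule AE_E[OF assms])
  have "emeasure (lborel \<Otimes>\<^sub>M lborel) (N \<times> (UNIV :: 'b set)) = 0"
    using N by (subst lborel.emeasure_pair_measure_Times) auto
  then have "N \<times> (UNIV :: 'b set) \<in> null_sets lborel"
    using N(3) by (auto simp: null_sets_def lborel_prod[symmetric])
  then show ?thesis by (rule AE_I') (use N(1) in auto)
qed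

text \<open>The zero set is a hyperplane when c = 0. Otherwise completing the square turns it into
  the sphere centred at -z0/(2c) that passes through the origin.\<close>

lemma AE_quadric:
  fixes z0 :: "'a::euclidean_space"
  assumes "z0 \<noteq> 0 \<or> c \<noteq> 0"
  shows "AE p in lborel. p \<bullet> z0 + c * (norm p)\<^sup>2 \<noteq> 0"
proof -
  have "negligible {p. p \<bullet> z0 + c * (norm p)\<^sup>2 = 0}"
  proof (cases "c = 0")
    case True
    then have "{p. p \<bullet> z0 + c * (norm p)\<^sup>2 = 0} = {p. z0 \<bullet> p = 0}" by (auto simp: inner_commute)
    then show ?thesis using negligible_hyperplane[of z0 0] assms True by simp
  next
    case False
    let ?y = "- (1 / (2 * c)) *\<^sub>R z0"
    have "{p. p \<bullet> z0 + c * (norm p)\<^sup>2 = 0} \<subseteq> sphere ?y (norm ?y)"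
    proof
      fix p assume "p \<in> {p. p \<bullet> z0 + c * (norm p)\<^sup>2 = 0}"
      then have "p \<bullet> z0 + c * (norm p)\<^sup>2 = 0" by simp
      then have "(norm p)\<^sup>2 = - (p \<bullet> z0) / c" using False by (simp add: field_simps eq_neg_iff_add_eq_0)
      moreover have "(norm (y - p))\<^sup>2 = (norm y)\<^sup>2 - 2 * (y \<bullet> p) + (norm p)\<^sup>2" for y
        by (simp add: power2_norm_eq_inner inner_diff_left inner_diff_right inner_commute)
      moreover have "2 * (?y \<bullet> p) = - (p \<bullet> z0) / c" by (simp add: inner_commute)
      ultimately have "(norm (?y - p))\<^sup>2 = (norm ?y)\<^sup>2" by (simp only:)
      then have "norm (?y - p) = norm ?y" by (rule power2_eq_imp_eq) auto
      then show "p \<in> sphere ?y (norm ?y)" by (simp only: mem_sphere dist_norm)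
    qed
    moreover have "negligible (sphere ?y (norm ?y))"
      by (rule negligible_sphere)
    ultimately show ?thesis using negligible_subset by blast
  qed
  from AE_lborel_of_negligible[OF this] show ?thesis by simp
qed

text \<open>A compactness argument. Along a counterexample, (\<zeta>, 1) divided by 1 + |\<zeta>|
  converges to some (z0, c0) different from 0, and the argument of \<Phi> is k(1 + |\<zeta>|) times
  a quantity tending to p . z0 + \<sigma> c0 |p|^2. By \<open>AE_quadric\<close> this limit is
  nonzero for almost every p, so the argument tends to infinity and dominated convergence
  contradicts the lower bound e.\<close>

lemma oscillation_small:
  fixes A :: "'a::euclidean_space \<times> 'a \<Rightarrow> complex" and \<Phi> :: "real \<Rightarrow> complex"
  assumes A: "integrable lborel A" and \<Phi> [measurable]: "\<Phi> \<in> borel_measurable borel"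
    and B: "\<And>s. cmod (\<Phi> s) \<le> B" and lim: "(\<Phi> \<longlongrightarrow> 0) at_infinity" and e: "e > 0" and \<sigma>: "\<sigma> \<noteq> (0::real)"
  shows "\<exists>L>0. \<forall>k>0. \<forall>\<zeta>. L \<le> k * (1 + norm \<zeta>) \<longrightarrow>
    (LINT z|lborel. cmod (A z) * cmod (\<Phi> (k * (fst z \<bullet> (\<zeta> + \<sigma> *\<^sub>R fst z))))) \<le> e"
proof (rule ccontr)
  have [measurable]: "A \<in> borel_measurable borel" using borel_measurable_integrable[OF A] by simp
  have [measurable]: "fst \<in> borel_measurable (borel :: ('a \<times> 'a) measure)" by (auto simp: borel_prod[symmetric])
  let ?I = "\<lambda>k \<zeta>. LINT z|lborel. cmod (A z) * cmod (\<Phi> (k * (fst z \<bullet> (\<zeta> + \<sigma> *\<^sub>R fst z))))"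
  assume neg: "\<not> ?thesis"
  have "\<exists>k \<zeta>. k > 0 \<and> L \<le> k * (1 + norm \<zeta>) \<and> e < ?I k \<zeta>" if "L > 0" for L
  proof -
    obtain k \<zeta> where "k > 0" "L \<le> k * (1 + norm \<zeta>)" "\<not> ?I k \<zeta> \<le> e" using neg \<open>L > 0\<close> by blast
    then show ?thesis by (intro exI[of _ k] exI[of _ \<zeta>]) simp
  qed
  then have "\<forall>n::nat. \<exists>k \<zeta>. k > 0 \<and> real (Suc n) \<le> k * (1 + norm \<zeta>) \<and> e < ?I k \<zeta>" by simp
  from choice[OF this] obtain k where "\<forall>n::nat. \<exists>\<zeta>. k n > 0 \<and> real (Suc n) \<le> k n * (1 + norm \<zeta>) \<and> e < ?I (k n) \<zeta>" ..
  from choice[OF this] obtain \<zeta> where kz: "\<forall>n::nat. k n > 0 \<and> real (Suc n) \<le> k n * (1 + norm (\<zeta> n)) \<and> e < ?I (k n) (\<zeta> n)" ..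
  \<comment> \<open>The norm of the first component plus the second is 1, so limits of subsequences
    cannot vanish.\<close>
  define y where "y = (\<lambda>n. (inverse (1 + norm (\<zeta> n)) *\<^sub>R \<zeta> n, inverse (1 + norm (\<zeta> n))))"
  have y1: "norm (fst (y n)) + snd (y n) = 1" for n
  proof -
    have "1 + norm (\<zeta> n) > 0" by (rule add_pos_nonneg) auto
    then show ?thesis by (simp add: y_def field_simps)
  qed
  have y2: "0 < snd (y n)" for n by (simp add: y_def add_pos_nonneg)
  have yin: "y n \<in> cball 0 1 \<times> cball 0 1" for n
  proof -
    have "norm (fst (y n)) \<le> 1" "\<bar>snd (y n)\<bar> \<le> 1"
      using y1[of n] y2[of n] norm_ge_zero[of "fst (y n)"] by linarith+
    then show ?thesis by (simp add: mem_Times_iff)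
  qed
  have "seq_compact (cball (0::'a) 1 \<times> cball (0::real) 1)"
    by (intro compact_imp_seq_compact compact_Times compact_cball)
  then obtain y0 r where r: "strict_mono r" and yl: "(y \<circ> r) \<longlonglongrightarrow> y0"
    using yin unfolding seq_compact_def by blast
  obtain z0 c0 where y0: "y0 = (z0, c0)" by (cases y0)
  have zl: "(\<lambda>n. fst (y (r n))) \<longlonglongrightarrow> z0" and cl: "(\<lambda>n. snd (y (r n))) \<longlonglongrightarrow> c0"
    using tendsto_fst[OF yl] tendsto_snd[OF yl] by (simp_all add: y0 o_def)
  have "(\<lambda>n. norm (fst (y (r n))) + snd (y (r n))) \<longlonglongrightarrow> norm z0 + c0" by (intro tendsto_intros zl cl)
  then have "norm z0 + c0 = 1" by (simp add: y1 LIMSEQ_const_iff)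
  then have nz: "z0 \<noteq> 0 \<or> \<sigma> * c0 \<noteq> 0" using \<sigma> by auto
  define lam where "lam = (\<lambda>n. k (r n) * (1 + norm (\<zeta> (r n))))"
  have "filterlim (\<lambda>n. real (Suc (r n))) at_top sequentially"
    by (intro filterlim_compose[OF filterlim_real_sequentially] filterlim_compose[OF filterlim_Suc] filterlim_subseq r)
  then have "filterlim lam at_top sequentially"
    by (rule filterlim_at_top_mono) (use kz in \<open>auto simp: lam_def\<close>)
  then have lam: "filterlim lam at_infinity sequentially"
    by (rule filterlim_mono[OF _ at_top_le_at_infinity order_refl])
  have arg: "k (r n) * (p \<bullet> (\<zeta> (r n) + \<sigma> *\<^sub>R p)) = (p \<bullet> fst (y (r n)) + \<sigma> * snd (y (r n)) * (norm p)\<^sup>2) * lam n" for n p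
  proof -
    define j where "j = 1 + norm (\<zeta> (r n))"
    have "j > 0" unfolding j_def by (rule add_pos_nonneg) auto
    then have j1: "inverse j * j = 1" by simp
    have "(p \<bullet> fst (y (r n)) + \<sigma> * snd (y (r n)) * (norm p)\<^sup>2) * lam n
        = (k (r n) * (p \<bullet> \<zeta> (r n) + \<sigma> * (p \<bullet> p))) * (inverse j * j)"
      unfolding y_def lam_def j_def[symmetric] power2_norm_eq_inner fst_conv snd_conv inner_scaleR_right
      by (simp only: algebra_simps)
    then show ?thesis unfolding j1 by (simp add: inner_add_right)
  qed
  have "(\<lambda>n. ?I (k (r n)) (\<zeta> (r n))) \<longlonglongrightarrow> (LINT z|(lborel :: ('a \<times> 'a) measure). (0::real))"
  proof (rule integral_dominated_convergence[where w = "\<lambda>z. cmod (A z) * B"])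
    have "AE p in lborel. p \<bullet> z0 + (\<sigma> * c0) * (norm p)\<^sup>2 \<noteq> 0" by (rule AE_quadric[OF nz])
    then have "AE z in lborel. fst (z::'a \<times> 'a) \<bullet> z0 + (\<sigma> * c0) * (norm (fst z))\<^sup>2 \<noteq> 0" by (rule AE_lborel_fst)
    then show "AE z in lborel. (\<lambda>n. cmod (A z) * cmod (\<Phi> (k (r n) * (fst z \<bullet> (\<zeta> (r n) + \<sigma> *\<^sub>R fst z))))) \<longlonglongrightarrow> 0"
    proof eventually_elim
      case (elim z)
      have "(\<lambda>n. fst z \<bullet> fst (y (r n)) + \<sigma> * snd (y (r n)) * (norm (fst z))\<^sup>2) \<longlonglongrightarrow> fst z \<bullet> z0 + \<sigma> * c0 * (norm (fst z))\<^sup>2"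
        by (intro tendsto_intros zl cl)
      from tendsto_mult_filterlim_at_infinity[OF this elim lam]
      have "filterlim (\<lambda>n. k (r n) * (fst z \<bullet> (\<zeta> (r n) + \<sigma> *\<^sub>R fst z))) at_infinity sequentially"
        by (simp only: arg)
      from filterlim_compose[OF lim this]
      show ?case by (intro tendsto_mult_right_zero tendsto_norm_zero)
    qed
    show "integrable lborel (\<lambda>z. cmod (A z) * B)" using A by simp
    show "AE z in lborel. norm (cmod (A z) * cmod (\<Phi> (k (r n) * (fst z \<bullet> (\<zeta> (r n) + \<sigma> *\<^sub>R fst z))))) \<le> cmod (A z) * B" for n
      by (intro AE_I2) (simp add: mult_left_mono B)
  qed measurable
  then have "(\<lambda>n. ?I (k (r n)) (\<zeta> (r n))) \<longlonglongrightarrow> 0" by simp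
  then have "e \<le> 0" by (rule LIMSEQ_le_const) (use kz less_imp_le in blast)
  then show False using e by simp
qed

text \<open>Translating t by pi/s reverses the sign of cis(s t). Twice the integral is therefore
  bounded by the integral of |\<phi> t - \<phi> (t + pi/s)|, which tends to 0 by continuity and
  compact support.\<close>

lemma riemann_lebesgue_Cc:
  fixes \<phi> :: "real \<Rightarrow> complex"
  assumes \<phi>: "\<phi> \<in> Cc"
  shows "((\<lambda>s. LINT t|lborel. \<phi> t * cis (s * t)) \<longlongrightarrow> 0) at_infinity"
proof (rule ccontr)
  let ?\<Phi> = "\<lambda>s. LINT t|lborel. \<phi> t * cis (s * t)"
  have [measurable]: "\<phi> \<in> borel_measurable borel" by (rule Cc_measurable[OF \<phi>])
  have \<phi>c: "continuous_on UNIV \<phi>" using \<phi> by (simp add: Cc_def)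
  assume "\<not> ?thesis"
  then obtain e where e: "e > 0" and "\<forall>b. \<exists>s. b \<le> norm s \<and> e \<le> cmod (?\<Phi> s)"
    unfolding Lim_at_infinity by (auto simp: not_less)
  then have "\<forall>n::nat. \<exists>s. real (Suc n) \<le> \<bar>s\<bar> \<and> e \<le> cmod (?\<Phi> s)" by simp
  from choice[OF this] obtain s where s: "\<And>n::nat. real (Suc n) \<le> \<bar>s n\<bar>" "\<And>n. e \<le> cmod (?\<Phi> (s n))" by blast
  define r where "r = (\<lambda>n. pi / s n)"
  have s0: "s n \<noteq> 0" for n using s(1)[of n] by auto
  have rb: "\<bar>r n\<bar> \<le> pi * (1 / real (Suc n))" for n
  proof -
    have "pi / \<bar>s n\<bar> \<le> pi / real (Suc n)" using s(1)[of n] by (intro divide_left_mono) auto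
    then show ?thesis by (simp add: r_def)
  qed
  have "r \<longlonglongrightarrow> 0"
  proof (rule Lim_null_comparison)
    show "\<forall>\<^sub>F n in sequentially. norm (r n) \<le> pi * (1 / real (Suc n))" using rb by simp
    show "(\<lambda>n. pi * (1 / real (Suc n))) \<longlonglongrightarrow> 0"
      by (intro tendsto_mult_right_zero LIMSEQ_Suc[OF lim_1_over_n])
  qed
  obtain C where C: "C > 0" "\<And>t. cmod (\<phi> t) \<le> C" using Cc_bounded[OF \<phi>] by blast
  obtain R where R: "\<And>t. R < norm t \<Longrightarrow> \<phi> t = 0" using \<phi> by (auto simp: Cc_def)
  have i: "integrable lborel (\<lambda>t. \<phi> t * cis (s n * t))" for n
    by (intro integrable_mult_cis Cc_integrable[OF \<phi>]) measurable
  have half: "2 * cmod (?\<Phi> (s n)) \<le> (LINT t|lborel. cmod (\<phi> t - \<phi> (r n + t)))" for n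
  proof -
    have "?\<Phi> (s n) = (LINT t|lborel. \<phi> (r n + t) * cis (s n * (r n + t)))"
      by (rule lborel_integral_translate[symmetric]) measurable
    also have "\<dots> = (LINT t|lborel. - (\<phi> (r n + t) * cis (s n * t)))"
    proof -
      have "s n * (r n + t) = pi + s n * t" for t using s0[of n] by (simp add: r_def field_simps)
      then show ?thesis by (simp add: cis_mult[symmetric])
    qed
    finally have "?\<Phi> (s n) + ?\<Phi> (s n) = (LINT t|lborel. \<phi> t * cis (s n * t)) + (LINT t|lborel. - (\<phi> (r n + t) * cis (s n * t)))" by simp
    also have "\<dots> = (LINT t|lborel. \<phi> t * cis (s n * t) + - (\<phi> (r n + t) * cis (s n * t)))"
    proof (rule Bochner_Integration.integral_add[symmetric, OF i])
      have "integrable lborel (\<lambda>t. \<phi> (r n + t))" by (rule lborel_integrable_translate[OF Cc_integrable[OF \<phi>]])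
      then show "integrable lborel (\<lambda>t. - (\<phi> (r n + t) * cis (s n * t)))"
        by (intro Bochner_Integration.integrable_minus integrable_mult_cis) measurable
    qed
    finally have d: "2 * ?\<Phi> (s n) = (LINT t|lborel. (\<phi> t - \<phi> (r n + t)) * cis (s n * t))"
      by (simp add: algebra_simps)
    have "2 * cmod (?\<Phi> (s n)) = cmod (2 * ?\<Phi> (s n))" by (simp add: norm_mult)
    also have "\<dots> \<le> (LINT t|lborel. cmod ((\<phi> t - \<phi> (r n + t)) * cis (s n * t)))" unfolding d by simp
    finally show ?thesis by (simp add: norm_mult)
  qed
  have "(\<lambda>n. LINT t|lborel. cmod (\<phi> t - \<phi> (r n + t))) \<longlonglongrightarrow> (LINT t|lborel. cmod (\<phi> t - \<phi> (0 + t)))"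
  proof (rule integral_dominated_convergence[where w = "\<lambda>t. 2 * C * indicator (cball 0 (R + pi)) t"])
    show "integrable lborel (\<lambda>t::real. 2 * C * indicator (cball 0 (R + pi)) t)"
      using emeasure_lborel_cball_finite[of "0::real" "R + pi"] by (intro integrable_mult_right) auto
    show "AE t in lborel. (\<lambda>n. cmod (\<phi> t - \<phi> (r n + t))) \<longlonglongrightarrow> cmod (\<phi> t - \<phi> (0 + t))"
    proof (rule AE_I2)
      fix t
      have "(\<lambda>n. r n + t) \<longlonglongrightarrow> 0 + t" by (intro tendsto_intros \<open>r \<longlonglongrightarrow> 0\<close>)
      then have "(\<lambda>n. \<phi> (r n + t)) \<longlonglongrightarrow> \<phi> (0 + t)"
        by (intro continuous_on_tendsto_compose[OF \<phi>c]) auto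
      then show "(\<lambda>n. cmod (\<phi> t - \<phi> (r n + t))) \<longlonglongrightarrow> cmod (\<phi> t - \<phi> (0 + t))" by (intro tendsto_intros)
    qed
    show "AE t in lborel. norm (cmod (\<phi> t - \<phi> (r n + t))) \<le> 2 * C * indicator (cball 0 (R + pi)) t" for n
    proof (rule AE_I2)
      fix t
      show "norm (cmod (\<phi> t - \<phi> (r n + t))) \<le> 2 * C * indicator (cball 0 (R + pi)) t"
      proof (cases "\<bar>t\<bar> \<le> R + pi")
        case True
        have "cmod (\<phi> t - \<phi> (r n + t)) \<le> C + C" by (rule order_trans[OF norm_triangle_ineq4 add_mono[OF C(2) C(2)]])
        then show ?thesis using True by simp
      next
        case False
        have "pi * (1 / real (Suc n)) \<le> pi" by (simp add: field_simps)
        then have "\<bar>r n\<bar> \<le> pi" using rb[of n] by linarith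
        then have "R < norm t" "R < norm (r n + t)" using False pi_gt_zero by (auto simp: abs_if split: if_splits)
        then show ?thesis using R C(1) by (simp add: indicator_def)
      qed
    qed
  qed measurable
  then have "(\<lambda>n. LINT t|lborel. cmod (\<phi> t - \<phi> (r n + t))) \<longlonglongrightarrow> 0" by simp
  then have "2 * e \<le> 0"
  proof (rule LIMSEQ_le_const)
    have "2 * e \<le> (LINT t|lborel. cmod (\<phi> t - \<phi> (r n + t)))" for n using half[of n] s(2)[of n] by linarith
    then show "\<exists>N. \<forall>n\<ge>N. 2 * e \<le> (LINT t|lborel. cmod (\<phi> t - \<phi> (r n + t)))" by blast
  qed
  then show False using e by simp
qed

section \<open>Phase forms, the free evolution and time averages\<close>

lemma phase_form_measurable:
  fixes S P :: "'c::euclidean_space \<Rightarrow> 'a::euclidean_space"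
  assumes [measurable]: "S \<in> borel_measurable borel" "P \<in> borel_measurable borel"
    "f \<in> borel_measurable borel" "g \<in> borel_measurable borel"
  shows "(\<lambda>z. phase_form (S z) (P z) f g) \<in> borel_measurable borel"
  unfolding phase_form_def by measurable

lemma phase_form_integrable:
  fixes S P :: "'c::euclidean_space \<Rightarrow> 'a::euclidean_space"
  assumes A: "integrable lborel A" and S: "S \<in> borel_measurable borel" and P: "P \<in> borel_measurable borel"
    and f: "f \<in> L2" and g: "g \<in> L2"
  shows "integrable lborel (\<lambda>z. A z * phase_form (S z) (P z) f g)"
proof (rule Bochner_Integration.integrable_bound)
  have [measurable]: "(\<lambda>z. phase_form (S z) (P z) f g) \<in> borel_measurable borel"
    by (rule phase_form_measurable[OF S P L2_measurable[OF f] L2_measurable[OF g]])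
  have [measurable]: "A \<in> borel_measurable borel" using borel_measurable_integrable[OF A] by simp
  show "(\<lambda>z. A z * phase_form (S z) (P z) f g) \<in> borel_measurable lborel" by measurable
  show "integrable lborel (\<lambda>z. cmod (A z) * (L2_norm f * L2_norm g))" using A by (intro integrable_mult_left integrable_norm)
  show "AE z in lborel. norm (A z * phase_form (S z) (P z) f g) \<le> norm (cmod (A z) * (L2_norm f * L2_norm g))"
    using phase_form_bound[OF f g] by (auto simp: norm_mult abs_mult L2_norm_nonneg intro!: AE_I2 mult_left_mono)
qed

lemma phase_form_integrand:
  assumes f: "f \<in> L2" and g: "g \<in> L2"
  shows "integrable lborel (\<lambda>x. cis (s \<bullet> (x - (1/2) *\<^sub>R p)) * (f (x - p) * cnj (g x)))"
proof -
  have "integrable lborel (\<lambda>x. (f (x - p) * cnj (g x)) * cis (s \<bullet> (x - (1/2) *\<^sub>R p)))"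
    by (intro integrable_mult_cis L2_inner_integrable shift_L2 f g) measurable
  then show ?thesis by (simp add: mult.commute)
qed

lemma phase_form_add_left:
  assumes "f \<in> L2" "f' \<in> L2" "g \<in> L2"
  shows "phase_form s p (\<lambda>x. f x + f' x) g = phase_form s p f g + phase_form s p f' g"
  unfolding phase_form_def distrib_right distrib_left
  by (rule Bochner_Integration.integral_add[OF phase_form_integrand phase_form_integrand]) (rule assms)+

lemma phase_form_add_right:
  assumes "f \<in> L2" "g \<in> L2" "g' \<in> L2"
  shows "phase_form s p f (\<lambda>x. g x + g' x) = phase_form s p f g + phase_form s p f g'"
  unfolding phase_form_def complex_cnj_add distrib_left
  by (rule Bochner_Integration.integral_add[OF phase_form_integrand phase_form_integrand]) (rule assms)+

text \<open>\<tau>(|x|^2 - |x - p|^2) = 2\<tau> p . (x - p/2), exactly the phase already present in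
  the form: evolution only adds 2\<tau>p to the displacement.\<close>

lemma phase_form_evolve:
  assumes f: "f \<in> L2" and f': "f' \<in> L2" and ae: "AE x in lborel. f' x = cis (- (\<tau> * (norm x)\<^sup>2)) * f x"
  shows "phase_form s p f' f' = phase_form (s + (2 * \<tau>) *\<^sub>R p) p f f"
  unfolding phase_form_def
proof (rule integral_cong_AE)
  have [measurable]: "f \<in> borel_measurable borel" "f' \<in> borel_measurable borel" by (auto intro!: L2_measurable f f')
  show "(\<lambda>x. cis (s \<bullet> (x - (1/2) *\<^sub>R p)) * (f' (x - p) * cnj (f' x))) \<in> borel_measurable lborel" by measurable
  show "(\<lambda>x. cis ((s + (2 * \<tau>) *\<^sub>R p) \<bullet> (x - (1/2) *\<^sub>R p)) * (f (x - p) * cnj (f x))) \<in> borel_measurable lborel" by measurable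
  from lborel_AE_translate[OF ae, of "- p"]
  have "AE x in lborel. f' (x - p) = cis (- (\<tau> * (norm (x - p))\<^sup>2)) * f (x - p)" by simp
  with ae show "AE x in lborel. cis (s \<bullet> (x - (1/2) *\<^sub>R p)) * (f' (x - p) * cnj (f' x))
      = cis ((s + (2 * \<tau>) *\<^sub>R p) \<bullet> (x - (1/2) *\<^sub>R p)) * (f (x - p) * cnj (f x))"
  proof eventually_elim
    case (elim x)
    have "s \<bullet> (x - (1/2) *\<^sub>R p) + (- (\<tau> * (norm (x - p))\<^sup>2) + \<tau> * (norm x)\<^sup>2) = (s + (2 * \<tau>) *\<^sub>R p) \<bullet> (x - (1/2) *\<^sub>R p)"
      by (simp add: power2_norm_eq_inner inner_diff_left inner_diff_right inner_add_left inner_commute algebra_simps)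
    then have "cis ((s + (2 * \<tau>) *\<^sub>R p) \<bullet> (x - (1/2) *\<^sub>R p))
        = cis (s \<bullet> (x - (1/2) *\<^sub>R p)) * (cis (- (\<tau> * (norm (x - p))\<^sup>2)) * cis (\<tau> * (norm x)\<^sup>2))"
      by (simp only: cis_mult)
    then show ?case unfolding elim by (simp add: cis_cnj mult_ac)
  qed
qed

lemma phase_form_cong_AE:
  assumes f: "f \<in> L2" and g: "g \<in> L2" and f': "f' \<in> L2" and g': "g' \<in> L2"
    and ae: "AE x in lborel. f x = f' x" "AE x in lborel. g x = g' x"
  shows "phase_form s p f g = phase_form s p f' g'"
  unfolding phase_form_def
proof (rule integral_cong_AE)
  from lborel_AE_translate[OF ae(1), of "- p"]
  have "AE x in lborel. f (x - p) = f' (x - p)" by simp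
  with ae(2) show "AE x in lborel. cis (s \<bullet> (x - (1/2) *\<^sub>R p)) * (f (x - p) * cnj (g x)) = cis (s \<bullet> (x - (1/2) *\<^sub>R p)) * (f' (x - p) * cnj (g' x))"
    by eventually_elim simp
qed (use phase_form_integrand[OF f g] phase_form_integrand[OF f' g'] in \<open>auto dest: borel_measurable_integrable\<close>)

text \<open>The Wigner form of the solution at time \<open>t\<close>, on the Fourier side, with \<open>k = \<alpha>h\<close>.\<close>

definition wigner_form ::
    "('a::euclidean_space \<times> 'a \<Rightarrow> complex) \<Rightarrow> real \<Rightarrow> real \<Rightarrow> real \<Rightarrow> ('a \<Rightarrow> complex) \<Rightarrow> ('a \<Rightarrow> complex) \<Rightarrow> complex" where
  "wigner_form A h k t f g = (LINT z|lborel. A z * phase_form (h *\<^sub>R snd z + (k * t) *\<^sub>R fst z) (fst z) f g)"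

lemma fst_snd_measurable [measurable]:
  "fst \<in> borel_measurable (borel :: ('a::euclidean_space \<times> 'b::euclidean_space) measure)"
  "snd \<in> borel_measurable (borel :: ('a::euclidean_space \<times> 'b::euclidean_space) measure)"
  by (auto simp: borel_prod[symmetric])

lemma weyl_schroedinger:
  fixes a :: "'a::euclidean_space \<times> 'a \<Rightarrow> complex"
  assumes a: "a \<in> test_fun" and h: "h > 0" and u: "u \<in> L2"
  shows "L2_inner (weyl_op h a (schroedinger (\<alpha> * h * t / 2) u)) (schroedinger (\<alpha> * h * t / 2) u)
    = wigner_form (ft a) h (\<alpha> * h) t (fourier u) (fourier u) / complex_of_real ((2 * pi) ^ DIM('a) * (2 * pi) ^ DIM('a))"
proof -
  let ?v = "schroedinger (\<alpha> * h * t / 2) u"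
  have v: "?v \<in> L2" by (rule schroedinger_L2[OF u])
  have "phase_form (h *\<^sub>R snd z) (fst z) (fourier ?v) (fourier ?v)
      = phase_form (h *\<^sub>R snd z + (2 * (\<alpha> * h * t / 2)) *\<^sub>R fst z) (fst z) (fourier u) (fourier u)" for z :: "'a \<times> 'a"
    by (rule phase_form_evolve[OF fourier_L2[OF u] fourier_L2[OF v] fourier_schroedinger[OF u]])
  then show ?thesis unfolding weyl_inner[OF a h v v] wigner_form_def by simp
qed

lemma wigner_integrable:
  fixes A :: "'a::euclidean_space \<times> 'a \<Rightarrow> complex"
  assumes "integrable lborel A" "f \<in> L2" "g \<in> L2"
  shows "integrable lborel (\<lambda>z. A z * phase_form (h *\<^sub>R snd z + (k * t) *\<^sub>R fst z) (fst z) f g)"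
  using assms by (intro phase_form_integrable) measurable

lemma wigner_form_bound:
  fixes A :: "'a::euclidean_space \<times> 'a \<Rightarrow> complex"
  assumes A: "integrable lborel A" and f: "f \<in> L2" and g: "g \<in> L2"
  shows "cmod (wigner_form A h k t f g) \<le> (LINT z|lborel. cmod (A z)) * (L2_norm f * L2_norm g)"
proof -
  have "cmod (wigner_form A h k t f g) \<le> (LINT z|lborel. cmod (A z) * (L2_norm f * L2_norm g))"
    unfolding wigner_form_def
  proof (rule integral_norm_le)
    show "integrable lborel (\<lambda>z. cmod (A z) * (L2_norm f * L2_norm g))" using A by (intro integrable_mult_left integrable_norm)
    show "cmod (A z * phase_form (h *\<^sub>R snd z + (k * t) *\<^sub>R fst z) (fst z) f g) \<le> cmod (A z) * (L2_norm f * L2_norm g)" for z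
      using phase_form_bound[OF f g] by (simp add: norm_mult mult_left_mono)
  qed
  then show ?thesis by simp
qed

lemma wigner_form_measurable:
  fixes A :: "'a::euclidean_space \<times> 'a \<Rightarrow> complex"
  assumes A: "A \<in> borel_measurable borel" and f: "f \<in> borel_measurable borel" and g: "g \<in> borel_measurable borel"
  shows "(\<lambda>t. wigner_form A h k t f g) \<in> borel_measurable borel"
proof -
  note [measurable] = A f g
  show ?thesis unfolding wigner_form_def phase_form_def by measurable
qed

text \<open>With f the low and g the high part, the terms other than the low-low one have g in at
  least one slot, which suffices for \<open>high_frequency_bound\<close>.\<close>

lemma wigner_form_split:
  fixes A :: "'a::euclidean_space \<times> 'a \<Rightarrow> complex"
  assumes A: "integrable lborel A" and f: "f \<in> L2" and g: "g \<in> L2"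
  shows "wigner_form A h k t (\<lambda>x. f x + g x) (\<lambda>x. f x + g x)
    = wigner_form A h k t f f + wigner_form A h k t g f + wigner_form A h k t (\<lambda>x. f x + g x) g"
proof -
  have fg: "(\<lambda>x. f x + g x) \<in> L2" by (rule L2_add[OF f g])
  have "wigner_form A h k t (\<lambda>x. f x + g x) (\<lambda>x. f x + g x)
      = (LINT z|lborel. (A z * phase_form (h *\<^sub>R snd z + (k * t) *\<^sub>R fst z) (fst z) f f
          + A z * phase_form (h *\<^sub>R snd z + (k * t) *\<^sub>R fst z) (fst z) g f)
          + A z * phase_form (h *\<^sub>R snd z + (k * t) *\<^sub>R fst z) (fst z) (\<lambda>x. f x + g x) g)"
    unfolding wigner_form_def phase_form_add_right[OF fg f g] phase_form_add_left[OF f g f] by (simp add: distrib_left)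
  then show ?thesis
    unfolding wigner_form_def
    by (simp only: Bochner_Integration.integral_add[OF Bochner_Integration.integrable_add[OF
          wigner_integrable[OF A f f] wigner_integrable[OF A g f]] wigner_integrable[OF A fg g]]
        Bochner_Integration.integral_add[OF wigner_integrable[OF A f f] wigner_integrable[OF A g f]])
qed

text \<open>Integrating over time first turns the evolution phase into a Fourier integral of \<phi>,
  so that the form acquires the multiplier to which \<open>schur_form\<close> applies.\<close>

lemma wigner_time_average:
  fixes A :: "'a::euclidean_space \<times> 'a \<Rightarrow> complex"
  assumes A: "integrable lborel A" and \<phi>: "integrable lborel \<phi>" and f: "f \<in> L2" and g: "g \<in> L2"
  shows "(LINT t|lborel. \<phi> t * wigner_form A h k t f g)
    = (LINT z|lborel. A z * (LINT x|lborel. (cis (h *\<^sub>R snd z \<bullet> (x - (1/2) *\<^sub>R fst z))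
        * (LINT t|lborel. \<phi> t * cis (k * (fst z \<bullet> (x + (-1/2) *\<^sub>R fst z)) * t))) * (f (x - fst z) * cnj (g x))))"
proof -
  have [measurable]: "A \<in> borel_measurable borel" "\<phi> \<in> borel_measurable borel"
    using borel_measurable_integrable[OF A] borel_measurable_integrable[OF \<phi>] by auto
  have [measurable]: "f \<in> borel_measurable borel" "g \<in> borel_measurable borel" by (auto intro!: L2_measurable f g)
  let ?pf = "\<lambda>t z. phase_form (h *\<^sub>R snd z + (k * t) *\<^sub>R fst z) (fst z) f g"
  have "(LINT t|lborel. \<phi> t * wigner_form A h k t f g) = (LINT t|lborel. LINT z|lborel. \<phi> t * (A z * ?pf t z))"
    unfolding wigner_form_def by simp
  also have "\<dots> = (LINT z|lborel. LINT t|lborel. \<phi> t * (A z * ?pf t z))"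
  proof (rule lborel_Fubini_product_bound(1)[OF _ \<phi>])
    show "(\<lambda>(t, z). \<phi> t * (A z * ?pf t z)) \<in> borel_measurable (borel \<Otimes>\<^sub>M borel)"
      unfolding phase_form_def by measurable
    show "integrable lborel (\<lambda>z. A z * complex_of_real (L2_norm f * L2_norm g))" using A by (intro integrable_mult_left)
    show "cmod (\<phi> t * (A z * ?pf t z)) \<le> cmod (\<phi> t) * cmod (A z * complex_of_real (L2_norm f * L2_norm g))" for t z
      using phase_form_bound[OF f g] unfolding norm_mult norm_of_real
      by (intro mult_left_mono) (auto simp: abs_mult L2_norm_nonneg intro!: mult_left_mono)
  qed
  also have "\<dots> = (LINT z|lborel. A z * (LINT x|lborel. (cis (h *\<^sub>R snd z \<bullet> (x - (1/2) *\<^sub>R fst z))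
        * (LINT t|lborel. \<phi> t * cis (k * (fst z \<bullet> (x + (-1/2) *\<^sub>R fst z)) * t))) * (f (x - fst z) * cnj (g x))))"
  proof (rule Bochner_Integration.integral_cong[OF refl])
    fix z :: "'a \<times> 'a"
    let ?F = "\<lambda>x. f (x - fst z) * cnj (g x)"
    let ?h = "\<lambda>x. cis (h *\<^sub>R snd z \<bullet> (x - (1/2) *\<^sub>R fst z))"
    let ?a = "\<lambda>x. k * (fst z \<bullet> (x + (-1/2) *\<^sub>R fst z))"
    have Fi: "integrable lborel ?F" by (intro L2_inner_integrable shift_L2 f g)
    have e: "\<phi> t * (cis ((h *\<^sub>R snd z + (k * t) *\<^sub>R fst z) \<bullet> (x - (1/2) *\<^sub>R fst z)) * ?F x)
        = (?h x * ?F x) * (\<phi> t * cis (?a x * t))" for t x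
    proof -
      have "(h *\<^sub>R snd z + (k * t) *\<^sub>R fst z) \<bullet> (x - (1/2) *\<^sub>R fst z) = h *\<^sub>R snd z \<bullet> (x - (1/2) *\<^sub>R fst z) + ?a x * t"
        by (simp add: inner_add_left)
      then show ?thesis by (simp only: cis_mult[symmetric] mult_ac)
    qed
    have "(LINT t|lborel. \<phi> t * (A z * ?pf t z)) = (LINT t|lborel. A z * (\<phi> t * ?pf t z))" by (simp add: mult.left_commute)
    also have "\<dots> = A z * (LINT t|lborel. \<phi> t * ?pf t z)" by (rule integral_mult_right_zero)
    also have "(LINT t|lborel. \<phi> t * ?pf t z) = (LINT t|lborel. LINT x|lborel. (?h x * ?F x) * (\<phi> t * cis (?a x * t)))"
      unfolding phase_form_def e[symmetric] by simp
    also have "\<dots> = (LINT x|lborel. LINT t|lborel. (?h x * ?F x) * (\<phi> t * cis (?a x * t)))"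
      by (rule lborel_Fubini_product_bound(1)[OF _ \<phi> Fi]) (measurable, simp add: norm_mult mult.commute)
    also have "\<dots> = (LINT x|lborel. (?h x * (LINT t|lborel. \<phi> t * cis (?a x * t))) * ?F x)"
      unfolding integral_mult_right_zero by (simp only: mult_ac)
    finally show "(LINT t|lborel. \<phi> t * (A z * ?pf t z)) = A z * (LINT x|lborel. (?h x * (LINT t|lborel. \<phi> t * cis (?a x * t))) * ?F x)" .
  qed
  finally show ?thesis .
qed

text \<open>The threshold is uniform in h because h enters through a factor of modulus 1, and
  uniform in k because \<open>oscillation_small\<close> depends on k and \<zeta> through k(1 +
  |\<zeta>|).\<close>

lemma high_frequency_bound:
  fixes A :: "'a::euclidean_space \<times> 'a \<Rightarrow> complex"
  assumes A: "integrable lborel A" and \<phi>: "\<phi> \<in> Cc" and \<eta>: "\<eta> > 0" and M: "M \<ge> 0"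
  shows "\<exists>L>0. \<forall>h k f g. k > 0 \<longrightarrow> f \<in> L2 \<longrightarrow> g \<in> L2 \<longrightarrow> L2_norm f \<le> M \<longrightarrow> L2_norm g \<le> M \<longrightarrow>
    (\<forall>x. g x \<noteq> 0 \<longrightarrow> L \<le> k * (1 + norm x)) \<or> (\<forall>x. f x \<noteq> 0 \<longrightarrow> L \<le> k * (1 + norm x)) \<longrightarrow>
    cmod (LINT t|lborel. \<phi> t * wigner_form A h k t f g) \<le> \<eta>"
proof -
  have \<phi>i: "integrable lborel \<phi>" by (rule Cc_integrable[OF \<phi>])
  have [measurable]: "\<phi> \<in> borel_measurable borel" by (rule Cc_measurable[OF \<phi>])
  have [measurable]: "A \<in> borel_measurable borel" using borel_measurable_integrable[OF A] by simp
  define \<Phi> where "\<Phi> = (\<lambda>s. LINT t|lborel. \<phi> t * cis (s * t))"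
  have \<Phi>m [measurable]: "\<Phi> \<in> borel_measurable borel" unfolding \<Phi>_def by measurable
  let ?B = "LINT t|lborel. cmod (\<phi> t)" and ?W = "LINT z|lborel. cmod (A z)"
  have B: "cmod (\<Phi> s) \<le> ?B" for s
  proof -
    have "cmod (\<Phi> s) \<le> (LINT t|lborel. cmod (\<phi> t * cis (s * t)))" unfolding \<Phi>_def by simp
    then show ?thesis by (simp add: norm_mult)
  qed
  have lim: "(\<Phi> \<longlongrightarrow> 0) at_infinity" unfolding \<Phi>_def by (rule riemann_lebesgue_Cc[OF \<phi>])
  have BW: "0 \<le> ?B * ?W * M\<^sup>2" by (intro mult_nonneg_nonneg) auto
  \<comment> \<open>The Schur parameter is fixed first, so that the term with the uniform bound is
    at most \<eta>/2. The added 1 avoids a division by 0.\<close>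
  define l where "l = \<eta> / (2 * (?B * ?W * M\<^sup>2 + 1))"
  have "0 < 2 * (X + 1)" if "0 \<le> X" for X :: real using that by simp
  from this[OF BW] have BW1: "0 < 2 * (?B * ?W * M\<^sup>2 + 1)" .
  have l: "l > 0" unfolding l_def by (rule divide_pos_pos[OF \<eta> BW1])
  \<comment> \<open>Chosen after l: the other Schur term is at most e M^2 / l, hence at most
    \<eta>/2.\<close>
  define e where "e = \<eta> * l / (2 * (M\<^sup>2 + 1))"
  have e: "e > 0" unfolding e_def using \<eta> l by (intro divide_pos_pos mult_pos_pos) (auto simp: add_nonneg_pos)
  obtain L1 where L1: "L1 > 0" "\<forall>k>0. \<forall>\<zeta>. L1 \<le> k * (1 + norm \<zeta>) \<longrightarrow>
    (LINT z|lborel. cmod (A z) * cmod (\<Phi> (k * (fst z \<bullet> (\<zeta> + (-1/2) *\<^sub>R fst z))))) \<le> e"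
    using oscillation_small[OF A \<Phi>m B lim e, of "-1/2"] by auto
  \<comment> \<open>The sign +1/2 belongs to the case where f is the high factor: the form is then
    recentred by x to p + x, and (p + x) - p/2 = x + p/2.\<close>
  obtain L2' where L2': "L2' > 0" "\<forall>k>0. \<forall>\<zeta>. L2' \<le> k * (1 + norm \<zeta>) \<longrightarrow>
    (LINT z|lborel. cmod (A z) * cmod (\<Phi> (k * (fst z \<bullet> (\<zeta> + (1/2) *\<^sub>R fst z))))) \<le> e"
    using oscillation_small[OF A \<Phi>m B lim e, of "1/2"] by auto
  have nn: "(\<integral>\<^sup>+z. ennreal (cmod (A z) * cmod (\<Phi> (k * (fst z \<bullet> (\<zeta> + \<sigma> *\<^sub>R fst z))))) \<partial>lborel)
      = ennreal (LINT z|lborel. cmod (A z) * cmod (\<Phi> (k * (fst z \<bullet> (\<zeta> + \<sigma> *\<^sub>R fst z)))))" for k \<zeta> \<sigma>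
  proof (rule nn_integral_eq_integral)
    show "integrable lborel (\<lambda>z. cmod (A z) * cmod (\<Phi> (k * (fst z \<bullet> (\<zeta> + \<sigma> *\<^sub>R fst z)))))"
    proof (rule Bochner_Integration.integrable_bound)
      show "integrable lborel (\<lambda>z. cmod (A z) * ?B)" using A by (intro integrable_mult_left integrable_norm)
      show "AE z in lborel. norm (cmod (A z) * cmod (\<Phi> (k * (fst z \<bullet> (\<zeta> + \<sigma> *\<^sub>R fst z))))) \<le> norm (cmod (A z) * ?B)"
        by (intro AE_I2) (simp add: abs_mult mult_left_mono B)
    qed measurable
  qed auto
  show ?thesis
  proof (intro exI[of _ "max L1 L2'"] conjI allI impI)
    show "max L1 L2' > 0" using L1(1) by simp
    fix h k :: real and f g :: "'a \<Rightarrow> complex"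
    assume k: "k > 0" and f: "f \<in> L2" and g: "g \<in> L2" and fM: "L2_norm f \<le> M" and gM: "L2_norm g \<le> M"
      and supp: "(\<forall>x. g x \<noteq> 0 \<longrightarrow> max L1 L2' \<le> k * (1 + norm x)) \<or> (\<forall>x. f x \<noteq> 0 \<longrightarrow> max L1 L2' \<le> k * (1 + norm x))"
    let ?m = "\<lambda>(z :: 'a \<times> 'a) x. cis (h *\<^sub>R snd z \<bullet> (x - (1/2) *\<^sub>R fst z)) * \<Phi> (k * (fst z \<bullet> (x + (-1/2) *\<^sub>R fst z)))"
    have mm: "case_prod ?m \<in> borel_measurable (borel \<Otimes>\<^sub>M borel)" by measurable
    have mB: "cmod (?m z x) \<le> ?B" for z x using B by (simp add: norm_mult)
    have sm: "(\<forall>x. g x \<noteq> 0 \<longrightarrow> (\<integral>\<^sup>+z. ennreal (cmod (A z) * cmod (?m z x)) \<partial>lborel) \<le> ennreal e)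
      \<or> (\<forall>x. f x \<noteq> 0 \<longrightarrow> (\<integral>\<^sup>+z. ennreal (cmod (A z) * cmod (?m z (fst z + x))) \<partial>lborel) \<le> ennreal e)"
      using supp
    proof
      assume s: "\<forall>x. g x \<noteq> 0 \<longrightarrow> max L1 L2' \<le> k * (1 + norm x)"
      have "(\<integral>\<^sup>+z. ennreal (cmod (A z) * cmod (?m z x)) \<partial>lborel) \<le> ennreal e" if "g x \<noteq> 0" for x
      proof -
        have "(\<integral>\<^sup>+z. ennreal (cmod (A z) * cmod (?m z x)) \<partial>lborel)
            = (\<integral>\<^sup>+z. ennreal (cmod (A z) * cmod (\<Phi> (k * (fst z \<bullet> (x + (-1/2) *\<^sub>R fst z))))) \<partial>lborel)"
          by (simp only: norm_mult norm_cis mult_1)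
        also have "\<dots> \<le> ennreal e" unfolding nn using s that L1(2) k by (intro ennreal_leI) auto
        finally show ?thesis .
      qed
      then show ?thesis by blast
    next
      assume s: "\<forall>x. f x \<noteq> 0 \<longrightarrow> max L1 L2' \<le> k * (1 + norm x)"
      have "(\<integral>\<^sup>+z. ennreal (cmod (A z) * cmod (?m z (fst z + x))) \<partial>lborel) \<le> ennreal e" if "f x \<noteq> 0" for x
      proof -
        have "fst z + x + (-1/2) *\<^sub>R fst z = x + (1/2) *\<^sub>R fst z" for z :: "'a \<times> 'a"
          using scaleR_add_left[of 1 "-1/2" "fst z"] by (simp add: algebra_simps)
        then have "(\<integral>\<^sup>+z. ennreal (cmod (A z) * cmod (?m z (fst z + x))) \<partial>lborel)
            = (\<integral>\<^sup>+z. ennreal (cmod (A z) * cmod (\<Phi> (k * (fst z \<bullet> (x + (1/2) *\<^sub>R fst z))))) \<partial>lborel)"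
          by (simp only: norm_mult norm_cis mult_1)
        also have "\<dots> \<le> ennreal e" unfolding nn using s that L2'(2) k by (intro ennreal_leI) auto
        finally show ?thesis .
      qed
      then show ?thesis by blast
    qed
    let ?S = "(L2_norm f)\<^sup>2 + (L2_norm g)\<^sup>2"
    have S: "?S \<le> 2 * M\<^sup>2" using power_mono[OF fM L2_norm_nonneg, of 2] power_mono[OF gM L2_norm_nonneg, of 2] by simp
    have "cmod (LINT t|lborel. \<phi> t * wigner_form A h k t f g) \<le> (l / 2) * ?B * ?W * ?S + e / (2 * l) * ?S"
      unfolding wigner_time_average[OF A \<phi>i f g] \<Phi>_def[symmetric]
      using schur_form[OF A fst_snd_measurable(1) mm mB f g l less_imp_le[OF e] sm] unfolding \<Phi>_def by simp
    also have "\<dots> \<le> (l / 2) * ?B * ?W * (2 * M\<^sup>2) + e / (2 * l) * (2 * M\<^sup>2)"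
      using S l e by (intro add_mono mult_left_mono) (auto intro!: mult_nonneg_nonneg)
    also have "\<dots> = l * (?B * ?W * M\<^sup>2) + e * M\<^sup>2 / l" using l by (simp add: field_simps)
    also have "\<dots> \<le> \<eta> / 2 + \<eta> / 2"
    proof (rule add_mono)
      have cancel: "\<eta> / (2 * X) * X = \<eta> / 2" if "2 * X \<noteq> 0" for X using that by (simp add: field_simps)
      have "l * (?B * ?W * M\<^sup>2) \<le> l * (?B * ?W * M\<^sup>2 + 1)" using l by (intro mult_left_mono) auto
      also have "\<dots> = \<eta> / 2" unfolding l_def by (rule cancel) (rule less_imp_neq[OF BW1, symmetric])
      finally show "l * (?B * ?W * M\<^sup>2) \<le> \<eta> / 2" .
      have "\<eta> * l / (2 * Y) * X / l = \<eta> / 2 * (X / Y)" for X Y using l by simp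
      then have "e * M\<^sup>2 / l = \<eta> / 2 * (M\<^sup>2 / (M\<^sup>2 + 1))" unfolding e_def .
      also have "\<dots> \<le> \<eta> / 2 * 1" using \<eta> by (intro mult_left_mono) (auto simp: divide_le_eq add_nonneg_pos)
      finally show "e * M\<^sup>2 / l \<le> \<eta> / 2" by simp
    qed
    finally show "cmod (LINT t|lborel. \<phi> t * wigner_form A h k t f g) \<le> \<eta>" by simp
  qed
qed

section \<open>Commutators of multiplication operators and Fourier multipliers\<close>

text \<open>The common size of all commutator errors: F weights the translations, K |Q| bounds the
  change of a phase or a multiplier under each, and the cap 2 keeps the integral finite for every
  integrable F.\<close>

definition osc_modulus :: "('c::euclidean_space \<Rightarrow> complex) \<Rightarrow> ('c \<Rightarrow> 'a::real_normed_vector) \<Rightarrow> real \<Rightarrow> real" where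
  "osc_modulus F Q K = (LINT z|lborel. cmod (F z) * min 2 (K * norm (Q z)))"

lemma osc_modulus_integrable:
  fixes Q :: "'c::euclidean_space \<Rightarrow> 'a::euclidean_space"
  assumes F: "integrable lborel F" and [measurable]: "Q \<in> borel_measurable borel" and K: "K \<ge> 0"
  shows "integrable lborel (\<lambda>z. cmod (F z) * min 2 (K * norm (Q z)))"
proof (rule Bochner_Integration.integrable_bound)
  have [measurable]: "F \<in> borel_measurable borel" using borel_measurable_integrable[OF F] by simp
  show "integrable lborel (\<lambda>z. cmod (F z) * 2)" using F by (intro integrable_mult_left integrable_norm)
  show "(\<lambda>z. cmod (F z) * min 2 (K * norm (Q z))) \<in> borel_measurable lborel" by measurable
  show "AE z in lborel. norm (cmod (F z) * min 2 (K * norm (Q z))) \<le> norm (cmod (F z) * 2)"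
    using K by (intro AE_I2) (simp add: abs_mult mult_left_mono)
qed

lemma osc_modulus_nonneg: "K \<ge> 0 \<Longrightarrow> 0 \<le> osc_modulus F Q K"
  unfolding osc_modulus_def by (intro Bochner_Integration.integral_nonneg) auto

lemma osc_modulus_mono:
  fixes Q :: "'c::euclidean_space \<Rightarrow> 'a::euclidean_space"
  assumes F: "integrable lborel F" and Q: "Q \<in> borel_measurable borel" and K: "0 \<le> K" "K \<le> K'"
  shows "osc_modulus F Q K \<le> osc_modulus F Q K'"
  unfolding osc_modulus_def
proof (rule integral_mono)
  show "integrable lborel (\<lambda>z. cmod (F z) * min 2 (K * norm (Q z)))" by (rule osc_modulus_integrable[OF F Q K(1)])
  show "integrable lborel (\<lambda>z. cmod (F z) * min 2 (K' * norm (Q z)))" using K by (intro osc_modulus_integrable F Q) simp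
  show "cmod (F z) * min 2 (K * norm (Q z)) \<le> cmod (F z) * min 2 (K' * norm (Q z))" for z
    using mult_right_mono[OF K(2) norm_ge_zero[of "Q z"]] by (intro mult_left_mono) auto
qed

lemma osc_modulus_small:
  fixes Q :: "'c::euclidean_space \<Rightarrow> 'a::euclidean_space"
  assumes F: "integrable lborel F" and Q [measurable]: "Q \<in> borel_measurable borel" and e: "e > 0"
  shows "\<exists>\<delta>>0. \<forall>K. 0 \<le> K \<longrightarrow> K \<le> \<delta> \<longrightarrow> osc_modulus F Q K \<le> e"
proof -
  have [measurable]: "F \<in> borel_measurable borel" using borel_measurable_integrable[OF F] by simp
  have inv: "(\<lambda>n. 1 / real (Suc n)) \<longlonglongrightarrow> 0" by (rule lim_1_over_real_power[of 1, simplified, THEN LIMSEQ_Suc])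
  have "(\<lambda>n. osc_modulus F Q (1 / real (Suc n))) \<longlonglongrightarrow> (LINT z|(lborel :: 'c measure). 0)"
    unfolding osc_modulus_def
  proof (rule integral_dominated_convergence)
    show "integrable lborel (\<lambda>z. cmod (F z) * 2)" using F by (intro integrable_mult_left integrable_norm)
    show "AE z in lborel. (\<lambda>n. cmod (F z) * min 2 (1 / real (Suc n) * norm (Q z))) \<longlonglongrightarrow> 0"
    proof (rule AE_I2)
      fix z
      have "(\<lambda>n. cmod (F z) * min 2 (1 / real (Suc n) * norm (Q z))) \<longlonglongrightarrow> cmod (F z) * min 2 (0 * norm (Q z))"
        by (intro tendsto_intros inv)
      then show "(\<lambda>n. cmod (F z) * min 2 (1 / real (Suc n) * norm (Q z))) \<longlonglongrightarrow> 0" by simp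
    qed
    show "AE z in lborel. norm (cmod (F z) * min 2 (1 / real (Suc n) * norm (Q z))) \<le> cmod (F z) * 2" for n
      by (intro AE_I2) (simp add: abs_mult mult_left_mono)
  qed measurable
  then have "(\<lambda>n. osc_modulus F Q (1 / real (Suc n))) \<longlonglongrightarrow> 0" by simp
  from order_tendstoD(2)[OF this e] obtain n where n: "osc_modulus F Q (1 / real (Suc n)) < e"
    unfolding eventually_sequentially by blast
  have "osc_modulus F Q K \<le> e" if "0 \<le> K" "K \<le> 1 / real (Suc n)" for K
    using osc_modulus_mono[OF F Q that] n by linarith
  then show ?thesis by (intro exI[of _ "1 / real (Suc n)"]) auto
qed

lemma osc_modulus_form:
  fixes Q :: "'c::euclidean_space \<Rightarrow> 'b::euclidean_space" and f g :: "'a::euclidean_space \<Rightarrow> complex"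
  assumes F: "integrable lborel F" and Q: "Q \<in> borel_measurable borel" and K: "K \<ge> 0" and f: "f \<in> L2" and g: "g \<in> L2"
    and m: "\<And>z x. f (x - P z) \<noteq> 0 \<Longrightarrow> g x \<noteq> 0 \<Longrightarrow> cmod (m z x) \<le> min 2 (K * norm (Q z))"
  shows "cmod (LINT z|lborel. F z * (LINT x|lborel. m z x * (f (x - P z) * cnj (g x))))
    \<le> osc_modulus F Q K * (L2_norm f * L2_norm g)"
proof -
  have "cmod (LINT z|lborel. F z * (LINT x|lborel. m z x * (f (x - P z) * cnj (g x))))
      \<le> (LINT z|lborel. (cmod (F z) * min 2 (K * norm (Q z))) * (L2_norm f * L2_norm g))"
  proof (rule integral_norm_le)
    show "integrable lborel (\<lambda>z. (cmod (F z) * min 2 (K * norm (Q z))) * (L2_norm f * L2_norm g))"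
      by (intro integrable_mult_left osc_modulus_integrable F Q K)
    show "cmod (F z * (LINT x|lborel. m z x * (f (x - P z) * cnj (g x))))
        \<le> (cmod (F z) * min 2 (K * norm (Q z))) * (L2_norm f * L2_norm g)" for z
      unfolding norm_mult mult.assoc using K
      by (intro mult_left_mono shifted_form_bound f g) (auto dest: m)
  qed
  then show ?thesis unfolding osc_modulus_def by simp
qed

lemma cis_diff_bound: "cmod (cis a - cis b) \<le> min 2 \<bar>a - b\<bar>"
proof -
  have "cmod (cis (a - b) - 1) \<le> \<bar>a - b\<bar>"
    using iexp_approx1[of "a - b" 0] by (simp add: cis_conv_exp)
  moreover have "cis a - cis b = cis b * (cis (a - b) - 1)" by (simp add: right_diff_distrib cis_mult)
  ultimately have "cmod (cis a - cis b) \<le> \<bar>a - b\<bar>" by (simp add: norm_mult)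
  moreover have "cmod (cis a - cis b) \<le> 2" using norm_triangle_ineq4[of "cis a" "cis b"] by simp
  ultimately show ?thesis by simp
qed

lemma test_fun_lipschitz:
  assumes f: "f \<in> test_fun"
  obtains L where "L \<ge> 0" "\<And>x y. cmod (f x - f y) \<le> L * norm (x - y)"
proof -
  have "\<exists>C>0. \<forall>x. cmod (partial_deriv b f x) \<le> C" if "b \<in> Basis" for b
    using Cc_bounded[OF test_fun_Cc[OF test_fun_partial[OF f that]]] by metis
  then obtain C where C: "\<And>b. b \<in> Basis \<Longrightarrow> C b > 0" "\<And>b x. b \<in> Basis \<Longrightarrow> cmod (partial_deriv b f x) \<le> C b"
    by metis
  have d: "(f has_derivative frechet_derivative f (at x)) (at x)" for x
    using f smooth_has_derivative unfolding test_fun_def by blast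
  show ?thesis
  proof (rule that[of "\<Sum>b\<in>Basis. C b"])
    show "0 \<le> (\<Sum>b\<in>Basis. C b)" using C(1) by (intro sum_nonneg less_imp_le) auto
    fix x y
    show "cmod (f x - f y) \<le> (\<Sum>b\<in>Basis. C b) * norm (x - y)"
    proof (rule differentiable_bound[of UNIV])
      show "(f has_derivative frechet_derivative f (at x)) (at x within UNIV)" for x using d[of x] by simp
      fix x
      have l: "linear (frechet_derivative f (at x))" by (rule has_derivative_linear[OF d])
      show "onorm (frechet_derivative f (at x)) \<le> (\<Sum>b\<in>Basis. C b)"
      proof (rule onorm_bound)
        show "0 \<le> (\<Sum>b\<in>Basis. C b)" using C(1) by (intro sum_nonneg less_imp_le) auto
        fix y
        have "frechet_derivative f (at x) y = (\<Sum>b\<in>Basis. (y \<bullet> b) *\<^sub>R partial_deriv b f x)"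
          unfolding partial_deriv_def
          by (subst (1) euclidean_representation[symmetric, of y]) (simp only: linear_sum[OF l] linear_cmul[OF l])
        also have "cmod \<dots> \<le> (\<Sum>b\<in>Basis. C b * norm y)"
        proof (rule sum_norm_le)
          fix b :: 'a assume b: "b \<in> Basis"
          have "cmod (partial_deriv b f x) * \<bar>y \<bullet> b\<bar> \<le> C b * norm y"
            using C[OF b] Basis_le_norm[OF b, of y] by (intro mult_mono) (auto intro: less_imp_le)
          then show "cmod ((y \<bullet> b) *\<^sub>R partial_deriv b f x) \<le> C b * norm y" by (simp add: mult.commute)
        qed
        finally show "norm (frechet_derivative f (at x) y) \<le> (\<Sum>b\<in>Basis. C b) * norm y" by (simp add: sum_distrib_right)
      qed
    qed auto
  qed
qed

lemma ft_bump_scale: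
  fixes p :: "'a::euclidean_space"
  assumes N: "(N::real) > 0"
  shows "ft (\<lambda>x. complex_of_real (bump c N x)) p = complex_of_real (N ^ DIM('a)) * ft (\<lambda>x. complex_of_real (bump c 1 x)) (N *\<^sub>R p)"
proof -
  let ?f = "\<lambda>x. complex_of_real (bump c N x) * cis (- (x \<bullet> p))"
  have b: "bump c N (N *\<^sub>R x) = bump c 1 x" for x :: 'a using N unfolding bump_def by simp
  have "(LINT x|lborel. ?f x) = \<bar>N\<bar> ^ DIM('a) *\<^sub>R (LINT x|lborel. ?f (0 + N *\<^sub>R x))"
    using N by (intro lborel_integral_scale) auto
  then show ?thesis using N unfolding ft_def by (simp add: b scaleR_conv_of_real)
qed

text \<open>Widening a bump concentrates its transform without changing the total mass of that
  transform, so the width N divides K. This makes a fixed K harmless for large N.\<close>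

lemma osc_modulus_bump:
  fixes N :: real
  assumes N: "N > 0"
  shows "osc_modulus (ft (\<lambda>x::'a::euclidean_space. complex_of_real (bump c N x))) (\<lambda>p. p) K
    = osc_modulus (ft (\<lambda>x::'a. complex_of_real (bump c 1 x))) (\<lambda>p. p) (K / N)"
proof -
  have [measurable]: "ft (\<lambda>x::'a. complex_of_real (bump c 1 x)) \<in> borel_measurable borel" by measurable
  let ?G = "\<lambda>y. cmod (ft (\<lambda>x::'a. complex_of_real (bump c 1 x)) y) * min 2 (K / N * norm y)"
  have "(LINT y|lborel. ?G y) = \<bar>N\<bar> ^ DIM('a) *\<^sub>R (LINT y|lborel. ?G (0 + N *\<^sub>R y))"
    using N by (intro lborel_integral_scale) auto
  then show ?thesis unfolding osc_modulus_def ft_bump_scale[OF N] using N by (simp add: norm_mult norm_power mult.assoc)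
qed

text \<open>The map P allows weights on phase space: with P = \<open>fst\<close> the formula also
  covers multiplication by a(x, 0), whose weight is \<open>ft a\<close>.\<close>

lemma multiplier_form:
  fixes \<mu> :: "'c::euclidean_space \<Rightarrow> complex" and w v :: "'a::euclidean_space \<Rightarrow> complex"
  assumes \<mu>: "integrable lborel \<mu>" and P [measurable]: "P \<in> borel_measurable borel"
    and \<theta>: "\<And>x. \<theta> x = (LINT z|lborel. \<mu> z * cis (x \<bullet> P z))" and w: "w \<in> L2" and v: "v \<in> L2"
  shows "(LINT x|lborel. \<theta> x * (w x * cnj (v x))) = (LINT z|lborel. \<mu> z * phase_form 0 (P z) (fourier w) (fourier v))"
proof -
  have [measurable]: "\<mu> \<in> borel_measurable borel" using borel_measurable_integrable[OF \<mu>] by simp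
  have [measurable]: "w \<in> borel_measurable borel" "v \<in> borel_measurable borel" by (auto intro!: L2_measurable w v)
  have e: "phase_form 0 p (fourier w) (fourier v) = (LINT x|lborel. cis (x \<bullet> p) * (w x * cnj (v x)))" for p
    using phase_translation_inner[OF w v, of 0 p] by (simp add: mult.assoc)
  have "(LINT z|lborel. \<mu> z * phase_form 0 (P z) (fourier w) (fourier v))
      = (LINT z|lborel. LINT x|lborel. \<mu> z * (cis (x \<bullet> P z) * (w x * cnj (v x))))"
    unfolding e by simp
  also have "\<dots> = (LINT x|lborel. LINT z|lborel. \<mu> z * (cis (x \<bullet> P z) * (w x * cnj (v x))))"
    by (rule lborel_Fubini_product_bound(1)[OF _ \<mu> L2_inner_integrable[OF w v]]) (measurable, simp add: norm_mult)
  also have "\<dots> = (LINT x|lborel. \<theta> x * (w x * cnj (v x)))"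
    unfolding \<theta> by (simp add: mult.assoc[symmetric])
  finally show ?thesis by simp
qed

lemma borel_ident: "(\<lambda>x. x) \<in> borel_measurable (borel :: 'a::topological_space measure)"
  by simp

lemma test_fun_multiplier:
  fixes \<theta> :: "'a::euclidean_space \<Rightarrow> complex"
  assumes \<theta>: "\<theta> \<in> test_fun" and w: "w \<in> L2" and v: "v \<in> L2"
  shows "(LINT x|lborel. \<theta> x * (w x * cnj (v x)))
    = (LINT p|lborel. ft \<theta> p * phase_form 0 p (fourier w) (fourier v)) / complex_of_real ((2 * pi) ^ DIM('a))"
proof -
  let ?c = "complex_of_real ((2 * pi) ^ DIM('a))"
  have "integrable lborel (\<lambda>p. ft \<theta> p / ?c)" using ft_test_fun_integrable[OF \<theta>] by (rule integrable_divide)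
  from multiplier_form[OF this borel_ident _ w v, of \<theta>]
  show ?thesis by (simp add: ft_inversion_test_fun[OF \<theta>] del: of_real_mult of_real_power)
qed

lemma real_multiplier_L2:
  fixes m :: "'a::euclidean_space \<Rightarrow> real"
  assumes "m \<in> borel_measurable borel" "\<And>x. \<bar>m x\<bar> \<le> C" "f \<in> L2"
  shows "(\<lambda>x. complex_of_real (m x) * f x) \<in> L2"
  using assms by (intro L2_bdd_mult[of f _ C]) auto

text \<open>On the Fourier side, \<theta> averages over shifts by p and the multiplier is
  multiplication by m, so the commutator has the factor m(x - p) - m(x), at most min(2,
  l|p|).\<close>

lemma multiplier_commutator:
  fixes \<theta> u :: "'a::euclidean_space \<Rightarrow> complex" and m :: "'a \<Rightarrow> real"
  assumes \<theta>: "\<theta> \<in> test_fun" and u: "u \<in> L2" and mm: "m \<in> borel_measurable borel"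
    and m1: "\<And>x. \<bar>m x\<bar> \<le> 1" and lip: "\<And>x y. \<bar>m x - m y\<bar> \<le> l * norm (x - y)" and l: "l \<ge> 0"
  shows "L2_norm (\<lambda>x. \<theta> x * fourinv (\<lambda>x. complex_of_real (m x) * fourier u x) x
      - fourinv (\<lambda>x. complex_of_real (m x) * fourier (\<lambda>x. \<theta> x * u x) x) x)
    \<le> osc_modulus (ft \<theta>) (\<lambda>p. p) l / (2 * pi) ^ DIM('a) * L2_norm u"
proof -
  let ?c = "(2 * pi) ^ DIM('a)" and ?M = "\<lambda>f x. complex_of_real (m x) * f x"
  obtain C where C: "\<And>x. cmod (\<theta> x) \<le> C" using Cc_bounded[OF test_fun_Cc[OF \<theta>]] by blast
  have \<theta>L: "(\<lambda>x. \<theta> x * f x) \<in> L2" if "f \<in> L2" for f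
    by (rule L2_bdd_mult[OF that Cc_measurable[OF test_fun_Cc[OF \<theta>]] C])
  have ML2: "?M f \<in> L2" if "f \<in> L2" for f by (rule real_multiplier_L2[OF mm m1 that])
  let ?f = "fourier u" and ?B = "fourinv (?M (fourier u))" and ?G = "fourinv (?M (fourier (\<lambda>x. \<theta> x * u x)))"
  have f: "?f \<in> L2" by (rule fourier_L2[OF u])
  have B: "?B \<in> L2" by (intro fourinv_L2 ML2 f)
  have G: "?G \<in> L2" by (intro fourinv_L2 ML2 fourier_L2 \<theta>L u)
  have F: "integrable lborel (ft \<theta>)" by (rule ft_test_fun_integrable[OF \<theta>])
  have key: "cmod (L2_inner (\<lambda>x. \<theta> x * ?B x - ?G x) w) \<le> (osc_modulus (ft \<theta>) (\<lambda>p. p) l / ?c * L2_norm u) * L2_norm w" if w: "w \<in> L2" for w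
  proof -
    let ?w = "fourier w"
    have wL: "?w \<in> L2" by (rule fourier_L2[OF w])
    let ?k1 = "\<lambda>p. phase_form 0 p (?M ?f) ?w" and ?k2 = "\<lambda>p. phase_form 0 p ?f (?M ?w)"
    have "L2_inner (\<lambda>x. \<theta> x * ?B x) w = (LINT x|lborel. \<theta> x * (?B x * cnj (w x)))"
      unfolding L2_inner_def by (simp add: mult.assoc)
    also have "\<dots> = (LINT p|lborel. ft \<theta> p * ?k1 p) / complex_of_real ?c"
      unfolding test_fun_multiplier[OF \<theta> B w]
      by (subst phase_form_cong_AE[OF fourier_L2[OF B] wL ML2[OF f] wL fourier_fourinv[OF ML2[OF f]] AE_I2[OF refl]]) (rule refl)
    finally have 1: "L2_inner (\<lambda>x. \<theta> x * ?B x) w = (LINT p|lborel. ft \<theta> p * ?k1 p) / complex_of_real ?c" .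
    have "L2_inner ?G w = L2_inner (?M (fourier (\<lambda>x. \<theta> x * u x))) ?w"
      by (rule fourinv_adjoint[OF ML2[OF fourier_L2[OF \<theta>L[OF u]]] w])
    also have "\<dots> = L2_inner (fourier (\<lambda>x. \<theta> x * u x)) (?M ?w)"
      unfolding L2_inner_def by (simp add: mult_ac)
    also have "\<dots> = L2_inner (\<lambda>x. \<theta> x * u x) (fourinv (?M ?w))" by (rule fourier_adjoint[OF \<theta>L[OF u] ML2[OF wL]])
    also have "\<dots> = (LINT x|lborel. \<theta> x * (u x * cnj (fourinv (?M ?w) x)))"
      unfolding L2_inner_def by (simp add: mult.assoc)
    also have "\<dots> = (LINT p|lborel. ft \<theta> p * ?k2 p) / complex_of_real ?c"
      unfolding test_fun_multiplier[OF \<theta> u fourinv_L2[OF ML2[OF wL]]]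
      by (subst phase_form_cong_AE[OF f fourier_L2[OF fourinv_L2[OF ML2[OF wL]]] f ML2[OF wL] AE_I2[OF refl] fourier_fourinv[OF ML2[OF wL]]]) (rule refl)
    finally have 2: "L2_inner ?G w = (LINT p|lborel. ft \<theta> p * ?k2 p) / complex_of_real ?c" .
    have k: "?k1 p - ?k2 p = (LINT x|lborel. complex_of_real (m (x - p) - m x) * (?f (x - p) * cnj (?w x)))" for p
    proof -
      have "?k1 p - ?k2 p = (LINT x|lborel. cis (0 \<bullet> (x - (1/2) *\<^sub>R p)) * (?M ?f (x - p) * cnj (?w x)) - cis (0 \<bullet> (x - (1/2) *\<^sub>R p)) * (?f (x - p) * cnj (?M ?w x)))"
        unfolding phase_form_def
        by (rule Bochner_Integration.integral_diff[symmetric, OF phase_form_integrand[OF ML2[OF f] wL] phase_form_integrand[OF f ML2[OF wL]]])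
      also have "\<dots> = (LINT x|lborel. complex_of_real (m (x - p) - m x) * (?f (x - p) * cnj (?w x)))"
        by (rule Bochner_Integration.integral_cong[OF refl]) (simp add: algebra_simps)
      finally show ?thesis .
    qed
    have "L2_inner (\<lambda>x. \<theta> x * ?B x - ?G x) w = L2_inner (\<lambda>x. \<theta> x * ?B x) w - L2_inner ?G w"
      by (rule L2_inner_diff_left[OF \<theta>L[OF B] G w])
    also have "\<dots> = (LINT p|lborel. ft \<theta> p * (?k1 p - ?k2 p)) / complex_of_real ?c"
      unfolding 1 2 diff_divide_distrib[symmetric] right_diff_distrib
      by (subst Bochner_Integration.integral_diff[OF phase_form_integrable[OF F _ _ ML2[OF f] wL] phase_form_integrable[OF F _ _ f ML2[OF wL]]]) auto
    finally have "cmod (L2_inner (\<lambda>x. \<theta> x * ?B x - ?G x) w)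
        = cmod (LINT p|lborel. ft \<theta> p * (LINT x|lborel. complex_of_real (m (x - p) - m x) * (?f (x - p) * cnj (?w x)))) / ?c"
      unfolding k by (simp add: norm_divide del: of_real_mult of_real_power)
    also have "\<dots> \<le> osc_modulus (ft \<theta>) (\<lambda>p. p) l * (L2_norm ?f * L2_norm ?w) / ?c"
    proof (intro divide_right_mono osc_modulus_form F borel_ident l f wL)
      fix p x
      show "cmod (complex_of_real (m (x - p) - m x)) \<le> min 2 (l * norm p)"
        unfolding norm_of_real using lip[of "x - p" x] m1[of "x - p"] m1[of x] by simp
    qed simp
    finally show ?thesis by (simp add: fourier_norm[OF u] fourier_norm[OF w])
  qed
  let ?D = "\<lambda>x. \<theta> x * ?B x - ?G x"
  have D: "?D \<in> L2" by (rule L2_diff[OF \<theta>L[OF B] G])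
  \<comment> \<open>Duality: the bound for all w is applied to the commutator itself.\<close>
  have 1: "L2_norm ?D * L2_norm ?D \<le> (osc_modulus (ft \<theta>) (\<lambda>p. p) l / ?c * L2_norm u) * L2_norm ?D"
    using key[OF D] unfolding L2_inner_self by (simp add: power2_eq_square norm_mult L2_norm_nonneg)
  have 2: "0 \<le> osc_modulus (ft \<theta>) (\<lambda>p. p) l / ?c * L2_norm u"
    by (intro mult_nonneg_nonneg divide_nonneg_nonneg osc_modulus_nonneg l L2_norm_nonneg) simp
  have "x \<le> y" if "x * x \<le> y * x" "0 \<le> y" "0 \<le> x" for x y :: real
    using that mult_right_le_imp_le[of x x y] by (cases "x = 0") auto
  from this[OF 1 2 L2_norm_nonneg] show ?thesis .
qed

lemma lborel_integral_pair:
  fixes F :: "'a::euclidean_space \<Rightarrow> 'b::euclidean_space \<Rightarrow> complex"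
  assumes "integrable lborel (\<lambda>z. F (fst z) (snd z))"
  shows "(LINT z|lborel. F (fst z) (snd z)) = (LINT p|lborel. LINT q|lborel. F p q)"
proof -
  have "integrable (lborel \<Otimes>\<^sub>M lborel) (case_prod F)" using assms by (simp add: lborel_prod case_prod_beta')
  from lborel_pair.integral_fst[OF this] show ?thesis by (simp add: lborel_prod case_prod_beta')
qed

lemma ft_tensor:
  fixes \<theta> :: "'a::euclidean_space \<Rightarrow> complex" and b :: "'b::euclidean_space \<Rightarrow> complex"
  assumes "integrable lborel (\<lambda>z. \<theta> (fst z) * b (snd z))"
  shows "ft (\<lambda>z. \<theta> (fst z) * b (snd z)) z = ft \<theta> (fst z) * ft b (snd z)"
proof -
  have "integrable lborel (\<lambda>y. (\<theta> (fst y) * b (snd y)) * cis (- (fst y \<bullet> fst z + snd y \<bullet> snd z)))"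
    by (rule integrable_mult_cis[OF assms]) measurable
  from lborel_integral_pair[of "\<lambda>x y. (\<theta> x * b y) * cis (- (x \<bullet> fst z + y \<bullet> snd z))", OF this]
  have "ft (\<lambda>z. \<theta> (fst z) * b (snd z)) z = (LINT x|lborel. LINT y|lborel. (\<theta> x * b y) * cis (- (x \<bullet> fst z + y \<bullet> snd z)))"
    unfolding ft_def inner_prod_def by simp
  also have "(\<lambda>x y. (\<theta> x * b y) * cis (- (x \<bullet> fst z + y \<bullet> snd z)))
      = (\<lambda>x y. (\<theta> x * cis (- (x \<bullet> fst z))) * (b y * cis (- (y \<bullet> snd z))))"
    by (intro ext) (simp add: cis_mult mult_ac)
  finally show ?thesis unfolding ft_def by simp
qed

text \<open>For a product symbol the q-integral is a Fourier inversion of b; what remains is b at h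
  times the midpoint of x - p and x.\<close>

lemma weyl_tensor:
  fixes \<theta> b u :: "'a::euclidean_space \<Rightarrow> complex"
  assumes \<theta>: "\<theta> \<in> test_fun" and b: "b \<in> test_fun" and a: "(\<lambda>z. \<theta> (fst z) * b (snd z)) \<in> test_fun"
    and h: "h > 0" and u: "u \<in> L2"
  shows "L2_inner (weyl_op h (\<lambda>z. \<theta> (fst z) * b (snd z)) u) u
    = (LINT p|lborel. ft \<theta> p * (LINT x|lborel. b (h *\<^sub>R (x - (1/2) *\<^sub>R p)) * (fourier u (x - p) * cnj (fourier u x))))
      / complex_of_real ((2 * pi) ^ DIM('a))"
proof -
  let ?a = "\<lambda>z. \<theta> (fst z) * b (snd z)" and ?f = "fourier u" and ?c = "complex_of_real ((2 * pi) ^ DIM('a))"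
  have f: "?f \<in> L2" by (rule fourier_L2[OF u])
  have [measurable]: "?f \<in> borel_measurable borel" by (rule L2_measurable[OF f])
  have bi: "integrable lborel (ft b)" by (rule ft_test_fun_integrable[OF b])
  have [measurable]: "ft b \<in> borel_measurable borel" using borel_measurable_integrable[OF bi] by simp
  have fta: "ft ?a z = ft \<theta> (fst z) * ft b (snd z)" for z
    by (rule ft_tensor[OF Cc_integrable[OF test_fun_Cc[OF a]]])
  have i: "integrable lborel (\<lambda>z. ft ?a z * phase_form (h *\<^sub>R snd z) (fst z) ?f ?f)"
    using ft_test_fun_integrable[OF a] by (intro phase_form_integrable f) measurable
  have inner: "(LINT q|lborel. ft b q * phase_form (h *\<^sub>R q) p ?f ?f)
      = ?c * (LINT x|lborel. b (h *\<^sub>R (x - (1/2) *\<^sub>R p)) * (?f (x - p) * cnj (?f x)))" for p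
  proof -
    have Fi: "integrable lborel (\<lambda>x. ?f (x - p) * cnj (?f x))" by (intro L2_inner_integrable shift_L2 f)
    have "(LINT q|lborel. ft b q * phase_form (h *\<^sub>R q) p ?f ?f)
        = (LINT q|lborel. LINT x|lborel. ft b q * (cis (h *\<^sub>R q \<bullet> (x - (1/2) *\<^sub>R p)) * (?f (x - p) * cnj (?f x))))"
      unfolding phase_form_def by simp
    also have "\<dots> = (LINT x|lborel. LINT q|lborel. ft b q * (cis (h *\<^sub>R q \<bullet> (x - (1/2) *\<^sub>R p)) * (?f (x - p) * cnj (?f x))))"
      by (rule lborel_Fubini_product_bound(1)[OF _ bi Fi]) (measurable, simp add: norm_mult)
    also have "\<dots> = (LINT x|lborel. (LINT q|lborel. ft b q * cis ((h *\<^sub>R (x - (1/2) *\<^sub>R p)) \<bullet> q)) * (?f (x - p) * cnj (?f x)))"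
      by (simp add: mult.assoc[symmetric] inner_commute)
    also have "\<dots> = (LINT x|lborel. ?c * (b (h *\<^sub>R (x - (1/2) *\<^sub>R p)) * (?f (x - p) * cnj (?f x))))"
      by (simp add: ft_inversion_test_fun[OF b] mult.assoc del: of_real_mult of_real_power)
    finally show ?thesis by simp
  qed
  have "(LINT z|lborel. ft ?a z * phase_form (h *\<^sub>R snd z) (fst z) ?f ?f)
      = (LINT p|lborel. LINT q|lborel. (ft \<theta> p * ft b q) * phase_form (h *\<^sub>R q) p ?f ?f)"
    using i unfolding fta by (rule lborel_integral_pair[of "\<lambda>p q. (ft \<theta> p * ft b q) * phase_form (h *\<^sub>R q) p ?f ?f"])
  also have "\<dots> = (LINT p|lborel. ?c * (ft \<theta> p * (LINT x|lborel. b (h *\<^sub>R (x - (1/2) *\<^sub>R p)) * (?f (x - p) * cnj (?f x)))))"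
    by (simp only: mult.assoc integral_mult_right_zero inner mult.left_commute[of "ft \<theta> _" ?c])
  finally show ?thesis unfolding weyl_inner[OF a h u u] by simp
qed

text \<open>Both quantities are averages over p with weight \<open>ft \<theta>\<close>; one carries
  m(x - p) m(x), the other the square of m at the midpoint. For a slowly varying m they nearly
  agree, so the Weyl form measures localized mass.\<close>

lemma weyl_localization:
  fixes \<theta> b u :: "'a::euclidean_space \<Rightarrow> complex" and m :: "'a \<Rightarrow> real"
  assumes \<theta>: "\<theta> \<in> test_fun" and b: "b \<in> test_fun" and a: "(\<lambda>z. \<theta> (fst z) * b (snd z)) \<in> test_fun"
    and h: "h > 0" and u: "u \<in> L2" and mm: "m \<in> borel_measurable borel"
    and m1: "\<And>x. \<bar>m x\<bar> \<le> 1" and lip: "\<And>x y. \<bar>m x - m y\<bar> \<le> l * norm (x - y)" and l: "l \<ge> 0"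
    and bm: "\<And>x. b (h *\<^sub>R x) = complex_of_real ((m x)\<^sup>2)"
  shows "cmod ((LINT x|lborel. \<theta> x * complex_of_real ((cmod (fourinv (\<lambda>x. complex_of_real (m x) * fourier u x) x))\<^sup>2))
      - L2_inner (weyl_op h (\<lambda>z. \<theta> (fst z) * b (snd z)) u) u)
    \<le> osc_modulus (ft \<theta>) (\<lambda>p. p) l / (2 * pi) ^ DIM('a) * (L2_norm u)\<^sup>2"
proof -
  let ?c = "(2 * pi) ^ DIM('a)" and ?f = "fourier u"
  have f: "?f \<in> L2" by (rule fourier_L2[OF u])
  have [measurable]: "?f \<in> borel_measurable borel" "m \<in> borel_measurable borel" by (rule L2_measurable[OF f], rule mm)
  let ?M = "\<lambda>x. complex_of_real (m x) * ?f x"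
  have M: "?M \<in> L2" by (rule real_multiplier_L2[OF mm m1 f])
  have F: "integrable lborel (ft \<theta>)" by (rule ft_test_fun_integrable[OF \<theta>])
  have [measurable]: "b \<in> borel_measurable borel" by (rule Cc_measurable[OF test_fun_Cc[OF b]])
  let ?g = "\<lambda>p x. ?f (x - p) * cnj (?f x)"
  let ?m1 = "\<lambda>p x. complex_of_real (m (x - p) * m x)" and ?m2 = "\<lambda>p x. complex_of_real ((m (x - (1/2) *\<^sub>R p))\<^sup>2)"
  have bounded: "integrable lborel (\<lambda>x. complex_of_real (w x) * ?g p x)"
    if [measurable]: "w \<in> borel_measurable borel" and "\<And>x. \<bar>w x\<bar> \<le> 1" for w p
  proof (rule Bochner_Integration.integrable_bound)
    show "integrable lborel (?g p)" by (intro L2_inner_integrable shift_L2 f)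
    show "(\<lambda>x. complex_of_real (w x) * ?g p x) \<in> borel_measurable lborel" by measurable
    show "AE x in lborel. norm (complex_of_real (w x) * ?g p x) \<le> norm (?g p x)"
      using that(2) by (intro AE_I2) (simp add: norm_mult mult_left_le_one_le)
  qed
  have i1: "integrable lborel (\<lambda>x. ?m1 p x * ?g p x)" for p
    by (rule bounded) (measurable, use m1 in \<open>simp add: abs_mult mult_le_one\<close>)
  have i2: "integrable lborel (\<lambda>x. ?m2 p x * ?g p x)" for p
    by (rule bounded) (measurable, use m1 in \<open>simp add: abs_square_le_1\<close>)
  have "(LINT x|lborel. \<theta> x * complex_of_real ((cmod (fourinv ?M x))\<^sup>2)) = (LINT x|lborel. \<theta> x * (fourinv ?M x * cnj (fourinv ?M x)))"
    by (simp only: complex_norm_square)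
  also have "\<dots> = (LINT p|lborel. ft \<theta> p * phase_form 0 p ?M ?M) / complex_of_real ?c"
    unfolding test_fun_multiplier[OF \<theta> fourinv_L2[OF M] fourinv_L2[OF M]]
    by (subst phase_form_cong_AE[OF fourier_L2[OF fourinv_L2[OF M]] fourier_L2[OF fourinv_L2[OF M]] M M
          fourier_fourinv[OF M] fourier_fourinv[OF M]]) (rule refl)
  finally have 1: "(LINT x|lborel. \<theta> x * complex_of_real ((cmod (fourinv ?M x))\<^sup>2))
      = (LINT p|lborel. ft \<theta> p * phase_form 0 p ?M ?M) / complex_of_real ?c" .
  have pf: "phase_form 0 p ?M ?M = (LINT x|lborel. ?m1 p x * ?g p x)" for p
    unfolding phase_form_def by (simp add: mult_ac)
  have weyl: "L2_inner (weyl_op h (\<lambda>z. \<theta> (fst z) * b (snd z)) u) u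
      = (LINT p|lborel. ft \<theta> p * (LINT x|lborel. ?m2 p x * ?g p x)) / complex_of_real ?c"
    unfolding weyl_tensor[OF \<theta> b a h u] bm ..
  have j1: "integrable lborel (\<lambda>p. ft \<theta> p * (LINT x|lborel. ?m1 p x * ?g p x))"
    unfolding pf[symmetric] by (intro phase_form_integrable F M) auto
  have j2: "integrable lborel (\<lambda>p. ft \<theta> p * (LINT x|lborel. ?m2 p x * ?g p x))"
  proof (rule Bochner_Integration.integrable_bound)
    have [measurable]: "ft \<theta> \<in> borel_measurable borel" using borel_measurable_integrable[OF F] by simp
    show "(\<lambda>p. ft \<theta> p * (LINT x|lborel. ?m2 p x * ?g p x)) \<in> borel_measurable lborel" by measurable
    show "integrable lborel (\<lambda>p. ft \<theta> p * complex_of_real (L2_norm ?f * L2_norm ?f))" using F by (rule integrable_mult_left)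
    have "cmod (LINT x|lborel. ?m2 p x * ?g p x) \<le> 1 * (L2_norm ?f * L2_norm ?f)" for p
    proof (rule shifted_form_bound[OF f f])
      show "cmod (?m2 p x) \<le> 1" for x using m1 by (simp add: abs_square_le_1 del: of_real_power)
    qed simp
    then show "AE p in lborel. norm (ft \<theta> p * (LINT x|lborel. ?m2 p x * ?g p x)) \<le> norm (ft \<theta> p * complex_of_real (L2_norm ?f * L2_norm ?f))"
      unfolding norm_mult norm_of_real by (intro AE_I2 mult_left_mono) (auto simp: abs_mult L2_norm_nonneg)
  qed
  have k: "(LINT x|lborel. ?m1 p x * ?g p x) - (LINT x|lborel. ?m2 p x * ?g p x)
      = (LINT x|lborel. (?m1 p x - ?m2 p x) * ?g p x)" for p
    unfolding left_diff_distrib by (rule Bochner_Integration.integral_diff[symmetric, OF i1 i2])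
  have "(LINT x|lborel. \<theta> x * complex_of_real ((cmod (fourinv ?M x))\<^sup>2)) - L2_inner (weyl_op h (\<lambda>z. \<theta> (fst z) * b (snd z)) u) u
      = (LINT p|lborel. ft \<theta> p * (LINT x|lborel. (?m1 p x - ?m2 p x) * ?g p x)) / complex_of_real ?c"
    unfolding 1 weyl pf diff_divide_distrib[symmetric] k[symmetric] right_diff_distrib
    by (subst Bochner_Integration.integral_diff[OF j1 j2]) (rule refl)
  moreover have "cmod (LINT p|lborel. ft \<theta> p * (LINT x|lborel. (?m1 p x - ?m2 p x) * ?g p x))
      \<le> osc_modulus (ft \<theta>) (\<lambda>p. p) l * (L2_norm ?f * L2_norm ?f)"
  proof (intro osc_modulus_form F borel_ident l f)
    fix p x :: 'a
    \<comment> \<open>The midpoint has distance |p|/2 from x and from x - p, so each of the two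
      differences of m contributes l|p|/2.\<close>
    let ?y = "x - (1/2) *\<^sub>R p"
    have d1: "\<bar>m (x - p) - m ?y\<bar> \<le> l * norm p / 2" and d2: "\<bar>m x - m ?y\<bar> \<le> l * norm p / 2"
    proof -
      have "x - p - ?y = (-1/2) *\<^sub>R p" using scaleR_add_left[of "1/2" "1/2" p] by (simp add: algebra_simps)
      then show "\<bar>m (x - p) - m ?y\<bar> \<le> l * norm p / 2" using lip[of "x - p" ?y] by simp
      show "\<bar>m x - m ?y\<bar> \<le> l * norm p / 2" using lip[of x ?y] by simp
    qed
    have "m (x - p) * m x - (m ?y)\<^sup>2 = m (x - p) * (m x - m ?y) + m ?y * (m (x - p) - m ?y)"
      by (simp add: algebra_simps power2_eq_square)
    also have "\<bar>\<dots>\<bar> \<le> \<bar>m (x - p)\<bar> * \<bar>m x - m ?y\<bar> + \<bar>m ?y\<bar> * \<bar>m (x - p) - m ?y\<bar>"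
      by (metis abs_mult abs_triangle_ineq)
    also have "\<dots> \<le> 1 * (l * norm p / 2) + 1 * (l * norm p / 2)"
      using d1 d2 m1 by (intro add_mono mult_mono) auto
    finally have A: "\<bar>m (x - p) * m x - (m ?y)\<^sup>2\<bar> \<le> l * norm p" by simp
    have "\<bar>m (x - p) * m x\<bar> \<le> 1" using m1 by (simp add: abs_mult mult_le_one)
    moreover have "\<bar>(m ?y)\<^sup>2\<bar> \<le> 1" using m1 by (simp add: abs_square_le_1)
    ultimately have "\<bar>m (x - p) * m x - (m ?y)\<^sup>2\<bar> \<le> 2" by linarith
    with A show "cmod (?m1 p x - ?m2 p x) \<le> min 2 (l * norm p)"
      unfolding of_real_diff[symmetric] norm_of_real by simp
  qed
  ultimately show ?thesis
    by (simp add: fourier_norm[OF u] norm_divide power2_eq_square divide_right_mono del: of_real_mult of_real_power)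
qed

section \<open>Low frequencies\<close>

text \<open>Three replacements. Dropping the displacement h q costs the modulus at h R and leaves
  multiplication by a(x, 0) on the evolved function. There |a(x, 0)| is dominated by C \<theta>.
  Undoing the evolution inside the form of \<theta> costs the modulus at T k R, the distance
  travelled.\<close>

lemma wigner_low_bound:
  fixes a :: "'a::euclidean_space \<times> 'a \<Rightarrow> complex" and \<theta> :: "'a \<Rightarrow> real" and f :: "'a \<Rightarrow> complex"
  assumes a: "a \<in> test_fun" and \<theta>: "(\<lambda>x. complex_of_real (\<theta> x)) \<in> test_fun" and f: "f \<in> L2"
    and supp: "\<And>x. f x \<noteq> 0 \<Longrightarrow> norm x \<le> R" and R: "R \<ge> 0" and h: "h \<ge> 0" and k: "k \<ge> 0"
    and dom: "\<And>x. cmod (a (x, 0)) \<le> C * \<theta> x" and C: "C \<ge> 0" and t: "\<bar>t\<bar> \<le> T"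
  shows "cmod (wigner_form (ft a) h k t f f) \<le> osc_modulus (ft a) snd (h * R) * (L2_norm f)\<^sup>2
    + (2 * pi) ^ DIM('a \<times> 'a) * (C * ((LINT x|lborel. \<theta> x * (cmod (fourinv f x))\<^sup>2)
        + osc_modulus (ft (\<lambda>x. complex_of_real (\<theta> x))) (\<lambda>p. p) (T * k * R) / (2 * pi) ^ DIM('a) * (L2_norm f)\<^sup>2))"
proof -
  let ?A = "ft a" and ?c2 = "(2 * pi) ^ DIM('a \<times> 'a)" and ?c = "(2 * pi) ^ DIM('a)"
  let ?\<theta> = "\<lambda>x. complex_of_real (\<theta> x)"
  have T: "T \<ge> 0" using t by simp
  have A: "integrable lborel ?A" by (rule ft_test_fun_integrable[OF a])
  have F: "integrable lborel (ft ?\<theta>)" by (rule ft_test_fun_integrable[OF \<theta>])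
  \<comment> \<open>The midpoint of two points of the ball of radius R; this bounds the vector
    against which the displacements are paired.\<close>
  have mid: "norm (x - (1/2) *\<^sub>R p) \<le> R" if "f (x - p) \<noteq> 0" "f x \<noteq> 0" for x p
  proof -
    have "x - (1/2) *\<^sub>R p = (1/2) *\<^sub>R x + (1/2) *\<^sub>R (x - p)"
      using scaleR_add_left[of "1/2" "1/2" x] by (simp add: algebra_simps)
    then have "norm (x - (1/2) *\<^sub>R p) \<le> norm ((1/2) *\<^sub>R x) + norm ((1/2) *\<^sub>R (x - p))" by (metis norm_triangle_ineq)
    then show ?thesis using supp[OF that(1)] supp[OF that(2)] by simp
  qed
  \<comment> \<open>Changing the displacement from S1 to S2 alters the phase by at most |S1 - S2| R.
    It is used for the symbol on phase space and for \<theta> on position space, hence the separate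
    type of the weight.\<close>
  have difference: "cmod (phase_diff) \<le> osc_modulus G Q K * (L2_norm f * L2_norm f)"
    if G: "integrable lborel G" and [measurable]: "S1 \<in> borel_measurable borel" "S2 \<in> borel_measurable borel" "P \<in> borel_measurable borel"
      and Q: "Q \<in> borel_measurable borel" and K: "K \<ge> 0" and S: "\<And>z. norm (S1 z - S2 z) * R \<le> K * norm (Q z)"
      and pd: "phase_diff = (LINT z|lborel. G z * phase_form (S1 z) (P z) f f) - (LINT z|lborel. G z * phase_form (S2 z) (P z) f f)"
    for phase_diff and G :: "'c::euclidean_space \<Rightarrow> complex" and S1 S2 P Q :: "'c \<Rightarrow> 'a" and K
  proof -
    let ?y = "\<lambda>z x. x - (1/2) *\<^sub>R P z" and ?g = "\<lambda>z x. f (x - P z) * cnj (f x)"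
    have e: "phase_form (S1 z) (P z) f f - phase_form (S2 z) (P z) f f
        = (LINT x|lborel. (cis (S1 z \<bullet> ?y z x) - cis (S2 z \<bullet> ?y z x)) * ?g z x)" for z
      unfolding phase_form_def left_diff_distrib
      by (rule Bochner_Integration.integral_diff[symmetric, OF phase_form_integrand[OF f f] phase_form_integrand[OF f f]])
    have "phase_diff = (LINT z|lborel. G z * (LINT x|lborel. (cis (S1 z \<bullet> ?y z x) - cis (S2 z \<bullet> ?y z x)) * ?g z x))"
      unfolding pd e[symmetric] right_diff_distrib
      by (rule Bochner_Integration.integral_diff[symmetric]) (intro phase_form_integrable G f; measurable)+
    also have "cmod \<dots> \<le> osc_modulus G Q K * (L2_norm f * L2_norm f)"
    proof (rule osc_modulus_form[OF G Q K f f])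
      fix z x assume nz: "f (x - P z) \<noteq> 0" "f x \<noteq> 0"
      have "\<bar>S1 z \<bullet> ?y z x - S2 z \<bullet> ?y z x\<bar> = \<bar>(S1 z - S2 z) \<bullet> ?y z x\<bar>" by (simp only: inner_diff_left)
      also have "\<dots> \<le> norm (S1 z - S2 z) * norm (?y z x)" by (rule Cauchy_Schwarz_ineq2)
      also have "\<dots> \<le> norm (S1 z - S2 z) * R" by (intro mult_left_mono mid nz) simp
      also have "\<dots> \<le> K * norm (Q z)" by (rule S)
      finally show "cmod (cis (S1 z \<bullet> ?y z x) - cis (S2 z \<bullet> ?y z x)) \<le> min 2 (K * norm (Q z))"
        using cis_diff_bound[of "S1 z \<bullet> ?y z x" "S2 z \<bullet> ?y z x"] by simp
    qed
    finally show ?thesis .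
  qed
  let ?I = "LINT z|lborel. ?A z * phase_form ((k * t) *\<^sub>R fst z) (fst z) f f"
  have 1: "cmod (wigner_form ?A h k t f f - ?I) \<le> osc_modulus ?A snd (h * R) * (L2_norm f * L2_norm f)"
  proof (rule difference[OF A])
    show "norm (h *\<^sub>R snd z + (k * t) *\<^sub>R fst z - (k * t) *\<^sub>R fst z) * R \<le> h * R * norm (snd z)" for z :: "'a \<times> 'a"
      using h by (simp add: mult_ac)
  qed (use h R in \<open>auto simp: wigner_form_def\<close>)
  \<comment> \<open>The freely evolved transform; \<tau> = k t / 2 produces the displacement (k t)
    p.\<close>
  define g where "g = (\<lambda>x. cis (- (k * t / 2 * (norm x)\<^sup>2)) * f x)"
  have g: "g \<in> L2" unfolding g_def by (rule L2_cis_mult[OF f]) measurable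
  have ev: "phase_form 0 p g g = phase_form ((k * t) *\<^sub>R p) p f f" for p
    using phase_form_evolve[OF f g, of "k * t / 2" 0 p] unfolding g_def by simp
  let ?w = "fourinv g"
  have w: "?w \<in> L2" by (rule fourinv_L2[OF g])
  have wg: "phase_form 0 p (fourier ?w) (fourier ?w) = phase_form ((k * t) *\<^sub>R p) p f f" for p
    unfolding ev[symmetric] by (rule phase_form_cong_AE[OF fourier_L2[OF w] fourier_L2[OF w] g g fourier_fourinv[OF g] fourier_fourinv[OF g]])
  let ?v = "fourinv f"
  have v: "?v \<in> L2" by (rule fourinv_L2[OF f])
  have vf: "phase_form 0 p (fourier ?v) (fourier ?v) = phase_form 0 p f f" for p
    by (rule phase_form_cong_AE[OF fourier_L2[OF v] fourier_L2[OF v] f f fourier_fourinv[OF f] fourier_fourinv[OF f]])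
  have \<theta>i: "integrable lborel (\<lambda>x. \<theta> x * (cmod (y x))\<^sup>2)" if y: "y \<in> L2" for y
  proof -
    obtain B where B: "\<And>x. cmod (?\<theta> x) \<le> B" using Cc_bounded[OF test_fun_Cc[OF \<theta>]] by blast
    have "(\<lambda>x. ?\<theta> x * y x) \<in> L2" by (rule L2_bdd_mult[OF y Cc_measurable[OF test_fun_Cc[OF \<theta>]] B])
    from integrable_Re[OF L2_inner_integrable[OF this y]] show ?thesis
      by (simp add: mult.assoc complex_norm_square[symmetric] flip: of_real_mult of_real_power)
  qed
  have V: "complex_of_real (LINT x|lborel. \<theta> x * (cmod (y x))\<^sup>2)
      = (LINT p|lborel. ft ?\<theta> p * phase_form 0 p (fourier y) (fourier y)) / complex_of_real ?c" if "y \<in> L2" for y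
    unfolding test_fun_multiplier[OF \<theta> that that, symmetric]
    by (simp only: complex_norm_square[symmetric] of_real_mult[symmetric] integral_complex_of_real)
  let ?V = "\<lambda>y. LINT x|lborel. \<theta> x * (cmod (y x))\<^sup>2"
  have "cmod ((LINT p|lborel. ft ?\<theta> p * phase_form ((k * t) *\<^sub>R p) p f f) - (LINT p|lborel. ft ?\<theta> p * phase_form 0 p f f))
      \<le> osc_modulus (ft ?\<theta>) (\<lambda>p. p) (T * k * R) * (L2_norm f * L2_norm f)"
  proof (rule difference[OF F])
    show "norm ((k * t) *\<^sub>R p - 0) * R \<le> T * k * R * norm p" for p :: 'a
    proof -
      have "(k * R * norm p) * \<bar>t\<bar> \<le> (k * R * norm p) * T" using k R t by (intro mult_left_mono) auto
      then show ?thesis using k by (simp add: abs_mult mult_ac)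
    qed
  qed (use T k R in auto)
  then have "cmod (complex_of_real (?V ?w) - complex_of_real (?V ?v)) \<le> osc_modulus (ft ?\<theta>) (\<lambda>p. p) (T * k * R) * (L2_norm f * L2_norm f) / ?c"
    unfolding V[OF w] V[OF v] wg vf diff_divide_distrib[symmetric]
    by (simp add: norm_divide divide_right_mono del: of_real_mult of_real_power)
  then have 2: "?V ?w \<le> ?V ?v + osc_modulus (ft ?\<theta>) (\<lambda>p. p) (T * k * R) / ?c * (L2_norm f)\<^sup>2"
    unfolding of_real_diff[symmetric] norm_of_real by (simp add: power2_eq_square abs_le_iff)
  have "(LINT x|lborel. a (x, 0) * (?w x * cnj (?w x)))
      = (LINT z|lborel. ?A z / complex_of_real ?c2 * phase_form 0 (fst z) (fourier ?w) (fourier ?w))"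
  proof (rule multiplier_form[OF _ _ _ w w])
    show "integrable lborel (\<lambda>z. ?A z / complex_of_real ?c2)" using A by (rule integrable_divide)
    show "a (x, 0) = (LINT z|lborel. ?A z / complex_of_real ?c2 * cis (x \<bullet> fst z))" for x
      unfolding ft_inversion_test_fun[OF a, of "(x, 0)"] by (simp add: inner_prod_def)
  qed simp
  then have I: "?I = complex_of_real ?c2 * (LINT x|lborel. a (x, 0) * (?w x * cnj (?w x)))"
    unfolding wg by simp
  have "cmod (LINT x|lborel. a (x, 0) * (?w x * cnj (?w x))) \<le> (LINT x|lborel. C * (\<theta> x * (cmod (?w x))\<^sup>2))"
  proof (rule integral_norm_le)
    show "integrable lborel (\<lambda>x. C * (\<theta> x * (cmod (?w x))\<^sup>2))" by (intro integrable_mult_right \<theta>i w)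
    show "cmod (a (x, 0) * (?w x * cnj (?w x))) \<le> C * (\<theta> x * (cmod (?w x))\<^sup>2)" for x
      using mult_right_mono[OF dom[of x], of "(cmod (?w x))\<^sup>2"] by (simp add: norm_mult power2_eq_square mult.assoc)
  qed
  then have "cmod ?I \<le> ?c2 * (C * ?V ?w)"
    unfolding I norm_mult norm_of_real by (simp add: mult_left_mono)
  also have "\<dots> \<le> ?c2 * (C * (?V ?v + osc_modulus (ft ?\<theta>) (\<lambda>p. p) (T * k * R) / ?c * (L2_norm f)\<^sup>2))"
    using 2 C by (intro mult_left_mono) auto
  finally show ?thesis using 1 norm_triangle_sub[of "wigner_form ?A h k t f f" ?I] unfolding power2_eq_square by linarith
qed

text \<open>Commute \<rho> past \<theta>, dominate it pointwise by K m, commute m back, and read the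
  square of the resulting norm as a Weyl form. Squaring is the reason why the symbol has the
  position factor \<theta>^2 and the frequency factor m^2.\<close>

lemma localized_cutoff_bound:
  fixes \<theta> m \<rho> :: "'a::euclidean_space \<Rightarrow> real" and b u :: "'a \<Rightarrow> complex"
  defines "\<theta>1 \<equiv> \<lambda>x. complex_of_real (\<theta> x)" and "\<theta>2 \<equiv> \<lambda>x. complex_of_real ((\<theta> x)\<^sup>2)"
  assumes \<theta>: "\<theta>1 \<in> test_fun" "\<theta>2 \<in> test_fun" and b: "b \<in> test_fun" and a: "(\<lambda>z. \<theta>2 (fst z) * b (snd z)) \<in> test_fun"
    and h: "h > 0" and u: "u \<in> L2"
    and m: "m \<in> borel_measurable borel" "\<And>x. \<bar>m x\<bar> \<le> 1" "\<And>x y. \<bar>m x - m y\<bar> \<le> l * norm (x - y)" "l \<ge> 0"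
    and \<rho>: "\<rho> \<in> borel_measurable borel" "\<And>x. \<bar>\<rho> x\<bar> \<le> 1" "\<And>x y. \<bar>\<rho> x - \<rho> y\<bar> \<le> l' * norm (x - y)" "l' \<ge> 0"
    and bm: "\<And>x. b (h *\<^sub>R x) = complex_of_real ((m x)\<^sup>2)" and dom: "\<And>x. \<bar>\<rho> x\<bar> \<le> K * \<bar>m x\<bar>" and K: "K \<ge> 0"
  shows "L2_norm (\<lambda>x. \<theta>1 x * fourinv (\<lambda>x. complex_of_real (\<rho> x) * fourier u x) x)
    \<le> osc_modulus (ft \<theta>1) (\<lambda>p. p) l' / (2 * pi) ^ DIM('a) * L2_norm u
      + K * (osc_modulus (ft \<theta>1) (\<lambda>p. p) l / (2 * pi) ^ DIM('a) * L2_norm u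
        + sqrt (cmod (L2_inner (weyl_op h (\<lambda>z. \<theta>2 (fst z) * b (snd z)) u) u)
            + osc_modulus (ft \<theta>2) (\<lambda>p. p) l / (2 * pi) ^ DIM('a) * (L2_norm u)\<^sup>2))"
proof -
  obtain C where C: "\<And>x. cmod (\<theta>1 x) \<le> C" using Cc_bounded[OF test_fun_Cc[OF \<theta>(1)]] by blast
  have \<theta>L: "(\<lambda>x. \<theta>1 x * f x) \<in> L2" if "f \<in> L2" for f
    by (rule L2_bdd_mult[OF that Cc_measurable[OF test_fun_Cc[OF \<theta>(1)]] C])
  let ?F = "fourier (\<lambda>x. \<theta>1 x * u x)"
  have F: "?F \<in> L2" by (intro fourier_L2 \<theta>L u)
  have mF: "(\<lambda>x. complex_of_real (m x) * ?F x) \<in> L2" by (rule real_multiplier_L2[OF m(1,2) F])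
  have mf: "(\<lambda>x. complex_of_real (m x) * fourier u x) \<in> L2" by (rule real_multiplier_L2[OF m(1,2) fourier_L2[OF u]])
  have cF: "(\<lambda>x. complex_of_real (\<rho> x) * ?F x) \<in> L2" by (rule real_multiplier_L2[OF \<rho>(1,2) F])
  have cf: "(\<lambda>x. complex_of_real (\<rho> x) * fourier u x) \<in> L2" by (rule real_multiplier_L2[OF \<rho>(1,2) fourier_L2[OF u]])
  let ?Y = "\<lambda>x. \<theta>1 x * fourinv (\<lambda>x. complex_of_real (\<rho> x) * fourier u x) x"
  let ?X = "\<lambda>x. \<theta>1 x * fourinv (\<lambda>x. complex_of_real (m x) * fourier u x) x"
  have s1: "L2_norm ?Y \<le> L2_norm (fourinv (\<lambda>x. complex_of_real (\<rho> x) * ?F x)) + osc_modulus (ft \<theta>1) (\<lambda>p. p) l' / (2 * pi) ^ DIM('a) * L2_norm u"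
    using multiplier_commutator[OF \<theta>(1) u \<rho>] L2_norm_triangle_diff[OF \<theta>L[OF fourinv_L2[OF cf]] fourinv_L2[OF cF]] by linarith
  have s2: "L2_norm (fourinv (\<lambda>x. complex_of_real (\<rho> x) * ?F x)) = L2_norm (\<lambda>x. complex_of_real (\<rho> x) * ?F x)"
    by (rule fourinv_norm[OF cF])
  have s3: "L2_norm (\<lambda>x. complex_of_real (\<rho> x) * ?F x) \<le> K * L2_norm (\<lambda>x. complex_of_real (m x) * ?F x)"
  proof -
    have "L2_norm (\<lambda>x. complex_of_real (\<rho> x) * ?F x) \<le> L2_norm (\<lambda>x. complex_of_real K * (complex_of_real (m x) * ?F x))"
      unfolding L2_norm_def
    proof (intro real_sqrt_le_mono integral_mono L2_integrable cF L2_scale mF power_mono)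
      show "cmod (complex_of_real (\<rho> x) * ?F x) \<le> cmod (complex_of_real K * (complex_of_real (m x) * ?F x))" for x
        using mult_right_mono[OF dom[of x] norm_ge_zero[of "?F x"]] K by (simp add: norm_mult mult.assoc)
    qed simp
    then show ?thesis unfolding L2_norm_scale using K by simp
  qed
  have s4: "L2_norm (\<lambda>x. complex_of_real (m x) * ?F x) \<le> osc_modulus (ft \<theta>1) (\<lambda>p. p) l / (2 * pi) ^ DIM('a) * L2_norm u + L2_norm ?X"
    unfolding fourinv_norm[OF mF, symmetric]
    using multiplier_commutator[OF \<theta>(1) u m] L2_norm_triangle_diff[OF \<theta>L[OF fourinv_L2[OF mf]] fourinv_L2[OF mF]] by linarith
  have s5: "L2_norm ?X \<le> sqrt (cmod (L2_inner (weyl_op h (\<lambda>z. \<theta>2 (fst z) * b (snd z)) u) u)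
            + osc_modulus (ft \<theta>2) (\<lambda>p. p) l / (2 * pi) ^ DIM('a) * (L2_norm u)\<^sup>2)"
  proof (rule real_le_rsqrt)
    let ?W = "L2_inner (weyl_op h (\<lambda>z. \<theta>2 (fst z) * b (snd z)) u) u"
    let ?J = "LINT x|lborel. \<theta>2 x * complex_of_real ((cmod (fourinv (\<lambda>x. complex_of_real (m x) * fourier u x) x))\<^sup>2)"
    have "complex_of_real ((L2_norm ?X)\<^sup>2) = ?J"
      unfolding L2_norm_sq \<theta>1_def \<theta>2_def integral_complex_of_real[symmetric] by (simp add: norm_mult power_mult_distrib)
    from arg_cong[OF this, of cmod] have "(L2_norm ?X)\<^sup>2 = cmod ?J" by (simp only: norm_of_real abs_power2)
    also have "\<dots> \<le> cmod ?W + cmod (?J - ?W)" by (rule norm_triangle_sub)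
    also have "cmod (?J - ?W) \<le> osc_modulus (ft \<theta>2) (\<lambda>p. p) l / (2 * pi) ^ DIM('a) * (L2_norm u)\<^sup>2"
      by (rule weyl_localization[OF \<theta>(2) b a h u m bm])
    finally show "(L2_norm ?X)\<^sup>2 \<le> cmod ?W + osc_modulus (ft \<theta>2) (\<lambda>p. p) l / (2 * pi) ^ DIM('a) * (L2_norm u)\<^sup>2" by simp
  qed
  have "K * L2_norm (\<lambda>x. complex_of_real (m x) * ?F x) \<le> K * (osc_modulus (ft \<theta>1) (\<lambda>p. p) l / (2 * pi) ^ DIM('a) * L2_norm u
        + sqrt (cmod (L2_inner (weyl_op h (\<lambda>z. \<theta>2 (fst z) * b (snd z)) u) u)
            + osc_modulus (ft \<theta>2) (\<lambda>p. p) l / (2 * pi) ^ DIM('a) * (L2_norm u)\<^sup>2))"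
    using s4 s5 K by (intro mult_left_mono) auto
  with s1 s2 s3 show ?thesis by linarith
qed

text \<open>As \<delta> shrinks, the symbol tends to 0 wherever \<xi> is nonzero, hence almost
  everywhere for \<mu>. The indicator of a fixed compact set, of finite measure, dominates.\<close>

lemma bump_concentration:
  fixes \<mu> :: "('a::euclidean_space \<times> 'a) measure"
  assumes \<mu>: "radon_measure \<mu>" and zero: "emeasure \<mu> {(x, \<xi>). \<xi> = 0} = 0" and N: "(N::real) > 0" and e: "e > 0"
  shows "\<exists>\<delta>>0. cmod (LINT z|\<mu>. complex_of_real (bump 2 N (fst z)) * complex_of_real (bump 1 \<delta> (snd z))) < e"
proof -
  have sets [measurable_cong]: "sets \<mu> = sets borel" using \<mu> unfolding radon_measure_def by simp
  have b [measurable]: "(\<lambda>z::'a \<times> 'a. bump c r (fst z)) \<in> borel_measurable borel" "(\<lambda>z::'a \<times> 'a. bump c r (snd z)) \<in> borel_measurable borel" for c r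
    using measurable_compose[OF fst_snd_measurable(1) bump_measurable] measurable_compose[OF fst_snd_measurable(2) bump_measurable] by auto
  let ?\<delta> = "\<lambda>n. 1 / real (Suc n)"
  let ?f = "\<lambda>n z. complex_of_real (bump 2 N (fst z)) * complex_of_real (bump 1 (?\<delta> n) (snd z))"
  let ?d = "real DIM('a)"
  let ?K = "cball (0::'a) (2 * N * ?d) \<times> cball (0::'a) (2 * ?d)"
  have "emeasure \<mu> ?K < \<infinity>" using \<mu> unfolding radon_measure_def by (simp add: compact_Times)
  have K: "integrable \<mu> (indicator ?K :: _ \<Rightarrow> real)"
  proof (rule integrable_real_indicator)
    show "?K \<in> sets \<mu>" unfolding sets by (intro borel_compact compact_Times compact_cball)
  qed fact
  have "(\<lambda>n. LINT z|\<mu>. ?f n z) \<longlonglongrightarrow> (LINT z|\<mu>. 0)"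
  proof (rule integral_dominated_convergence[OF _ _ K])
    have "{(x::'a, \<xi>::'a). \<xi> = 0} \<in> null_sets \<mu>"
    proof
      have "{(x::'a, \<xi>::'a). \<xi> = 0} = UNIV \<times> {0}" by auto
      then show "{(x::'a, \<xi>::'a). \<xi> = 0} \<in> sets \<mu>" unfolding sets by (simp add: borel_closed closed_Times)
    qed fact
    then have "AE z in \<mu>. snd z \<noteq> 0" by (rule AE_I') auto
    then show "AE z in \<mu>. (\<lambda>n. ?f n z) \<longlonglongrightarrow> 0"
    proof eventually_elim
      case (elim z)
      have "(\<lambda>n. 2 * ?\<delta> n * ?d) \<longlonglongrightarrow> 2 * 0 * ?d" by (intro tendsto_intros LIMSEQ_Suc[OF lim_1_over_n])
      then have "eventually (\<lambda>n. 2 * ?\<delta> n * ?d < norm (snd z)) sequentially"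
        using elim by (intro order_tendstoD(2)) auto
      then have "eventually (\<lambda>n. ?f n z = 0) sequentially"
        by eventually_elim (simp add: bump_support)
      then show ?case by (rule tendsto_eventually)
    qed
    show "AE z in \<mu>. norm (?f n z) \<le> indicator ?K z" for n
    proof (rule AE_I2)
      fix z :: "'a \<times> 'a"
      show "norm (?f n z) \<le> indicator ?K z"
      proof (cases "z \<in> ?K")
        case True
        have "bump 2 N (fst z) * bump 1 (?\<delta> n) (snd z) \<le> 1"
          by (intro mult_le_one bump_le_1 bump_nonneg) auto
        then show ?thesis using True by (simp add: norm_mult bump_nonneg)
      next
        case False
        then consider "2 * N * ?d < norm (fst z)" | "2 * 1 * ?d < norm (snd z)" by (cases z) (auto simp: not_le)
        then have "?f n z = 0"
        proof cases
          case 1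
          from bump_support[OF N 1] show ?thesis by simp
        next
          case 2
          moreover have "2 * ?\<delta> n * ?d \<le> 2 * 1 * ?d" by (intro mult_mono) auto
          ultimately have "2 * ?\<delta> n * ?d < norm (snd z)" by linarith
          from bump_support[OF _ this] show ?thesis by simp
        qed
        then show ?thesis by (simp only: norm_zero indicator_pos_le)
      qed
    qed
  qed measurable
  then have "(\<lambda>n. cmod (LINT z|\<mu>. ?f n z)) \<longlonglongrightarrow> 0" using tendsto_norm by fastforce
  from order_tendstoD(2)[OF this e] obtain n where "cmod (LINT z|\<mu>. ?f n z) < e"
    unfolding eventually_sequentially by blast
  then show ?thesis by (intro exI[of _ "?\<delta> n"]) simp
qed

text \<open>For L > 0, equal to 1 where k(1 + |x|) \<le> L, equal to 0 where k(1 + |x|) \<ge> 2L,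
  and affine in k(1 + |x|) between. It is used as a Lipschitz multiplier.\<close>

definition freq_cutoff :: "real \<Rightarrow> real \<Rightarrow> 'a::real_normed_vector \<Rightarrow> real" where
  "freq_cutoff L k x = max 0 (min 1 (2 - k * (1 + norm x) / L))"

lemma freq_cutoff_measurable [measurable]: "freq_cutoff L k \<in> borel_measurable (borel :: 'a::euclidean_space measure)"
  unfolding freq_cutoff_def by measurable

lemma freq_cutoff_range: "0 \<le> freq_cutoff L k x" "freq_cutoff L k x \<le> 1"
  unfolding freq_cutoff_def by auto

lemma freq_cutoff_low:
  assumes "L > 0" "freq_cutoff L k x \<noteq> 0"
  shows "k * (1 + norm x) \<le> 2 * L"
proof -
  have "k * (1 + norm x) / L \<le> 2" using assms(2) unfolding freq_cutoff_def by (auto simp: max_def min_def split: if_splits)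
  then show ?thesis using assms(1) by (simp add: pos_divide_le_eq)
qed

lemma freq_cutoff_high:
  assumes "L > 0" "freq_cutoff L k x \<noteq> 1"
  shows "L \<le> k * (1 + norm x)"
proof -
  have "1 \<le> k * (1 + norm x) / L" using assms(2) unfolding freq_cutoff_def by (auto simp: max_def min_def split: if_splits)
  then show ?thesis using assms(1) by (simp add: pos_le_divide_eq)
qed

text \<open>The cutoff vanishes identically once \<open>k > 2L\<close>, so its Lipschitz constant \<open>k / L\<close> can be
  replaced by \<open>2\<close>.\<close>

lemma freq_cutoff_lipschitz:
  assumes L: "L > 0" and k: "k > 0"
  shows "\<bar>freq_cutoff L k x - freq_cutoff L k y\<bar> \<le> 2 * norm (x - y)"
proof (cases "k \<le> 2 * L")
  case True
  have "\<bar>freq_cutoff L k x - freq_cutoff L k y\<bar> \<le> \<bar>k * (1 + norm x) / L - k * (1 + norm y) / L\<bar>"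
    unfolding freq_cutoff_def by (auto simp: max_def min_def abs_if)
  also have "\<dots> = k / L * \<bar>norm x - norm y\<bar>"
  proof -
    have "k * (1 + norm x) / L - k * (1 + norm y) / L = k / L * (norm x - norm y)"
      using L by (simp add: field_simps)
    then show ?thesis using L k by (simp add: abs_mult)
  qed
  also have "\<dots> \<le> 2 * norm (x - y)"
    using True L k norm_triangle_ineq3[of x y] by (intro mult_mono) (auto simp: pos_divide_le_eq)
  finally show ?thesis .
next
  case False
  have "freq_cutoff L k z = 0" for z :: 'a
  proof (rule ccontr)
    assume "freq_cutoff L k z \<noteq> 0"
    from freq_cutoff_low[OF L this] have "k * (1 + norm z) \<le> 2 * L" .
    moreover have "k * 1 \<le> k * (1 + norm z)" using k by (intro mult_left_mono) auto
    ultimately show False using False by linarith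
  qed
  then show ?thesis by simp
qed

lemma bump_lipschitz:
  assumes "c > 0" "(N::real) > 0"
  obtains l where "l \<ge> 0" "\<And>x y :: 'a::euclidean_space. \<bar>bump c N x - bump c N y\<bar> \<le> l * norm (x - y)"
proof -
  obtain l where l: "l \<ge> 0" "\<And>x y :: 'a. cmod (complex_of_real (bump c N x) - complex_of_real (bump c N y)) \<le> l * norm (x - y)"
    using test_fun_lipschitz[OF bump_test_fun[OF assms]] by blast
  show thesis using l(2) unfolding of_real_diff[symmetric] norm_of_real by (rule that[OF l(1)])
qed

definition low_part :: "real \<Rightarrow> real \<Rightarrow> ('a::euclidean_space \<Rightarrow> complex) \<Rightarrow> 'a \<Rightarrow> complex" where
  "low_part L k f x = complex_of_real (freq_cutoff L k x) * f x"

lemma low_part_L2: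
  assumes "f \<in> L2"
  shows "low_part L k f \<in> L2" "L2_norm (low_part L k f) \<le> L2_norm f"
proof -
  show 1: "low_part L k f \<in> L2"
    unfolding low_part_def
  proof (rule real_multiplier_L2[OF freq_cutoff_measurable _ assms])
    show "\<bar>freq_cutoff L k x\<bar> \<le> 1" for x :: 'a using freq_cutoff_range[of L k x] by simp
  qed
  show "L2_norm (low_part L k f) \<le> L2_norm f"
    unfolding L2_norm_def
  proof (intro real_sqrt_le_mono integral_mono L2_integrable 1 assms power_mono)
    show "cmod (low_part L k f x) \<le> cmod (f x)" for x
      unfolding low_part_def using freq_cutoff_range[of L k x] by (simp add: norm_mult mult_left_le_one_le)
  qed simp
qed

text \<open>Combines \<open>wigner_low_bound\<close> with \<open>localized_cutoff_bound\<close>. The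
  estimates involve t through |t| \<le> T only, so one index threshold serves all these
  times.\<close>

lemma low_frequency_vanishing:
  fixes h \<alpha> :: "nat \<Rightarrow> real" and u :: "nat \<Rightarrow> 'a::euclidean_space \<Rightarrow> complex" and \<mu> :: "('a \<times> 'a) measure"
  assumes h: "\<And>n. 0 < h n" "h \<longlonglongrightarrow> 0" and u: "\<And>n. u n \<in> L2" and uM: "\<And>n. L2_norm (u n) \<le> M" and M: "M > 0"
    and \<alpha>: "\<And>n. 0 < \<alpha> n" "filterlim \<alpha> at_top sequentially"
    and \<mu>: "radon_measure \<mu>" "emeasure \<mu> {(x, \<xi>). \<xi> = 0} = 0"
    and lim: "\<And>a. a \<in> test_fun \<Longrightarrow> (\<lambda>n. L2_inner (weyl_op (h n) a (u n)) (u n)) \<longlonglongrightarrow> (LINT z|\<mu>. a z)"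
    and a: "a \<in> test_fun" and L: "L > 0" and T: "T \<ge> 0" and e: "e > 0"
  shows "eventually (\<lambda>n. \<forall>t. \<bar>t\<bar> \<le> T \<longrightarrow>
    cmod (wigner_form (ft a) (h n) (\<alpha> n * h n) t (low_part L (\<alpha> n * h n) (fourier (u n))) (low_part L (\<alpha> n * h n) (fourier (u n)))) \<le> e) sequentially"
proof -
  define c where "c = (2 * pi) ^ DIM('a)"
  define c2 where "c2 = (2 * pi) ^ DIM('a \<times> 'a)"
  have c: "c > 0" "c2 > 0" unfolding c_def c2_def by auto
  obtain R0 where R0: "R0 > 0" "\<And>m \<xi>. R0 < norm m \<or> R0 < norm \<xi> \<Longrightarrow> a (m, \<xi>) = 0" using test_fun_pair_support[OF a] by blast
  obtain Ca where Ca: "Ca > 0" "\<And>z. cmod (a z) \<le> Ca" using Cc_bounded[OF test_fun_Cc[OF a]] by blast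
  \<comment> \<open>The denominator is the lower bound of \<open>bump 2 N\<close> on the ball of
    radius N, so C times that bump dominates a(x, 0) as soon as N \<ge> R0.\<close>
  define C where "C = Ca / exp (- 2 / 3) ^ DIM('a)"
  have C: "C > 0" unfolding C_def using Ca(1) by simp
  \<comment> \<open>Solves c2 C (\<kappa> + \<kappa>) = e/2: one \<kappa> for the initial mass in
    the large ball, one for the transport error.\<close>
  define \<kappa> where "\<kappa> = e / (4 * c2 * C)"
  have \<kappa>: "\<kappa> > 0" unfolding \<kappa>_def using e c C by simp
  define s where "s = sqrt \<kappa>"
  have s: "s > 0" "s\<^sup>2 = \<kappa>" unfolding s_def using \<kappa> by auto
  \<comment> \<open>The reciprocal of the lower bound of \<open>bump (1/2) \<delta>\<close> on the
    ball of radius \<delta>.\<close>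
  define K :: real where "K = 1 / exp (- (1/2) / 3) ^ DIM('a)"
  have K: "K > 0" unfolding K_def by simp
  \<comment> \<open>Makes K sqrt(\<eta>) = s/3, so that the norm bound s is reached by three equal
    contributions.\<close>
  define \<eta> where "\<eta> = (s / (3 * K))\<^sup>2"
  have \<eta>: "\<eta> > 0" unfolding \<eta>_def using s K by simp
  let ?b = "\<lambda>c N x::'a. complex_of_real (bump c N x)"
  have tf: "?b c N \<in> test_fun" if "c > 0" "N > 0" for c N :: real by (rule bump_test_fun[OF that])
  have int: "integrable lborel (ft (?b c N))" if "c > 0" "N > 0" for c N :: real by (intro ft_test_fun_integrable tf that)
  obtain d1 where d1: "d1 > 0" "\<forall>K. 0 \<le> K \<longrightarrow> K \<le> d1 \<longrightarrow> osc_modulus (ft (?b 2 1)) (\<lambda>p. p) K \<le> \<kappa> * c / M\<^sup>2"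
    using osc_modulus_small[OF int borel_ident, of 2 1 "\<kappa> * c / M\<^sup>2"] \<kappa> c M by auto
  obtain d2 where d2: "d2 > 0" "\<forall>K. 0 \<le> K \<longrightarrow> K \<le> d2 \<longrightarrow> osc_modulus (ft (?b 1 1)) (\<lambda>p. p) K \<le> (s / 3) * c / M"
    using osc_modulus_small[OF int borel_ident, of 1 1 "(s / 3) * c / M"] s c M by auto
  \<comment> \<open>R0 makes the bump cover the support of a(x, 0), 2TL/d1 absorbs the distance
    travelled up to time T, and 2/d2 absorbs the commutator with the cutoff, whose Lipschitz
    constant is 2.\<close>
  define N where "N = max R0 (max (2 * T * L / d1) (2 / d2))"
  have N: "N > 0" "R0 \<le> N" "2 * T * L / d1 \<le> N" "2 / d2 \<le> N" unfolding N_def using R0(1) by auto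
  have Nd: "2 * T * L / N \<le> d1" "2 / N \<le> d2"
    using N(1,3,4) d1(1) d2(1) by (auto simp: pos_divide_le_eq mult.commute)
  \<comment> \<open>Depends on N; the hypothesis that \<mu> does not charge \<xi> = 0 enters
    here.\<close>
  obtain \<delta> where \<delta>: "\<delta> > 0" "cmod (LINT z|\<mu>. complex_of_real (bump 2 N (fst z)) * complex_of_real (bump 1 \<delta> (snd z))) < \<eta> / 2"
    using bump_concentration[OF \<mu> N(1), of "\<eta> / 2"] \<eta> by auto
  obtain l where l: "l \<ge> 0" "\<And>x y :: 'a. \<bar>bump (1/2) \<delta> x - bump (1/2) \<delta> y\<bar> \<le> l * norm (x - y)"
    using bump_lipschitz[of "1/2" \<delta>] \<delta>(1) by auto
  obtain d3 where d3: "d3 > 0" "\<forall>k. 0 \<le> k \<longrightarrow> k \<le> d3 \<longrightarrow> osc_modulus (ft (?b 1 N)) (\<lambda>p. p) k \<le> (s / (3 * K)) * c / M"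
    using osc_modulus_small[OF int borel_ident, of 1 N "(s / (3 * K)) * c / M"] s c M K N(1) by auto
  obtain d4 where d4: "d4 > 0" "\<forall>k. 0 \<le> k \<longrightarrow> k \<le> d4 \<longrightarrow> osc_modulus (ft (?b 2 N)) (\<lambda>p. p) k \<le> (\<eta> / 2) * c / M\<^sup>2"
    using osc_modulus_small[OF int borel_ident, of 2 N "(\<eta> / 2) * c / M\<^sup>2"] \<eta> c M N(1) by auto
  obtain d5 where d5: "d5 > 0" "\<forall>k. 0 \<le> k \<longrightarrow> k \<le> d5 \<longrightarrow> osc_modulus (ft a) snd k \<le> e / 2 / M\<^sup>2"
    using osc_modulus_small[OF ft_test_fun_integrable[OF a] fst_snd_measurable(2), of "e / 2 / M\<^sup>2"] e M by auto
  let ?sym = "\<lambda>z::'a \<times> 'a. complex_of_real ((bump 1 N (fst z))\<^sup>2) * complex_of_real (bump 1 \<delta> (snd z))"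
  have sq: "(bump 1 N x)\<^sup>2 = bump 2 N x" for x :: 'a unfolding bump_square by simp
  have sym: "?sym \<in> test_fun"
    unfolding sq of_real_mult[symmetric] using bump_pair_test_fun[of 2 N 1 \<delta>] N(1) \<delta>(1) by simp
  \<comment> \<open>The convergence of the Weyl forms is applied to one symbol, fixed before
    n.\<close>
  have ev1: "eventually (\<lambda>n. cmod (L2_inner (weyl_op (h n) ?sym (u n)) (u n)) < \<eta> / 2) sequentially"
    using tendsto_norm[OF lim[OF sym]] \<delta>(2) unfolding sq by (rule order_tendstoD(2))
  \<comment> \<open>l h is the Lipschitz constant of the rescaled frequency bump, so its commutators
    disappear in the limit.\<close>
  have lh: "(\<lambda>n. l * h n) \<longlonglongrightarrow> 0" using tendsto_mult_right_zero[OF h(2)] by simp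
  have ev2: "eventually (\<lambda>n. l * h n < min d3 d4) sequentially" using lh d3(1) d4(1) by (intro order_tendstoD(2)) auto
  have ev3: "eventually (\<lambda>n. 2 * L / min \<delta> d5 \<le> \<alpha> n) sequentially" using \<alpha>(2) unfolding filterlim_at_top by blast
  from ev1 ev2 ev3 show ?thesis
  proof eventually_elim
    case (elim n)
    define k where "k = \<alpha> n * h n"
    have k: "k > 0" unfolding k_def using \<alpha>(1) h(1) by simp
    \<comment> \<open>The radius of the ball that contains the low frequencies.\<close>
    define R where "R = 2 * L / k"
    have R: "R > 0" unfolding R_def using L k by simp
    \<comment> \<open>The factor h cancels and leaves 2L/\<alpha>: it is the growth of \<alpha> that
      sends the rescaled low frequencies to 0.\<close>
    have hR: "h n * R = 2 * L / \<alpha> n" unfolding R_def k_def using h(1)[of n] by simp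
    have hR': "h n * R \<le> \<delta>" "h n * R \<le> d5"
    proof -
      have "2 * L / \<alpha> n \<le> min \<delta> d5"
        using elim(3) \<alpha>(1)[of n] \<delta>(1) d5(1) by (simp add: pos_divide_le_eq mult.commute del: min_less_iff_conj min.bounded_iff)
      then show "h n * R \<le> \<delta>" "h n * R \<le> d5" unfolding hR by auto
    qed
    let ?f = "fourier (u n)" and ?\<rho> = "freq_cutoff L k :: 'a \<Rightarrow> real"
    let ?fl = "low_part L k ?f"
    have f: "?f \<in> L2" by (rule fourier_L2[OF u])
    have fl: "?fl \<in> L2" by (rule low_part_L2[OF f])
    have flM: "L2_norm ?fl \<le> M" using low_part_L2(2)[OF f, of L k] uM[of n] by (simp add: fourier_norm[OF u])
    have flM2: "(L2_norm ?fl)\<^sup>2 \<le> M\<^sup>2" by (intro power_mono flM L2_norm_nonneg)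
    have uM2: "(L2_norm (u n))\<^sup>2 \<le> M\<^sup>2" by (intro power_mono uM L2_norm_nonneg)
    have supp: "norm x \<le> R" if "?\<rho> x \<noteq> 0" for x
    proof -
      have "k * norm x \<le> 2 * L" using freq_cutoff_low[OF L that] k by (simp add: distrib_left)
      then show ?thesis unfolding R_def using k by (simp add: pos_le_divide_eq mult.commute)
    qed
    let ?m = "\<lambda>x::'a. bump (1/2) \<delta> (h n *\<^sub>R x)"
    have "L2_norm (\<lambda>x. ?b 1 N x * fourinv (\<lambda>x. complex_of_real (?\<rho> x) * ?f x) x)
      \<le> osc_modulus (ft (?b 1 N)) (\<lambda>p. p) 2 / (2 * pi) ^ DIM('a) * L2_norm (u n)
      + K * (osc_modulus (ft (?b 1 N)) (\<lambda>p. p) (l * h n) / (2 * pi) ^ DIM('a) * L2_norm (u n)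
        + sqrt (cmod (L2_inner (weyl_op (h n) ?sym (u n)) (u n))
            + osc_modulus (ft (\<lambda>x::'a. complex_of_real ((bump 1 N x)\<^sup>2))) (\<lambda>p. p) (l * h n) / (2 * pi) ^ DIM('a) * (L2_norm (u n))\<^sup>2))"
    proof (rule localized_cutoff_bound[where \<theta> = "bump 1 N" and b = "?b 1 \<delta>" and m = ?m and \<rho> = ?\<rho> and K = K])
      show "?b 1 N \<in> test_fun" "?b 1 \<delta> \<in> test_fun" using N(1) \<delta>(1) by (auto intro: tf)
      show "(\<lambda>x::'a. complex_of_real ((bump 1 N x)\<^sup>2)) \<in> test_fun" unfolding sq using N(1) by (auto intro: tf)
      show "?sym \<in> test_fun" by (rule sym)
      show "0 < h n" "u n \<in> L2" by (rule h(1), rule u)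
      show "?m \<in> borel_measurable borel" by measurable
      show "\<bar>?m x\<bar> \<le> 1" for x using bump_le_1[of "1/2" \<delta> "h n *\<^sub>R x"] bump_nonneg[of "1/2" \<delta> "h n *\<^sub>R x"] by simp
      show "\<bar>?m x - ?m y\<bar> \<le> l * h n * norm (x - y)" for x y
        using l(2)[of "h n *\<^sub>R x" "h n *\<^sub>R y"] h(1)[of n] by (simp flip: scaleR_diff_right)
      show "0 \<le> l * h n" using l(1) h(1)[of n] by simp
      show "?\<rho> \<in> borel_measurable borel" by measurable
      show "\<bar>?\<rho> x\<bar> \<le> 1" for x using freq_cutoff_range[of L k x] by simp
      show "\<bar>?\<rho> x - ?\<rho> y\<bar> \<le> 2 * norm (x - y)" for x y by (rule freq_cutoff_lipschitz[OF L k])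
      show "?b 1 \<delta> (h n *\<^sub>R x) = complex_of_real ((?m x)\<^sup>2)" for x unfolding bump_square by simp
      \<comment> \<open>Where the cutoff is nonzero, h|x| \<le> h R \<le> \<delta>, so the bump is
        at least 1/K there.\<close>
      show "\<bar>?\<rho> x\<bar> \<le> K * \<bar>?m x\<bar>" for x
      proof (cases "?\<rho> x = 0")
        case False
        have "norm (h n *\<^sub>R x) \<le> h n * R" using supp[OF False] h(1)[of n] by simp
        then have "norm (h n *\<^sub>R x) \<le> \<delta>" using hR'(1) by linarith
        from bump_lower[OF \<delta>(1) _ this, of "1/2"] have "1 \<le> K * ?m x"
          unfolding K_def by (simp add: pos_le_divide_eq)
        then show ?thesis using freq_cutoff_range[of L k x] bump_nonneg[of "1/2" \<delta> "h n *\<^sub>R x"] by simp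
      qed (use K bump_nonneg[of "1/2" \<delta> "h n *\<^sub>R x"] in simp)
    qed (use K in auto)
    also have "\<dots> \<le> s / 3 + K * (s / (3 * K) + sqrt (\<eta> / 2 + \<eta> / 2))"
    proof -
      have conv: "X / c * Y \<le> Z" if "X \<le> Z * c / Y'" "Y \<le> Y'" "0 \<le> X" "0 < Y'" for X Y Y' Z :: real
      proof -
        have "X / c * Y \<le> X / c * Y'" using that c by (intro mult_left_mono) auto
        also have "\<dots> \<le> Z" using that c by (simp add: field_simps)
        finally show ?thesis .
      qed
      have "osc_modulus (ft (?b 1 N)) (\<lambda>p. p) 2 = osc_modulus (ft (?b 1 1)) (\<lambda>p. p) (2 / N)"
        by (rule osc_modulus_bump[OF N(1)])
      also have "\<dots> \<le> (s / 3) * c / M" using d2(2) Nd(2) N(1) by simp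
      finally have 1: "osc_modulus (ft (?b 1 N)) (\<lambda>p. p) 2 / (2 * pi) ^ DIM('a) * L2_norm (u n) \<le> s / 3"
        unfolding c_def[symmetric] by (intro conv[OF _ uM] osc_modulus_nonneg M) auto
      have lh0: "0 \<le> l * h n" using l(1) h(1)[of n] by simp
      have 2: "osc_modulus (ft (?b 1 N)) (\<lambda>p. p) (l * h n) / (2 * pi) ^ DIM('a) * L2_norm (u n) \<le> s / (3 * K)"
        unfolding c_def[symmetric] using d3(2) lh0 elim(2) by (intro conv[OF _ uM] osc_modulus_nonneg M) auto
      have 3: "osc_modulus (ft (\<lambda>x::'a. complex_of_real ((bump 1 N x)\<^sup>2))) (\<lambda>p. p) (l * h n) / (2 * pi) ^ DIM('a) * (L2_norm (u n))\<^sup>2 \<le> \<eta> / 2"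
        unfolding c_def[symmetric] sq using d4(2) lh0 elim(2) M by (intro conv[OF _ uM2] osc_modulus_nonneg) auto
      show ?thesis using 1 2 3 elim(1) K by (intro add_mono mult_left_mono real_sqrt_le_mono) auto
    qed
    also have "\<dots> = s"
    proof -
      have "sqrt (\<eta> / 2 + \<eta> / 2) = s / (3 * K)" unfolding \<eta>_def using K s(1) by simp
      then show ?thesis using K by (simp add: field_simps)
    qed
    finally have S: "L2_norm (\<lambda>x. ?b 1 N x * fourinv ?fl x) \<le> s" unfolding low_part_def .
    have V: "(LINT x|lborel. bump 2 N x * (cmod (fourinv ?fl x))\<^sup>2) \<le> \<kappa>"
    proof -
      have "(LINT x|lborel. bump 2 N x * (cmod (fourinv ?fl x))\<^sup>2) = (L2_norm (\<lambda>x. ?b 1 N x * fourinv ?fl x))\<^sup>2"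
        unfolding L2_norm_sq sq[symmetric] by (simp add: norm_mult power_mult_distrib)
      also have "\<dots> \<le> s\<^sup>2" by (intro power_mono S L2_norm_nonneg)
      finally show ?thesis unfolding s(2) .
    qed
    have E: "osc_modulus (ft (?b 2 N)) (\<lambda>p. p) (T * k * R) / (2 * pi) ^ DIM('a) * (L2_norm ?fl)\<^sup>2 \<le> \<kappa>"
    proof -
      have "T * k * R = 2 * T * L" unfolding R_def using k by simp
      then have "osc_modulus (ft (?b 2 N)) (\<lambda>p. p) (T * k * R) = osc_modulus (ft (?b 2 1)) (\<lambda>p. p) (2 * T * L / N)"
        by (simp only: osc_modulus_bump[OF N(1)])
      also have "\<dots> \<le> \<kappa> * c / M\<^sup>2" using d1(2) Nd(1) N(1) T L by simp
      finally have "osc_modulus (ft (?b 2 N)) (\<lambda>p. p) (T * k * R) / c \<le> \<kappa> / M\<^sup>2" using c M by (simp add: field_simps)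
      then have "osc_modulus (ft (?b 2 N)) (\<lambda>p. p) (T * k * R) / c * (L2_norm ?fl)\<^sup>2 \<le> \<kappa> / M\<^sup>2 * M\<^sup>2"
        using flM2 \<kappa> by (intro mult_mono) auto
      then show ?thesis unfolding c_def using M by simp
    qed
    have A: "osc_modulus (ft a) snd (h n * R) * (L2_norm ?fl)\<^sup>2 \<le> e / 2"
    proof -
      have "osc_modulus (ft a) snd (h n * R) * (L2_norm ?fl)\<^sup>2 \<le> e / 2 / M\<^sup>2 * M\<^sup>2"
        using d5(2) hR'(2) h(1)[of n] R flM2 e by (intro mult_mono) auto
      then show ?thesis using M by simp
    qed
    have "cmod (wigner_form (ft a) (h n) k t ?fl ?fl) \<le> e" if t: "\<bar>t\<bar> \<le> T" for t
    proof -
      have "cmod (wigner_form (ft a) (h n) k t ?fl ?fl) \<le> osc_modulus (ft a) snd (h n * R) * (L2_norm ?fl)\<^sup>2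
        + (2 * pi) ^ DIM('a \<times> 'a) * (C * ((LINT x|lborel. bump 2 N x * (cmod (fourinv ?fl x))\<^sup>2)
        + osc_modulus (ft (?b 2 N)) (\<lambda>p. p) (T * k * R) / (2 * pi) ^ DIM('a) * (L2_norm ?fl)\<^sup>2))"
      proof (rule wigner_low_bound[OF a tf fl _ _ _ _ _ _ t])
        show "norm x \<le> R" if "?fl x \<noteq> 0" for x using that by (intro supp) (auto simp: low_part_def)
        show "cmod (a (x, 0)) \<le> C * bump 2 N x" for x
        proof (cases "norm x \<le> N")
          case True
          have "Ca / exp (- 2 / 3) ^ DIM('a) * exp (- 2 / 3) ^ DIM('a) \<le> C * bump 2 N x"
            unfolding C_def using bump_lower[OF N(1) _ True, of 2] Ca(1) by (intro mult_left_mono) auto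
          then show ?thesis using Ca(2)[of "(x, 0)"] by simp
        next
          case False
          then show ?thesis using R0(2)[of x 0] N(2) C bump_nonneg[of 2 N x] by simp
        qed
      qed (use N(1) R h(1)[of n] k C in auto)
      also have "\<dots> \<le> e / 2 + c2 * (C * (\<kappa> + \<kappa>))"
        unfolding c2_def[symmetric] using A V E c C by (intro add_mono mult_left_mono) auto
      also have "\<dots> = e" unfolding \<kappa>_def using c C by (simp add: field_simps)
      finally show ?thesis .
    qed
    then show ?case unfolding k_def by blast
  qed
qed

section \<open>The limit of the time averages\<close>

lemma wigner_average_integrable:
  fixes A :: "'a::euclidean_space \<times> 'a \<Rightarrow> complex"
  assumes A: "integrable lborel A" and \<phi>: "integrable lborel \<phi>" and f: "f \<in> L2" and g: "g \<in> L2"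
  shows "integrable lborel (\<lambda>t. \<phi> t * wigner_form A h k t f g)"
    and "cmod (LINT t|lborel. \<phi> t * wigner_form A h k t f g)
      \<le> (LINT t|lborel. cmod (\<phi> t)) * ((LINT z|lborel. cmod (A z)) * (L2_norm f * L2_norm g))"
proof -
  let ?B = "(LINT z|lborel. cmod (A z)) * (L2_norm f * L2_norm g)"
  have B: "cmod (wigner_form A h k t f g) \<le> ?B" for t by (rule wigner_form_bound[OF A f g])
  then have B0: "0 \<le> ?B" by (rule order_trans[OF norm_ge_zero])
  have [measurable]: "\<phi> \<in> borel_measurable borel" using borel_measurable_integrable[OF \<phi>] by simp
  have [measurable]: "(\<lambda>t. wigner_form A h k t f g) \<in> borel_measurable borel"
    using borel_measurable_integrable[OF A] by (intro wigner_form_measurable L2_measurable[OF f] L2_measurable[OF g]) simp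
  have i: "integrable lborel (\<lambda>t. cmod (\<phi> t) * ?B)" using \<phi> by (intro integrable_mult_left integrable_norm)
  have le: "cmod (\<phi> t * wigner_form A h k t f g) \<le> cmod (\<phi> t) * ?B" for t
    unfolding norm_mult by (intro mult_left_mono B) simp
  show "integrable lborel (\<lambda>t. \<phi> t * wigner_form A h k t f g)"
  proof (rule Bochner_Integration.integrable_bound[OF i])
    have "0 \<le> cmod (\<phi> t) * ?B" for t by (rule mult_nonneg_nonneg[OF norm_ge_zero B0])
    then show "AE t in lborel. norm (\<phi> t * wigner_form A h k t f g) \<le> norm (cmod (\<phi> t) * ?B)"
      using le by (intro AE_I2) (simp only: real_norm_def abs_of_nonneg)
  qed measurable
  have "cmod (LINT t|lborel. \<phi> t * wigner_form A h k t f g) \<le> (LINT t|lborel. cmod (\<phi> t) * ?B)"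
    by (rule integral_norm_le[OF i le])
  then show "cmod (LINT t|lborel. \<phi> t * wigner_form A h k t f g) \<le> (LINT t|lborel. cmod (\<phi> t)) * ?B" by simp
qed

theorem time_averaged_wigner_tendsto_0:
  fixes h \<alpha> :: "nat \<Rightarrow> real" and u :: "nat \<Rightarrow> 'a::euclidean_space \<Rightarrow> complex" and \<mu> :: "('a \<times> 'a) measure"
  assumes h: "\<And>n. 0 < h n" "h \<longlonglongrightarrow> 0" and u: "\<And>n. u n \<in> L2" and u_bdd: "\<exists>C. \<forall>n. L2_norm (u n) \<le> C"
    and \<alpha>: "\<And>n. 0 < \<alpha> n" "filterlim \<alpha> at_top sequentially"
    and \<mu>: "radon_measure \<mu>" "emeasure \<mu> {(x, \<xi>). \<xi> = 0} = 0"
    and lim: "\<And>a. a \<in> test_fun \<Longrightarrow> (\<lambda>n. L2_inner (weyl_op (h n) a (u n)) (u n)) \<longlonglongrightarrow> (LINT z|\<mu>. a z)"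
    and \<phi>: "integrable lborel \<phi>" and a: "a \<in> test_fun"
  shows "(\<lambda>n. time_averaged_wigner (h n) (\<alpha> n) (u n) \<phi> a) \<longlonglongrightarrow> 0"
proof -
  obtain M0 where M0: "\<And>n. L2_norm (u n) \<le> M0" using u_bdd by blast
  define M where "M = max M0 1"
  have M: "M > 0" and uM: "\<And>n. L2_norm (u n) \<le> M" unfolding M_def using M0 by (auto intro: le_max_iff_disj[THEN iffD2])
  let ?A = "ft a" and ?f = "\<lambda>n. fourier (u n)" and ?k = "\<lambda>n. \<alpha> n * h n"
  define c where "c = (2 * pi) ^ DIM('a) * (2 * pi) ^ DIM('a)"
  have c: "c > 0" unfolding c_def by simp
  have A: "integrable lborel ?A" by (rule ft_test_fun_integrable[OF a])
  have f: "?f n \<in> L2" and fM: "L2_norm (?f n) \<le> M" for n using u uM by (auto simp: fourier_L2 fourier_norm)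
  let ?I = "\<lambda>\<phi> n. LINT t|lborel. \<phi> t * wigner_form ?A (h n) (?k n) t (?f n) (?f n)"
  have tw: "time_averaged_wigner (h n) (\<alpha> n) (u n) \<phi> a = ?I \<phi> n / complex_of_real c" for n
    unfolding time_averaged_wigner_def weyl_schroedinger[OF a h(1) u] c_def by simp
  define B where "B = (LINT z|lborel. cmod (?A z)) * (M * M)"
  have B: "B \<ge> 0" unfolding B_def by (intro mult_nonneg_nonneg Bochner_Integration.integral_nonneg) (use M in auto)
  have ev: "eventually (\<lambda>n. cmod (?I \<phi> n) \<le> e) sequentially" if e: "e > 0" for e
  proof -
    \<comment> \<open>The tolerance e is shared by four errors: the low-low term, two terms with a
      high factor, and the replacement of \<phi> by g.\<close>
    have e4: "e / (4 * (B + 1)) > 0" using e B by simp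
    have [measurable]: "\<phi> \<in> borel_measurable borel" using borel_measurable_integrable[OF \<phi>] by simp
    \<comment> \<open>B bounds the Wigner forms uniformly in t and n, so closeness of \<phi> and g
      in the mean suffices. Continuity of g serves the Riemann-Lebesgue lemma, its bounded support
      limits the times to be controlled at low frequency.\<close>
    obtain g where g: "g \<in> Cc" "(LINT t|lborel. cmod (\<phi> t - g t)) < e / (4 * (B + 1))"
      using Cc_dense[of \<phi> 1 "e / (4 * (B + 1))"] \<phi> e4 by (auto simp: integrable_norm)
    have gi: "integrable lborel g" by (rule Cc_integrable[OF g(1)])
    let ?G = "LINT t|lborel. cmod (g t)"
    have G: "?G \<ge> 0" by (intro Bochner_Integration.integral_nonneg) simp
    obtain T where T: "\<And>t. T < norm t \<Longrightarrow> g t = 0" using g(1) unfolding Cc_def by blast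
    \<comment> \<open>The frequency threshold depends on g, the symbol and e, and precedes all
      constants of the low frequency estimate.\<close>
    obtain L where L: "L > 0" "\<forall>h k f f'. k > 0 \<longrightarrow> f \<in> L2 \<longrightarrow> f' \<in> L2 \<longrightarrow> L2_norm f \<le> M \<longrightarrow> L2_norm f' \<le> M \<longrightarrow>
        (\<forall>x. f' x \<noteq> 0 \<longrightarrow> L \<le> k * (1 + norm x)) \<or> (\<forall>x. f x \<noteq> 0 \<longrightarrow> L \<le> k * (1 + norm x)) \<longrightarrow>
        cmod (LINT t|lborel. g t * wigner_form ?A h k t f f') \<le> e / 4"
      using high_frequency_bound[OF A g(1), of "e / 4" M] e M by auto
    have "0 < 4 * (X + 1)" if "0 \<le> X" for X :: real using that by simp
    from divide_pos_pos[OF e this[OF G]] have eG: "e / (4 * (?G + 1)) > 0" .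
    have "eventually (\<lambda>n. \<forall>t. \<bar>t\<bar> \<le> max T 0 \<longrightarrow>
        cmod (wigner_form ?A (h n) (?k n) t (low_part L (?k n) (?f n)) (low_part L (?k n) (?f n))) \<le> e / (4 * (?G + 1))) sequentially"
      by (rule low_frequency_vanishing[OF h u uM M \<alpha> \<mu> lim a L(1) _ eG]) auto
    then show ?thesis
    proof eventually_elim
      case (elim n)
      let ?fl = "low_part L (?k n) (?f n)" and ?fh = "\<lambda>x. complex_of_real (1 - freq_cutoff L (?k n) x) * ?f n x"
      let ?J = "\<lambda>\<phi> f f'. LINT t|lborel. \<phi> t * wigner_form ?A (h n) (?k n) t f f'"
      have k: "?k n > 0" using h(1) \<alpha>(1) by simp
      have fl: "?fl \<in> L2" "L2_norm ?fl \<le> M" using low_part_L2[OF f[of n], of L "?k n"] fM[of n] by auto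
      have fh: "?fh \<in> L2"
      proof (rule real_multiplier_L2[OF _ _ f])
        show "\<bar>1 - freq_cutoff L (?k n) x\<bar> \<le> 1" for x :: 'a using freq_cutoff_range[of L "?k n" x] by simp
      qed measurable
      have fhM: "L2_norm ?fh \<le> M"
      proof -
        have "L2_norm ?fh \<le> L2_norm (?f n)"
          unfolding L2_norm_def
        proof (intro real_sqrt_le_mono integral_mono L2_integrable fh f power_mono)
          show "cmod (complex_of_real (1 - freq_cutoff L (?k n) x) * ?f n x) \<le> cmod (?f n x)" for x
            unfolding norm_mult norm_of_real using freq_cutoff_range[of L "?k n" x] by (intro mult_left_le_one_le) auto
        qed simp
        then show ?thesis using fM[of n] by linarith
      qed
      have sum: "(\<lambda>x. ?fl x + ?fh x) = ?f n" unfolding low_part_def by (simp add: algebra_simps)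
      have hi: "L \<le> ?k n * (1 + norm x)" if "?fh x \<noteq> 0" for x
        using that by (intro freq_cutoff_high[OF L(1)]) auto
      have 1: "cmod (?J g ?fh ?fl) \<le> e / 4" using hi by (intro L(2)[rule_format, OF k fh fl(1) fhM fl(2)]) blast
      have 2: "cmod (?J g (?f n) ?fh) \<le> e / 4" using hi by (intro L(2)[rule_format, OF k f fh fM fhM]) blast
      have 3: "cmod (?J g ?fl ?fl) \<le> e / 4"
      proof -
        have "cmod (?J g ?fl ?fl) \<le> (LINT t|lborel. cmod (g t) * (e / (4 * (?G + 1))))"
        proof (rule integral_norm_le)
          show "integrable lborel (\<lambda>t. cmod (g t) * (e / (4 * (?G + 1))))" using gi by (intro integrable_mult_left integrable_norm)
          show "cmod (g t * wigner_form ?A (h n) (?k n) t ?fl ?fl) \<le> cmod (g t) * (e / (4 * (?G + 1)))" for t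
          proof (cases "\<bar>t\<bar> \<le> max T 0")
            case True
            then show ?thesis using elim unfolding norm_mult by (intro mult_left_mono) auto
          next
            case False
            then show ?thesis using T[of t] by simp
          qed
        qed
        also have "\<dots> = ?G * (e / (4 * (?G + 1)))" by simp
        also have "\<dots> \<le> (?G + 1) * (e / (4 * (?G + 1)))" using eG by (intro mult_right_mono) auto
        also have "\<dots> = e / 4"
        proof -
          have "(X + 1) * (e / (4 * (X + 1))) = e / 4" if "0 \<le> X" for X :: real using that by (simp add: field_simps)
          from this[OF G] show ?thesis .
        qed
        finally show ?thesis .
      qed
      have "?J g (?f n) (?f n) = (LINT t|lborel. (g t * wigner_form ?A (h n) (?k n) t ?fl ?fl
          + g t * wigner_form ?A (h n) (?k n) t ?fh ?fl) + g t * wigner_form ?A (h n) (?k n) t (?f n) ?fh)"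
        using wigner_form_split[OF A fl(1) fh] unfolding sum by (simp add: distrib_left)
      also have "\<dots> = ?J g ?fl ?fl + ?J g ?fh ?fl + ?J g (?f n) ?fh"
        using wigner_average_integrable(1)[OF A gi fl(1) fl(1)] wigner_average_integrable(1)[OF A gi fh fl(1)]
          wigner_average_integrable(1)[OF A gi f fh]
        by (simp only: Bochner_Integration.integral_add Bochner_Integration.integrable_add)
      finally have split: "?J g (?f n) (?f n) = ?J g ?fl ?fl + ?J g ?fh ?fl + ?J g (?f n) ?fh" .
      have "cmod (?J g (?f n) (?f n)) \<le> cmod (?J g ?fl ?fl) + cmod (?J g ?fh ?fl) + cmod (?J g (?f n) ?fh)"
        unfolding split by (intro order_trans[OF norm_triangle_ineq] add_right_mono norm_triangle_ineq)
      with 1 2 3 have 4: "cmod (?J g (?f n) (?f n)) \<le> 3 * (e / 4)" by linarith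
      have d: "integrable lborel (\<lambda>t. \<phi> t - g t)" using \<phi> gi by (rule Bochner_Integration.integrable_diff)
      have "cmod (?J (\<lambda>t. \<phi> t - g t) (?f n) (?f n)) \<le> (LINT t|lborel. cmod (\<phi> t - g t)) * ((LINT z|lborel. cmod (?A z)) * (L2_norm (?f n) * L2_norm (?f n)))"
        by (rule wigner_average_integrable(2)[OF A d f f])
      also have "\<dots> \<le> e / (4 * (B + 1)) * B"
        unfolding B_def using g(2) e4 fM M
        by (intro mult_mono) (auto intro!: mult_nonneg_nonneg simp: L2_norm_nonneg B_def)
      also have "\<dots> \<le> e / (4 * (B + 1)) * (B + 1)" using e4 by (intro mult_left_mono) auto
      also have "\<dots> = e / 4" using B by (simp add: field_simps)
      finally have 5: "cmod (?J (\<lambda>t. \<phi> t - g t) (?f n) (?f n)) \<le> e / 4" .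
      have "?J \<phi> (?f n) (?f n) = ?J g (?f n) (?f n) + ?J (\<lambda>t. \<phi> t - g t) (?f n) (?f n)"
        using wigner_average_integrable(1)[OF A gi f f] wigner_average_integrable(1)[OF A d f f]
        by (subst Bochner_Integration.integral_add[symmetric]) (auto simp: algebra_simps)
      then show ?case using 4 5 norm_triangle_ineq[of "?J g (?f n) (?f n)" "?J (\<lambda>t. \<phi> t - g t) (?f n) (?f n)"] by simp
    qed
  qed
  have "?I \<phi> \<longlonglongrightarrow> 0"
  proof (rule tendstoI)
    fix e :: real assume "e > 0"
    then have "eventually (\<lambda>n. cmod (?I \<phi> n) \<le> e / 2) sequentially" by (intro ev) simp
    then show "eventually (\<lambda>n. dist (?I \<phi> n) 0 < e) sequentially"
      by eventually_elim (use \<open>e > 0\<close> in simp)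
  qed
  from tendsto_divide[OF this tendsto_const, of "complex_of_real c"] c show ?thesis unfolding tw by simp
qed

text \<open>Countably many nonnegative symbols suffice: bumps of growing width, positive on balls
  that exhaust the space. When the integrals of all of them against a positive measure vanish, so
  does the measure.\<close>

theorem Linf_measures_eq_null:
  fixes \<mu> :: "real \<Rightarrow> 'a::euclidean_space measure"
  assumes \<mu>: "\<mu> \<in> Linf_measures"
    and zero: "\<And>\<phi> a. integrable lborel \<phi> \<Longrightarrow> a \<in> test_fun \<Longrightarrow> (LINT t|lborel. \<phi> t * (LINT z|\<mu> t. a z)) = 0"
  shows "AE t in lborel. \<mu> t = null_measure borel"
proof -
  have sets [simp]: "sets (\<mu> t) = sets borel" and fin: "finite_measure (\<mu> t)" for t
    using \<mu> unfolding Linf_measures_def radon_measure_def by auto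
  obtain C where C: "AE t in lborel. measure (\<mu> t) UNIV \<le> C" using \<mu> unfolding Linf_measures_def by blast
  have space: "space (\<mu> t) = UNIV" for t using sets_eq_imp_space_eq[OF sets] by simp
  let ?g = "\<lambda>k. bump 1 (real (Suc k)) :: 'a \<Rightarrow> real" and ?G = "\<lambda>k t. LINT z|\<mu> t. bump 1 (real (Suc k)) z"
  have g: "(\<lambda>z::'a. complex_of_real (?g k z)) \<in> test_fun" for k by (rule bump_test_fun) auto
  have gi: "integrable (\<mu> t) (?g k)" for t k
  proof (rule finite_measure.integrable_const_bound[OF fin, where B = 1])
    show "AE z in \<mu> t. norm (?g k z) \<le> 1"
    proof (rule AE_I2)
      show "norm (?g k z) \<le> 1" for z using bump_le_1[of 1 "real (Suc k)" z] bump_nonneg[of 1 "real (Suc k)" z] by simp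
    qed
    show "?g k \<in> borel_measurable (\<mu> t)" using bump_measurable by (simp cong: measurable_cong_sets)
  qed
  have G0: "0 \<le> ?G k t" for k t by (intro Bochner_Integration.integral_nonneg bump_nonneg)
  have G1: "?G k t \<le> measure (\<mu> t) UNIV" for k t
  proof -
    have "?G k t \<le> (LINT z|\<mu> t. 1)"
      by (rule integral_mono[OF gi]) (auto intro: bump_le_1 finite_measure.integrable_const[OF fin])
    then show ?thesis by (simp add: space)
  qed
  have Gm [measurable]: "?G k \<in> borel_measurable borel" for k
  proof -
    have "continuous_on UNIV (\<lambda>z. Re (complex_of_real (?g k z)))"
      using g[of k] smooth_continuous unfolding test_fun_def by (intro continuous_on_Re) blast
    moreover have "compactly_supported (?g k)" using g[of k] unfolding test_fun_def compactly_supported_def by simp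
    ultimately show ?thesis using \<mu> unfolding Linf_measures_def by simp
  qed
  have "AE t in lborel. ?G k t = 0" for k
  proof -
    \<comment> \<open>The Gaussian is an integrable time weight without zeros. Since the inner
      integral is nonnegative, the vanishing of its time average forces it to vanish for almost
      every t.\<close>
    let ?F = "\<lambda>t::real. gauss t * ?G k t"
    have [measurable]: "gauss \<in> borel_measurable (borel :: real measure)" by (rule gauss_measurable)
    have Fi: "integrable lborel ?F"
    proof (rule Bochner_Integration.integrable_bound)
      show "integrable lborel (\<lambda>t::real. gauss t * C)" by (intro integrable_mult_left gauss_integrable)
      show "?F \<in> borel_measurable lborel" by measurable
      show "AE t in lborel. norm (?F t) \<le> norm (gauss t * C)"
        using C
      proof eventually_elim
        case (elim t)
        have "\<bar>?G k t\<bar> \<le> \<bar>C\<bar>" using G0[of t k] G1[of t k] elim by linarith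
        then show ?case by (simp add: abs_mult mult_left_mono)
      qed
    qed
    have "complex_of_real (LINT t|lborel. ?F t) = (LINT t|lborel. complex_of_real (gauss t) * (LINT z|\<mu> t. complex_of_real (?g k z)))"
      by (simp only: integral_complex_of_real of_real_mult[symmetric])
    also have "\<dots> = 0" by (rule zero[OF _ g]) (simp add: gauss_integrable)
    finally have "(LINT t|lborel. ?F t) = 0" by simp
    moreover have "AE t in lborel. 0 \<le> ?F t" using G0 gauss_nonneg by (intro AE_I2 mult_nonneg_nonneg)
    ultimately have "AE t in lborel. ?F t = 0" using integral_nonneg_eq_0_iff_AE[OF Fi] by simp
    then show ?thesis
    proof eventually_elim
      case (elim t)
      then show ?case using gauss_pos[of t] by simp
    qed
  qed
  then have "AE t in lborel. \<forall>k. ?G k t = 0" by (simp add: AE_all_countable)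
  then show ?thesis
  proof eventually_elim
    case (elim t)
    have "AE z in \<mu> t. ?g k z = 0" for k
      using elim integral_nonneg_eq_0_iff_AE[OF gi[of t k] AE_I2[OF bump_nonneg]] by simp
    then have "AE z in \<mu> t. \<forall>k. ?g k z = 0" by (simp add: AE_all_countable)
    then have "AE z in \<mu> t. False"
    proof eventually_elim
      case (elim z)
      obtain k where "norm z \<le> real k" using real_arch_simple by blast
      then have "norm z \<le> real (Suc k)" by simp
      from bump_lower[OF _ _ this, of 1] have "0 < ?g k z" by (auto intro: less_le_trans[rotated])
      then show ?case using elim[rule_format, of k] by simp
    qed
    then have "emeasure (\<mu> t) UNIV = 0"
      using AE_iff_null_sets[of UNIV "\<mu> t"] by (auto simp: null_sets_def)
    then have "emeasure (\<mu> t) X = 0" if "X \<in> sets borel" for X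
      using emeasure_mono[of X UNIV "\<mu> t"] by simp
    then show ?case by (intro measure_eqI) auto
  qed
qed

theorem proposition6:
  fixes h \<alpha> :: "nat \<Rightarrow> real"
    and u :: "nat \<Rightarrow> real ^ 'd \<Rightarrow> complex"
    and \<mu>0 :: "((real ^ 'd) \<times> (real ^ 'd)) measure"
  assumes h_pos: "\<And>n. 0 < h n"
    and h_lim: "h \<longlonglongrightarrow> 0"
    and u_L2: "\<And>n. u n \<in> L2"
    and u_bdd: "\<exists>C. \<forall>n. L2_norm (u n) \<le> C"
    and h_osc: "\<And>\<phi>. \<phi> \<in> test_fun \<Longrightarrow>
      ((\<lambda>R. limsup (\<lambda>n. ereal (L2_norm (spectral_cutoff {..<R} ((h n)\<^sup>2) (\<lambda>x. \<phi> x * u n x)))))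
         \<longlongrightarrow> 0) at_bot"
    and \<mu>0_radon: "radon_measure \<mu>0"
    and \<mu>0_lim: "\<And>a. a \<in> test_fun \<Longrightarrow>
      (\<lambda>n. L2_inner (weyl_op (h n) a (u n)) (u n)) \<longlonglongrightarrow> (LINT z|\<mu>0. a z)"
    and \<alpha>_pos: "\<And>n. 0 < \<alpha> n"
    and \<alpha>_lim: "filterlim \<alpha> at_top sequentially"
    and \<mu>0_zero: "emeasure \<mu>0 {(x, \<xi>). \<xi> = 0} = 0"
  shows "(\<forall>\<mu> \<in> Linf_measures. \<forall>r :: nat \<Rightarrow> nat. strict_mono r \<longrightarrow>
            (\<forall>\<phi> a. integrable lborel \<phi> \<longrightarrow> a \<in> test_fun \<longrightarrow>
               (\<lambda>k. time_averaged_wigner (h (r k)) (\<alpha> (r k)) (u (r k)) \<phi> a)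
                 \<longlonglongrightarrow> (LINT t|lborel. \<phi> t * (LINT z|\<mu> t. a z))) \<longrightarrow>
            (AE t in lborel. \<mu> t = null_measure borel)) \<and>
         (\<forall>\<phi> a. integrable lborel \<phi> \<longrightarrow> a \<in> test_fun \<longrightarrow>
            (\<lambda>n. time_averaged_wigner (h n) (\<alpha> n) (u n) \<phi> a) \<longlonglongrightarrow> 0)"
proof -
  have lim: "(\<lambda>n. time_averaged_wigner (h n) (\<alpha> n) (u n) \<phi> a) \<longlonglongrightarrow> 0"
    if "integrable lborel \<phi>" "a \<in> test_fun" for \<phi> a
    by (rule time_averaged_wigner_tendsto_0[OF h_pos h_lim u_L2 u_bdd \<alpha>_pos \<alpha>_lim \<mu>0_radon \<mu>0_zero \<mu>0_lim that])
  have "AE t in lborel. \<mu> t = null_measure borel"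
    if \<mu>: "\<mu> \<in> Linf_measures" and r: "strict_mono (r :: nat \<Rightarrow> nat)"
      and lim_r: "\<forall>\<phi> a. integrable lborel \<phi> \<longrightarrow> a \<in> test_fun \<longrightarrow>
        (\<lambda>k. time_averaged_wigner (h (r k)) (\<alpha> (r k)) (u (r k)) \<phi> a) \<longlonglongrightarrow> (LINT t|lborel. \<phi> t * (LINT z|\<mu> t. a z))" for \<mu> r
  \<comment> \<open>The full sequence already tends to 0, hence so does the subsequence, and the
    pairing with \<mu> is its unique limit.\<close>
  proof (rule Linf_measures_eq_null[OF \<mu>])
    fix \<phi> :: "real \<Rightarrow> complex" and a :: "(real ^ 'd) \<times> (real ^ 'd) \<Rightarrow> complex"
    assume "integrable lborel \<phi>" "a \<in> test_fun"
    then have "(\<lambda>k. time_averaged_wigner (h (r k)) (\<alpha> (r k)) (u (r k)) \<phi> a) \<longlonglongrightarrow> (LINT t|lborel. \<phi> t * (LINT z|\<mu> t. a z))"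
      and "(\<lambda>k. time_averaged_wigner (h (r k)) (\<alpha> (r k)) (u (r k)) \<phi> a) \<longlonglongrightarrow> 0"
      using lim_r LIMSEQ_subseq_LIMSEQ[OF lim r] by (auto simp: o_def)
    then show "(LINT t|lborel. \<phi> t * (LINT z|\<mu> t. a z)) = 0" by (rule LIMSEQ_unique)
  qed
  with lim show ?thesis by blast
qed

end
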